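(* Let $s\in\mathbb{C}$ with $\Re s>-1/2$. Let $\lambda_1(N)$ denote the largest eigenvalue of a random $N\times N$ Hermitian matrix distributed according to the generalized Cauchy probability measure with parameter $s$. Then the law of $\lambda_1(N)/N$ converges to the distribution of the largest point of the determinantal process on $\mathbb{R}^*$ with kernel $K_\infty$, in the following sense: for every $x_0>0$, $$P\left[\frac{\lambda_1(N)}{N}\le x_0\right]=\det(I-K_N)|_{L_2(Nx_0,\infty)}\longrightarrow\det(I-K_\infty)|_{L_2(x_0,\infty)}\quad\text{as }N\to\infty.$$
   Context: Notation: $\mathbb{R}^*=\mathbb{R}\setminus\{0\}$; $(x)_0=1$, $(x)_n=x(x+1)\cdots(x+n-1)$; ${}_2F_1[a,b,c;x]=\sum_{n\ge0}\frac{(a)_n(b)_n}{(c)_n n!}x^n$; ${}_1F_1[r,q;x]=\sum_{n\ge0}\frac{(r)_n}{(q)_n n!}x^n$. Here $s\in\mathbb{C}$ with $\Re s>-1/2$ is fixed and $N\geq 1$ is an integer. Generalized Cauchy measure. On the space $H(N)$ of $N\times N$ Hermitian matrices it is the probability measure $\mathrm{const}\cdot\det((1+iX)^{-s-N})\det((1-iX)^{-\overline s-N})\prod_{1\le j<k\le N}dX_{jk}\prod_{i=1}^N dX_{ii}$ (principal branches; $dX_{jk}$ is Lebesgue measure on $\mathbb{C}$ for $j<k$). The induced eigenvalue density is $\mathrm{const}\cdot\prod_{1\le j<k\le N}(x_j-x_k)^2\prod_{j=1}^N w_H(x_j)dx_j$ with $w_H$ as below. Finite-$N$ kernel. For $x\in\mathbb{R}$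 put $w_H(x)=(1+ix)^{-s-N}(1-ix)^{-\overline{s}-N}=(1+x^2)^{-\Re s-N}e^{2\Im s\,\mathrm{Arg}(1+ix)}$, $p_{N-1}(x)=(x-i)^{N-1}{}_2F_1\left[-(N-1),s+1,2\Re s+2;\frac{2}{1+ix}\right]$, $\tilde p_N(x)=(x-i)^N{}_2F_1\left[-N,s,2\Re s+1;\frac{2}{1+ix}\right]$ (both are polynomials), and $C=\frac{2^{2\Re s}}{\pi}\frac{\Gamma(2\Re s+N+1)\Gamma(s+1)\Gamma(\overline s+1)}{\Gamma(N)\Gamma(2\Re s+1)\Gamma(2\Re s+2)}$. For $x\ne y$ real, $K_N(x,y)=C\,\frac{\tilde p_N(x)p_{N-1}(y)-p_{N-1}(x)\tilde p_N(y)}{x-y}\sqrt{w_H(x)w_H(y)}$, and $K_N(x,x)=C\,(\tilde p_N'(x)p_{N-1}(x)-\tilde p_N(x)p_{N-1}'(x))\,w_H(x)$. Limiting kernel. For $x\in\mathbb{R}^*$ put $\tilde P(x)=|2/x|^{\Re s}e^{-i/x+\pi\Im s\,\mathrm{Sgn}(x)/2}\,{}_1F_1[s,2\Re s+1;2i/x]$, $Q(x)=(2/x)|2/x|^{\Re s}e^{-i/x+\pi\Im s\,\mathrm{Sgn}(x)/2}\,{}_1F_1[s+1,2\Re s+2;2i/x]$. With $c_s=\frac{1}{2\pi}\frac{\Gamma(s+1)\Gamma(\overline s+1)}{\Gamma(2\Re s+1)\Gamma(2\Re s+2)}$, set $K_\infty(x,y)=c_s\frac{\tilde P(x)Q(y)-Q(x)\tilde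 P(y)}{x-y}$ for $x\neq y$ in $\mathbb{R}^*$, and $K_\infty(x,x)=c_s(\tilde P'(x)Q(x)-Q'(x)\tilde P(x))$. It is known (Borodin–Olshanski) that $K_\infty$ is the correlation kernel of a determinantal point process on $\mathbb{R}^*$. For a kernel $K$, $\det(I-K)|_{L_2(t,\infty)}=1+\sum_{k\ge1}\frac{(-1)^k}{k!}\int_{(t,\infty)^k}\det(K(x_i,x_j))_{1\le i,j\le k}\,dx_1\cdots dx_k$. *)

theory Defs
  imports
    "HOL-Analysis.Analysis"
    "Jordan_Normal_Form.Char_Poly"
    "Jordan_Normal_Form.Schur_Decomposition"
begin

section \<open>Hypergeometric series\<close>

definition hyp2F1 :: "complex \<Rightarrow> complex \<Rightarrow> complex \<Rightarrow> complex \<Rightarrow> complex" where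
  "hyp2F1 a b c x =
     (\<Sum>n. pochhammer a n * pochhammer b n / (pochhammer c n * fact n) * x ^ n)"

definition hyp1F1 :: "complex \<Rightarrow> complex \<Rightarrow> complex \<Rightarrow> complex" where
  "hyp1F1 r q x = (\<Sum>n. pochhammer r n / (pochhammer q n * fact n) * x ^ n)"


section \<open>Lebesgue measure on the space of Hermitian matrices\<close>

text \<open>The coordinates of a Hermitian matrix are its real diagonal entries and its
  complex entries strictly above the diagonal.\<close>

definition upper_pairs :: "nat \<Rightarrow> (nat \<times> nat) set" where
  "upper_pairs N = {(j, k). j < k \<and> k < N}"

definition herm_coords :: "nat \<Rightarrow> ((nat \<Rightarrow> real) \<times> (nat \<times> nat \<Rightarrow> complex)) measure" where
  "herm_coords N = (\<Pi>\<^sub>M i\<in>{..<N}. lborel) \<Otimes>\<^sub>M (\<Pi>\<^sub>M p\<in>upper_pairs N. lborel)"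

definition herm_of_coords ::
  "nat \<Rightarrow> (nat \<Rightarrow> real) \<times> (nat \<times> nat \<Rightarrow> complex) \<Rightarrow> complex mat" where
  "herm_of_coords N = (\<lambda>(d, z). Matrix.mat N N (\<lambda>(j, k).
     if j = k then complex_of_real (d j)
     else if j < k then z (j, k) else cnj (z (k, j))))"

definition hermitian_mats :: "nat \<Rightarrow> complex mat set" where
  "hermitian_mats N = {X \<in> carrier_mat N N. mat_adjoint X = X}"

definition lebesgue_herm :: "nat \<Rightarrow> complex mat measure" where
  "lebesgue_herm N = embed_measure (herm_coords N) (herm_of_coords N)"

lemma mat_adjoint_index:
  assumes "X \<in> carrier_mat n n" "i < n" "j < n"
  shows "mat_adjoint X $$ (i, j) = cnj ((X::complex mat) $$ (j, i))"
  using assms by (auto simp: mat_adjoint_def mat_of_rows_def)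

text \<open>The following two facts show that the image measure above really is a measure on
  exactly the Hermitian matrices.\<close>

lemma inj_on_herm_of_coords: "inj_on (herm_of_coords N) (space (herm_coords N))"
proof (rule inj_onI, clarify)
  fix d z d' z'
  assume sp: "(d, z) \<in> space (herm_coords N)" "(d', z') \<in> space (herm_coords N)"
    and eq: "herm_of_coords N (d, z) = herm_of_coords N (d', z')"
  have ent: "herm_of_coords N (d, z) $$ (j, k) = herm_of_coords N (d', z') $$ (j, k)" for j k
    using eq by simp
  have "d i = d' i" if "i < N" for i
    using ent[of i i] that by (simp add: herm_of_coords_def)
  moreover have "z (j, k) = z' (j, k)" if "j < k" "k < N" for j k
    using ent[of j k] that by (simp add: herm_of_coords_def)
  moreover have "d \<in> (\<Pi>\<^sub>E i\<in>{..<N}. UNIV)" "d' \<in> (\<Pi>\<^sub>E i\<in>{..<N}. UNIV)"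
      "z \<in> (\<Pi>\<^sub>E p\<in>upper_pairs N. UNIV)" "z' \<in> (\<Pi>\<^sub>E p\<in>upper_pairs N. UNIV)"
    using sp by (simp_all add: herm_coords_def space_pair_measure space_PiM)
  ultimately show "d = d' \<and> z = z'"
    by (auto simp: upper_pairs_def elim!: PiE_ext)
qed

lemma space_lebesgue_herm: "space (lebesgue_herm N) = hermitian_mats N"
proof (intro equalityI subsetI)
  fix X assume "X \<in> space (lebesgue_herm N)"
  then obtain d z where X: "X = herm_of_coords N (d, z)"
    by (auto simp: lebesgue_herm_def space_embed_measure)
  have c: "X \<in> carrier_mat N N" by (simp add: X herm_of_coords_def)
  have "mat_adjoint X = X"
  proof (rule eq_matI)
    fix i j assume "i < dim_row X" "j < dim_col X"
    with c have ij: "i < N" "j < N" by auto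
    then show "mat_adjoint X $$ (i, j) = X $$ (i, j)"
      by (subst mat_adjoint_index[OF c]) (auto simp: X herm_of_coords_def)
  qed (use c in \<open>auto simp: mat_adjoint_def\<close>)
  with c show "X \<in> hermitian_mats N" by (simp add: hermitian_mats_def)
next
  fix X assume "X \<in> hermitian_mats N"
  then have c: "X \<in> carrier_mat N N" and a: "mat_adjoint X = X"
    by (auto simp: hermitian_mats_def)
  have h: "X $$ (i, j) = cnj (X $$ (j, i))" if "i < N" "j < N" for i j
    using mat_adjoint_index[OF c that] a by simp
  define d where "d = restrict (\<lambda>i. Re (X $$ (i, i))) {..<N}"
  define z where "z = restrict (\<lambda>p. X $$ p) (upper_pairs N)"
  have "X = herm_of_coords N (d, z)"
  proof (rule eq_matI)
    fix i j
    assume "i < dim_row (herm_of_coords N (d, z))" "j < dim_col (herm_of_coords N (d, z))"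
    then have ij: "i < N" "j < N" by (auto simp: herm_of_coords_def)
    show "X $$ (i, j) = herm_of_coords N (d, z) $$ (i, j)"
      using ij h[OF ij] h[OF ij(1) ij(1)]
      by (auto simp: herm_of_coords_def d_def z_def upper_pairs_def complex_eq_iff)
  qed (use c in \<open>auto simp: herm_of_coords_def\<close>)
  moreover have "(d, z) \<in> space (herm_coords N)"
    by (auto simp: herm_coords_def space_pair_measure space_PiM d_def z_def)
  ultimately show "X \<in> space (lebesgue_herm N)"
    by (auto simp: lebesgue_herm_def space_embed_measure)
qed


section \<open>The generalized Cauchy measure\<close>

text \<open>Principal power of a normal matrix, by functional calculus.\<close>

definition mat_cpowr :: "complex mat \<Rightarrow> complex \<Rightarrow> complex mat" where
  "mat_cpowr A z = (THE B. \<exists>U d. U \<in> carrier_mat (dim_row A) (dim_row A) \<and>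
     U * mat_adjoint U = 1\<^sub>m (dim_row A) \<and>
     A = U * mat_diag (dim_row A) d * mat_adjoint U \<and>
     B = U * mat_diag (dim_row A) (\<lambda>i. d i powr z) * mat_adjoint U)"

text \<open>The product of the two determinants is a positive real number for Hermitian
  \<open>X\<close>, so that taking its real part only changes the type.\<close>

definition cauchy_weight :: "complex \<Rightarrow> nat \<Rightarrow> complex mat \<Rightarrow> real" where
  "cauchy_weight s N X = Re
     (Determinant.det (mat_cpowr (1\<^sub>m N + \<i> \<cdot>\<^sub>m X) (- s - of_nat N)) *
      Determinant.det (mat_cpowr (1\<^sub>m N - \<i> \<cdot>\<^sub>m X) (- cnj s - of_nat N)))"

definition cauchy_measure :: "complex \<Rightarrow> nat \<Rightarrow> complex mat measure" where
  "cauchy_measure s N = density (lebesgue_herm N) (\<lambda>X. ennreal (cauchy_weight s N X) /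
     (\<integral>\<^sup>+ Y. ennreal (cauchy_weight s N Y) \<partial>lebesgue_herm N))"

definition largest_eigenvalue :: "complex mat \<Rightarrow> real" where
  "largest_eigenvalue X = Max {l. eigenvalue X (complex_of_real l)}"


section \<open>The finite kernel\<close>

definition w_H :: "complex \<Rightarrow> nat \<Rightarrow> real \<Rightarrow> real" where
  "w_H s N x = (1 + x\<^sup>2) powr (- Re s - real N) *
     exp (2 * Im s * Arg (1 + \<i> * complex_of_real x))"

lemma w_H_eq_powr:
  "complex_of_real (w_H s N x) =
     (1 + \<i> * x) powr (- s - of_nat N) * (1 - \<i> * x) powr (- cnj s - of_nat N)"
proof -
  define u where "u = 1 + \<i> * complex_of_real x"
  have re: "Re u = 1" and nz: "u \<noteq> 0" by (auto simp: u_def complex_eq_iff)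
  have cu: "1 - \<i> * complex_of_real x = cnj u" by (simp add: u_def)
  have nr: "u \<notin> \<real>\<^sub>\<le>\<^sub>0" using re by (auto elim: nonpos_Reals_cases)
  have lc: "Ln (cnj u) = cnj (Ln u)" using cnj_Ln[OF nr] by simp
  have L: "Ln u = of_real (ln (cmod u)) + \<i> * of_real (Arg u)"
    using nz by (simp add: complex_eq_iff Arg_eq_Im_Ln)
  have "1 + x\<^sup>2 = (cmod u)\<^sup>2" by (simp add: u_def cmod_def)
  then have "ln (1 + x\<^sup>2) = 2 * ln (cmod u)" using nz by (simp add: ln_realpow)
  moreover have "1 + x\<^sup>2 > 0" by (simp add: add_pos_nonneg)
  ultimately have "w_H s N x =
      exp ((- Re s - real N) * (2 * ln (cmod u)) + 2 * Im s * Arg u)"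
    unfolding w_H_def u_def[symmetric] by (simp add: powr_def exp_add)
  moreover have "u powr (- s - of_nat N) * cnj u powr (- cnj s - of_nat N) =
      exp ((- s - of_nat N) * Ln u + (- cnj s - of_nat N) * cnj (Ln u))"
    using nz by (simp add: powr_def exp_add lc)
  moreover have "(- s - of_nat N) * Ln u + (- cnj s - of_nat N) * cnj (Ln u) =
      of_real ((- Re s - real N) * (2 * ln (cmod u)) + 2 * Im s * Arg u)"
    unfolding L by (simp add: complex_eq_iff algebra_simps)
  ultimately show ?thesis unfolding cu u_def[symmetric] by (simp only: exp_of_real)
qed

text \<open>These polynomials may have non-real coefficients (\<open>p_tilde 0 1 x = x - \<i>\<close>), although the
  kernel is real; hence kernels are complex-valued functions of real variables, and
  their diagonals are formed with \<open>vector_derivative\<close>.\<close>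

definition p_N1 :: "complex \<Rightarrow> nat \<Rightarrow> real \<Rightarrow> complex" where
  "p_N1 s N x = (of_real x - \<i>) ^ (N - 1) *
     hyp2F1 (- of_nat (N - 1)) (s + 1) (2 * of_real (Re s) + 2) (2 / (1 + \<i> * of_real x))"

definition p_tilde :: "complex \<Rightarrow> nat \<Rightarrow> real \<Rightarrow> complex" where
  "p_tilde s N x = (of_real x - \<i>) ^ N *
     hyp2F1 (- of_nat N) s (2 * of_real (Re s) + 1) (2 / (1 + \<i> * of_real x))"

definition C_N :: "complex \<Rightarrow> nat \<Rightarrow> complex" where
  "C_N s N = of_real (2 powr (2 * Re s) / pi) *
     (Gamma (2 * of_real (Re s) + of_nat N + 1) * Gamma (s + 1) * Gamma (cnj s + 1)) /
     (Gamma (of_nat N) * Gamma (2 * of_real (Re s) + 1) * Gamma (2 * of_real (Re s) + 2))"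

definition K_N :: "complex \<Rightarrow> nat \<Rightarrow> real \<Rightarrow> real \<Rightarrow> complex" where
  "K_N s N x y =
     (if x = y then
        C_N s N * (vector_derivative (p_tilde s N) (at x) * p_N1 s N x
                   - p_tilde s N x * vector_derivative (p_N1 s N) (at x)) *
        of_real (w_H s N x)
      else
        C_N s N * ((p_tilde s N x * p_N1 s N y - p_N1 s N x * p_tilde s N y) /
                   (of_real x - of_real y)) *
        of_real (sqrt (w_H s N x * w_H s N y)))"


section \<open>The limiting kernel\<close>

definition P_lim :: "complex \<Rightarrow> real \<Rightarrow> complex" where
  "P_lim s x = of_real (\<bar>2 / x\<bar> powr Re s) *
     exp (- \<i> / of_real x + of_real (pi * Im s * sgn x / 2)) *
     hyp1F1 s (2 * of_real (Re s) + 1) (2 * \<i> / of_real x)"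

definition Q_lim :: "complex \<Rightarrow> real \<Rightarrow> complex" where
  "Q_lim s x = of_real (2 / x) * of_real (\<bar>2 / x\<bar> powr Re s) *
     exp (- \<i> / of_real x + of_real (pi * Im s * sgn x / 2)) *
     hyp1F1 (s + 1) (2 * of_real (Re s) + 2) (2 * \<i> / of_real x)"

definition c_lim :: "complex \<Rightarrow> complex" where
  "c_lim s = of_real (1 / (2 * pi)) * (Gamma (s + 1) * Gamma (cnj s + 1)) /
     (Gamma (2 * of_real (Re s) + 1) * Gamma (2 * of_real (Re s) + 2))"

definition K_inf :: "complex \<Rightarrow> real \<Rightarrow> real \<Rightarrow> complex" where
  "K_inf s x y =
     (if x = y then
        c_lim s * (vector_derivative (P_lim s) (at x) * Q_lim s x
                   - vector_derivative (Q_lim s) (at x) * P_lim s x)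
      else
        c_lim s * ((P_lim s x * Q_lim s y - Q_lim s x * P_lim s y) /
                   (of_real x - of_real y)))"


section \<open>The Fredholm determinant\<close>

text \<open>\<open>fredholm_det K t\<close> is the determinant of \<open>I - K\<close> on \<open>L\<^sub>2(t, \<infinity>)\<close>.\<close>

definition fredholm_det :: "(real \<Rightarrow> real \<Rightarrow> complex) \<Rightarrow> real \<Rightarrow> complex" where
  "fredholm_det K t = 1 + (\<Sum>m. let k = Suc m in
     (- 1) ^ k / fact k *
     (LINT x:(\<Pi>\<^sub>E i\<in>{..<k}. {t<..})|(\<Pi>\<^sub>M i\<in>{..<k}. lborel).
        Determinant.det (Matrix.mat k k (\<lambda>(i, j). K (x i) (x j)))))"

end

theory Submission
 imports Defs "HOL-Real_Asymp.Real_Asymp"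
begin

text \<open>The joint law of the eigenvalues is found by induction on \<open>N\<close>. Bordering a Hermitian matrix,
diagonalising the old block and rotating the new column leads to an arrow matrix whose eigenvalues
interlace the old ones; passing from the new column to these eigenvalues has a quotient of
Vandermonde determinants as Jacobian, and integrating the old eigenvalues out produces the second
Vandermonde factor. Expanded in orthonormal polynomials, the law of the largest eigenvalue becomes
\<open>det (1 - G)\<close> for a Gram matrix \<open>G\<close> on \<open>(t, \<infinity>)\<close> by Andreief's identity, and the expansion of this
determinant in principal minors is the Fredholm series.

By Cauchy's beta integral and the Chu-Vandermonde sum both \<^const>\<open>p_N1\<close> and \<^const>\<open>p_tilde\<close> are
orthogonal to \<open>(1 - \<i> x)\<^sup>m\<close> for \<open>m < N - 1\<close>. As \<^const>\<open>p_tilde\<close> need not be square integrable, the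
Christoffel-Darboux formula is derived from the reproducing property of the kernel. After rescaling,
the hypergeometric sums converge term by term (Tannery), and the Fredholm series converge by
dominated convergence, where Hadamard's inequality bounds the determinants by products of diagonal
values.\<close>

text \<open>The weight \<open>w_H\<close> decays like |x|^(-2 Re s - 2N), and Re s > -1/2 guarantees
  its moments just up to degree 2N - 2. This suffices for the products of N orthonormal polynomials
  of degree below N, and it is why \<open>p_tilde\<close> is only ever paired with polynomials of
  degree at most N - 2.

  Bordering replaces the geometry of unitary orbits: it uses only the invariance of Lebesgue measure
  on C^n under unitary maps and substitutions in one real variable. The constant in the resulting
  formula is left undetermined, since it cancels between the weight of the event and the total
  weight.

  Writing the kernel as a sum of products f(x) f(y) of real functions turns all its matrices into
  Gram matrices; Hadamard's inequality needs this, and the formula with \<open>p_tilde\<close> and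
  \<open>p_N1\<close> hides it.

  The condition x0 > 0 keeps away from the essential singularity of the limit at the origin. On (x0,
  infinity) the rescaled diagonal is at most a constant times x^(-2 Re s - 2), which is integrable
  at infinity exactly because Re s > -1/2.\<close>

no_notation vec_nth (infixl "$" 90)

hide_const (open) Module.smult Determinants.det Finite_Cartesian_Product.mat

abbreviation real_diag :: "nat => (nat => real) => complex mat" where
 "real_diag n d \<equiv> mat_diag n (\<lambda>i. complex_of_real (d i))"

section \<open>Unitary diagonalisation\<close>

lemma index_mult_mat_sum:
 assumes "A \<in> carrier_mat n m" "B \<in> carrier_mat m k" "i < n" "j < k"
 shows "(A * B) $$ (i, j) = (\<Sum>l<m. A $$ (i, l) * B $$ (l, j))"
 using assms by (auto simp: scalar_prod_def lessThan_atLeast0 intro!: sum.cong)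

declare index_mult_mat(1) [simp del]

lemma mat_adjoint_carrier [simp]:
 "A \<in> carrier_mat n n ==> mat_adjoint (A :: complex mat) \<in> carrier_mat n n"
 by (auto simp: mat_adjoint_def mat_of_rows_def)

lemma dim_mat_adjoint [simp]:
 "dim_row (mat_adjoint A) = dim_col A" "dim_col (mat_adjoint A) = dim_row (A :: complex mat)"
 by (auto simp: mat_adjoint_def mat_of_rows_def)

lemma mat_adjoint_mult:
 assumes "A \<in> carrier_mat n n" "B \<in> carrier_mat n n"
 shows "mat_adjoint (A * B) = mat_adjoint B * mat_adjoint (A :: complex mat)"
proof (rule eq_matI)
 have AB: "A * B \<in> carrier_mat n n" using assms by auto
 have aa: "mat_adjoint B * mat_adjoint A \<in> carrier_mat n n" using assms
  by (intro mult_carrier_mat) auto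
 show "dim_row (mat_adjoint (A * B)) = dim_row (mat_adjoint B * mat_adjoint A)"
  "dim_col (mat_adjoint (A * B)) = dim_col (mat_adjoint B * mat_adjoint A)"
  using assms by auto
 fix i j assume "i < dim_row (mat_adjoint B * mat_adjoint A)" "j < dim_col (mat_adjoint B * mat_adjoint A)"
 with aa have ij: "i < n" "j < n" by auto
 have "(mat_adjoint B * mat_adjoint A) $$ (i, j) =
    (\<Sum>l<n. mat_adjoint B $$ (i, l) * mat_adjoint A $$ (l, j))"
  by (rule index_mult_mat_sum) (use assms ij in auto)
 also have "... = (\<Sum>l<n. cnj (B $$ (l, i)) * cnj (A $$ (j, l)))"
  using assms ij by (intro sum.cong refl) (simp add: mat_adjoint_index)
 also have "... = cnj ((A * B) $$ (j, i))"
  using ij assms by (simp add: index_mult_mat_sum[of A n n B n] mult.commute)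
 finally show "mat_adjoint (A * B) $$ (i, j) = (mat_adjoint B * mat_adjoint A) $$ (i, j)"
  using mat_adjoint_index[OF AB ij] by simp
qed

lemma mat_adjoint_adjoint:
 assumes "A \<in> carrier_mat n n"
 shows "mat_adjoint (mat_adjoint A) = (A :: complex mat)"
proof (rule eq_matI)
 fix i j assume "i < dim_row A" "j < dim_col A"
 with assms have ij: "i < n" "j < n" by auto
 show "mat_adjoint (mat_adjoint A) $$ (i, j) = A $$ (i, j)"
  using ij assms by (simp add: mat_adjoint_index[where n=n])
qed (use assms in \<open>auto dest!: mat_adjoint_carrier\<close>)

lemma mult_mat_assoc5:
 assumes "A \<in> carrier_mat n n" "B \<in> carrier_mat n n" "C \<in> carrier_mat n n"
  "D \<in> carrier_mat n n" "E \<in> carrier_mat n n"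
 shows "A * (B * C * D) * E = (A * B) * C * (D * E)"
proof -
 have "A * (B * C * D) = A * (B * C) * D"
  using assoc_mult_mat[OF assms(1) mult_carrier_mat[OF assms(2,3)] assms(4)] by simp
 also have "A * (B * C) = A * B * C" using assoc_mult_mat[OF assms(1-3)] by simp
 finally show ?thesis
  using assoc_mult_mat[OF mult_carrier_mat[OF mult_carrier_mat[OF assms(1,2)] assms(3)] assms(4,5)]
  by simp
qed

text \<open>Only one of the two products is required, as in the condition inside
  \<open>mat_cpowr\<close>; the other one follows in finite dimension.\<close>

definition unitary_mat :: "nat => complex mat => bool" where
 "unitary_mat n U \<longleftrightarrow> U \<in> carrier_mat n n \<and> U * mat_adjoint U = 1\<^sub>m n"

lemma unitary_matD:
 assumes "unitary_mat n U"
 shows "U \<in> carrier_mat n n" "U * mat_adjoint U = 1\<^sub>m n" "mat_adjoint U * U = 1\<^sub>m n"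
  "mat_adjoint U \<in> carrier_mat n n"
 using assms mat_mult_left_right_inverse[of U n "mat_adjoint U"]
 by (auto simp: unitary_mat_def)

lemma unitary_mat_mult:
 assumes "unitary_mat n U" "unitary_mat n V"
 shows "unitary_mat n (U * V)"
proof -
 note U = unitary_matD[OF assms(1)] note V = unitary_matD[OF assms(2)]
 have "U * V * mat_adjoint (U * V) = U * (V * 1\<^sub>m n * mat_adjoint V) * mat_adjoint U"
  unfolding mat_adjoint_mult[OF U(1) V(1)]
  using mult_mat_assoc5[OF U(1) V(1) one_carrier_mat V(4) U(4)] U(1) V(1) by simp
 also have "... = 1\<^sub>m n" using U V by simp
 finally show ?thesis using U(1) V(1) by (simp add: unitary_mat_def)
qed

lemma hermitian_matsD:
 assumes "A \<in> hermitian_mats n"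
 shows "A \<in> carrier_mat n n" "mat_adjoint A = A"
  "\<And>i j. i < n ==> j < n ==> A $$ (i, j) = cnj (A $$ (j, i))"
proof -
 show A: "A \<in> carrier_mat n n" "mat_adjoint A = A" using assms by (auto simp: hermitian_mats_def)
 fix i j assume ij: "i < n" "j < n"
 show "A $$ (i, j) = cnj (A $$ (j, i))"
  by (rule mat_adjoint_index[OF A(1) ij, unfolded A(2)])
qed

lemma hermitian_matsI:
 assumes "A \<in> carrier_mat n n" "\<And>i j. i < n ==> j < n ==> A $$ (i, j) = cnj (A $$ (j, i))"
 shows "A \<in> hermitian_mats n"
proof -
 have "mat_adjoint A = A"
 proof (rule eq_matI)
  fix i j assume "i < dim_row A" "j < dim_col A"
  with assms(1) have ij: "i < n" "j < n" by auto
  show "mat_adjoint A $$ (i, j) = A $$ (i, j)"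
   using assms(2)[OF ij] mat_adjoint_index[OF assms(1) ij] by simp
 qed (use assms(1) in auto)
 with assms(1) show ?thesis by (simp add: hermitian_mats_def)
qed

text \<open>Gram-Schmidt applied to a basis that starts with \<open>v\<close> keeps \<open>v\<close>
  as its first vector. Dividing every vector by its norm makes the columns orthonormal, hence the
  factor \<open>c\<close>.\<close>

lemma unitary_extension:
 assumes v: "v \<in> carrier_vec n" "v ~= 0\<^sub>v n"
 shows "\<exists>U c. unitary_mat n U \<and> c ~= 0 \<and> (\<forall>i<n. U $$ (i, 0) = c * v $ i)"
proof -
 have n0: "n ~= 0" using v by auto
 interpret cof_vec_space n "TYPE(complex)" .
 define b where "b = basis_completion v"
 define ws where "ws = gram_schmidt n b"
 from basis_completion[OF v, folded b_def]
 have dist_b: "distinct b" and indep: "\<not> lin_dep (set b)" and b: "set b \<subseteq> carrier_vec n"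
  and hdb: "hd b = v" and len_b: "length b = n" by auto
 from hdb len_b n0 obtain vs where bv: "b = v # vs" by (cases b, auto)
 from gram_schmidt_result[OF b dist_b indep refl, folded ws_def]
 have ws: "set ws \<subseteq> carrier_vec n" "corthogonal ws" "length ws = n" by (auto simp: len_b)
 from gram_schmidt_hd[OF v(1), of vs, folded bv] have hdws: "hd ws = v" unfolding ws_def .
 have ws0: "ws ! 0 = v" using hdws ws(3) n0 by (metis hd_conv_nth list.size(3))
 have wsc: "ws ! j \<in> carrier_vec n" if "j < n" for j using ws that by auto
 define nr where "nr j = (\<Sum>i<n. (cmod (ws ! j $ i))\<^sup>2)" for j
 have ip: "ws ! i \<bullet>c ws ! j = (\<Sum>l<n. ws ! i $ l * cnj (ws ! j $ l))" if "i < n" "j < n" for i j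
  using wsc[OF that(1)] wsc[OF that(2)] by (simp add: scalar_prod_def lessThan_atLeast0)
 have ipn: "(\<Sum>l<n. ws ! j $ l * cnj (ws ! j $ l)) = of_real (nr j)" for j
  unfolding nr_def of_real_sum by (intro sum.cong refl) (simp only: complex_norm_square)
 have nr0: "nr j > 0" if "j < n" for j
 proof -
  have "ws ! j \<bullet>c ws ! j ~= 0" using corthogonalD[OF ws(2), of j j] ws(3) that by auto
  then have "nr j ~= 0" using ip[OF that that] ipn[of j] by auto
  moreover have "nr j >= 0" unfolding nr_def by (intro sum_nonneg) auto
  ultimately show ?thesis by simp
 qed
 define U where "U = mat n n (\<lambda>(i, j). ws ! j $ i / of_real (sqrt (nr j)))"
 have U: "U \<in> carrier_mat n n" by (simp add: U_def)
 have "mat_adjoint U * U = 1\<^sub>m n"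
 proof (rule eq_matI)
  fix i j assume "i < dim_row (1\<^sub>m n :: complex mat)" "j < dim_col (1\<^sub>m n :: complex mat)"
  then have ij: "i < n" "j < n" by auto
  have "(mat_adjoint U * U) $$ (i, j) = (\<Sum>l<n. mat_adjoint U $$ (i, l) * U $$ (l, j))"
   by (rule index_mult_mat_sum) (use U ij in auto)
  also have "... = (\<Sum>l<n. ws ! j $ l * cnj (ws ! i $ l)) / (of_real (sqrt (nr i)) * of_real (sqrt (nr j)))"
   unfolding sum_divide_distrib using U ij
   by (intro sum.cong refl) (simp add: mat_adjoint_index, simp add: U_def)
  also have "... = (if i = j then 1 else 0)"
  proof (cases "i = j")
   case True
   then show ?thesis using nr0[OF ij(1)] unfolding True ipn
    by (simp flip: of_real_mult)
  next
   case False
   then have "ws ! j \<bullet>c ws ! i = 0" using corthogonalD[OF ws(2), of j i] ws(3) ij by auto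
   then show ?thesis using ip[OF ij(2) ij(1)] False by simp
  qed
  finally show "(mat_adjoint U * U) $$ (i, j) = 1\<^sub>m n $$ (i, j)" using ij by simp
 qed (use U in auto)
 then have "U * mat_adjoint U = 1\<^sub>m n"
  using mat_mult_left_right_inverse[of "mat_adjoint U" n U] U by simp
 then have "unitary_mat n U" using U by (simp add: unitary_mat_def)
 moreover have "\<forall>i<n. U $$ (i, 0) = (1 / of_real (sqrt (nr 0))) * v $ i"
  using n0 ws0 by (auto simp: U_def)
 moreover have "1 / complex_of_real (sqrt (nr 0)) ~= 0" using nr0[of 0] n0 by simp
 ultimately show ?thesis by blast
qed

lemma mat_diag_carrier [simp]: "mat_diag n d \<in> carrier_mat n n"
 by (simp add: mat_diag_def)

lemma mat_diag_index [simp]: "i < n ==> j < n ==> mat_diag n d $$ (i, j) = (if i = j then d j else 0)"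
 by (simp add: mat_diag_def)

lemma unitary_conj_iff:
 assumes "unitary_mat n U" "A \<in> carrier_mat n n" "B \<in> carrier_mat n n"
  and "mat_adjoint U * A * U = B"
 shows "A = U * B * mat_adjoint U"
proof -
 note U = unitary_matD[OF assms(1)]
 have "U * B * mat_adjoint U = (U * mat_adjoint U) * A * (U * mat_adjoint U)"
  unfolding assms(4)[symmetric] by (rule mult_mat_assoc5[where n=n]) (use U(1,4) assms(2) in auto)
 also have "... = A" unfolding U(2) using assms(2) by simp
 finally show ?thesis by simp
qed

lemma unitary_four_block:
 assumes "unitary_mat n V"
 shows "unitary_mat (Suc n) (mat (Suc n) (Suc n) (\<lambda>(i, j).
     if i = 0 \<or> j = 0 then (if i = j then 1 else 0) else V $$ (i - 1, j - 1)))"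
  (is "unitary_mat _ ?W")
proof -
 note V = unitary_matD[OF assms]
 define W where "W = ?W"
 have W: "W \<in> carrier_mat (Suc n) (Suc n)" by (simp add: W_def)
 have "W * mat_adjoint W = 1\<^sub>m (Suc n)"
 proof (rule eq_matI)
  fix i j assume "i < dim_row (1\<^sub>m (Suc n) :: complex mat)" "j < dim_col (1\<^sub>m (Suc n) :: complex mat)"
  then have ij: "i < Suc n" "j < Suc n" by auto
  have "(W * mat_adjoint W) $$ (i, j) = (\<Sum>l<Suc n. W $$ (i, l) * mat_adjoint W $$ (l, j))"
   by (rule index_mult_mat_sum[OF W mat_adjoint_carrier[OF W] ij])
  also have "... = (\<Sum>l<Suc n. W $$ (i, l) * cnj (W $$ (j, l)))"
   using mat_adjoint_index[OF W] ij by (intro sum.cong refl) simp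
  also have "... = (if i = j then 1 else 0)"
  proof (cases "i = 0 \<or> j = 0")
   case True
   then show ?thesis using ij by (subst sum.lessThan_Suc_shift) (auto simp: W_def)
  next
   case False
   then have ij': "i - 1 < n" "j - 1 < n" using ij by auto
   have "(\<Sum>l<Suc n. W $$ (i, l) * cnj (W $$ (j, l))) = (\<Sum>l<n. V $$ (i - 1, l) * cnj (V $$ (j - 1, l)))"
    using False ij by (subst sum.lessThan_Suc_shift) (auto simp: W_def)
   also have "... = (V * mat_adjoint V) $$ (i - 1, j - 1)"
    unfolding index_mult_mat_sum[OF V(1,4) ij']
    by (intro sum.cong refl) (simp only: mat_adjoint_index[OF V(1) _ ij'(2)] lessThan_iff)
   also have "... = (if i = j then 1 else 0)" unfolding V(2) using ij' False by auto
   finally show ?thesis .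
  qed
  finally show "(W * mat_adjoint W) $$ (i, j) = 1\<^sub>m (Suc n) $$ (i, j)" using ij by simp
 qed (use W in auto)
 then show ?thesis using W unfolding W_def by (simp add: unitary_mat_def)
qed

lemma hermitian_conj:
 assumes "A \<in> hermitian_mats n" "U \<in> carrier_mat n n"
 shows "mat_adjoint U * A * U \<in> hermitian_mats n"
proof -
 note A = hermitian_matsD[OF assms(1)]
 have c: "mat_adjoint U \<in> carrier_mat n n" using assms by simp
 have "mat_adjoint (mat_adjoint U * A * U) = mat_adjoint U * (A * U)"
  using mat_adjoint_mult[of "mat_adjoint U * A" n U] mat_adjoint_mult[OF c A(1)]
   mat_adjoint_adjoint[OF assms(2)] A(2) assms(2) mult_carrier_mat[OF c A(1)] by presburger
 also have "... = mat_adjoint U * A * U" using assoc_mult_mat[OF c A(1) assms(2)] by simp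
 finally show ?thesis using mult_carrier_mat[OF mult_carrier_mat[OF c A(1)] assms(2)] by (simp add: hermitian_mats_def del: assoc_mult_mat)
qed

text \<open>Deflation: a unitary matrix whose first column is an eigenvector conjugates
  \<open>A\<close> to a block diagonal matrix, and the induction hypothesis applies to the lower
  block.\<close>

theorem hermitian_spectral:
 assumes "A \<in> hermitian_mats n"
 shows "\<exists>U d. unitary_mat n U \<and> A = U * real_diag n d * mat_adjoint U"
 using assms
proof (induction n arbitrary: A)
 case 0
 have "unitary_mat 0 (1\<^sub>m 0)" by (auto simp: unitary_mat_def mat_adjoint_def)
 moreover have "A = 1\<^sub>m 0 * mat_diag 0 (\<lambda>i. complex_of_real ((\<lambda>_. 0) i)) * mat_adjoint (1\<^sub>m 0)"
  using hermitian_matsD(1)[OF 0] by (intro eq_matI) (auto simp: mat_adjoint_def)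
 ultimately show ?case by (intro exI[of _ "1\<^sub>m 0"] exI[of _ "\<lambda>_. 0"] conjI)
next
 case (Suc n)
 define m where "m = Suc n"
 note A0 = Suc.prems[folded m_def]
 note A = hermitian_matsD[OF A0]
 have m0: "0 < m" by (simp add: m_def)
 obtain as where as: "char_poly A = (\<Prod>a\<leftarrow>as. [:- a, 1:])" "length as = m"
  using char_poly_factorized[OF A(1)] by blast
 then obtain e es where "as = e # es" by (cases as) (auto simp: m_def)
 then have "eigenvalue A e" unfolding eigenvalue_root_char_poly[OF A(1)] as(1) by simp
 then obtain v where v: "v \<in> carrier_vec m" "v ~= 0\<^sub>v m" "A *\<^sub>v v = e \<cdot>\<^sub>v v"
  using A(1) unfolding eigenvalue_def eigenvector_def by auto
 obtain U c where U0: "unitary_mat m U" "c ~= 0" "\<forall>i<m. U $$ (i, 0) = c * v $ i"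
  using unitary_extension[OF v(1,2)] by blast
 note U = unitary_matD[OF U0(1)]
 define B where "B = mat_adjoint U * A * U"
 have B: "B \<in> hermitian_mats m" unfolding B_def by (rule hermitian_conj) (use A0 U in auto)
 note Bd = hermitian_matsD[OF B]
 have AU: "(A * U) $$ (i, 0) = e * U $$ (i, 0)" if "i < m" for i
 proof -
  have "(A * U) $$ (i, 0) = (\<Sum>l<m. A $$ (i, l) * U $$ (l, 0))"
   by (rule index_mult_mat_sum) (use A(1) U(1) that m0 in auto)
  also have "... = c * (\<Sum>l<m. A $$ (i, l) * v $ l)"
   unfolding sum_distrib_left using U0(3) by (intro sum.cong refl) simp
  also have "(\<Sum>l<m. A $$ (i, l) * v $ l) = (A *\<^sub>v v) $ i"
   using A(1) v(1) that by (auto simp: mult_mat_vec_def scalar_prod_def lessThan_atLeast0 intro!: sum.cong)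
  also have "... = e * v $ i" using v(1,3) that by simp
  finally show ?thesis using U0(3) that by simp
 qed
 \<comment> \<open>The first column of \<open>U\<close> is an eigenvector of \<open>A\<close> and
   the columns of \<open>U\<close> are orthonormal, so the first column of \<open>B\<close> is a
   multiple of the first unit vector. Hermitian symmetry then clears the first row and makes
   \<open>e\<close> real.\<close>
 have B0: "B $$ (i, 0) = (if i = 0 then e else 0)" if i: "i < m" for i
 proof -
  have "B = mat_adjoint U * (A * U)" unfolding B_def using assoc_mult_mat[OF U(4) A(1) U(1)] by simp
  then have "B $$ (i, 0) = (\<Sum>l<m. mat_adjoint U $$ (i, l) * (A * U) $$ (l, 0))"
   by (simp only: index_mult_mat_sum[OF U(4) mult_carrier_mat[OF A(1) U(1)] i m0] refl simp_thms)
  also have "... = e * (\<Sum>l<m. mat_adjoint U $$ (i, l) * U $$ (l, 0))"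
   unfolding sum_distrib_left using AU by (intro sum.cong refl) simp
  also have "(\<Sum>l<m. mat_adjoint U $$ (i, l) * U $$ (l, 0)) = (mat_adjoint U * U) $$ (i, 0)"
   by (simp only: index_mult_mat_sum[OF U(4,1) i m0] refl simp_thms)
  finally show ?thesis unfolding U(3) using i by simp
 qed
 have ereal: "cnj e = e" using Bd(3)[OF m0 m0] B0[OF m0] by simp
 define C where "C = mat n n (\<lambda>(i, j). B $$ (Suc i, Suc j))"
 have "C \<in> hermitian_mats n"
 proof (rule hermitian_matsI)
  fix i j assume "i < n" "j < n"
  then show "C $$ (i, j) = cnj (C $$ (j, i))"
   using Bd(3)[of "Suc i" "Suc j"] by (simp add: C_def m_def)
 qed (simp add: C_def)
 then obtain V d where V0: "unitary_mat n V" and Ceq: "C = V * real_diag n d * mat_adjoint V"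
  using Suc.IH by blast
 note V = unitary_matD[OF V0]
 define W where "W = mat m m (\<lambda>(i, j).
  if i = 0 \<or> j = 0 then (if i = j then 1 else 0) else V $$ (i - 1, j - 1))"
 have W0: "unitary_mat m W" unfolding W_def m_def by (rule unitary_four_block[OF V0])
 note W = unitary_matD[OF W0]
 define d' where "d' i = (case i of 0 => Re e | Suc j => d j)" for i
 have eRe: "of_real (Re e) = e" using ereal by (simp add: complex_eq_iff)
 have Vd: "(V * real_diag n d * mat_adjoint V) $$ (i, j) =
  (\<Sum>l<n. V $$ (i, l) * of_real (d l) * cnj (V $$ (j, l)))" if "i < n" "j < n" for i j
 proof -
  have "(V * real_diag n d * mat_adjoint V) $$ (i, j) =
   (\<Sum>l<n. (V * real_diag n d) $$ (i, l) * mat_adjoint V $$ (l, j))"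
   by (rule index_mult_mat_sum) (use V that in auto)
  also have "... = (\<Sum>l<n. V $$ (i, l) * of_real (d l) * cnj (V $$ (j, l)))"
   using that V by (intro sum.cong refl)
    (simp add: index_mult_mat_sum[of V n n _ n] mat_adjoint_index sum.delta' if_distrib[of "\<lambda>x. _ * x"] cong: if_cong)
  finally show ?thesis .
 qed
 have "W * mat_diag m (\<lambda>i. complex_of_real (d' i)) * mat_adjoint W = B"
 proof (rule eq_matI)
  fix i j assume "i < dim_row B" "j < dim_col B"
  with Bd(1) have ij: "i < m" "j < m" by auto
  have "(W * mat_diag m (\<lambda>i. complex_of_real (d' i)) * mat_adjoint W) $$ (i, j) =
   (\<Sum>l<m. (W * mat_diag m (\<lambda>i. complex_of_real (d' i))) $$ (i, l) * mat_adjoint W $$ (l, j))"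
   by (rule index_mult_mat_sum) (use W ij in auto)
  also have "... = (\<Sum>l<m. W $$ (i, l) * of_real (d' l) * cnj (W $$ (j, l)))"
   using ij W by (intro sum.cong refl)
    (simp add: index_mult_mat_sum[of W m m _ m] mat_adjoint_index sum.delta' if_distrib[of "\<lambda>x. _ * x"] cong: if_cong)
  also have "... = W $$ (i, 0) * e * cnj (W $$ (j, 0)) + (\<Sum>l<n. W $$ (i, Suc l) * of_real (d l) * cnj (W $$ (j, Suc l)))"
   unfolding m_def by (subst sum.lessThan_Suc_shift) (simp add: d'_def eRe)
  also have "... = B $$ (i, j)"
  proof (cases "i = 0 \<or> j = 0")
   case True
   then have z: "(\<Sum>l<n. W $$ (i, Suc l) * of_real (d l) * cnj (W $$ (j, Suc l))) = 0"
    using ij by (intro sum.neutral) (auto simp: W_def m_def)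
   have "W $$ (i, 0) = (if i = 0 then 1 else 0)" "W $$ (j, 0) = (if j = 0 then 1 else 0)"
    using ij by (auto simp: W_def)
   with z True show ?thesis using ij B0[OF ij(1)] B0[OF ij(2)] Bd(3)[OF m0 ij(2)] ereal
    by (cases "j = 0"; cases "i = 0") auto
  next
   case False
   then obtain i' j' where eq: "i = Suc i'" "j = Suc j'" using not0_implies_Suc by blast
   with ij have ij': "i' < n" "j' < n" by (auto simp: m_def)
   have "B $$ (i, j) = C $$ (i', j')" using ij' eq by (simp add: C_def m_def)
   also have "... = (\<Sum>l<n. V $$ (i', l) * of_real (d l) * cnj (V $$ (j', l)))"
    unfolding Ceq by (rule Vd[OF ij'])
   finally show ?thesis using ij' eq by (simp add: W_def m_def)
  qed
  finally show "(W * mat_diag m (\<lambda>i. complex_of_real (d' i)) * mat_adjoint W) $$ (i, j) = B $$ (i, j)" .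
 qed (use W Bd(1) in auto)
 then have "A = U * (W * mat_diag m (\<lambda>i. complex_of_real (d' i)) * mat_adjoint W) * mat_adjoint U"
  using unitary_conj_iff[OF U0(1) A(1) Bd(1)] B_def by simp
 also have "... = (U * W) * mat_diag m (\<lambda>i. complex_of_real (d' i)) * mat_adjoint (U * W)"
  unfolding mat_adjoint_mult[OF U(1) W(1)]
  by (rule mult_mat_assoc5[where n=m]) (use U(1,4) W(1,4) in auto)
 finally show ?case using unitary_mat_mult[OF U0(1) W0] unfolding m_def by blast
qed

section \<open>Ordered eigenvalues\<close>

lemma unitary_diag_index:
 assumes "U \<in> carrier_mat n n" "i < n" "j < n"
 shows "(U * mat_diag n d * mat_adjoint U) $$ (i, j) = (\<Sum>l<n. U $$ (i, l) * d l * cnj (U $$ (j, l)))"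
proof -
 have "(U * mat_diag n d * mat_adjoint U) $$ (i, j) =
   (\<Sum>l<n. (U * mat_diag n d) $$ (i, l) * mat_adjoint U $$ (l, j))"
  by (rule index_mult_mat_sum[of _ n n _ n]) (use assms in auto)
 also have "... = (\<Sum>l<n. U $$ (i, l) * d l * cnj (U $$ (j, l)))"
 proof (intro sum.cong refl)
  fix l assume l: "l \<in> {..<n}"
  have "(U * mat_diag n d) $$ (i, l) = (\<Sum>k<n. U $$ (i, k) * mat_diag n d $$ (k, l))"
   by (rule index_mult_mat_sum[of _ n n _ n]) (use assms l in auto)
  also have "... = (\<Sum>k<n. if k = l then U $$ (i, k) * d k else 0)"
   using l by (intro sum.cong refl) auto
  also have "... = U $$ (i, l) * d l" using l by simp
  finally show "(U * mat_diag n d) $$ (i, l) * mat_adjoint U $$ (l, j) = U $$ (i, l) * d l * cnj (U $$ (j, l))"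
   using mat_adjoint_index[OF assms(1), of l j] l assms by simp
 qed
 finally show ?thesis .
qed

lemma unitary_index_sum:
 assumes "unitary_mat n U" "i < n" "j < n"
 shows "(\<Sum>l<n. U $$ (i, l) * cnj (U $$ (j, l))) = (if i = j then 1 else 0)"
  "(\<Sum>l<n. cnj (U $$ (l, i)) * U $$ (l, j)) = (if i = j then 1 else 0)"
proof -
 note U = unitary_matD[OF assms(1)]
 have "(\<Sum>l<n. U $$ (i, l) * cnj (U $$ (j, l))) = (U * mat_adjoint U) $$ (i, j)"
  unfolding index_mult_mat_sum[OF U(1,4) assms(2,3)]
  by (intro sum.cong refl) (simp add: mat_adjoint_index[OF U(1) _ assms(3)])
 then show "(\<Sum>l<n. U $$ (i, l) * cnj (U $$ (j, l))) = (if i = j then 1 else 0)"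
  unfolding U(2) using assms by simp
 have "(\<Sum>l<n. cnj (U $$ (l, i)) * U $$ (l, j)) = (mat_adjoint U * U) $$ (i, j)"
  unfolding index_mult_mat_sum[OF U(4,1) assms(2,3)]
  by (intro sum.cong refl) (simp add: mat_adjoint_index[OF U(1) assms(2)])
 then show "(\<Sum>l<n. cnj (U $$ (l, i)) * U $$ (l, j)) = (if i = j then 1 else 0)"
  unfolding U(3) using assms by simp
qed

lemma unitary_similar:
 assumes "unitary_mat n U" "B \<in> carrier_mat n n"
 shows "similar_mat (U * B * mat_adjoint U) B"
proof -
 note U = unitary_matD[OF assms(1)]
 have "similar_mat_wit (U * B * mat_adjoint U) B U (mat_adjoint U)"
  by (rule similar_mat_witI[of _ _ n]) (use U(1) U(4) assms(2) in \<open>auto simp: U(2,3)\<close>)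
 then show ?thesis unfolding similar_mat_def by blast
qed

lemma det_unitary_conj:
 assumes "unitary_mat n U"
 shows "det (U * mat_diag n d * mat_adjoint U) = (\<Prod>i<n. d i)"
proof -
 have "det (U * mat_diag n d * mat_adjoint U) = det (mat_diag n d)"
  by (rule det_similar[OF unitary_similar[OF assms]]) simp
 also have "... = prod_list (diag_mat (mat_diag n d))"
  by (rule det_upper_triangular[of _ n]) (auto simp: upper_triangular_def mat_diag_def)
 also have "... = (\<Prod>i<n. d i)"
  unfolding prod_list_diag_prod by (simp add: lessThan_atLeast0 mat_diag_def)
 finally show ?thesis .
qed

lemma char_poly_unitary_conj:
 assumes "unitary_mat n U"
 shows "char_poly (U * mat_diag n d * mat_adjoint U) = (\<Prod>i<n. [:- d i, 1:])"
proof -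
 have "char_poly (U * mat_diag n d * mat_adjoint U) = char_poly (mat_diag n d)"
  by (rule char_poly_similar[OF unitary_similar[OF assms]]) simp
 also have "... = (\<Prod>a\<leftarrow>diag_mat (mat_diag n d). [:- a, 1:])"
  by (rule char_poly_upper_triangular[of _ n]) (auto simp: upper_triangular_def mat_diag_def)
 also have "... = (\<Prod>i<n. [:- d i, 1:])"
  unfolding diag_mat_def
  by (simp add: prod.list_conv_set_nth lessThan_atLeast0 mat_diag_def)
 finally show ?thesis .
qed

text \<open>The power does not depend on the diagonalisation. For two of them, with unitary factors
  U and V, the matrix W = (adjoint of V) U intertwines the diagonals, so an entry of W vanishes
  unless the two diagonal entries that it links are equal; hence W also intertwines their
  powers.\<close>

lemma mat_cpowr_unitary_conj:
 assumes "unitary_mat n U"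
 shows "mat_cpowr (U * mat_diag n d * mat_adjoint U) z =
  U * mat_diag n (\<lambda>i. d i powr z) * mat_adjoint U"
proof -
 note U = unitary_matD[OF assms]
 let ?A = "U * mat_diag n d * mat_adjoint U"
 have dr: "dim_row ?A = n" using U(1) by simp
 show ?thesis unfolding mat_cpowr_def dr
 proof (rule the_equality)
  show "\<exists>V e. V \<in> carrier_mat n n \<and> V * mat_adjoint V = 1\<^sub>m n \<and> ?A = V * mat_diag n e * mat_adjoint V \<and>
   U * mat_diag n (\<lambda>i. d i powr z) * mat_adjoint U = V * mat_diag n (\<lambda>i. e i powr z) * mat_adjoint V"
   using U(1,2) by blast
 next
  fix B assume "\<exists>V e. V \<in> carrier_mat n n \<and> V * mat_adjoint V = 1\<^sub>m n \<and> ?A = V * mat_diag n e * mat_adjoint V \<and>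
   B = V * mat_diag n (\<lambda>i. e i powr z) * mat_adjoint V"
  then obtain V e where V0: "V \<in> carrier_mat n n" "V * mat_adjoint V = 1\<^sub>m n"
   and AV: "?A = V * mat_diag n e * mat_adjoint V" and B: "B = V * mat_diag n (\<lambda>i. e i powr z) * mat_adjoint V"
   by blast
  have Vu: "unitary_mat n V" using V0 by (simp add: unitary_mat_def)
  note V = unitary_matD[OF Vu]
  define W where "W = mat_adjoint V * U"
  have W: "W \<in> carrier_mat n n" using mult_carrier_mat[OF V(4) U(1)] by (simp add: W_def)
  have AU: "?A * U = U * mat_diag n d"
   unfolding assoc_mult_mat[OF mult_carrier_mat[OF U(1) mat_diag_carrier] U(4,1)] U(3)
   by (rule right_mult_one_mat[OF mult_carrier_mat[OF U(1) mat_diag_carrier]])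
  have VA: "mat_adjoint V * ?A = mat_diag n e * mat_adjoint V"
  proof -
   have "mat_adjoint V * ?A = (mat_adjoint V * V) * (mat_diag n e * mat_adjoint V)"
    unfolding AV assoc_mult_mat[OF V(1) mat_diag_carrier V(4)]
     assoc_mult_mat[OF V(4,1) mult_carrier_mat[OF mat_diag_carrier V(4)]] ..
   then show ?thesis
    unfolding V(3) left_mult_one_mat[OF mult_carrier_mat[OF mat_diag_carrier V(4)]] .
  qed
  have "W * mat_diag n d = mat_adjoint V * (U * mat_diag n d)"
   unfolding W_def by (rule assoc_mult_mat[OF V(4) U(1) mat_diag_carrier])
  also have "... = mat_adjoint V * ?A * U"
   using AU assoc_mult_mat[OF V(4) _ U(1), of ?A] mult_carrier_mat[OF mult_carrier_mat[OF U(1) mat_diag_carrier] U(4)]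
   by metis
  also have "... = mat_diag n e * W"
   unfolding VA W_def by (rule assoc_mult_mat[OF mat_diag_carrier V(4) U(1)])
  finally have WD: "W * mat_diag n d = mat_diag n e * W" .
  have Wr: "(W * mat_diag n f) $$ (i, j) = W $$ (i, j) * f j" if "i < n" "j < n" for i j f
  proof -
   have "(W * mat_diag n f) $$ (i, j) = (\<Sum>k<n. W $$ (i, k) * mat_diag n f $$ (k, j))"
    by (rule index_mult_mat_sum[OF W mat_diag_carrier that])
   also have "... = (\<Sum>k<n. if k = j then W $$ (i, k) * f k else 0)"
    using that by (intro sum.cong refl) auto
   finally show ?thesis using that by simp
  qed
  have Wl: "(mat_diag n f * W) $$ (i, j) = f i * W $$ (i, j)" if "i < n" "j < n" for i j f
  proof -
   have "(mat_diag n f * W) $$ (i, j) = (\<Sum>k<n. mat_diag n f $$ (i, k) * W $$ (k, j))"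
    by (rule index_mult_mat_sum[OF mat_diag_carrier W that])
   also have "... = (\<Sum>k<n. if k = i then f i * W $$ (k, j) else 0)"
    using that by (intro sum.cong refl) auto
   finally show ?thesis using that by simp
  qed
  have WD': "W * mat_diag n (\<lambda>i. d i powr z) = mat_diag n (\<lambda>i. e i powr z) * W"
  proof (rule eq_matI)
   fix i j assume "i < dim_row (mat_diag n (\<lambda>i. e i powr z) * W)" "j < dim_col (mat_diag n (\<lambda>i. e i powr z) * W)"
   with W have ij: "i < n" "j < n" by (auto simp: mat_diag_def)
   have "W $$ (i, j) * d j = e i * W $$ (i, j)"
    using Wr[OF ij] Wl[OF ij] WD by metis
   then have "W $$ (i, j) = 0 \<or> d j = e i" by auto
   then show "(W * mat_diag n (\<lambda>i. d i powr z)) $$ (i, j) = (mat_diag n (\<lambda>i. e i powr z) * W) $$ (i, j)"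
    unfolding Wr[OF ij] Wl[OF ij] by auto
  qed (use W in \<open>auto simp: mat_diag_def\<close>)
  have VW: "V * W = U"
   unfolding W_def assoc_mult_mat[OF V(1,4) U(1), symmetric] V(2) left_mult_one_mat[OF U(1)] ..
  let ?D = "mat_diag n (\<lambda>i. d i powr z)" and ?E = "mat_diag n (\<lambda>i. e i powr z)"
  have WU: "W * mat_adjoint U = mat_adjoint V"
   unfolding W_def assoc_mult_mat[OF V(4) U(1,4)] U(2) right_mult_one_mat[OF V(4)] ..
  have "U * ?D * mat_adjoint U = (V * W) * ?D * mat_adjoint U" by (simp add: VW)
  also have "(V * W) * ?D = V * (W * ?D)" by (rule assoc_mult_mat[OF V(1) W mat_diag_carrier])
  also have "... = V * (?E * W)" by (simp add: WD')
  also have "... = V * ?E * W" using assoc_mult_mat[OF V(1) mat_diag_carrier W] by simp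
  also have "... * mat_adjoint U = V * ?E * (W * mat_adjoint U)"
   by (rule assoc_mult_mat[OF mult_carrier_mat[OF V(1) mat_diag_carrier] W U(4)])
  also have "... = B" unfolding WU B ..
  finally show "B = U * ?D * mat_adjoint U" ..
 qed
qed

lemma unitary_conj_affine:
 assumes "unitary_mat n U"
 shows "1\<^sub>m n + c \<cdot>\<^sub>m (U * mat_diag n d * mat_adjoint U) =
  U * mat_diag n (\<lambda>i. 1 + c * d i) * mat_adjoint U"
proof (rule eq_matI)
 note U = unitary_matD[OF assms]
 fix i j assume "i < dim_row (U * mat_diag n (\<lambda>i. 1 + c * d i) * mat_adjoint U)"
  "j < dim_col (U * mat_diag n (\<lambda>i. 1 + c * d i) * mat_adjoint U)"
 with U(1) have ij: "i < n" "j < n" by auto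
 have c: "U * mat_diag n d * mat_adjoint U \<in> carrier_mat n n" using U by auto
 have g: "(1\<^sub>m n + c \<cdot>\<^sub>m M) $$ (i, j) = (if i = j then 1 else 0) + c * M $$ (i, j)"
  if "M \<in> carrier_mat n n" for M using that ij by simp
 have "(1\<^sub>m n + c \<cdot>\<^sub>m (U * mat_diag n d * mat_adjoint U)) $$ (i, j) =
  (if i = j then 1 else 0) + c * (U * mat_diag n d * mat_adjoint U) $$ (i, j)"
  by (rule g[OF c])
 also have "... = (\<Sum>l<n. U $$ (i, l) * cnj (U $$ (j, l))) + c * (\<Sum>l<n. U $$ (i, l) * d l * cnj (U $$ (j, l)))"
  unfolding unitary_index_sum[OF assms ij] unitary_diag_index[OF U(1) ij] ..
 also have "... = (\<Sum>l<n. U $$ (i, l) * (1 + c * d l) * cnj (U $$ (j, l)))"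
  unfolding sum_distrib_left sum.distrib[symmetric] by (intro sum.cong refl) (simp add: algebra_simps)
 finally show "(1\<^sub>m n + c \<cdot>\<^sub>m (U * mat_diag n d * mat_adjoint U)) $$ (i, j) =
  (U * mat_diag n (\<lambda>i. 1 + c * d i) * mat_adjoint U) $$ (i, j)"
  unfolding unitary_diag_index[OF U(1) ij] .
qed (use unitary_matD[OF assms] in auto)

lemma cauchy_weight_eq_prod:
 assumes "unitary_mat N U" and X: "X = U * real_diag N d * mat_adjoint U"
 shows "cauchy_weight s N X = (\<Prod>i<N. w_H s N (d i))"
proof -
 note U = unitary_matD[OF assms(1)]
 have Xc: "X \<in> carrier_mat N N" unfolding X using U by auto
 have m: "1\<^sub>m N - \<i> \<cdot>\<^sub>m X = 1\<^sub>m N + (- \<i>) \<cdot>\<^sub>m X"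
  using Xc by (intro eq_matI) auto
 have "det (mat_cpowr (1\<^sub>m N + \<i> \<cdot>\<^sub>m X) (- s - of_nat N)) *
   det (mat_cpowr (1\<^sub>m N - \<i> \<cdot>\<^sub>m X) (- cnj s - of_nat N)) =
   (\<Prod>i<N. (1 + \<i> * of_real (d i)) powr (- s - of_nat N)) *
   (\<Prod>i<N. (1 + - \<i> * of_real (d i)) powr (- cnj s - of_nat N))"
  unfolding m unfolding X unitary_conj_affine[OF assms(1)] mat_cpowr_unitary_conj[OF assms(1)]
   det_unitary_conj[OF assms(1)] ..
 also have "... = (\<Prod>i<N. complex_of_real (w_H s N (d i)))"
  unfolding prod.distrib[symmetric] w_H_eq_powr by (intro prod.cong refl) simp
 finally show ?thesis unfolding cauchy_weight_def by (simp flip: of_real_prod)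
qed

lemma order_linear_factor: "Polynomial.order a [:- b, 1 :: complex:] = (if b = a then 1 else 0)"
 using order_power_n_n[of a 1] by (auto intro: Polynomial.order_0I)

text \<open>The last entry of a monotone vector is the largest root. The two vectors therefore agree
  there, and the common linear factor cancels.\<close>

lemma roots_unique:
 fixes x y :: "nat => real"
 assumes "mono_on {..<n} x" "mono_on {..<n} y"
  "(\<Prod>i<n. [:- complex_of_real (x i), 1:]) = (\<Prod>i<n. [:- complex_of_real (y i), 1:])"
 shows "\<forall>i<n. x i = y i"
 using assms
proof (induction n)
 case (Suc n)
 have root: "poly (\<Prod>i<Suc n. [:- complex_of_real (x i), 1:]) (of_real t) = 0 \<longleftrightarrow> (\<exists>i<Suc n. t = x i)"
  for t and x :: "nat => real"
  unfolding poly_prod by (subst prod_zero_iff) (auto simp del: prod.lessThan_Suc)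
 have le: "x n <= y n" if "mono_on {..<Suc n} y"
  "(\<Prod>i<Suc n. [:- complex_of_real (x i), 1:]) = (\<Prod>i<Suc n. [:- complex_of_real (y i), 1:])"
  for x y :: "nat => real"
 proof -
  have "poly (\<Prod>i<Suc n. [:- complex_of_real (x i), 1:]) (of_real (x n)) = 0"
   unfolding root by blast
  then have "\<exists>i<Suc n. x n = y i" unfolding that(2) root .
  then obtain i where "i < Suc n" "x n = y i" by blast
  then show ?thesis using mono_onD[OF that(1), of i n] by auto
 qed
 have eq: "x n = y n" using le[of y x] le[of x y] Suc.prems by simp
 have "[:- complex_of_real (x n), 1:] ~= 0" by simp
 then have "(\<Prod>i<n. [:- complex_of_real (x i), 1:]) = (\<Prod>i<n. [:- complex_of_real (y i), 1:])"
  using Suc.prems(3) eq by (simp del: mult_pCons_left mult_pCons_right)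
 moreover have "mono_on {..<n} x" "mono_on {..<n} y"
  using Suc.prems(1,2) by (auto intro: mono_on_subset)
 ultimately have "\<forall>i<n. x i = y i" using Suc.IH by blast
 then show ?case using eq less_Suc_eq by metis
qed simp

text \<open>Monotonicity fixes the values, and extensionality makes the vector a point of the
  product space over \<open>{..<n}\<close>, so that the choice is unique and can be integrated
  over.\<close>

definition eigs :: "nat => complex mat => nat => real" where
 "eigs n A = (SOME x. x \<in> extensional {..<n} \<and> mono_on {..<n} x \<and>
  char_poly A = (\<Prod>i<n. [:- complex_of_real (x i), 1:]))"

lemma
 assumes "A \<in> hermitian_mats n"
 shows eigs_extensional: "eigs n A \<in> extensional {..<n}"
  and eigs_mono: "mono_on {..<n} (eigs n A)"
  and eigs_char_poly: "char_poly A = (\<Prod>i<n. [:- complex_of_real (eigs n A i), 1:])"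
proof -
 obtain U d where U: "unitary_mat n U"
  and A: "A = U * real_diag n d * mat_adjoint U"
  using hermitian_spectral[OF assms] by blast
 define xs where "xs = sort (map d [0..<n])"
 define x where "x = restrict (\<lambda>i. xs ! i) {..<n}"
 have len: "length xs = n" by (simp add: xs_def)
 have "mono_on {..<n} x"
  by (rule mono_onI) (auto simp: x_def xs_def intro: sorted_nth_mono)
 moreover have "char_poly A = (\<Prod>i<n. [:- complex_of_real (x i), 1:])"
 proof -
  let ?f = "\<lambda>t. [:- complex_of_real t, 1:]"
  have "char_poly A = (\<Prod>i<n. ?f (d i))" unfolding A char_poly_unitary_conj[OF U] ..
  also have "... = prod_list (map ?f (map d [0..<n]))"
   by (simp add: prod.list_conv_set_nth lessThan_atLeast0)
  also have "... = prod_mset (mset (map ?f (map d [0..<n])))" by (simp only: prod_mset_prod_list)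
  also have "mset (map ?f (map d [0..<n])) = mset (map ?f xs)" by (simp only: mset_map xs_def mset_sort)
  also have "prod_mset (mset (map ?f xs)) = prod_list (map ?f xs)" by (simp only: prod_mset_prod_list)
  also have "... = (\<Prod>i<n. ?f (x i))"
   using len by (simp add: prod.list_conv_set_nth lessThan_atLeast0 x_def)
  finally show ?thesis .
 qed
 moreover have "x \<in> extensional {..<n}" by (simp add: x_def)
 ultimately have "\<exists>x. x \<in> extensional {..<n} \<and> mono_on {..<n} x \<and>
  char_poly A = (\<Prod>i<n. [:- complex_of_real (x i), 1:])" by blast
 from someI_ex[OF this, folded eigs_def]
 show "eigs n A \<in> extensional {..<n}" "mono_on {..<n} (eigs n A)"
  "char_poly A = (\<Prod>i<n. [:- complex_of_real (eigs n A i), 1:])" by auto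
qed

lemma eigs_eqI:
 assumes "A \<in> hermitian_mats n" "x \<in> extensional {..<n}" "mono_on {..<n} x"
  "char_poly A = (\<Prod>i<n. [:- complex_of_real (x i), 1:])"
 shows "eigs n A = x"
proof -
 have "\<forall>i<n. eigs n A i = x i"
  by (rule roots_unique[OF eigs_mono[OF assms(1)] assms(3)])
   (rule trans[OF sym[OF eigs_char_poly[OF assms(1)]] assms(4)])
 then show ?thesis
  by (intro extensionalityI[OF eigs_extensional[OF assms(1)] assms(2)]) simp
qed

lemma eigs_cong_char_poly:
 assumes "A \<in> hermitian_mats n" "B \<in> hermitian_mats n" "char_poly A = char_poly B"
 shows "eigs n A = eigs n B"
 by (rule eigs_eqI[OF assms(1) eigs_extensional[OF assms(2)] eigs_mono[OF assms(2)]])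
  (rule trans[OF assms(3) eigs_char_poly[OF assms(2)]])

lemma eigenvalue_iff_eigs:
 assumes "A \<in> hermitian_mats n"
 shows "eigenvalue A (complex_of_real l) \<longleftrightarrow> (\<exists>i<n. l = eigs n A i)"
 unfolding eigenvalue_root_char_poly[OF hermitian_matsD(1)[OF assms]] eigs_char_poly[OF assms] poly_prod
 by (subst prod_zero_iff) auto

lemma largest_eigenvalue_eq_eigs:
 assumes "A \<in> hermitian_mats n" "n >= 1"
 shows "largest_eigenvalue A = eigs n A (n - 1)"
 unfolding largest_eigenvalue_def eigenvalue_iff_eigs[OF assms(1)]
proof (rule Max_eqI)
 have "{l. \<exists>i<n. l = eigs n A i} = eigs n A ` {..<n}" by auto
 then show "finite {l. \<exists>i<n. l = eigs n A i}" by simp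
 show "eigs n A (n - 1) \<in> {l. \<exists>i<n. l = eigs n A i}" using assms(2) by (auto intro!: exI[of _ "n - 1"])
 fix y assume "y \<in> {l. \<exists>i<n. l = eigs n A i}"
 then show "y <= eigs n A (n - 1)" using mono_onD[OF eigs_mono[OF assms(1)], of _ "n - 1"] by auto
qed

text \<open>The diagonalisation may be rearranged so that the diagonal is \<^term>\<open>eigs n A\<close>; for the
 weight only the multiset of diagonal entries matters.\<close>

lemma cauchy_weight_eigs:
 assumes "X \<in> hermitian_mats N"
 shows "cauchy_weight s N X = (\<Prod>i<N. w_H s N (eigs N X i))"
proof -
 obtain U d where U: "unitary_mat N U"
  and X: "X = U * real_diag N d * mat_adjoint U"
  using hermitian_spectral[OF assms] by blast
 have inj: "inj (\<lambda>t. [:- complex_of_real t, 1:])" by (auto simp: inj_def)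
 have eqp: "(\<Prod>i<N. [:- complex_of_real (d i), 1:]) = (\<Prod>i<N. [:- complex_of_real (eigs N X i), 1:])"
  using eigs_char_poly[OF assms] char_poly_unitary_conj[OF U] X by simp
 define c where "c p t = Polynomial.order (complex_of_real t) p" for p :: "complex poly" and t
 \<comment> \<open>The multiplicity of a number among the diagonal entries is its order as a root,
   so equal characteristic polynomials give equal multisets.\<close>
 have ord: "Polynomial.order a (\<Prod>i<N. [:- complex_of_real (x i), 1:]) =
   (\<Sum>i<N. if of_real (x i) = a then 1 else 0)" for x :: "nat => real" and a
 proof (induction N)
  case (Suc m)
  have "(\<Prod>i<m. [:- complex_of_real (x i), 1:]) * [:- complex_of_real (x m), 1:] ~= 0"
   by (simp del: mult_pCons_right mult_pCons_left)
  then show ?case using Suc.IH by (simp add: order_mult order_linear_factor del: mult_pCons_right mult_pCons_left)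
 qed simp
 have pm: "(\<Prod>i<N. f (x i)) = prod_mset (image_mset f (image_mset x (mset_set {..<N})))"
  for f :: "real => real" and x :: "nat => real"
  by (simp add: prod_unfold_prod_mset multiset.map_comp o_def)
 have "image_mset d (mset_set {..<N}) = image_mset (eigs N X) (mset_set {..<N})"
 proof (rule multiset_eqI)
  fix t
  have cnt: "count (image_mset x (mset_set {..<N})) t =
    (\<Sum>i<N. if complex_of_real (x i) = of_real t then 1 else 0)" for x :: "nat => real"
   by (simp add: count_image_mset sum.If_cases Int_def vimage_def conj_commute)
  show "count (image_mset d (mset_set {..<N})) t = count (image_mset (eigs N X) (mset_set {..<N})) t"
   unfolding cnt ord[symmetric] eqp ..
 qed
 then have "(\<Prod>i<N. w_H s N (d i)) = (\<Prod>i<N. w_H s N (eigs N X i))"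
  using pm[of "w_H s N" d] pm[of "w_H s N" "eigs N X"] by simp
 then show ?thesis using cauchy_weight_eq_prod[OF U X] by simp
qed

section \<open>Bordered matrices\<close>

definition border :: "nat => complex mat => (nat => complex) => real => complex mat" where
 "border n X v a = mat (Suc n) (Suc n) (\<lambda>(i, j). if i < n \<and> j < n then X $$ (i, j)
  else if i < n then v i else if j < n then cnj (v j) else of_real a)"

lemma border_carrier [simp]: "border n X v a \<in> carrier_mat (Suc n) (Suc n)"
 by (simp add: border_def)

lemma border_hermitian:
 assumes "X \<in> hermitian_mats n"
 shows "border n X v a \<in> hermitian_mats (Suc n)"
proof (rule hermitian_matsI)
 fix i j assume ij: "i < Suc n" "j < Suc n"
 show "border n X v a $$ (i, j) = cnj (border n X v a $$ (j, i))"
 proof (cases "i < n \<and> j < n")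
  case True
  then have "border n X v a $$ (i, j) = X $$ (i, j)" "border n X v a $$ (j, i) = X $$ (j, i)"
   using ij by (auto simp: border_def)
  then show ?thesis using hermitian_matsD(3)[OF assms, of i j] True by metis
 qed (use ij in \<open>auto simp: border_def\<close>)
qed simp

text \<open>The unitary matrix is \<open>U\<close> with an added corner entry 1. It diagonalises the
  old block, fixes the corner and turns the new column into the adjoint of \<open>U\<close> applied
  to \<open>v\<close>.\<close>

lemma border_conj:
 assumes U0: "unitary_mat n U"
  and X: "X = U * mat_diag n d * mat_adjoint U"
  and w: "\<And>j. j < n ==> w j = (\<Sum>i<n. cnj (U $$ (i, j)) * v i)"
 shows "\<exists>W. unitary_mat (Suc n) W \<and>
  border n X v a = W * border n (mat_diag n d) w a * mat_adjoint W"
proof -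
 note U = unitary_matD[OF U0]
 define m where "m = Suc n"
 define W where "W = mat m m (\<lambda>(i, j). if i < n \<and> j < n then U $$ (i, j) else if i = j then 1 else 0)"
 have W: "W \<in> carrier_mat m m" by (simp add: W_def)
 have Wa: "mat_adjoint W \<in> carrier_mat m m" by (rule mat_adjoint_carrier[OF W])
 have Wi: "W $$ (i, j) = U $$ (i, j)" "W $$ (i, n) = 0" "W $$ (n, j) = 0" if "i < n" "j < n" for i j
  using that by (auto simp: W_def m_def)
 have Wn: "W $$ (n, n) = 1" by (simp add: W_def m_def)
 have lt: "i < n \<or> i = n" if "i < m" for i using that by (auto simp: m_def)
 have sumSuc: "(\<Sum>l<m. f l) = (\<Sum>l<n. f l) + f n" for f :: "nat => complex" by (simp add: m_def)
 have "W * mat_adjoint W = 1\<^sub>m m"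
 proof (rule eq_matI)
  fix i j assume "i < dim_row (1\<^sub>m m :: complex mat)" "j < dim_col (1\<^sub>m m :: complex mat)"
  then have ij: "i < m" "j < m" by auto
  have "(W * mat_adjoint W) $$ (i, j) = (\<Sum>l<m. W $$ (i, l) * cnj (W $$ (j, l)))"
   unfolding index_mult_mat_sum[OF W Wa ij]
   by (intro sum.cong refl) (simp add: mat_adjoint_index[OF W _ ij(2)])
  also have "... = (if i = j then 1 else 0)"
   unfolding sumSuc using lt[OF ij(1)] lt[OF ij(2)] unitary_index_sum(1)[OF U0, of i j]
   by (elim disjE) (simp_all add: Wi Wn)
  finally show "(W * mat_adjoint W) $$ (i, j) = 1\<^sub>m m $$ (i, j)" using ij by simp
 qed (use W in auto)
 then have Wu: "unitary_mat m W" using W by (simp add: unitary_mat_def)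
 let ?B = "border n (mat_diag n d) w a"
 have B: "?B \<in> carrier_mat m m" by (simp add: m_def)
 have Bi: "?B $$ (k, l) = (if k = l then d k else 0)" "?B $$ (k, n) = w k" "?B $$ (n, l) = cnj (w l)"
  if "k < n" "l < n" for k l using that by (auto simp: border_def)
 have Bn: "?B $$ (n, n) = of_real a" by (simp add: border_def)
 have Uv: "(\<Sum>l<n. U $$ (i, l) * w l) = v i" if i: "i < n" for i
 proof -
  have "(\<Sum>l<n. U $$ (i, l) * w l) = (\<Sum>l<n. \<Sum>k<n. U $$ (i, l) * cnj (U $$ (k, l)) * v k)"
   by (intro sum.cong refl) (simp add: w sum_distrib_left mult.assoc)
  also have "... = (\<Sum>k<n. (\<Sum>l<n. U $$ (i, l) * cnj (U $$ (k, l))) * v k)"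
   unfolding sum_distrib_right by (rule sum.swap)
  also have "... = (\<Sum>k<n. if i = k then v k else 0)"
   by (intro sum.cong refl) (simp add: unitary_index_sum(1)[OF U0 i])
  finally show ?thesis using i by simp
 qed
 have Uv': "(\<Sum>l<n. cnj (w l) * cnj (U $$ (i, l))) = cnj (v i)" if i: "i < n" for i
  using arg_cong[OF Uv[OF i], of cnj] by (simp add: mult.commute)
 have "border n X v a = W * ?B * mat_adjoint W"
 proof (rule eq_matI)
  have c: "W * ?B * mat_adjoint W \<in> carrier_mat m m"
   by (rule mult_carrier_mat[OF mult_carrier_mat[OF W B] Wa])
  then show "dim_row (border n X v a) = dim_row (W * ?B * mat_adjoint W)"
   "dim_col (border n X v a) = dim_col (W * ?B * mat_adjoint W)"
   using W by (auto simp: border_def m_def)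
  fix i j assume "i < dim_row (W * ?B * mat_adjoint W)" "j < dim_col (W * ?B * mat_adjoint W)"
  with c have ij: "i < m" "j < m" by auto
  have WB: "(W * ?B) $$ (i, l) = (\<Sum>k<m. W $$ (i, k) * ?B $$ (k, l))" if "l < m" for l
   by (rule index_mult_mat_sum[OF W B ij(1) that])
  have "(W * ?B * mat_adjoint W) $$ (i, j) = (\<Sum>l<m. (W * ?B) $$ (i, l) * cnj (W $$ (j, l)))"
   unfolding index_mult_mat_sum[OF mult_carrier_mat[OF W B] Wa ij]
   by (intro sum.cong refl) (simp add: mat_adjoint_index[OF W _ ij(2)])
  also have "... = (\<Sum>l<n. (W * ?B) $$ (i, l) * cnj (W $$ (j, l))) + (W * ?B) $$ (i, n) * cnj (W $$ (j, n))"
   by (rule sumSuc)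
  also have "... = border n X v a $$ (i, j)"
  proof (cases "i < n")
   case i: True
   have Xn: "border n X v a $$ (i, n) = v i" using i by (simp add: border_def)
   have e1: "(W * ?B) $$ (i, l) = U $$ (i, l) * d l" if "l < n" for l
   proof -
    have "(W * ?B) $$ (i, l) = (\<Sum>k<n. W $$ (i, k) * ?B $$ (k, l)) + W $$ (i, n) * ?B $$ (n, l)"
     using WB[of l] that by (simp add: sumSuc m_def)
    also have "(\<Sum>k<n. W $$ (i, k) * ?B $$ (k, l)) = (\<Sum>k<n. if k = l then U $$ (i, k) * d k else 0)"
     by (intro sum.cong refl) (simp add: Wi[OF i] Bi that)
    finally show ?thesis using that by (simp add: Wi[OF i that])
   qed
   have e2: "(W * ?B) $$ (i, n) = v i"
   proof -
    have "(W * ?B) $$ (i, n) = (\<Sum>k<n. W $$ (i, k) * ?B $$ (k, n)) + W $$ (i, n) * ?B $$ (n, n)"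
     using WB[of n] by (simp add: sumSuc m_def)
    also have "(\<Sum>k<n. W $$ (i, k) * ?B $$ (k, n)) = (\<Sum>k<n. U $$ (i, k) * w k)"
     by (intro sum.cong refl) (simp add: Wi[OF i] Bi)
    finally show ?thesis by (simp add: Wi[OF i i] Uv[OF i])
   qed
   show ?thesis
   proof (cases "j < n")
    case j: True
    have "(\<Sum>l<n. (W * ?B) $$ (i, l) * cnj (W $$ (j, l))) = X $$ (i, j)"
     unfolding X unitary_diag_index[OF U(1) i j]
     by (intro sum.cong refl) (simp add: e1 Wi[OF j])
    moreover have "border n X v a $$ (i, j) = X $$ (i, j)" using i j by (simp add: border_def)
    ultimately show ?thesis by (simp add: Wi[OF j j])
   next
    case False
    then have jn: "j = n" using lt[OF ij(2)] by simp
    have "(\<Sum>l<n. (W * ?B) $$ (i, l) * cnj (W $$ (j, l))) = 0"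
     by (intro sum.neutral) (simp add: jn Wi)
    then show ?thesis by (simp only: jn Wn e2 Xn) simp
   qed
  next
   case False
   then have inn: "i = n" using lt[OF ij(1)] by simp
   have e1: "(W * ?B) $$ (n, l) = cnj (w l)" if "l < n" for l
   proof -
    have "(W * ?B) $$ (n, l) = (\<Sum>k<n. W $$ (n, k) * ?B $$ (k, l)) + W $$ (n, n) * ?B $$ (n, l)"
     using WB[of l] that by (simp add: sumSuc m_def inn)
    also have "(\<Sum>k<n. W $$ (n, k) * ?B $$ (k, l)) = 0"
     by (intro sum.neutral) (simp add: Wi)
    finally show ?thesis using that by (simp add: Wn Bi)
   qed
   have e2: "(W * ?B) $$ (n, n) = of_real a"
   proof -
    have "(W * ?B) $$ (n, n) = (\<Sum>k<n. W $$ (n, k) * ?B $$ (k, n)) + W $$ (n, n) * ?B $$ (n, n)"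
     using WB[of n] by (simp add: sumSuc m_def inn)
    also have "(\<Sum>k<n. W $$ (n, k) * ?B $$ (k, n)) = 0"
     by (intro sum.neutral) (simp add: Wi)
    finally show ?thesis by (simp add: Wn Bn)
   qed
   show ?thesis
   proof (cases "j < n")
    case j: True
    have "(\<Sum>l<n. (W * ?B) $$ (n, l) * cnj (W $$ (j, l))) = cnj (v j)"
     unfolding Uv'[OF j, symmetric] by (intro sum.cong refl) (simp add: e1 Wi[OF j])
    moreover have "border n X v a $$ (n, j) = cnj (v j)" using j by (simp add: border_def)
    ultimately show ?thesis by (simp add: inn Wi[OF j j])
   next
    case False
    then have jn: "j = n" using lt[OF ij(2)] by simp
    have "(\<Sum>l<n. (W * ?B) $$ (n, l) * cnj (W $$ (n, l))) = 0"
     by (intro sum.neutral) (simp add: Wi)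
    moreover have "border n X v a $$ (n, n) = of_real a" by (simp add: border_def)
    ultimately show ?thesis by (simp add: inn jn Wn e2)
   qed
  qed
  finally show "border n X v a $$ (i, j) = (W * ?B * mat_adjoint W) $$ (i, j)" ..
 qed
 with Wu show ?thesis unfolding m_def by blast
qed

text \<open>A Schur complement, computed for \<open>x\<close> different from every
  \<open>d j\<close>. Both sides are polynomials in \<open>x\<close>, and agreement outside a finite
  set gives equality.\<close>

lemma char_poly_arrow:
 "char_poly (border n (mat_diag n d) w a) = [:- of_real a, 1:] * (\<Prod>j<n. [:- d j, 1:]) -
  (\<Sum>j<n. smult (of_real ((cmod (w j))\<^sup>2)) (\<Prod>k\<in>{..<n} - {j}. [:- d k, 1:]))"
  (is "?L = ?R")
proof -
 have ev: "poly ?L x = poly ?R x" if x: "x \<notin> d ` {..<n}" for x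
 proof -
  define m where "m = Suc n"
  let ?A = "border n (mat_diag n d) w a"
  define M where "M = - char_matrix ?A x"
  have M: "M \<in> carrier_mat m m" by (simp add: M_def m_def)
  have Me: "M $$ (i, j) = (if i = j then x else 0) - ?A $$ (i, j)" if "i < m" "j < m" for i j
   using that by (simp add: M_def char_matrix_def m_def border_def)
  have nz: "x - d j ~= 0" if "j < n" for j using x that by auto
  \<comment> \<open>Multiplication by the upper triangular \<open>T\<close> scales the old columns
    and clears the last column above the corner, so that \<open>M * T\<close> is lower triangular
    with diagonal 1, ..., 1 and the Schur complement.\<close>
  define T where "T = mat m m (\<lambda>(i, j). if i < n \<and> j < n then (if i = j then 1 / (x - d i) else 0)
   else if i < n then w i / (x - d i) else if j < n then 0 else 1)"
  have T: "T \<in> carrier_mat m m" by (simp add: T_def)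
  have Ti: "T $$ (k, l) = (if k = l then 1 / (x - d k) else 0)" "T $$ (k, n) = w k / (x - d k)" "T $$ (n, l) = 0"
   if "k < n" "l < n" for k l using that by (auto simp: T_def m_def)
  have Tn: "T $$ (n, n) = 1" by (simp add: T_def m_def)
  have Mi: "M $$ (k, l) = (if k = l then x - d k else 0)" "M $$ (k, n) = - w k" "M $$ (n, l) = - cnj (w l)"
   if "k < n" "l < n" for k l using that Me by (auto simp: m_def border_def)
  have Mn: "M $$ (n, n) = x - of_real a" using Me[of n n] by (simp add: border_def m_def)
  have sumSuc: "(\<Sum>l<m. f l) = (\<Sum>l<n. f l) + f n" for f :: "nat => complex" by (simp add: m_def)
  have MT: "M * T \<in> carrier_mat m m" by (rule mult_carrier_mat[OF M T])
  have MTi: "(M * T) $$ (i, j) = (\<Sum>k<n. M $$ (i, k) * T $$ (k, j)) + M $$ (i, n) * T $$ (n, j)"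
   if "i < m" "j < m" for i j using index_mult_mat_sum[OF M T that] by (simp add: sumSuc)
  have detT: "det T = (\<Prod>j<n. 1 / (x - d j))"
  proof -
   have "det T = prod_list (diag_mat T)"
    by (rule det_upper_triangular[OF _ T]) (auto simp: upper_triangular_def T_def m_def)
   also have "... = (\<Prod>j<m. T $$ (j, j))" unfolding prod_list_diag_prod using T by (simp add: lessThan_atLeast0)
   also have "... = (\<Prod>j<n. T $$ (j, j)) * T $$ (n, n)" by (simp add: m_def)
   finally show ?thesis by (simp add: Ti Tn)
  qed
  have diag1: "(M * T) $$ (i, j) = (if i = j then 1 else 0)" if "i < n" "j < n" for i j
  proof -
   have "(\<Sum>k<n. M $$ (i, k) * T $$ (k, j)) = (\<Sum>k<n. if k = i then (x - d i) * T $$ (i, j) else 0)"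
    using that by (intro sum.cong refl) (auto simp: Mi)
   then show ?thesis using that nz[of i] MTi[of i j] by (auto simp: Mi Ti m_def)
  qed
  have diag2: "(M * T) $$ (i, n) = 0" if "i < n" for i
  proof -
   have "(\<Sum>k<n. M $$ (i, k) * T $$ (k, n)) = (\<Sum>k<n. if k = i then (x - d i) * T $$ (i, n) else 0)"
    using that by (intro sum.cong refl) (auto simp: Mi)
   then show ?thesis using that nz[of i] MTi[of i n] by (simp add: Mi Ti Tn m_def)
  qed
  have diag3: "(M * T) $$ (n, n) = x - of_real a - (\<Sum>k<n. of_real ((cmod (w k))\<^sup>2) / (x - d k))"
  proof -
   have "(\<Sum>k<n. M $$ (n, k) * T $$ (k, n)) = (\<Sum>k<n. - (of_real ((cmod (w k))\<^sup>2) / (x - d k)))"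
    by (intro sum.cong refl) (simp add: Mi Ti complex_norm_square mult.commute del: of_real_power)
   then show ?thesis using MTi[of n n] by (simp add: Mn Tn m_def sum_negf)
  qed
  have "det (M * T) = prod_list (diag_mat (M * T))"
  proof (rule det_lower_triangular[OF _ MT])
   fix i j assume "i < j" "j < m"
   then show "(M * T) $$ (i, j) = 0" using diag1[of i j] diag2[of i] by (cases "j = n") (auto simp: m_def)
  qed
  also have "... = (\<Prod>j<m. (M * T) $$ (j, j))" unfolding prod_list_diag_prod using M by (simp add: lessThan_atLeast0)
  also have "... = (\<Prod>j<n. (M * T) $$ (j, j)) * (M * T) $$ (n, n)" by (simp add: m_def)
  also have "(\<Prod>j<n. (M * T) $$ (j, j)) = 1" by (rule prod.neutral) (simp add: diag1)
  finally have dMT: "det (M * T) = x - of_real a - (\<Sum>k<n. of_real ((cmod (w k))\<^sup>2) / (x - d k))"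
   by (simp add: diag3)
  have dM: "det M * (\<Prod>j<n. 1 / (x - d j)) = x - of_real a - (\<Sum>k<n. of_real ((cmod (w k))\<^sup>2) / (x - d k))"
   unfolding dMT[symmetric] detT[symmetric] by (rule det_mult[OF M T, symmetric])
  have pr: "(\<Prod>j<n. 1 / (x - d j)) * (\<Prod>j<n. x - d j) = 1"
   unfolding prod.distrib[symmetric] by (rule prod.neutral) (use nz in auto)
  have "poly ?L x = det M" unfolding M_def by (rule char_poly_matrix[OF border_carrier])
  also have "... = det M * (\<Prod>j<n. 1 / (x - d j)) * (\<Prod>j<n. x - d j)"
   using pr by (simp add: mult.assoc)
  also have "... = (x - of_real a) * (\<Prod>j<n. x - d j) - (\<Sum>k<n. of_real ((cmod (w k))\<^sup>2) / (x - d k) * (\<Prod>j<n. x - d j))"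
   unfolding dM by (simp add: algebra_simps sum_distrib_left)
  also have "(\<Sum>k<n. of_real ((cmod (w k))\<^sup>2) / (x - d k) * (\<Prod>j<n. x - d j)) =
    (\<Sum>k<n. of_real ((cmod (w k))\<^sup>2) * (\<Prod>j\<in>{..<n} - {k}. x - d j))"
  proof (intro sum.cong refl)
   fix k assume k: "k \<in> {..<n}"
   have "(\<Prod>j<n. x - d j) = (x - d k) * (\<Prod>j\<in>{..<n} - {k}. x - d j)"
    by (rule prod.remove) (use k in auto)
   then show "of_real ((cmod (w k))\<^sup>2) / (x - d k) * (\<Prod>j<n. x - d j) =
    of_real ((cmod (w k))\<^sup>2) * (\<Prod>j\<in>{..<n} - {k}. x - d j)" using nz[of k] k by simp
  qed
  also have "(x - of_real a) * (\<Prod>j<n. x - d j) - ... = poly ?R x"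
   by (simp add: poly_prod poly_sum algebra_simps)
  finally show ?thesis .
 qed
 show ?thesis
 proof (rule ccontr)
  assume "?L ~= ?R"
  then have "finite {x. poly (?L - ?R) x = 0}" by (intro poly_roots_finite) simp
  moreover have "- (d ` {..<n}) \<subseteq> {x. poly (?L - ?R) x = 0}" using ev by (auto simp del: poly_diff poly_mult) (simp add: poly_diff)
  ultimately have "finite (- (d ` {..<n}))" by (rule rev_finite_subset)
  then have "finite (UNIV :: complex set)" using finite_compl[of "d ` {..<n}"] by simp
  then show False using infinite_UNIV_char_0 by blast
 qed
qed

lemma char_poly_border:
 assumes "unitary_mat n U" "X = U * mat_diag n d * mat_adjoint U"
  and w: "\<And>j. j < n ==> w j = (\<Sum>i<n. cnj (U $$ (i, j)) * v i)"
 shows "char_poly (border n X v a) = [:- of_real a, 1:] * (\<Prod>j<n. [:- d j, 1:]) -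
  (\<Sum>j<n. smult (of_real ((cmod (w j))\<^sup>2)) (\<Prod>k\<in>{..<n} - {j}. [:- d k, 1:]))"
proof -
 obtain W where W: "unitary_mat (Suc n) W"
  and eq: "border n X v a = W * border n (mat_diag n d) w a * mat_adjoint W"
  using border_conj[OF assms] by blast
 show ?thesis unfolding char_poly_arrow[symmetric] eq
  by (rule char_poly_similar[OF unitary_similar[OF W border_carrier]])
qed

section \<open>Measurable dependence of the ordered eigenvalues on the matrix\<close>

definition meas_poly :: "'a measure => ('a => 'b::{comm_ring_1,real_normed_algebra} poly) => bool" where
 "meas_poly M f \<longleftrightarrow> (\<forall>k. (\<lambda>x. coeff (f x) k) \<in> borel_measurable M)"

lemma meas_poly_const: "meas_poly M (\<lambda>_. p)" by (simp add: meas_poly_def)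

lemma meas_poly_pCons:
 "f \<in> borel_measurable M ==> meas_poly M g ==> meas_poly M (\<lambda>x. pCons (f x) (g x))"
 unfolding meas_poly_def
proof (intro allI)
 fix k assume "f \<in> borel_measurable M" "\<forall>k. (\<lambda>x. coeff (g x) k) \<in> borel_measurable M"
 then show "(\<lambda>x. coeff (pCons (f x) (g x)) k) \<in> borel_measurable M" by (cases k) auto
qed

lemma meas_poly_mult:
 fixes f g :: "'a => 'b::{comm_ring_1,real_normed_algebra,second_countable_topology} poly"
 shows "meas_poly M f ==> meas_poly M g ==> meas_poly M (\<lambda>x. f x * g x)"
 unfolding meas_poly_def coeff_mult by (intro allI borel_measurable_sum borel_measurable_times) auto

lemma meas_poly_prod:
 fixes f :: "'i => 'a => 'b::{comm_ring_1,real_normed_algebra,second_countable_topology} poly"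
 assumes "\<And>i. i \<in> I ==> meas_poly M (f i)"
 shows "meas_poly M (\<lambda>x. \<Prod>i\<in>I. f i x)"
 using assms by (induction I rule: infinite_finite_induct) (auto intro!: meas_poly_mult meas_poly_const)

lemma meas_poly_sum:
 fixes f :: "'i => 'a => 'b::{comm_ring_1,real_normed_algebra,second_countable_topology} poly"
 assumes "\<And>i. i \<in> I ==> meas_poly M (f i)"
 shows "meas_poly M (\<lambda>x. \<Sum>i\<in>I. f i x)"
 using assms unfolding meas_poly_def coeff_sum by (auto intro!: borel_measurable_sum)

lemma meas_poly_char_poly:
 assumes X: "\<And>x. X x \<in> carrier_mat n n"
  and m: "\<And>i j. i < n ==> j < n ==> (\<lambda>x. X x $$ (i, j)) \<in> borel_measurable M"
 shows "meas_poly M (\<lambda>x. char_poly (X x) :: complex poly)"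
proof -
 have e: "char_poly_matrix (X x) $$ (i, j) = [:- (X x $$ (i, j)), if i = j then 1 else 0:]"
  if "i < n" "j < n" for i j x using X[of x] that by (auto simp: char_poly_matrix_def)
 have eq: "char_poly (X x) = (\<Sum>p\<in>{p. p permutes {0..<n}}. signof p * (\<Prod>i = 0..<n. char_poly_matrix (X x) $$ (i, p i)))" for x
  unfolding char_poly_def by (rule det_def'[of _ n]) (simp add: X)
 have eq': "char_poly (X x) = (\<Sum>p\<in>{p. p permutes {0..<n}}. signof p *
   (\<Prod>i = 0..<n. [:- (X x $$ (i, p i)), if i = p i then 1 else 0:]))" for x
  unfolding eq
 proof (intro sum.cong refl arg_cong2[of _ _ _ _ times] prod.cong)
  fix p i assume "p \<in> {p. p permutes {0..<n}}" "i \<in> {0..<n}"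
  then have "i < n" "p i < n" using permutes_in_image[of p "{0..<n}" i] by auto
  then show "char_poly_matrix (X x) $$ (i, p i) = [:- (X x $$ (i, p i)), if i = p i then 1 else 0:]" by (rule e)
 qed
 show ?thesis unfolding eq'
 proof (intro meas_poly_sum meas_poly_mult meas_poly_const meas_poly_prod meas_poly_pCons)
  fix p i assume "p \<in> {p. p permutes {0..<n}}" "i \<in> {0..<n}"
  then have "i < n" "p i < n" using permutes_in_image[of p "{0..<n}" i] by auto
  then show "(\<lambda>x. - (X x $$ (i, p i))) \<in> borel_measurable M" using m by auto
 qed
qed

text \<open>Exhibits the coefficients of a shifted polynomial as linear combinations of those of
  \<open>p\<close> with constants independent of \<open>p\<close>, from which their measurability
  follows.\<close>

lemma pcompose_as_sum:
 fixes p :: "real poly"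
 assumes "Polynomial.degree p <= n"
 shows "pcompose p r = (\<Sum>i\<le>n. smult (coeff p i) (r ^ i))"
proof -
 have "poly p z = (\<Sum>i\<le>n. coeff p i * z ^ i)" for z
  unfolding poly_altdef using assms by (intro sum.mono_neutral_left) (auto simp: coeff_eq_0)
 then show ?thesis
  by (simp flip: poly_eq_poly_eq_iff add: fun_eq_iff poly_pcompose poly_sum)
qed

lemma degree_prod_linear: "Polynomial.degree (\<Prod>i<m. [:- x i, 1:: 'a::idom:]) = m"
 by (induction m) (auto simp: degree_mult_eq simp del: mult_pCons_left mult_pCons_right)

text \<open>The shift moves the roots to \<open>x i - t\<close>. If they are all at most 0, every
  factor has nonnegative coefficients and so has the product; conversely, a nonzero polynomial with
  nonnegative coefficients is positive at every positive point. A condition on a root thus becomes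
  countably many conditions on coefficients.\<close>

lemma max_root_le_iff:
 fixes x :: "nat => real"
 assumes "mono_on {..m} x"
 shows "x m <= t \<longleftrightarrow> (\<forall>k. coeff (pcompose (\<Prod>i<Suc m. [:- x i, 1:]) [:t, 1:]) k >= 0)"
proof
 have eq: "pcompose (\<Prod>i<k. [:- x i, 1:]) [:t, 1:] = (\<Prod>i<k. [:t - x i, 1:])" for k
  by (simp flip: poly_eq_poly_eq_iff add: fun_eq_iff poly_pcompose poly_prod algebra_simps)
 {
  assume le: "x m <= t"
  have "\<forall>l. coeff (\<Prod>i<k. [:t - x i, 1:]) l >= 0" if "k <= Suc m" for k
   using that
  proof (induction k)
   case (Suc k)
   have xk: "x k <= t" using mono_onD[OF assms, of k m] Suc.prems le by auto
   show ?case
   proof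
    fix l
    have "coeff (\<Prod>i<Suc k. [:t - x i, 1:]) l = (t - x k) * coeff (\<Prod>i<k. [:t - x i, 1:]) l +
      (case l of 0 => 0 | Suc l' => coeff (\<Prod>i<k. [:t - x i, 1:]) l')"
     by (simp add: mult.commute[of _ "pCons _ _"] coeff_pCons split: nat.split)
    then show "0 <= coeff (\<Prod>i<Suc k. [:t - x i, 1:]) l"
     using Suc.IH Suc.prems xk by (simp split: nat.split)
   qed
  qed simp
  then show "\<forall>k. coeff (pcompose (\<Prod>i<Suc m. [:- x i, 1:]) [:t, 1:]) k >= 0" unfolding eq by blast
 }
 assume nn: "\<forall>k. coeff (pcompose (\<Prod>i<Suc m. [:- x i, 1:]) [:t, 1:]) k >= 0"
 define q where "q = (\<Prod>i<Suc m. [:t - x i, 1:])"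
 have q: "\<forall>k. coeff q k >= 0" using nn unfolding eq q_def .
 have deg: "Polynomial.degree q = Suc m"
  unfolding q_def using degree_prod_linear[where x="\<lambda>i. x i - t" and m="Suc m"] by simp
 then have lc: "coeff q (Suc m) ~= 0" by (metis Zero_not_Suc degree_0 leading_coeff_0_iff)
 show "x m <= t"
 proof (rule ccontr)
  assume "\<not> x m <= t"
  then have pos: "x m - t > 0" by simp
  have "poly q (x m - t) = (\<Sum>i\<le>Suc m. coeff q i * (x m - t) ^ i)"
   unfolding poly_altdef deg ..
  also have "... > 0"
  proof (rule sum_pos2[of _ "Suc m"])
   have "coeff q (Suc m) > 0" using q lc by (simp add: less_le)
   then show "0 < coeff q (Suc m) * (x m - t) ^ Suc m" using pos by (intro mult_pos_pos zero_less_power)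
   show "0 <= coeff q i * (x m - t) ^ i" for i
    using q pos by (intro mult_nonneg_nonneg zero_le_power) auto
  qed auto
  finally have "poly q (x m - t) > 0" .
  moreover have "poly q (x m - t) = 0" unfolding q_def poly_prod by (subst prod_zero_iff) auto
  ultimately show False by simp
 qed
qed

lemma map_poly_of_real_prod:
 fixes x :: "nat => real"
 shows
 "map_poly complex_of_real (\<Prod>i<k. [:- x i, 1:]) = (\<Prod>i<k. [:- complex_of_real (x i), 1:])"
proof (induction k)
 case (Suc k)
 have "map_poly complex_of_real (p * [:- a, 1:]) = map_poly complex_of_real p * [:- complex_of_real a, 1:]" for p a
  by (rule poly_eqI) (simp add: coeff_map_poly coeff_pCons mult.commute[of _ "pCons _ _"] split: nat.split)
 then show ?case by (simp only: prod.lessThan_Suc Suc.IH)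
qed simp

text \<open>The largest root is measurable by \<open>max_root_le_iff\<close>. Splitting off its
  linear factor leaves a polynomial with measurable coefficients for the remaining roots, so the
  eigenvalues are treated from the top down.\<close>

lemma eigs_measurable:
 assumes X: "\<And>x. X x \<in> hermitian_mats n"
  and m: "\<And>i j. i < n ==> j < n ==> (\<lambda>x. X x $$ (i, j)) \<in> borel_measurable M"
 shows "(\<lambda>x. eigs n (X x)) \<in> measurable M (PiM {..<n} (\<lambda>_. borel))"
proof -
 define q where "q k x = (\<Prod>i<k. [:- eigs n (X x) i, 1:])" for k x
 have qdeg: "Polynomial.degree (q k x) = k" for k x unfolding q_def by (rule degree_prod_linear)
 have qn: "coeff (q n x) k = Re (coeff (char_poly (X x)) k)" for x k
 proof -
  have "char_poly (X x) = map_poly complex_of_real (q n x)"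
   unfolding eigs_char_poly[OF X] q_def
   by (simp only: map_poly_of_real_prod)
  then show ?thesis by (simp add: coeff_map_poly)
 qed
 have cp: "meas_poly M (\<lambda>x. char_poly (X x))"
  by (rule meas_poly_char_poly[of _ n]) (use hermitian_matsD(1)[OF X] m in auto)
 have base: "meas_poly M (q n)"
  unfolding meas_poly_def
 proof
  fix k show "(\<lambda>x. coeff (q n x) k) \<in> borel_measurable M"
   unfolding qn using cp by (auto simp: meas_poly_def intro!: measurable_compose[OF _ borel_measurable_Re])
 qed
 have lam: "(\<lambda>x. eigs n (X x) k) \<in> borel_measurable M" if "meas_poly M (q (Suc k))" "k < n" for k
 proof (rule borel_measurableI_le)
  fix t
  define C where "C l x = coeff (pcompose (q (Suc k) x) [:t, 1:]) l" for l x
  have [measurable]: "C l \<in> borel_measurable M" for l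
  proof -
   have eq: "C l = (\<lambda>x. \<Sum>i\<le>Suc k. coeff (q (Suc k) x) i * coeff ([:t, 1:] ^ i) l)"
    unfolding C_def by (subst pcompose_as_sum[of _ "Suc k"]) (auto simp: qdeg coeff_sum)
   show ?thesis unfolding eq
    by (intro borel_measurable_sum borel_measurable_times)
     (use that(1) in \<open>auto simp: meas_poly_def\<close>)
  qed
  have "eigs n (X x) k <= t \<longleftrightarrow> (\<forall>l. C l x >= 0)" for x
   unfolding C_def q_def
   by (rule max_root_le_iff, rule mono_on_subset[OF eigs_mono[OF X]]) (use that(2) in auto)
  then have "{x \<in> space M. eigs n (X x) k <= t} = {x \<in> space M. \<forall>l. C l x >= 0}" by simp
  also have "... \<in> sets M" by measurable
  finally show "{x \<in> space M. eigs n (X x) k <= t} \<in> sets M" .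
 qed
 have step: "meas_poly M (q k)" if q: "meas_poly M (q (Suc k))" and k: "k < n" for k
 proof -
  note l = lam[OF q k]
  \<comment> \<open>Synthetic division: each coefficient of the quotient is given by the next higher
    one. The induction on \<open>d\<close> starts above the degree, where the coefficient is 0, and
    descends.\<close>
  have rec: "coeff (q k x) j = coeff (q (Suc k) x) (Suc j) + eigs n (X x) k * coeff (q k x) (Suc j)" for x j
  proof -
   have "q (Suc k) x = pCons 0 (q k x) - smult (eigs n (X x) k) (q k x)"
    unfolding q_def by (simp add: mult.commute[of _ "pCons _ _"])
   then show ?thesis by simp
  qed
  have "(\<lambda>x. coeff (q k x) (Suc k - d)) \<in> borel_measurable M" for d
  proof (induction d)
   case 0
   then show ?case by (simp add: coeff_eq_0 qdeg)
  next
   case (Suc d)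
   show ?case
   proof (cases "d <= k")
    case True
    then have e: "Suc (Suc k - Suc d) = Suc k - d" by simp
    have "(\<lambda>x. coeff (q (Suc k) x) (Suc (Suc k - Suc d))) \<in> borel_measurable M"
     using q by (auto simp: meas_poly_def)
    then show ?thesis by (subst rec, subst (2) e) (intro borel_measurable_add borel_measurable_times Suc l)
   next
    case False
    then have "Suc k - Suc d = Suc k - d" by simp
    then show ?thesis using Suc by simp
   qed
  qed
  moreover have "(\<lambda>x. coeff (q k x) j) \<in> borel_measurable M" if "j > Suc k" for j
   using that by (simp add: coeff_eq_0 qdeg)
  moreover have "j = Suc k - (Suc k - j)" if "j <= Suc k" for j using that by simp
  ultimately show ?thesis unfolding meas_poly_def by (metis not_le)
 qed
 have all: "meas_poly M (q (n - d))" for d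
 proof (induction d)
  case (Suc d)
  then show ?case using step[of "n - Suc d"]
   by (cases "d < n") (auto simp: Suc_diff_Suc)
 qed (simp add: base)
 have ev: "(\<lambda>x. eigs n (X x) k) \<in> borel_measurable M" if "k < n" for k
  by (rule lam) (use all[of "n - Suc k"] that in auto)
 have "(\<lambda>x. \<lambda>i\<in>{..<n}. eigs n (X x) i) \<in> measurable M (PiM {..<n} (\<lambda>_. borel))"
  by (rule measurable_restrict) (use ev in auto)
 moreover have "(\<lambda>i\<in>{..<n}. eigs n (X x) i) = eigs n (X x)" for x
  using eigs_extensional[OF X] by (simp add: extensional_restrict)
 ultimately show ?thesis by simp
qed

section \<open>Determinants over finite sets and Andreief's identity\<close>

lemma poly_span:
 fixes e :: "nat => 'a::field poly"
 assumes "\<And>i. i < n ==> Polynomial.degree (e i) = i" "\<And>i. i < n ==> e i ~= 0"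
  and "\<And>k. k >= n ==> coeff q k = 0"
 shows "\<exists>c. q = (\<Sum>i<n. smult (c i) (e i))"
 using assms
proof (induction n arbitrary: q)
 case 0
 then have "q = 0" by (intro poly_eqI) simp
 then show ?case by simp
next
 case (Suc n)
 define a where "a = coeff q n / coeff (e n) n"
 have lc: "coeff (e n) n ~= 0" using Suc.prems(1,2)[of n] by (metis leading_coeff_0_iff lessI)
 have "\<exists>c. q - smult a (e n) = (\<Sum>i<n. smult (c i) (e i))"
 proof (rule Suc.IH)
  fix k assume "k >= n"
  then show "coeff (q - smult a (e n)) k = 0"
   using lc Suc.prems(3)[of k] Suc.prems(1)[of n] by (cases "k = n") (auto simp: a_def coeff_eq_0)
 qed (use Suc.prems in auto)
 then obtain c where "q - smult a (e n) = (\<Sum>i<n. smult (c i) (e i))" by blast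
 then have "q = (\<Sum>i<n. smult (c i) (e i)) + smult a (e n)" by (simp add: algebra_simps)
 then show ?case by (intro exI[of _ "c(n := a)"]) simp
qed

lemma det_triangular:
 assumes "A \<in> carrier_mat n n" "upper_triangular A \<or> (\<forall>i<n. \<forall>j<n. i < j --> A $$ (i, j) = 0)"
 shows "det A = (\<Prod>i<n. A $$ (i, i))"
proof -
 have "det A = prod_list (diag_mat A)"
  using assms det_upper_triangular[OF _ assms(1)] det_lower_triangular[OF _ assms(1)] by auto
 then show ?thesis unfolding prod_list_diag_prod using assms(1) by (simp add: lessThan_atLeast0)
qed

definition vand :: "nat => (nat => 'a::comm_ring_1) => 'a" where
 "vand n x = (\<Prod>j<n. \<Prod>i<j. x j - x i)"

text \<open>In the basis of Newton polynomials the matrix factors into two triangular ones. The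
  change of basis carries the leading coefficients on its diagonal; the values
  \<open>poly (q l) (x j)\<close> vanish for j < l and have the factors of the Vandermonde product
  on theirs.\<close>

lemma det_poly_vand:
 fixes x :: "nat => 'a::field"
 assumes "\<And>i. i < n ==> Polynomial.degree (p i) = i"
 shows "det (mat n n (\<lambda>(i, j). poly (p i) (x j))) = (\<Prod>i<n. lead_coeff (p i)) * vand n x"
proof -
 define q where "q i = (\<Prod>k<i. [:- x k, 1:])" for i
 have q0: "q i ~= 0" for i by (simp add: q_def)
 have dq: "Polynomial.degree (q i) = i" for i
  unfolding q_def by (induction i) (auto simp: degree_mult_eq simp del: mult_pCons_left mult_pCons_right)
 have lq: "coeff (q i) i = 1" for i
  using dq[of i] lead_coeff_prod[of "\<lambda>k. [:- x k, 1:]" "{..<i}"] by (simp add: q_def)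
 have "\<forall>i. \<exists>c. i < n --> p i = (\<Sum>l<Suc i. smult (c l) (q l))"
 proof (intro allI)
  fix i
  show "\<exists>c. i < n --> p i = (\<Sum>l<Suc i. smult (c l) (q l))"
  proof (cases "i < n")
   case True
   have "\<exists>c. p i = (\<Sum>l<Suc i. smult (c l) (q l))"
    by (rule poly_span) (use dq q0 assms[OF True] in \<open>auto intro: coeff_eq_0\<close>)
   then show ?thesis by blast
  qed simp
 qed
 from choice[OF this] obtain c where c: "\<And>i. i < n ==> p i = (\<Sum>l<Suc i. smult (c i l) (q l))" by blast
 have cii: "c i i = lead_coeff (p i)" if "i < n" for i
 proof -
  have "coeff (p i) i = (\<Sum>l<Suc i. c i l * coeff (q l) i)" by (subst c[OF that]) (simp add: coeff_sum)
  also have "... = (\<Sum>l<Suc i. if l = i then c i i else 0)"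
   by (intro sum.cong refl) (auto simp: lq dq coeff_eq_0)
  finally show ?thesis using assms[OF that] by simp
 qed
 define Cm where "Cm = mat n n (\<lambda>(i, l). if l <= i then c i l else 0)"
 define Q where "Q = mat n n (\<lambda>(l, j). poly (q l) (x j))"
 have Cc: "Cm \<in> carrier_mat n n" and Qc: "Q \<in> carrier_mat n n" by (auto simp: Cm_def Q_def)
 have "mat n n (\<lambda>(i, j). poly (p i) (x j)) = Cm * Q"
 proof (rule eq_matI)
  fix i j assume "i < dim_row (Cm * Q)" "j < dim_col (Cm * Q)"
  then have ij: "i < n" "j < n" by (auto simp: Cm_def Q_def)
  have "(Cm * Q) $$ (i, j) = (\<Sum>l<n. Cm $$ (i, l) * Q $$ (l, j))"
   by (rule index_mult_mat_sum[OF Cc Qc ij])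
  also have "... = (\<Sum>l<Suc i. Cm $$ (i, l) * Q $$ (l, j))"
   by (rule sum.mono_neutral_right) (use ij in \<open>auto simp: Cm_def\<close>)
  also have "... = (\<Sum>l<Suc i. c i l * poly (q l) (x j))"
   using ij by (intro sum.cong refl) (auto simp: Cm_def Q_def)
  also have "... = poly (p i) (x j)" by (subst c[OF ij(1)]) (simp add: poly_sum)
  finally show "mat n n (\<lambda>(i, j). poly (p i) (x j)) $$ (i, j) = (Cm * Q) $$ (i, j)" using ij by simp
 qed (auto simp: Cm_def Q_def)
 then have "det (mat n n (\<lambda>(i, j). poly (p i) (x j))) = det Cm * det Q"
  using det_mult[OF Cc Qc] by simp
 also have "det Cm = (\<Prod>i<n. lead_coeff (p i))"
 proof -
  have "det Cm = (\<Prod>i<n. Cm $$ (i, i))" by (rule det_triangular[OF Cc]) (auto simp: Cm_def)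
  then show ?thesis by (simp add: Cm_def cii)
 qed
 also have "det Q = vand n x"
 proof -
  have "det Q = (\<Prod>i<n. Q $$ (i, i))"
  proof (rule det_triangular[OF Qc], rule disjI1)
   show "upper_triangular Q"
   proof (rule upper_triangularI)
    fix i j assume "j < i" "i < dim_row Q"
    then show "Q $$ (i, j) = 0" by (auto simp: Q_def q_def poly_prod)
   qed
  qed
  then show ?thesis by (simp add: Q_def q_def poly_prod vand_def)
 qed
 finally show ?thesis .
qed

text \<open>Determinants over an arbitrary finite index set, so that principal minors need no
  renumbering.\<close>

definition det_on :: "('i => 'i => 'a::comm_ring_1) => 'i set => 'a" where
 "det_on G S = (\<Sum>p | p permutes S. of_int (sign p) * (\<Prod>i\<in>S. G i (p i)))"

lemma det_mat_eq_det_on: "det (mat n n (\<lambda>(i, j). G i j)) = det_on G {..<n}"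
 unfolding det_on_def
 by (subst det_def'[of _ n]) (auto simp: lessThan_atLeast0 intro!: sum.cong arg_cong2[of _ _ _ _ times] prod.cong
   dest: permutes_in_image)

lemma det_on_image:
 assumes "inj_on f A" "finite A"
 shows "det_on (\<lambda>i j. G (f i) (f j)) A = det_on G (f ` A)"
proof -
 have bij: "bij_betw f A (f ` A)" using assms by (simp add: bij_betw_def)
 have mp: "map_permutation A f = (\<lambda>p x. if x \<in> f ` A then f (p (inv_into A f x)) else x)"
  by (simp add: fun_eq_iff map_permutation_def restrict_id_def)
 have bb: "bij_betw (map_permutation A f) {p. p permutes A} {p. p permutes f ` A}"
  unfolding mp by (rule bij_betw_permutations[OF bij])
 show ?thesis
  unfolding det_on_def
 proof (rule sum.reindex_bij_betw[OF bb, symmetric, THEN trans, symmetric], intro sum.cong refl)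
  fix p assume "p \<in> {p. p permutes A}"
  then have p: "p permutes A" by simp
  have "(\<Prod>i\<in>f ` A. G i (map_permutation A f p i)) = (\<Prod>i\<in>A. G (f i) (map_permutation A f p (f i)))"
   by (rule prod.reindex_cong[OF assms(1)]) auto
  also have "... = (\<Prod>i\<in>A. G (f i) (f (p i)))"
   using assms(1) by (intro prod.cong refl) (simp add: map_permutation_def restrict_id_def)
  finally show "of_int (sign (map_permutation A f p)) * (\<Prod>i\<in>f ` A. G i (map_permutation A f p i)) =
   of_int (sign p) * (\<Prod>i\<in>A. G (f i) (f (p i)))"
   by (simp add: sign_map_permutation[OF assms(1) p assms(2)])
 qed
qed

text \<open>Each factor is expanded into its part from -G, chosen on the set S, and its part from
  the identity, chosen outside S. Only permutations that fix the complement of S survive, and these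
  are the permutations of S.\<close>

lemma det_on_one_minus:
 assumes "finite A"
 shows "det_on (\<lambda>i j. (if i = j then 1 else 0) - G i j) A = (\<Sum>S\<in>Pow A. (- 1) ^ card S * det_on G S)"
proof -
 let ?h = "\<lambda>p S. (\<Prod>i\<in>S. - G i (p i)) * (\<Prod>i\<in>A - S. if i = p i then 1 else 0)"
 have "det_on (\<lambda>i j. (if i = j then 1 else 0) - G i j) A =
  (\<Sum>p | p permutes A. \<Sum>S\<in>Pow A. of_int (sign p) *
    (?h p S))"
  unfolding det_on_def
  by (intro sum.cong refl) (simp add: prod_add[OF assms, symmetric] sum_distrib_left[symmetric] add.commute)
 also have "... = (\<Sum>S\<in>Pow A. \<Sum>p | p permutes A. of_int (sign p) *
    (?h p S))"
  by (rule sum.swap)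
 also have "... = (\<Sum>S\<in>Pow A. (- 1) ^ card S * det_on G S)"
 proof (intro sum.cong refl)
  fix S assume "S \<in> Pow A"
  then have S: "S \<subseteq> A" "finite S" using assms finite_subset by auto
  have "(\<Sum>p | p permutes A. of_int (sign p) * (?h p S)) =
   (\<Sum>p | p permutes S. of_int (sign p) * (?h p S))"
  proof (rule sum.mono_neutral_right)
   show "finite {p. p permutes A}" by (rule finite_permutations[OF assms])
   show "{p. p permutes S} \<subseteq> {p. p permutes A}" using permutes_subset[OF _ S(1)] by blast
   show "\<forall>p\<in>{p. p permutes A} - {p. p permutes S}. of_int (sign p) *
     (?h p S) = 0"
   proof
    fix p assume p: "p \<in> {p. p permutes A} - {p. p permutes S}"
    have "\<exists>i\<in>A - S. i ~= p i"
    proof (rule ccontr)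
     assume "\<not> ?thesis"
     then have "p permutes S"
      using p permutes_superset[of p A S] by auto
     then show False using p by simp
    qed
    then have "(\<Prod>i\<in>A - S. if i = p i then 1 else (0 :: 'b)) = 0"
     using assms by (intro prod_zero) auto
    then show "of_int (sign p) * (?h p S) = 0"
     by simp
   qed
  qed
  also have "... = (\<Sum>p | p permutes S. (- 1) ^ card S * (of_int (sign p) * (\<Prod>i\<in>S. G i (p i))))"
  proof (intro sum.cong refl)
   fix p assume "p \<in> {p. p permutes S}"
   then have "p permutes S" by simp
   then have "(\<Prod>i\<in>A - S. if i = p i then 1 else (0 :: 'b)) = 1"
    by (intro prod.neutral) (auto simp: permutes_not_in)
   moreover have "(\<Prod>i\<in>S. - G i (p i)) = (- 1) ^ card S * (\<Prod>i\<in>S. G i (p i))"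
    by (simp add: prod_uminus)
   ultimately show "of_int (sign p) * (?h p S) =
    (- 1) ^ card S * (of_int (sign p) * (\<Prod>i\<in>S. G i (p i)))" by simp
  qed
  finally show "(\<Sum>p | p permutes A. of_int (sign p) * (?h p S)) =
    (- 1) ^ card S * det_on G S" by (simp add: det_on_def sum_distrib_left)
 qed
 finally show ?thesis .
qed

lemma det_on_noninj:
 fixes G :: "'i => 'i => 'a::idom"
 assumes "\<not> inj_on l {..<k::nat}"
 shows "det_on (\<lambda>i j. G (l i) (l j)) {..<k} = 0"
proof -
 obtain i j where ij: "i < k" "j < k" "i ~= j" "l i = l j" using assms by (auto simp: inj_on_def)
 show ?thesis unfolding det_mat_eq_det_on[symmetric]
  by (rule det_identical_rows[OF _ ij(3,1,2)]) (use ij in \<open>auto intro!: eq_vecI\<close>)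
qed

text \<open>Composing one fixed bijection onto \<open>S\<close> with the permutations of the index
  set yields every injective tuple exactly once.\<close>

lemma card_bij_PiE:
 assumes "finite S" "card S = k"
 shows "card {l \<in> {..<k} \<rightarrow>\<^sub>E S. inj_on l {..<k}} = fact k"
proof -
 let ?L = "{l \<in> {..<k} \<rightarrow>\<^sub>E S. inj_on l {..<k}}"
 obtain h where h: "bij_betw h {..<k} S"
  using assms ex_bij_betw_nat_finite[of S] by (auto simp: lessThan_atLeast0)
 have hi: "inj_on h {..<k}" and hS: "h ` {..<k} = S" using h by (auto simp: bij_betw_def)
 have "bij_betw (\<lambda>p. \<lambda>i\<in>{..<k}. h (p i)) {p. p permutes {..<k}} ?L"
 proof (rule bij_betw_imageI)
  show "inj_on (\<lambda>p. \<lambda>i\<in>{..<k}. h (p i)) {p. p permutes {..<k}}"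
  proof (rule inj_onI)
   fix p q assume pq: "p \<in> {p. p permutes {..<k}}" "q \<in> {p. p permutes {..<k}}"
    and eq: "(\<lambda>i\<in>{..<k}. h (p i)) = (\<lambda>i\<in>{..<k}. h (q i))"
   show "p = q"
   proof
    fix i show "p i = q i"
    proof (cases "i < k")
     case True
     then have "h (p i) = h (q i)" using fun_cong[OF eq, of i] by simp
     moreover have "p i \<in> {..<k}" "q i \<in> {..<k}" using True pq permutes_in_image by fastforce+
     ultimately show ?thesis using hi by (auto simp: inj_on_def)
    next
     case False
     then show ?thesis using pq by (auto simp: permutes_not_in)
    qed
   qed
  qed
  show "(\<lambda>p. \<lambda>i\<in>{..<k}. h (p i)) ` {p. p permutes {..<k}} = ?L"
  proof (intro equalityI subsetI)
   fix l assume "l \<in> (\<lambda>p. \<lambda>i\<in>{..<k}. h (p i)) ` {p. p permutes {..<k}}"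
   then obtain p where p: "p permutes {..<k}" and l: "l = (\<lambda>i\<in>{..<k}. h (p i))" by blast
   have pi: "p i \<in> {..<k}" if "i \<in> {..<k}" for i using permutes_in_image[OF p] that by blast
   have "inj_on l {..<k}"
   proof (rule inj_onI)
    fix i j assume ij: "i \<in> {..<k}" "j \<in> {..<k}" "l i = l j"
    then have "h (p i) = h (p j)" by (simp add: l)
    then have "p i = p j" using inj_onD[OF hi] pi ij by blast
    then show "i = j" using permutes_inj[OF p] by (simp add: inj_eq)
   qed
   moreover have "l \<in> {..<k} \<rightarrow>\<^sub>E S" using pi hS by (auto simp: l)
   ultimately show "l \<in> ?L" by blast
  next
   fix l assume "l \<in> ?L"
   then have l: "l \<in> {..<k} \<rightarrow>\<^sub>E S" "inj_on l {..<k}" by auto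
   define p where "p i = (if i < k then inv_into {..<k} h (l i) else i)" for i
   have lS: "l i \<in> h ` {..<k}" if "i < k" for i using l(1) that hS by auto
   have hp: "h (p i) = l i" if "i < k" for i using f_inv_into_f[OF lS[OF that]] that by (simp add: p_def)
   have pk: "p i < k" if "i < k" for i using inv_into_into[OF lS[OF that]] that by (simp add: p_def)
   have "p permutes {..<k}"
   proof (rule bij_imp_permutes)
    have inj: "inj_on p {..<k}"
     by (rule inj_onI) (metis hp inj_onD l(2) lessThan_iff)
    moreover have "p ` {..<k} \<subseteq> {..<k}" using pk by auto
    ultimately show "bij_betw p {..<k} {..<k}"
     by (simp add: bij_betw_def endo_inj_surj)
   qed (simp add: p_def)
   moreover have "l = (\<lambda>i\<in>{..<k}. h (p i))"
    using hp l(1) by (auto simp: fun_eq_iff PiE_def extensional_def)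
   ultimately show "l \<in> (\<lambda>p. \<lambda>i\<in>{..<k}. h (p i)) ` {p. p permutes {..<k}}" by blast
  qed
 qed
 from bij_betw_same_card[OF this] show ?thesis by (simp add: card_permutations)
qed

text \<open>A tuple with a repeated entry gives two equal rows. The injective ones are grouped by
  their range, and each range of size k arises k! times.\<close>

lemma sum_det_on_tuples:
 fixes G :: "nat => nat => 'a::idom"
 shows "(\<Sum>l\<in>{..<k} \<rightarrow>\<^sub>E {..<n}. det_on (\<lambda>i j. G (l i) (l j)) {..<k}) =
  of_nat (fact k) * (\<Sum>S | S \<subseteq> {..<n} \<and> card S = k. det_on G S)"
proof -
 let ?L = "{..<k} \<rightarrow>\<^sub>E {..<n}"
 let ?I = "{l \<in> ?L. inj_on l {..<k}}"
 have fin: "finite ?L" by (intro finite_PiE) auto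
 then have finI: "finite ?I" by (rule rev_finite_subset) auto
 have "(\<Sum>l\<in>?L. det_on (\<lambda>i j. G (l i) (l j)) {..<k}) = (\<Sum>l\<in>?I. det_on (\<lambda>i j. G (l i) (l j)) {..<k})"
  using fin by (intro sum.mono_neutral_right) (auto simp: det_on_noninj)
 also have "... = (\<Sum>l\<in>?I. det_on G (l ` {..<k}))"
  by (intro sum.cong refl det_on_image) auto
 also have "... = (\<Sum>S | S \<subseteq> {..<n} \<and> card S = k. \<Sum>l | l \<in> ?I \<and> l ` {..<k} = S. det_on G (l ` {..<k}))"
 proof (rule sum.group[symmetric, OF finI])
  show "finite {S. S \<subseteq> {..<n} \<and> card S = k}"
   by (rule finite_subset[of _ "Pow {..<n}"]) auto
  show "(\<lambda>l. l ` {..<k}) ` ?I \<subseteq> {S. S \<subseteq> {..<n} \<and> card S = k}"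
  proof safe
   fix l i assume "l \<in> ?L" "inj_on l {..<k}"
   then show "card (l ` {..<k}) = k" by (simp add: card_image)
  qed auto
 qed
 also have "... = (\<Sum>S | S \<subseteq> {..<n} \<and> card S = k. of_nat (fact k) * det_on G S)"
 proof (intro sum.cong refl)
  fix S assume "S \<in> {S. S \<subseteq> {..<n} \<and> card S = k}"
  then have S: "S \<subseteq> {..<n}" "card S = k" "finite S" using finite_subset[of S "{..<n}"] by auto
  have eq: "{l. l \<in> ?I \<and> l ` {..<k} = S} = {l \<in> {..<k} \<rightarrow>\<^sub>E S. inj_on l {..<k}}"
  proof (intro equalityI subsetI)
   fix l assume "l \<in> {l \<in> {..<k} \<rightarrow>\<^sub>E S. inj_on l {..<k}}"
   then have l: "l \<in> {..<k} \<rightarrow>\<^sub>E S" "inj_on l {..<k}" by auto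
   then have "l ` {..<k} \<subseteq> S" by auto
   moreover have "card (l ` {..<k}) = card S" using l(2) S by (simp add: card_image)
   ultimately have "l ` {..<k} = S" using S(3) by (simp add: card_subset_eq)
   then show "l \<in> {l. l \<in> ?I \<and> l ` {..<k} = S}" using l S(1) by auto
  qed auto
  have "(\<Sum>l | l \<in> ?I \<and> l ` {..<k} = S. det_on G (l ` {..<k})) = (\<Sum>l | l \<in> ?I \<and> l ` {..<k} = S. det_on G S)"
   by (intro sum.cong refl) auto
  also have "... = of_nat (fact k) * det_on G S"
   unfolding eq by (simp add: card_bij_PiE[OF S(3,2)])
  finally show "(\<Sum>l | l \<in> ?I \<and> l ` {..<k} = S. det_on G (l ` {..<k})) = of_nat (fact k) * det_on G S" .
 qed
 finally show ?thesis by (simp add: sum_distrib_left)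
qed

text \<open>The Fredholm series of a matrix: the factorial in front of the k-th term cancels the
  number of tuples with a given range, and the principal minors of all sizes add up to the
  determinant. The terms with k > n vanish.\<close>

lemma discrete_fredholm:
 fixes G :: "nat => nat => real"
 shows "(\<lambda>k. (- 1) ^ k / fact k * (\<Sum>l\<in>{..<k} \<rightarrow>\<^sub>E {..<n}. det_on (\<lambda>i j. G (l i) (l j)) {..<k})) sums
  det_on (\<lambda>i j. (if i = j then 1 else 0) - G i j) {..<n}"
proof -
 let ?f = "\<lambda>k. (- 1) ^ k / fact k * (\<Sum>l\<in>{..<k} \<rightarrow>\<^sub>E {..<n}. det_on (\<lambda>i j. G (l i) (l j)) {..<k})"
 have f: "?f k = (\<Sum>S | S \<subseteq> {..<n} \<and> card S = k. (- 1) ^ card S * det_on G S)" for k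
  unfolding sum_det_on_tuples by (simp add: sum_distrib_left)
 have "?f sums (\<Sum>k\<in>{..n}. ?f k)"
 proof (rule sums_finite)
  fix k assume "k \<notin> {..n}"
  then have "{S. S \<subseteq> {..<n} \<and> card S = k} = {}"
   using card_mono[of "{..<n}"] by fastforce
  then show "?f k = 0" unfolding f by (simp only: sum.empty)
 qed simp
 also have "(\<Sum>k\<in>{..n}. ?f k) = (\<Sum>k\<in>{..n}. \<Sum>S | S \<in> Pow {..<n} \<and> card S = k. (- 1) ^ card S * det_on G S)"
  unfolding f by simp
 also have "... = (\<Sum>S\<in>Pow {..<n}. (- 1) ^ card S * det_on G S)"
  by (rule sum.group) (use card_mono[of "{..<n}"] in force)+
 finally show ?thesis unfolding det_on_one_minus[OF finite_lessThan] .
qed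

interpretation leb: product_sigma_finite "\<lambda>_::'i. lborel :: real measure" ..

text \<open>Expanding both determinants gives a double sum over permutations of products of
  one-dimensional integrals. For a fixed first permutation, the sum over the second is the
  determinant with permuted rows; the two signs cancel and n! equal terms remain.\<close>

lemma andreief:
 fixes f g :: "nat => real => real"
 assumes int: "\<And>i j. i < n ==> j < n ==> integrable lborel (\<lambda>x. f i x * g j x)"
 shows "has_bochner_integral (PiM {..<n} (\<lambda>_. lborel))
  (\<lambda>x. det_on (\<lambda>i j. f i (x j)) {..<n} * det_on (\<lambda>i j. g i (x j)) {..<n})
  (fact n * det_on (\<lambda>i j. \<integral>x. f i x * g j x \<partial>lborel) {..<n})"
proof -
 let ?a = "\<lambda>i j. \<integral>x. f i x * g j x \<partial>lborel"
 let ?P = "{p. p permutes {..<n}}"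
 let ?s = "\<Sum>p\<in>?P. \<Sum>q\<in>?P. of_int (sign p) * of_int (sign q) * (\<Prod>j<n. ?a (p j) (q j))"
 have col: "det_on h {..<n} = (\<Sum>p\<in>?P. of_int (sign p) * (\<Prod>j<n. h (p j) j))" for h :: "nat => nat => real"
  unfolding det_mat_eq_det_on[symmetric]
  by (subst det_col[of _ n]) (auto simp: lessThan_atLeast0 intro!: sum.cong arg_cong2[of _ _ _ _ times] prod.cong dest: permutes_in_image)
 have eq: "det_on (\<lambda>i j. f i (x j)) {..<n} * det_on (\<lambda>i j. g i (x j)) {..<n} =
  (\<Sum>p\<in>?P. \<Sum>q\<in>?P. of_int (sign p) * of_int (sign q) * (\<Prod>j<n. f (p j) (x j) * g (q j) (x j)))" for x
  unfolding col sum_product by (intro sum.cong refl) (simp add: prod.distrib mult_ac)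
 have "has_bochner_integral (PiM {..<n} (\<lambda>_. lborel))
  (\<lambda>x. \<Sum>p\<in>?P. \<Sum>q\<in>?P. of_int (sign p) * of_int (sign q) * (\<Prod>j<n. f (p j) (x j) * g (q j) (x j)))
  ?s"
 proof (intro has_bochner_integral_sum has_bochner_integral_mult_right)
  fix p q assume pq: "p \<in> ?P" "q \<in> ?P"
  have i: "integrable lborel (\<lambda>x. f (p j) x * g (q j) x)" if "j \<in> {..<n}" for j
   using pq that permutes_in_image[of p "{..<n}" j] permutes_in_image[of q "{..<n}" j] by (intro int) auto
  show "has_bochner_integral (PiM {..<n} (\<lambda>_. lborel)) (\<lambda>x. \<Prod>j<n. f (p j) (x j) * g (q j) (x j)) (\<Prod>j<n. ?a (p j) (q j))"
   using leb.product_integrable_prod[OF finite_lessThan i] leb.product_integral_prod[OF finite_lessThan i]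
   by (simp add: has_bochner_integral_iff)
 qed
 moreover have "?s = fact n * det_on ?a {..<n}"
 proof -
  have "(\<Sum>q\<in>?P. of_int (sign p) * of_int (sign q) * (\<Prod>j<n. ?a (p j) (q j))) = det_on ?a {..<n}"
   if p: "p \<in> ?P" for p
  proof -
   have p': "p permutes {0..<n}" using p by (simp add: lessThan_atLeast0)
   have "(\<Sum>q\<in>?P. of_int (sign p) * of_int (sign q) * (\<Prod>j<n. ?a (p j) (q j))) =
    of_int (sign p) * det_on (\<lambda>i j. ?a (p i) j) {..<n}"
    unfolding det_on_def by (simp add: sum_distrib_left mult.assoc)
   also have "det_on (\<lambda>i j. ?a (p i) j) {..<n} =
    det (mat n n (\<lambda>(i, j). mat n n (\<lambda>(i, j). ?a i j) $$ (p i, j)))"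
    unfolding det_mat_eq_det_on[symmetric]
    using permutes_in_image[OF p'] by (intro arg_cong[of _ _ det] cong_mat) auto
   also have "... = of_int (sign p) * det_on ?a {..<n}"
    unfolding det_mat_eq_det_on[symmetric] by (rule det_permute_rows[OF _ p']) simp
   also have "of_int (sign p) * (of_int (sign p) * det_on ?a {..<n}) = det_on ?a {..<n}"
    by (simp add: sign_def)
   finally show ?thesis .
  qed
  then have "?s =
   (\<Sum>p\<in>?P. det_on ?a {..<n})" by (rule sum.cong[OF refl])
  then show ?thesis by (simp add: card_permutations)
 qed
 ultimately show ?thesis unfolding eq by simp
qed

text \<open>Every row of the kernel matrix selects one summand through the tuple \<open>l\<close>.
  Reindexing by the permutation moves it from the variables to the functions, after which the
  integrand is a product over separate variables. The function \<open>c\<close> will be the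
  indicator of a half-line.\<close>

lemma integral_det_kernel:
 fixes f :: "nat => real => real" and c :: "real => real" and k :: nat
 assumes int: "\<And>i j. i < n ==> j < n ==> integrable lborel (\<lambda>x. c x * (f i x * f j x))"
 shows "has_bochner_integral (PiM {..<k} (\<lambda>_. lborel))
  (\<lambda>x. (\<Prod>i<k. c (x i)) * det_on (\<lambda>i j. \<Sum>l<n. f l (x i) * f l (x j)) {..<k})
  (\<Sum>l\<in>{..<k} \<rightarrow>\<^sub>E {..<n}. det_on (\<lambda>i j. \<integral>x. c x * (f (l i) x * f (l j) x) \<partial>lborel) {..<k})"
proof -
 let ?P = "{p. p permutes {..<k}}"
 let ?L = "{..<k} \<rightarrow>\<^sub>E {..<n}"
 let ?G = "\<lambda>i j. \<integral>x. c x * (f i x * f j x) \<partial>lborel"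
 let ?g = "\<lambda>p l. \<Prod>i<k. ?G (l i) (l (inv_into UNIV p i))"
 have eq: "(\<Prod>i<k. c (x i)) * det_on (\<lambda>i j. \<Sum>l<n. f l (x i) * f l (x j)) {..<k} =
  (\<Sum>p\<in>?P. \<Sum>l\<in>?L. of_int (sign p) * (\<Prod>i<k. c (x i) * (f (l i) (x i) * f (l (inv_into UNIV p i)) (x i))))" for x
 proof -
  have "(\<Prod>i<k. c (x i)) * det_on (\<lambda>i j. \<Sum>l<n. f l (x i) * f l (x j)) {..<k} =
   (\<Sum>p\<in>?P. \<Sum>l\<in>?L. of_int (sign p) * ((\<Prod>i<k. c (x i)) * (\<Prod>i<k. f (l i) (x i) * f (l i) (x (p i)))))"
   unfolding det_on_def sum_distrib_left
   by (intro sum.cong refl, subst prod_sum_PiE) (auto simp: sum_distrib_left mult_ac)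
  also have "... = (\<Sum>p\<in>?P. \<Sum>l\<in>?L. of_int (sign p) * (\<Prod>i<k. c (x i) * (f (l i) (x i) * f (l (inv_into UNIV p i)) (x i))))"
  proof (intro sum.cong refl)
   fix p l assume "p \<in> ?P"
   then have p: "p permutes {..<k}" by simp
   have "(\<Prod>i<k. f (l i) (x (p i))) = (\<Prod>i<k. f (l (inv_into UNIV p i)) (x i))"
    by (subst prod.permute[OF p, of "\<lambda>i. f (l (inv_into UNIV p i)) (x i)"]) (simp add: o_def permutes_inverses(2)[OF p])
   then show "of_int (sign p) * ((\<Prod>i<k. c (x i)) * (\<Prod>i<k. f (l i) (x i) * f (l i) (x (p i)))) =
    of_int (sign p) * (\<Prod>i<k. c (x i) * (f (l i) (x i) * f (l (inv_into UNIV p i)) (x i)))"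
    by (simp add: prod.distrib)
  qed
  finally show ?thesis .
 qed
 have "has_bochner_integral (PiM {..<k} (\<lambda>_. lborel))
  (\<lambda>x. \<Sum>p\<in>?P. \<Sum>l\<in>?L. of_int (sign p) * (\<Prod>i<k. c (x i) * (f (l i) (x i) * f (l (inv_into UNIV p i)) (x i))))
  (\<Sum>p\<in>?P. \<Sum>l\<in>?L. of_int (sign p) * (?g p l))"
 proof (intro has_bochner_integral_sum has_bochner_integral_mult_right)
  fix p l assume pl: "p \<in> ?P" "l \<in> ?L"
  have ip: "inv_into UNIV p permutes {..<k}" using pl permutes_inv by blast
  have i: "integrable lborel (\<lambda>x. c x * (f (l i) x * f (l (inv_into UNIV p i)) x))" if "i \<in> {..<k}" for i
   using pl that permutes_in_image[OF ip, of i] by (intro int) auto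
  show "has_bochner_integral (PiM {..<k} (\<lambda>_. lborel))
   (\<lambda>x. \<Prod>i<k. c (x i) * (f (l i) (x i) * f (l (inv_into UNIV p i)) (x i))) (?g p l)"
   using leb.product_integrable_prod[OF finite_lessThan i] leb.product_integral_prod[OF finite_lessThan i]
   by (simp add: has_bochner_integral_iff)
 qed
 moreover have "(\<Sum>p\<in>?P. \<Sum>l\<in>?L. of_int (sign p) * (?g p l)) =
  (\<Sum>l\<in>?L. det_on (\<lambda>i j. ?G (l i) (l j)) {..<k})"
 proof -
  have "(\<Sum>p\<in>?P. of_int (sign p) * (?g p l)) = det_on (\<lambda>i j. ?G (l i) (l j)) {..<k}" for l
  proof -
   have "(\<Sum>p\<in>?P. of_int (sign p) * (?g p l)) =
    (\<Sum>p\<in>?P. of_int (sign (inv_into UNIV p)) * (?g p l))"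
   proof (intro sum.cong refl)
    fix p assume "p \<in> ?P"
    then have "permutation p" using permutation_permutes finite_lessThan by blast
    from sign_inverse[OF this]
    show "of_int (sign p) * (?g p l) =
     of_int (sign (inv_into UNIV p)) * (?g p l)" by simp
   qed
   also have "... = det_on (\<lambda>i j. ?G (l i) (l j)) {..<k}"
    unfolding det_on_def
    by (rule sum_permutations_inverse[of "\<lambda>p. of_int (sign p) * (\<Prod>i<k. ?G (l i) (l (p i)))", symmetric])
   finally show ?thesis .
  qed
  then show ?thesis by (subst sum.swap) simp
 qed
 ultimately show ?thesis unfolding eq by simp
qed

section \<open>The interlacing change of variables\<close>

text \<open>The open interval is exhausted by compact ones, and both sides pass to the limit by
  monotone convergence. Open intervals are needed because the derivatives below may blow up at the
  ends and the intervals may be unbounded.\<close>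

lemma nn_integral_substitution_open:
 fixes f :: "real => ennreal" and a b :: ereal
 assumes f: "f \<in> borel_measurable borel" and "a < b"
  and deriv: "\<And>x. x \<in> einterval a b ==> (g has_real_derivative g' x) (at x)"
  and cont: "continuous_on (einterval a b) g'"
  and pos: "\<And>x. x \<in> einterval a b ==> g' x > 0"
 shows "(\<integral>\<^sup>+x. f x * indicator (g ` einterval a b) x \<partial>lborel) =
  (\<integral>\<^sup>+x. f (g x) * ennreal (g' x) * indicator (einterval a b) x \<partial>lborel)"
proof -
 obtain u l :: "nat => real" where ul: "einterval a b = (\<Union>i. {l i .. u i})" "incseq u" "decseq l"
  "\<And>i. l i < u i"
  by (rule einterval_Icc_approximation[OF \<open>a < b\<close>], blast)
 have sub: "{l i..u i} \<subseteq> einterval a b" for i using ul(1) by auto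
 have inc: "{l i..u i} \<subseteq> {l j..u j}" if "i <= j" for i j
  using that ul(2,3) by (auto simp: incseq_def decseq_def intro: order_trans)
 have contg: "continuous_on (einterval a b) g"
  using deriv by (auto intro!: continuous_at_imp_continuous_on DERIV_isCont)
 have mono: "g x <= g y" if "x <= y" "x \<in> {l i..u i}" "y \<in> {l i..u i}" for x y i
 proof -
  have "{x..y} \<subseteq> {l i..u i}" using that(2,3) by auto
  then have s: "z \<in> einterval a b" if "z \<in> {x..y}" for z using sub[of i] that by blast
  show ?thesis
   by (rule deriv_nonneg_imp_mono[of x y g g'])
    (rule deriv s less_imp_le pos that(1) | assumption)+
 qed
 have img: "g ` {l i..u i} = {g (l i)..g (u i)}" for i
 proof (intro equalityI subsetI)
  fix y assume y: "y \<in> {g (l i)..g (u i)}"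
  have "\<exists>x\<ge>l i. x <= u i \<and> g x = y"
   by (rule IVT') (use y ul(4)[of i] continuous_on_subset[OF contg sub[of i]] in \<open>auto intro: less_imp_le\<close>)
  then show "y \<in> g ` {l i..u i}" by auto
 next
  fix y assume "y \<in> g ` {l i..u i}"
  then obtain x where x: "x \<in> {l i..u i}" "y = g x" by blast
  have lu: "l i \<in> {l i..u i}" "u i \<in> {l i..u i}" using ul(4)[of i] by auto
  show "y \<in> {g (l i)..g (u i)}"
   unfolding x(2) using mono[OF _ lu(1) x(1)] mono[OF _ x(1) lu(2)] x(1) by simp
 qed
 have step: "(\<integral>\<^sup>+x. f x * indicator {g (l i)..g (u i)} x \<partial>lborel) =
   (\<integral>\<^sup>+x. f (g x) * ennreal (g' x) * indicator {l i..u i} x \<partial>lborel)" for i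
  by (rule nn_integral_substitution_aux[OF f _ deriv[OF subsetD[OF sub[of i]]]
     continuous_on_subset[OF cont sub[of i]] less_imp_le[OF pos[OF subsetD[OF sub[of i]]]] ul(4)]) simp_all
 have SUPind: "(SUP i. c * indicator (A i) x) = c * indicator (\<Union>i. A i) x"
  for c :: ennreal and A :: "nat => real set" and x
 proof (cases "x \<in> (\<Union>i. A i)")
  case True
  then obtain i where "x \<in> A i" by blast
  have "(SUP i. c * indicator (A i) x) = c"
   by (intro antisym SUP_least SUP_upper2[of i]) (auto simp: \<open>x \<in> A i\<close> split: split_indicator)
  then show ?thesis using True by simp
 next
  case False
  then have "\<And>i. x \<notin> A i" by blast
  then show ?thesis using False by simp
 qed
 have meas: "(\<lambda>x. f (g x) * ennreal (g' x) * indicator {l i..u i} x) \<in> borel_measurable borel" for i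
 proof -
  have "g \<in> borel_measurable (restrict_space borel {l i..u i})" "g' \<in> borel_measurable (restrict_space borel {l i..u i})"
   by (auto intro!: borel_measurable_continuous_on_restrict continuous_on_subset[OF contg sub[of i]]
     continuous_on_subset[OF cont sub[of i]])
  then have "(\<lambda>x. f (g x) * ennreal (g' x)) \<in> borel_measurable (restrict_space borel {l i..u i})"
   using f by measurable
  then show ?thesis by (subst (asm) borel_measurable_restrict_space_iff_ennreal) (auto simp: mult.commute)
 qed
 have "(\<integral>\<^sup>+x. f x * indicator (g ` einterval a b) x \<partial>lborel) =
   (\<integral>\<^sup>+x. (SUP i. f x * indicator {g (l i)..g (u i)} x) \<partial>lborel)"
  unfolding SUPind ul(1) image_UN img ..
 also have "... = (SUP i. \<integral>\<^sup>+x. f x * indicator {g (l i)..g (u i)} x \<partial>lborel)"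
 proof (rule nn_integral_monotone_convergence_SUP)
  have gsub: "{g (l i)..g (u i)} \<subseteq> {g (l j)..g (u j)}" if "i <= j" for i j
   unfolding img[symmetric] using inc[OF that] by auto
  show "incseq (\<lambda>i x. f x * indicator {g (l i)..g (u i)} x)"
  proof (intro incseq_SucI le_funI mult_left_mono)
   fix i x show "(indicator {g (l i)..g (u i)} x :: ennreal) <= indicator {g (l (Suc i))..g (u (Suc i))} x"
    using subsetD[OF gsub[of i "Suc i"], of x] by (auto simp: indicator_def simp del: atLeastAtMost_iff)
  qed simp
 qed (use f in auto)
 also have "... = (SUP i. \<integral>\<^sup>+x. f (g x) * ennreal (g' x) * indicator {l i..u i} x \<partial>lborel)"
  unfolding step ..
 also have "... = (\<integral>\<^sup>+x. (SUP i. f (g x) * ennreal (g' x) * indicator {l i..u i} x) \<partial>lborel)"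
 proof (rule nn_integral_monotone_convergence_SUP[symmetric])
  show "incseq (\<lambda>i x. f (g x) * ennreal (g' x) * indicator {l i..u i} x)"
  proof (intro incseq_SucI le_funI mult_left_mono)
   fix i x show "(indicator {l i..u i} x :: ennreal) <= indicator {l (Suc i)..u (Suc i)} x"
    using subsetD[OF inc[of i "Suc i"], of x] by (auto simp: indicator_def simp del: atLeastAtMost_iff)
  qed simp
 qed (use meas in auto)
 also have "... = (\<integral>\<^sup>+x. f (g x) * ennreal (g' x) * indicator (einterval a b) x \<partial>lborel)"
  unfolding SUPind ul(1) ..
 finally show ?thesis .
qed

text \<open>The increasing case applied to the negative of \<open>g\<close>. The image of the
  interval is connected, hence Borel, and this makes the reflected integrand measurable.\<close>

lemma nn_integral_substitution_open_decreasing: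
 fixes f :: "real => ennreal" and a b :: ereal
 assumes f: "f \<in> borel_measurable borel" and "a < b"
  and deriv: "\<And>x. x \<in> einterval a b ==> (g has_real_derivative - g' x) (at x)"
  and cont: "continuous_on (einterval a b) g'"
  and pos: "\<And>x. x \<in> einterval a b ==> g' x > 0"
 shows "(\<integral>\<^sup>+x. f x * indicator (g ` einterval a b) x \<partial>lborel) =
  (\<integral>\<^sup>+x. f (g x) * ennreal (g' x) * indicator (einterval a b) x \<partial>lborel)"
proof -
 let ?F = "\<lambda>x. f x * indicator (g ` einterval a b) x"
 have "(\<integral>\<^sup>+x. f (- x) * indicator ((\<lambda>x. - g x) ` einterval a b) x \<partial>lborel) =
  (\<integral>\<^sup>+x. f (- (- g x)) * ennreal (g' x) * indicator (einterval a b) x \<partial>lborel)"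
 proof (rule nn_integral_substitution_open)
  show "(\<lambda>x. f (- x)) \<in> borel_measurable borel" using f by measurable
 qed (use assms in \<open>auto intro!: derivative_eq_intros\<close>)
 moreover have "(\<integral>\<^sup>+x. f x * indicator (g ` einterval a b) x \<partial>lborel) =
  (\<integral>\<^sup>+x. f (- x) * indicator ((\<lambda>x. - g x) ` einterval a b) x \<partial>lborel)"
 proof -
  have contg: "continuous_on (einterval a b) g"
   using deriv by (auto intro!: continuous_at_imp_continuous_on DERIV_isCont)
  have "connected (g ` einterval a b)"
  proof (rule connected_continuous_image[OF contg])
   show "connected (einterval a b)"
    unfolding connected_iff_interval einterval_def
   proof safe
    fix x y z assume "a < ereal x" "ereal y < b" "x <= z" "z <= y"
    then show "a < ereal z" "ereal z < b"
     by (metis ereal_less_eq(3) less_le_trans, metis ereal_less_eq(3) le_less_trans)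
   qed
  qed
  then have "g ` einterval a b \<in> sets borel"
   by (intro real_interval_borel_measurable) (simp add: is_interval_connected_1)
  then have [measurable]: "?F \<in> borel_measurable borel" using f by measurable
  have "(\<integral>\<^sup>+x. ?F x \<partial>lborel) = (\<integral>\<^sup>+x. ?F (- x) \<partial>lborel)"
   using nn_integral_real_affine[of ?F "-1" 0] by simp
  moreover have "indicator (g ` einterval a b) (- x) = (indicator ((\<lambda>x. - g x) ` einterval a b) x :: ennreal)" for x
   by (auto split: split_indicator) (metis add.inverse_inverse image_eqI)
  ultimately show ?thesis by simp
 qed
 ultimately show ?thesis by simp
qed

lemma vand_Suc: "vand (Suc n) x = vand n x * (\<Prod>i<n. x n - x i)"
 by (simp add: vand_def)

lemma vand_cong: "(\<And>i. i < n ==> x i = y i) ==> vand n x = vand n y"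
 unfolding vand_def by (intro prod.cong refl) auto

lemma vand_pos: "(\<And>i j. i < j ==> j < n ==> x i < x j) ==> vand n x > (0::real)"
 unfolding vand_def by (intro prod_pos) auto

text \<open>The residues of the rational function \<open>\<Prod>i<n. (t - l i) / (t - m i)\<close> at its poles \<open>m j\<close>.\<close>

definition resid :: "nat => (nat => 'a::field) => (nat => 'a) => nat => 'a" where
 "resid n m l j = (m j - l j) * (\<Prod>i\<in>{..<n} - {j}. (m j - l i) / (m j - m i))"

lemma resid_Suc:
 assumes "j < n"
 shows "resid (Suc n) m l j = resid n m l j * ((m j - l n) / (m j - m n))"
proof -
 have "{..<Suc n} - {j} = insert n ({..<n} - {j})" using assms by auto
 then show ?thesis using assms by (simp add: resid_def)
qed

lemma resid_last: "resid (Suc n) m l n = (m n - l n) * (\<Prod>i<n. (m n - l i) / (m n - m i))"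
proof -
 have "{..<Suc n} - {n} = {..<n}" by auto
 then show ?thesis by (simp add: resid_def)
qed

lemma resid_cong:
 "(\<And>i. i < n ==> l i = l' i) ==> j < n ==> resid n m l j = resid n m l' j"
 unfolding resid_def by (intro arg_cong2[of _ _ _ _ times] prod.cong) auto

text \<open>A new factor splits each old simple fraction into one with the old pole and one with
  pole \<open>m n\<close>. The second kind is summed by the induction hypothesis taken at the point
  \<open>m n\<close> itself.\<close>

lemma partial_fractions:
 fixes m l :: "nat => 'a::field"
 assumes "inj_on m {..<n}" "\<And>j. j < n ==> t ~= m j"
 shows "1 + (\<Sum>j<n. resid n m l j / (t - m j)) = (\<Prod>i<n. (t - l i) / (t - m i))"
 using assms
proof (induction n arbitrary: t)
 case (Suc n)
 have inj: "inj_on m {..<n}" using Suc.prems(1) by (auto simp: inj_on_def)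
 have mn: "m n ~= m j" if "j < n" for j using inj_onD[OF Suc.prems(1), of n j] that by auto
 have tn: "t - m n ~= 0" using Suc.prems(2)[of n] by simp
 define P where "P = (\<Prod>i<n. (t - l i) / (t - m i))"
 define Q where "Q = (\<Prod>i<n. (m n - l i) / (m n - m i))"
 have P: "(\<Sum>j<n. resid n m l j / (t - m j)) = P - 1"
  using Suc.IH[OF inj, of t] Suc.prems(2) by (simp add: P_def algebra_simps)
 have Q: "(\<Sum>j<n. resid n m l j / (m n - m j)) = Q - 1"
  using Suc.IH[OF inj, of "m n"] mn by (simp add: Q_def algebra_simps)
 have "(\<Sum>j<n. resid (Suc n) m l j / (t - m j)) =
  (\<Sum>j<n. (t - l n) / (t - m n) * (resid n m l j / (t - m j)) -
    (m n - l n) / (t - m n) * (resid n m l j / (m n - m j)))"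
 proof (intro sum.cong refl)
  fix j assume "j \<in> {..<n}"
  then have j: "j < n" by simp
  have nz: "t - m j ~= 0" "m n - m j ~= 0" "m j - m n ~= 0" using Suc.prems(2)[of j] mn[OF j] j by auto
  have "(m j - l n) / (m j - m n) / (t - m j) =
   (t - l n) / (t - m n) / (t - m j) - (m n - l n) / (t - m n) / (m n - m j)"
   using nz tn by (simp add: divide_simps) (simp add: algebra_simps)
  then have "R * ((m j - l n) / (m j - m n) / (t - m j)) =
   R * ((t - l n) / (t - m n) / (t - m j) - (m n - l n) / (t - m n) / (m n - m j))" for R by simp
  from this[of "resid n m l j"] show "resid (Suc n) m l j / (t - m j) = (t - l n) / (t - m n) * (resid n m l j / (t - m j)) -
    (m n - l n) / (t - m n) * (resid n m l j / (m n - m j))"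
   unfolding resid_Suc[OF j] by (simp add: algebra_simps)
 qed
 also have "... = (t - l n) / (t - m n) * (P - 1) - (m n - l n) / (t - m n) * (Q - 1)"
  unfolding sum_subtractf sum_distrib_left[symmetric] P Q ..
 finally have "1 + (\<Sum>j<Suc n. resid (Suc n) m l j / (t - m j)) =
  1 + ((t - l n) / (t - m n) * (P - 1) - (m n - l n) / (t - m n) * (Q - 1)) + (m n - l n) * Q / (t - m n)"
  by (simp add: resid_last Q_def)
 also have "... = (t - l n) / (t - m n) * P"
  using tn by (simp add: divide_simps) (simp add: algebra_simps)
 finally show ?case by (simp add: P_def mult.commute)
qed simp

text \<open>Multiplying \<open>partial_fractions\<close> by t - l n gives the polynomial part t - l
  n + (sum of the residues) and the residue \<open>resid n m l j * (m j - l n)\<close> at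
  \<open>m j\<close>. Comparison with \<open>char_poly_arrow\<close> shows which corner entry and
  which squared moduli give an arrow matrix with eigenvalues \<open>l\<close>.\<close>

lemma interlacing_poly_identity:
 fixes m l :: "nat => 'a::field_char_0"
 assumes inj: "inj_on m {..<n}"
 shows "[:- (l n - (\<Sum>j<n. resid n m l j)), 1:] * (\<Prod>j<n. [:- m j, 1:]) -
  (\<Sum>j<n. smult (resid n m l j * (l n - m j)) (\<Prod>k\<in>{..<n} - {j}. [:- m k, 1:])) =
  (\<Prod>i<Suc n. [:- l i, 1:])" (is "?L = ?R")
proof -
 have ev: "poly ?L t = poly ?R t" if t: "t \<notin> m ` {..<n}" for t
 proof -
  have nz: "t - m j ~= 0" if "j < n" for j using t that by auto
  let ?M = "\<Prod>j<n. t - m j"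
  have M: "(\<Prod>k\<in>{..<n} - {j}. t - m k) = ?M / (t - m j)" if "j < n" for j
   using that nz by (subst prod.remove[of "{..<n}" j]) auto
  have "poly ?L t = (t - l n + (\<Sum>j<n. resid n m l j)) * ?M -
    (\<Sum>j<n. resid n m l j * (l n - m j) * (?M / (t - m j)))"
   by (simp add: poly_prod poly_sum M algebra_simps)
  also have "(\<Sum>j<n. resid n m l j * (l n - m j) * (?M / (t - m j))) =
    (\<Sum>j<n. (resid n m l j - (t - l n) * (resid n m l j / (t - m j))) * ?M)"
  proof (intro sum.cong refl)
   fix j assume "j \<in> {..<n}"
   then show "resid n m l j * (l n - m j) * (?M / (t - m j)) =
    (resid n m l j - (t - l n) * (resid n m l j / (t - m j))) * ?M"
    using nz[of j] by (simp add: divide_simps) (simp add: algebra_simps)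
  qed
  also have "... = ((\<Sum>j<n. resid n m l j) - (t - l n) * (\<Sum>j<n. resid n m l j / (t - m j))) * ?M"
   by (simp only: sum_distrib_right[symmetric] sum_subtractf sum_distrib_left[symmetric])
  also have "(t - l n + (\<Sum>j<n. resid n m l j)) * ?M - ... = (t - l n) * ((1 + (\<Sum>j<n. resid n m l j / (t - m j))) * ?M)"
   by (simp add: algebra_simps)
  also have "1 + (\<Sum>j<n. resid n m l j / (t - m j)) = (\<Prod>i<n. (t - l i) / (t - m i))"
   by (rule partial_fractions[OF inj]) (use t in auto)
  also have "... * ?M = (\<Prod>i<n. t - l i)"
   unfolding prod.distrib[symmetric] using nz by (intro prod.cong refl) auto
  finally show ?thesis by (simp add: poly_prod algebra_simps)
 qed
 show ?thesis
 proof (rule ccontr)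
  assume "?L ~= ?R"
  then have "finite {x. poly (?L - ?R) x = 0}" by (intro poly_roots_finite) simp
  moreover have "- (m ` {..<n}) \<subseteq> {x. poly (?L - ?R) x = 0}"
   using ev by (auto simp del: poly_diff poly_mult) (simp add: poly_diff)
  ultimately have "finite (- (m ` {..<n}))" by (rule rev_finite_subset)
  then have "finite (UNIV :: 'a set)" using finite_compl[of "m ` {..<n}"] by simp
  then show False using infinite_UNIV_char_0 by blast
 qed
qed

section \<open>Iterated integrals over finitely many real coordinates\<close>

abbreviation leb :: "nat => (nat => real) measure" where
 "leb n \<equiv> PiM {..<n} (\<lambda>_. lborel)"

abbreviation meas_leb :: "nat => ((nat => real) => 'b::topological_space) set" where
 "meas_leb n \<equiv> borel_measurable (leb n)"

lemma leb_Suc: "leb (Suc n) = PiM (insert n {..<n}) (\<lambda>_. lborel)" by (simp add: lessThan_Suc)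

lemma nn_integral_leb_Suc:
 assumes "f \<in> meas_leb (Suc n)"
 shows "(\<integral>\<^sup>+x. f x \<partial>leb (Suc n)) = (\<integral>\<^sup>+x. \<integral>\<^sup>+y. f (x(n := y)) \<partial>lborel \<partial>leb n)"
 using leb.product_nn_integral_insert[of "{..<n}" n f] assms by (simp add: leb_Suc)

lemma nn_integral_leb_Suc_rev:
 assumes "f \<in> meas_leb (Suc n)"
 shows "(\<integral>\<^sup>+x. f x \<partial>leb (Suc n)) = (\<integral>\<^sup>+y. \<integral>\<^sup>+x. f (x(n := y)) \<partial>leb n \<partial>lborel)"
 using leb.product_nn_integral_insert_rev[of "{..<n}" n f] assms by (simp add: leb_Suc)

lemma measurable_leb_update [measurable]:
 "(\<lambda>(x, y). x(n := y)) \<in> measurable (leb n \<Otimes>\<^sub>M lborel) (leb (Suc n))"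
 unfolding leb_Suc by (rule measurable_add_dim)

lemma nn_integral_leb_scale:
 fixes c :: "nat => real"
 assumes "\<And>j. j < n ==> c j > 0" and "f \<in> meas_leb n"
 shows "(\<integral>\<^sup>+x. f x \<partial>leb n) = (\<integral>\<^sup>+x. ennreal (\<Prod>j<n. c j) * f (\<lambda>j\<in>{..<n}. c j * x j) \<partial>leb n)"
 using assms
proof (induction n arbitrary: f)
 case 0
 then show ?case by (simp add: leb.nn_integral_empty restrict_def space_PiM)
next
 case (Suc n)
 note [measurable] = Suc.prems(2)
 have cn: "c n > 0" using Suc.prems by simp
 define F where "F x = (\<integral>\<^sup>+y. f (x(n := y)) \<partial>lborel)" for x
 have [measurable]: "F \<in> meas_leb n" unfolding F_def by measurable
 have meas_sc: "(\<lambda>x. \<lambda>j\<in>{..<Suc n}. c j * x j) \<in> measurable (leb (Suc n)) (leb (Suc n))" by measurable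
 have "(\<integral>\<^sup>+x. f x \<partial>leb (Suc n)) = (\<integral>\<^sup>+x. F x \<partial>leb n)"
  unfolding F_def by (rule nn_integral_leb_Suc) fact
 also have "... = (\<integral>\<^sup>+x. ennreal (\<Prod>j<n. c j) * F (\<lambda>j\<in>{..<n}. c j * x j) \<partial>leb n)"
  by (rule Suc.IH) (use Suc.prems in auto)
 also have "... = (\<integral>\<^sup>+x. \<integral>\<^sup>+y. ennreal (\<Prod>j<Suc n. c j) * f (\<lambda>j\<in>{..<Suc n}. c j * (x(n := y)) j) \<partial>lborel \<partial>leb n)"
 proof (rule nn_integral_cong)
  fix x assume x: "x \<in> space (leb n)"
  let ?g = "\<lambda>y. f ((\<lambda>j\<in>{..<n}. c j * x j)(n := y))"
  have "(\<lambda>j\<in>{..<n}. c j * x j) \<in> space (leb n)" by (simp add: space_PiM)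
  then have "(\<lambda>y. (\<lambda>j\<in>{..<n}. c j * x j)(n := y)) \<in> measurable lborel (leb (Suc n))"
   unfolding leb_Suc by (rule measurable_component_update) simp
  then have gm: "?g \<in> borel_measurable lborel"
   by (rule measurable_compose[OF _ Suc.prems(2)])
  then have gm': "?g \<in> borel_measurable borel" by simp
  have e: "(\<lambda>j\<in>{..<Suc n}. c j * (x(n := y)) j) = (\<lambda>j\<in>{..<n}. c j * x j)(n := c n * y)" for y
   by (auto simp: fun_eq_iff less_Suc_eq)
  have p: "0 <= (\<Prod>j<n. c j)" using Suc.prems(1) by (intro prod_nonneg) (auto intro: less_imp_le)
  have "F (\<lambda>j\<in>{..<n}. c j * x j) = ennreal (c n) * (\<integral>\<^sup>+y. ?g (c n * y) \<partial>lborel)"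
   unfolding F_def using nn_integral_real_affine[OF gm', of "c n" 0] cn by simp
  also have "... = (\<integral>\<^sup>+y. ennreal (c n) * ?g (c n * y) \<partial>lborel)"
   by (rule nn_integral_cmult[symmetric]) (rule measurable_compose[OF _ gm], simp)
  finally have Fe: "F (\<lambda>j\<in>{..<n}. c j * x j) = (\<integral>\<^sup>+y. ennreal (c n) * ?g (c n * y) \<partial>lborel)" .
   have "ennreal (\<Prod>j<n. c j) * F (\<lambda>j\<in>{..<n}. c j * x j) =
     (\<integral>\<^sup>+y. ennreal (\<Prod>j<n. c j) * (ennreal (c n) * ?g (c n * y)) \<partial>lborel)"
    unfolding Fe by (rule nn_integral_cmult[symmetric], intro borel_measurable_times_ennreal measurable_compose[OF _ gm]) auto
   also have "... = (\<integral>\<^sup>+y. ennreal (\<Prod>j<Suc n. c j) * ?g (c n * y) \<partial>lborel)"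
    using p cn by (simp add: ennreal_mult mult.assoc del: restrict_fupd fun_upd_apply)
   finally show "ennreal (\<Prod>j<n. c j) * F (\<lambda>j\<in>{..<n}. c j * x j) =
   (\<integral>\<^sup>+y. ennreal (\<Prod>j<Suc n. c j) * f (\<lambda>j\<in>{..<Suc n}. c j * (x(n := y)) j) \<partial>lborel)" unfolding e .
 qed
 also have "... = (\<integral>\<^sup>+x. ennreal (\<Prod>j<Suc n. c j) * f (\<lambda>j\<in>{..<Suc n}. c j * x j) \<partial>leb (Suc n))"
  by (rule nn_integral_leb_Suc[symmetric]) (use meas_sc in measurable)
 finally show ?case .
qed

lemma measurable_leb_I:
 assumes "\<And>j. j < n ==> (\<lambda>x. f x j) \<in> borel_measurable M"
  and "\<And>x. x \<in> space M ==> f x \<in> extensional {..<n}"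
 shows "f \<in> measurable M (leb n)"
proof -
 have "(\<lambda>x. \<lambda>j\<in>{..<n}. f x j) \<in> measurable M (leb n)"
  by (rule measurable_restrict) (use assms(1) in auto)
 then show ?thesis
  by (rule measurable_cong[THEN iffD1, rotated]) (simp add: assms(2) extensional_restrict)
qed

lemma measurable_leb_component: "j < n ==> (\<lambda>x. x j) \<in> meas_leb n"
 using measurable_component_singleton[of j "{..<n}" "\<lambda>_. lborel :: real measure"] by simp

lemma space_leb: "space (leb n) = extensional {..<n}"
 by (auto simp: space_PiM PiE_def)

lemma measurable_leb_restrict: "(\<lambda>x. restrict x {..<n}) \<in> measurable (leb (Suc n)) (leb n)"
 by (rule measurable_restrict_subset) auto

text \<open>One step of the change of variables: the last coordinate \<open>y\<close> is replaced by \<open>l\<close> through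
 \<open>y = g r l\<close>, and then the others are rescaled by \<open>t l j\<close> before they are replaced in turn.\<close>

lemma chain_step:
 fixes g D :: "(nat => real) => real => real" and t :: "real => nat => real"
  and J :: "(nat => real) => real" and rho :: "(nat => real) => nat => real"
 assumes sub: "\<And>r f. (\<And>j. j < K ==> 0 < r j) ==> f \<in> borel_measurable borel ==>
   (\<integral>\<^sup>+y. f y * indicator T y \<partial>lborel) = (\<integral>\<^sup>+l. f (g r l) * ennreal (D r l) * indicator S l \<partial>lborel)"
  and IH: "\<And>G. G \<in> meas_leb K ==>
   (\<integral>\<^sup>+r. G r * indicator {r. \<forall>j<K. 0 < r j} r \<partial>leb K) =
   (\<integral>\<^sup>+l. G (\<lambda>j\<in>{..<K}. rho l j) * ennreal (J l) * indicator A l \<partial>leb K)"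
  and t: "\<And>l j. l \<in> S ==> j < K ==> 0 < t l j"
  and cong: "\<And>r r' l. (\<And>j. j < K ==> r j = r' j) ==> g r l = g r' l \<and> D r l = D r' l \<and>
   J r = J r' \<and> (r \<in> A \<longleftrightarrow> r' \<in> A) \<and> (\<forall>j<K. rho r j = rho r' j)"
  and ST: "S \<in> sets borel" "T \<in> sets borel"
  and mg: "(\<lambda>x. g x (x K)) \<in> meas_leb (Suc K)"
  and mD: "(\<lambda>x. D x (x K)) \<in> meas_leb (Suc K)"
  and mJ: "J \<in> meas_leb K"
  and mA: "A \<inter> space (leb K) \<in> sets (leb K)"
  and mt: "\<And>j. j < K ==> (\<lambda>l. t l j) \<in> borel_measurable borel"
  and mrho: "\<And>j. j < K ==> (\<lambda>l. rho l j) \<in> meas_leb K"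
  and mG: "G \<in> meas_leb (Suc K)"
 shows "(\<integral>\<^sup>+x. G x * indicator {x. (\<forall>j<K. 0 < x j) \<and> x K \<in> T} x \<partial>leb (Suc K)) =
  (\<integral>\<^sup>+x. G ((\<lambda>j\<in>{..<K}. t (x K) j * rho x j)(K := g (\<lambda>j. t (x K) j * rho x j) (x K))) *
    (ennreal (\<Prod>j<K. t (x K) j) * ennreal (D (\<lambda>j. t (x K) j * rho x j) (x K)) * ennreal (J x)) *
    indicator {x. x \<in> A \<and> x K \<in> S} x \<partial>leb (Suc K))"
proof -
 let ?v = "\<lambda>x j. t (x K) j * rho x j"
 let ?w = "\<lambda>x. (restrict (?v x) {..<K})(K := g (?v x) (x K))"
 let ?R = "\<lambda>x. G (?w x) * (ennreal (\<Prod>j<K. t (x K) j) * ennreal (D (?v x) (x K)) * ennreal (J x)) * indicator {x. x \<in> A \<and> x K \<in> S} x"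
 note mc = measurable_leb_component
 define pos where "pos = {x :: nat => real. \<forall>j<K. 0 < x j}"
 have mpos: "pos \<inter> space (leb m) \<in> sets (leb m)" if "K <= m" for m
 proof -
  have "pos \<inter> space (leb m) = {x \<in> space (leb m). \<forall>j\<in>{..<K}. 0 < x j}" by (auto simp: pos_def)
  also have "... \<in> sets (leb m)"
   using that by (intro sets.sets_Collect_finite_All) (auto intro!: borel_measurable_less mc)
  finally show ?thesis .
 qed
 have ind: "(\<lambda>x. indicator B x :: ennreal) \<in> borel_measurable M" if "B \<inter> space M \<in> sets M" for B and M :: "(nat => real) measure"
  using that by (simp add: borel_measurable_indicator_iff)
 have mKS: "(\<lambda>x. indicator S (x K) :: ennreal) \<in> meas_leb (Suc K)"
  by (rule measurable_compose[OF mc borel_measurable_indicator[OF ST(1)]]) simp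
 have mKT: "(\<lambda>x. indicator T (x K) :: ennreal) \<in> meas_leb (Suc K)"
  by (rule measurable_compose[OF mc borel_measurable_indicator[OF ST(2)]]) simp
 have upd: "x(K := y) \<in> extensional {..<Suc K}" if "x \<in> space (leb K)" for x y
  using that by (auto simp: space_leb extensional_def)
 define H where "H x = G (x(K := g x (x K))) * ennreal (D x (x K)) * indicator S (x K) * indicator pos x" for x
 have mH: "H \<in> meas_leb (Suc K)"
 proof -
  have "(\<lambda>x. x(K := g x (x K))) \<in> measurable (leb (Suc K)) (leb (Suc K))"
  proof (rule measurable_leb_I)
   fix j assume "j < Suc K"
   then show "(\<lambda>x. (x(K := g x (x K))) j) \<in> meas_leb (Suc K)"
    using mg mc[of j "Suc K"] by (cases "j = K") auto
  qed (auto simp: space_leb extensional_def)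
  from measurable_compose[OF this mG] show ?thesis
   unfolding H_def by (intro borel_measurable_times_ennreal measurable_compose[OF mD measurable_ennreal] mKS ind mpos) auto
 qed
 have "(\<integral>\<^sup>+x. G x * indicator {x. (\<forall>j<K. 0 < x j) \<and> x K \<in> T} x \<partial>leb (Suc K)) =
  (\<integral>\<^sup>+x. G x * (indicator pos x * indicator T (x K)) \<partial>leb (Suc K))"
  by (intro nn_integral_cong) (auto simp: pos_def indicator_def)
 also have "... = (\<integral>\<^sup>+r. \<integral>\<^sup>+y. G (r(K := y)) * (indicator pos (r(K := y)) * indicator T ((r(K := y)) K)) \<partial>lborel \<partial>leb K)"
  by (rule nn_integral_leb_Suc) (intro borel_measurable_times_ennreal mG ind mpos mKT, simp)
 also have "... = (\<integral>\<^sup>+r. \<integral>\<^sup>+l. H (r(K := l)) \<partial>lborel \<partial>leb K)"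
 proof (rule nn_integral_cong)
  fix r assume r: "r \<in> space (leb K)"
  have pu: "r(K := y) \<in> pos \<longleftrightarrow> r \<in> pos" for y by (auto simp: pos_def)
  show "(\<integral>\<^sup>+y. G (r(K := y)) * (indicator pos (r(K := y)) * indicator T ((r(K := y)) K)) \<partial>lborel) =
   (\<integral>\<^sup>+l. H (r(K := l)) \<partial>lborel)"
  proof (cases "r \<in> pos")
   case True
   have "(\<lambda>y. r(K := y)) \<in> measurable lborel (leb (Suc K))"
    unfolding leb_Suc by (rule measurable_component_update[OF r]) simp
   from measurable_compose[OF this mG] have m: "(\<lambda>y. G (r(K := y))) \<in> borel_measurable borel" by simp
   have "g (r(K := l)) l = g r l" "D (r(K := l)) l = D r l" for l
    using cong[of "r(K := l)" r l] by auto
   then have "(\<integral>\<^sup>+l. H (r(K := l)) \<partial>lborel) = (\<integral>\<^sup>+l. G (r(K := g r l)) * ennreal (D r l) * indicator S l \<partial>lborel)"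
    using True unfolding H_def by (simp add: pu del: restrict_fupd)
   also have "... = (\<integral>\<^sup>+y. G (r(K := y)) * indicator T y \<partial>lborel)"
    by (rule sub[OF _ m, symmetric]) (use True in \<open>auto simp: pos_def\<close>)
   finally show ?thesis using True by (simp add: indicator_def[of pos] pu)
  next
   case False
   then show ?thesis by (simp add: H_def indicator_def[of pos] pu)
  qed
 qed
 also have "... = (\<integral>\<^sup>+x. H x \<partial>leb (Suc K))" by (rule nn_integral_leb_Suc[OF mH, symmetric])
 \<comment> \<open>The order of integration is reversed here: with the new last coordinate
   \<open>l\<close> fixed, the factors \<open>t l j\<close> are constants, and the others can be
   rescaled by them.\<close>
 also have "... = (\<integral>\<^sup>+l. \<integral>\<^sup>+r. H (r(K := l)) \<partial>leb K \<partial>lborel)" by (rule nn_integral_leb_Suc_rev[OF mH])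
 also have "... = (\<integral>\<^sup>+l. \<integral>\<^sup>+x. ?R (x(K := l)) \<partial>leb K \<partial>lborel)"
 proof (rule nn_integral_cong)
  fix l :: real
  have Au: "x(K := l) \<in> A \<longleftrightarrow> x \<in> A" for x using cong[of "x(K := l)" x] by auto
  have Ju: "J (x(K := l)) = J x" for x using cong[of "x(K := l)" x] by auto
  have ru: "rho (x(K := l)) j = rho x j" if "j < K" for x j using cong[of "x(K := l)" x] that by auto
  have gu: "g (\<lambda>j. t l j * rho (x(K := l)) j) l = g (\<lambda>j\<in>{..<K}. t l j * rho x j) l"
   "D (\<lambda>j. t l j * rho (x(K := l)) j) l = D (\<lambda>j\<in>{..<K}. t l j * rho x j) l" for x
   using cong[of "\<lambda>j. t l j * rho (x(K := l)) j" "\<lambda>j\<in>{..<K}. t l j * rho x j" l] ru by auto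
  have restr: "(\<lambda>j\<in>{..<K}. t l j * rho (x(K := l)) j) = (\<lambda>j\<in>{..<K}. t l j * rho x j)" for x
   using ru by (auto simp: fun_eq_iff restrict_def)
  show "(\<integral>\<^sup>+r. H (r(K := l)) \<partial>leb K) = (\<integral>\<^sup>+x. ?R (x(K := l)) \<partial>leb K)"
  proof (cases "l \<in> S")
   case False
   then show ?thesis by (simp add: H_def)
  next
   case l: True
   let ?sc = "\<lambda>r. \<lambda>j\<in>{..<K}. t l j * r j"
   define G0 where "G0 r = G (r(K := g r l)) * ennreal (D r l)" for r
   have mG0: "G0 \<in> meas_leb K"
   proof -
    have u: "(\<lambda>r. r(K := l)) \<in> measurable (leb K) (leb (Suc K))"
    proof (rule measurable_leb_I)
     fix j assume "j < Suc K"
     then show "(\<lambda>r. (r(K := l)) j) \<in> meas_leb K"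
      using mc[of j K] by (cases "j = K") auto
    qed (use upd in auto)
    have c: "g (r(K := l)) l = g r l" "D (r(K := l)) l = D r l" for r
     using cong[of "r(K := l)" r l] by auto
    have mg': "(\<lambda>r. g r l) \<in> meas_leb K" "(\<lambda>r. D r l) \<in> meas_leb K"
     using measurable_compose[OF u mg] measurable_compose[OF u mD] by (simp_all add: c)
    have "(\<lambda>r. r(K := g r l)) \<in> measurable (leb K) (leb (Suc K))"
    proof (rule measurable_leb_I)
     fix j assume "j < Suc K"
     then show "(\<lambda>r. (r(K := g r l)) j) \<in> meas_leb K"
      using mc[of j K] mg' by (cases "j = K") auto
    qed (use upd in auto)
    from measurable_compose[OF this mG] show ?thesis
     unfolding G0_def by (intro borel_measurable_times_ennreal measurable_compose[OF mg'(2) measurable_ennreal])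
   qed
   have msc: "?sc \<in> measurable (leb K) (leb K)"
   proof (rule measurable_leb_I)
    fix j assume "j < K"
    then show "(\<lambda>r. ?sc r j) \<in> meas_leb K" using mc[of j K] by simp
   qed simp
   have sceq: "?sc (\<lambda>j\<in>{..<K}. rho x j) = (\<lambda>j\<in>{..<K}. t l j * rho x j)" for x
    by (auto simp: fun_eq_iff restrict_def)
   have possc: "indicator pos (?sc r) = (indicator pos r :: ennreal)" for r
    using t[OF l] by (auto simp: pos_def indicator_def zero_less_mult_iff dest: less_asym)
   have "(\<integral>\<^sup>+r. H (r(K := l)) \<partial>leb K) = (\<integral>\<^sup>+r. G0 r * indicator pos r \<partial>leb K)"
   proof (rule nn_integral_cong)
    fix r
    have "indicator pos (r(K := l)) = (indicator pos r :: ennreal)" by (auto simp: pos_def indicator_def)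
    then show "H (r(K := l)) = G0 r * indicator pos r"
     using cong[of "r(K := l)" r l] l by (simp add: H_def G0_def)
   qed
   also have "... = (\<integral>\<^sup>+r. ennreal (\<Prod>j<K. t l j) * (G0 (?sc r) * indicator pos (?sc r)) \<partial>leb K)"
    by (rule nn_integral_leb_scale[OF t[OF l]]) (auto intro!: borel_measurable_times_ennreal mG0 ind mpos)
   also have "... = (\<integral>\<^sup>+r. (ennreal (\<Prod>j<K. t l j) * G0 (?sc r)) * indicator {r. \<forall>j<K. 0 < r j} r \<partial>leb K)"
    unfolding possc unfolding pos_def by (simp add: mult.assoc)
   also have "... = (\<integral>\<^sup>+x. (ennreal (\<Prod>j<K. t l j) * G0 (?sc (\<lambda>j\<in>{..<K}. rho x j))) * ennreal (J x) * indicator A x \<partial>leb K)"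
    by (rule IH) (intro borel_measurable_times_ennreal measurable_compose[OF msc mG0] borel_measurable_const)
   finally show ?thesis using l
    unfolding sceq by (simp add: G0_def Au Ju gu restr mult_ac indicator_def[of "{x. _ x}"] indicator_def[of A] cong: if_cong)
  qed
 qed
 also have "... = (\<integral>\<^sup>+x. ?R x \<partial>leb (Suc K))"
 proof (rule nn_integral_leb_Suc_rev[symmetric])
  have re: "(\<lambda>x. h (restrict x {..<K})) \<in> meas_leb (Suc K)" if "h \<in> meas_leb K" for h :: "_ => real"
   by (rule measurable_compose[OF measurable_leb_restrict that])
  have rc: "J (restrict x {..<K}) = J x" "restrict x {..<K} \<in> A \<longleftrightarrow> x \<in> A" "j < K ==> rho (restrict x {..<K}) j = rho x j" for x j
   using cong[of "restrict x {..<K}" x] by auto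
  have mJ': "J \<in> meas_leb (Suc K)" using re[OF mJ] by (simp add: rc)
  have mr': "(\<lambda>x. rho x j) \<in> meas_leb (Suc K)" if "j < K" for j
   using re[OF mrho[OF that]] that by (simp add: rc)
  have mA': "{x. x \<in> A \<and> x K \<in> S} \<inter> space (leb (Suc K)) \<in> sets (leb (Suc K))"
  proof -
   have "(\<lambda>x. restrict x {..<K}) -` (A \<inter> space (leb K)) \<inter> space (leb (Suc K)) \<in> sets (leb (Suc K))"
    by (rule measurable_sets[OF measurable_leb_restrict mA])
   moreover have "(\<lambda>x. x K) -` S \<inter> space (leb (Suc K)) \<in> sets (leb (Suc K))"
    by (rule measurable_sets[OF mc ST(1)]) simp
   moreover have "{x. x \<in> A \<and> x K \<in> S} \<inter> space (leb (Suc K)) =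
    ((\<lambda>x. restrict x {..<K}) -` (A \<inter> space (leb K)) \<inter> space (leb (Suc K))) \<inter>
    ((\<lambda>x. x K) -` S \<inter> space (leb (Suc K)))"
    by (auto simp: rc space_leb)
   ultimately show ?thesis by auto
  qed
  have mtr: "(\<lambda>x. t (x K) j * rho x j) \<in> meas_leb (Suc K)" if "j < K" for j
   by (intro borel_measurable_times mr' that measurable_compose[OF mc mt]) auto
  have mv: "(\<lambda>x. (restrict (?v x) {..<K})(K := x K)) \<in> measurable (leb (Suc K)) (leb (Suc K))"
  proof (rule measurable_leb_I)
   fix j assume "j < Suc K"
   then show "(\<lambda>x. ((restrict (?v x) {..<K})(K := x K)) j) \<in> meas_leb (Suc K)"
    using mc[of K "Suc K"] mtr[of j] by (cases "j = K") auto
  qed (auto simp: extensional_def)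
  have cc: "g ((restrict (?v x) {..<K})(K := x K)) (x K) = g (?v x) (x K)"
   "D ((restrict (?v x) {..<K})(K := x K)) (x K) = D (?v x) (x K)" for x
   using cong[of "(restrict (?v x) {..<K})(K := x K)" "?v x" "x K"] by auto
  have mg': "(\<lambda>x. g (?v x) (x K)) \<in> meas_leb (Suc K)"
   using measurable_compose[OF mv mg] unfolding fun_upd_same cc .
  have mD': "(\<lambda>x. D (?v x) (x K)) \<in> meas_leb (Suc K)"
   using measurable_compose[OF mv mD] unfolding fun_upd_same cc .
  have mv': "(\<lambda>x. ?w x) \<in> measurable (leb (Suc K)) (leb (Suc K))"
  proof (rule measurable_leb_I)
   fix j assume "j < Suc K"
   then show "(\<lambda>x. (?w x) j) \<in> meas_leb (Suc K)"
    using mg' mtr[of j] by (cases "j = K") auto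
  qed (auto simp: extensional_def)
  have mprod: "(\<lambda>x. \<Prod>j<K. t (x K) j) \<in> meas_leb (Suc K)"
   by (intro borel_measurable_prod measurable_compose[OF mc mt]) auto
  show "?R \<in> meas_leb (Suc K)"
   by (intro borel_measurable_times_ennreal measurable_compose[OF mv' mG] measurable_compose[OF mprod measurable_ennreal]
     measurable_compose[OF mD' measurable_ennreal] measurable_compose[OF mJ' measurable_ennreal] ind mA')
 qed
 finally show ?thesis .
qed

text \<open>The gap that ends at \<open>m j\<close>; the first one is unbounded to the left, and
  \<open>top_slot\<close> lies beyond the last point. Membership of every coordinate in its slot
  expresses strict interlacing.\<close>

definition slot :: "(nat => real) => nat => real set" where
 "slot m j = {x. (0 < j --> m (j - 1) < x) \<and> x < m j}"

definition top_slot :: "(nat => real) => nat => real set" where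
 "top_slot m j = {x. 0 < j --> m (j - 1) < x}"

lemma slot_einterval: "slot m j = einterval (if j = 0 then - \<infinity> else ereal (m (j - 1))) (ereal (m j))"
 by (auto simp: slot_def einterval_def)

lemma top_slot_einterval: "top_slot m j = einterval (if j = 0 then - \<infinity> else ereal (m (j - 1))) \<infinity>"
 by (auto simp: top_slot_def einterval_def)

lemma slot_gt:
 assumes "\<And>i j. i < j ==> j < K ==> m i < m j" "x \<in> top_slot m K" "j < K"
 shows "m j < (x :: real)"
proof -
 have "m j <= m (K - 1)" using assms(1)[of j "K - 1"] assms(3) by (metis Suc_diff_1 less_Suc_eq less_imp_le less_nat_zero_code order_refl not_gr_zero)
 then show ?thesis using assms(2,3) by (auto simp: top_slot_def)
qed

text \<open>On the slot the substituted function decreases through all positive values: it is 0 at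
  the right end, and at the left end it is driven to infinity by the nearest pole, or by the linear
  factor if there is no pole.\<close>

lemma slot_substitution:
 fixes m r :: "nat => real"
 assumes inc: "\<And>i j. i < j ==> j < Suc K ==> m i < m j" and r: "\<And>j. j < K ==> 0 < r j"
  and f: "f \<in> borel_measurable borel"
 shows "(\<integral>\<^sup>+y. f y * indicator {0<..} y \<partial>lborel) =
  (\<integral>\<^sup>+l. f ((m K - l) * (1 + (\<Sum>j<K. r j / (l - m j)))) *
   ennreal (1 + (\<Sum>j<K. r j * (m K - m j) / (l - m j)\<^sup>2)) * indicator (slot m K) l \<partial>lborel)"
proof -
 define g where "g l = (m K - l) * (1 + (\<Sum>j<K. r j / (l - m j)))" for l
 define D where "D l = 1 + (\<Sum>j<K. r j * (m K - m j) / (l - m j)\<^sup>2)" for l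
 have gt: "m j < l" if "l \<in> slot m K" "j < K" for l j
  by (rule slot_gt[of K]) (use inc that in \<open>auto simp: slot_def top_slot_def\<close>)
 have img: "g ` slot m K = {0<..}"
 proof (intro equalityI subsetI)
  fix y assume "y \<in> g ` slot m K"
  then obtain l where l: "l \<in> slot m K" "y = g l" by blast
  have "0 <= (\<Sum>j<K. r j / (l - m j))"
   using gt[OF l(1)] r by (intro sum_nonneg divide_nonneg_nonneg) (auto intro: less_imp_le)
  then show "y \<in> {0<..}" using l unfolding g_def by (auto simp: slot_def intro!: mult_pos_pos)
 next
  fix y :: real assume "y \<in> {0<..}"
  then have y: "y > 0" by simp
  show "y \<in> g ` slot m K"
  proof (cases "K = 0")
   case True
   then have "g (m K - y) = y" "m K - y \<in> slot m K" using y by (auto simp: g_def slot_def)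
   then show ?thesis by (metis image_eqI)
  next
   case False
   define a p where "a = m (K - 1)" and "p = r (K - 1)"
   have aM: "a < m K" using inc[of "K - 1" K] False by (simp add: a_def)
   have p: "p > 0" using r[of "K - 1"] False by (simp add: p_def)
   \<comment> \<open>The solution of (m K - l) p / (l - a) = y, which keeps only the nearest pole.
     The omitted terms are nonnegative, so \<open>g l0\<close> is at least \<open>y\<close>, and the
     intermediate value theorem applies on [l0, m K].\<close>
   define l0 where "l0 = (y * a + p * m K) / (y + p)"
   have d1: "m K - l0 = y * (m K - a) / (y + p)" using y p by (simp add: l0_def field_simps)
   have d2: "l0 - a = p * (m K - a) / (y + p)" using y p by (simp add: l0_def field_simps)
   have l0: "a < l0" "l0 < m K"
    using d1 d2 aM y p by (metis diff_gt_0_iff_gt divide_pos_pos add_pos_pos mult_pos_pos)+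
   have l0s: "l0 \<in> slot m K" using l0 by (simp add: slot_def a_def)
   have gl0: "g l0 >= y"
   proof -
    have "p / (l0 - a) <= (\<Sum>j<K. r j / (l0 - m j))"
     unfolding p_def a_def
     by (rule member_le_sum[of "K - 1" "{..<K}" "\<lambda>j. r j / (l0 - m j)"])
      (use False gt[OF l0s] r in \<open>auto intro!: divide_nonneg_nonneg less_imp_le\<close>)
    then have "(m K - l0) * (p / (l0 - a)) <= g l0"
     unfolding g_def using l0 by (intro mult_left_mono) auto
    moreover have "(m K - l0) * (p / (l0 - a)) = y"
    proof -
     have "m K - a ~= 0" "y + p ~= 0" "p ~= 0" using y p aM by auto
     then show ?thesis unfolding d1 d2 by (simp add: divide_simps)
    qed
    ultimately show ?thesis by simp
   qed
   have sub: "l - m j ~= 0" if "l \<in> {l0..m K}" "j < K" for l j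
    using gt[OF l0s that(2)] that(1) by auto
   have "continuous_on {l0..m K} g"
    unfolding g_def by (intro continuous_intros) (use sub in auto)
   moreover have "g (m K) <= y" using y by (simp add: g_def)
   ultimately have "\<exists>x\<ge>l0. x <= m K \<and> g x = y"
    using gl0 l0 by (intro IVT2') auto
   then obtain x where x: "l0 <= x" "x <= m K" "g x = y" by blast
   have "x ~= m K" using x(3) y by (auto simp: g_def)
   then have "x \<in> slot m K" using x l0 by (simp add: slot_def a_def)
   then show ?thesis using x(3) by blast
  qed
 qed
 let ?a = "if K = 0 then - \<infinity> else ereal (m (K - 1))"
 have "(\<integral>\<^sup>+y. f y * indicator (g ` einterval ?a (ereal (m K))) y \<partial>lborel) =
  (\<integral>\<^sup>+l. f (g l) * ennreal (D l) * indicator (einterval ?a (ereal (m K))) l \<partial>lborel)"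
 proof (rule nn_integral_substitution_open_decreasing[OF f])
  show "?a < ereal (m K)" using inc[of "K - 1" K] by auto
  fix l assume "l \<in> einterval ?a (ereal (m K))"
  then have l: "l \<in> slot m K" by (simp only: slot_einterval)
  have nz: "l - m j ~= 0" if "j < K" for j using gt[OF l that] by simp
  have ne: "l ~= m j" if "j < K" for j using gt[OF l that] by simp
  have "(g has_real_derivative (- 1) * (1 + (\<Sum>j<K. r j / (l - m j))) + (m K - l) * (\<Sum>j<K. - r j / (l - m j)\<^sup>2)) (at l)"
   unfolding g_def by (auto intro!: derivative_eq_intros simp: nz power2_eq_square dest: ne)
  also have "(- 1) * (1 + (\<Sum>j<K. r j / (l - m j))) + (m K - l) * (\<Sum>j<K. - r j / (l - m j)\<^sup>2) = - D l"
  proof -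
   \<comment> \<open>The two contributions of a pole combine through m K - m j = (m K - l) + (l - m
     j), which makes the sign of the derivative evident.\<close>
   have "r j * (m K - m j) / (l - m j)\<^sup>2 = r j / (l - m j) - (m K - l) * (- r j / (l - m j)\<^sup>2)" if "j < K" for j
    using nz[OF that] by (simp add: divide_simps power2_eq_square) (simp add: algebra_simps)
   then have "(\<Sum>j<K. r j * (m K - m j) / (l - m j)\<^sup>2) =
     (\<Sum>j<K. r j / (l - m j)) - (m K - l) * (\<Sum>j<K. - r j / (l - m j)\<^sup>2)"
    by (simp add: sum_distrib_left sum_subtractf sum_negf)
   then show ?thesis by (simp add: D_def)
  qed
  finally show "(g has_real_derivative - D l) (at l)" .
  have "0 <= (\<Sum>j<K. r j * (m K - m j) / (l - m j)\<^sup>2)"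
   using r inc[of _ K] by (intro sum_nonneg divide_nonneg_nonneg mult_nonneg_nonneg) (auto intro: less_imp_le)
  then show "0 < D l" by (simp add: D_def)
 next
  show "continuous_on (einterval ?a (ereal (m K))) D"
   unfolding slot_einterval[symmetric] D_def
   by (intro continuous_intros) (auto dest: gt)
 qed
 then show ?thesis unfolding slot_einterval[symmetric] img g_def D_def .
qed

text \<open>Beyond the last pole the function increases from minus infinity to infinity. Setting it
  equal to the corner entry is the equation of an arrow matrix for its largest eigenvalue.\<close>

lemma top_slot_substitution:
 fixes m r :: "nat => real"
 assumes inc: "\<And>i j. i < j ==> j < K ==> m i < m j" and r: "\<And>j. j < K ==> 0 < r j"
  and f: "f \<in> borel_measurable borel"
 shows "(\<integral>\<^sup>+y. f y * indicator UNIV y \<partial>lborel) =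
  (\<integral>\<^sup>+l. f (l - (\<Sum>j<K. r j / (l - m j))) *
   ennreal (1 + (\<Sum>j<K. r j / (l - m j)\<^sup>2)) * indicator (top_slot m K) l \<partial>lborel)"
proof -
 define g where "g l = l - (\<Sum>j<K. r j / (l - m j))" for l
 define D where "D l = 1 + (\<Sum>j<K. r j / (l - m j)\<^sup>2)" for l
 have gt: "m j < l" if "l \<in> top_slot m K" "j < K" for l j
  by (rule slot_gt[of K]) (use inc that in auto)
 have pos: "0 <= r j / (l - m j)" if "l \<in> top_slot m K" "j < K" for l j
  using gt[OF that] r[OF that(2)] by simp
 have img: "g ` top_slot m K = UNIV"
 proof (intro equalityI subsetI)
  fix y :: real
  show "y \<in> g ` top_slot m K"
  proof (cases "K = 0")
   case True
   then have "g y = y" "y \<in> top_slot m K" by (auto simp: g_def top_slot_def)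
   then show ?thesis by (metis image_eqI)
  next
   case False
   define a p where "a = m (K - 1)" and "p = r (K - 1)"
   have p: "p > 0" using r[of "K - 1"] False by (simp add: p_def)
   have ma: "m j <= a" if "j < K" for j
    using inc[of j "K - 1"] that unfolding a_def by (metis Suc_diff_1 less_Suc_eq less_imp_le less_nat_zero_code order_refl not_gr_zero)
   \<comment> \<open>Chosen at most 1 and so small that p / d exceeds |a + 1 - y|; this brings
     \<open>g (a + d)\<close> below \<open>y\<close>.\<close>
   define d where "d = min 1 (p / (\<bar>a + 1 - y\<bar> + 1))"
   have d: "0 < d" "d <= 1" "d <= p / (\<bar>a + 1 - y\<bar> + 1)" using p by (auto simp: d_def)
   have l0s: "a + d \<in> top_slot m K" using d by (simp add: top_slot_def a_def)
   have g0: "g (a + d) <= y"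
   proof -
    have "p / (a + d - a) <= (\<Sum>j<K. r j / (a + d - m j))"
     unfolding p_def a_def
     by (rule member_le_sum[of "K - 1" "{..<K}" "\<lambda>j. r j / (m (K - 1) + d - m j)"])
      (use False pos[OF l0s] in \<open>auto simp: a_def\<close>)
    moreover have "\<bar>a + 1 - y\<bar> + 1 <= p / d"
     using d p by (simp add: field_simps)
    ultimately show ?thesis using d(2) unfolding g_def by simp
   qed
   define R where "R = (\<Sum>j<K. r j)"
   \<comment> \<open>At distance at least 1 from every pole the subtracted sum is at most
     \<open>R\<close>.\<close>
   define l1 where "l1 = max (a + 1) (y + R)"
   have g1: "y <= g l1"
   proof -
    have "(\<Sum>j<K. r j / (l1 - m j)) <= (\<Sum>j<K. r j)"
    proof (intro sum_mono)
     fix j assume "j \<in> {..<K}"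
     then have "1 <= l1 - m j" "0 < r j" using ma[of j] r[of j] by (auto simp: l1_def)
     then have "r j / (l1 - m j) <= r j / 1" by (intro divide_left_mono) auto
     then show "r j / (l1 - m j) <= r j" by simp
    qed
    then show ?thesis unfolding g_def l1_def R_def by linarith
   qed
   have le: "a + d <= l1" using d by (simp add: l1_def)
   have "continuous_on {a + d..l1} g"
    unfolding g_def
   proof (intro continuous_intros ballI)
    fix x j assume "x \<in> {a + d..l1}" "j \<in> {..<K}"
    then show "x - m j ~= 0" using gt[OF l0s, of j] by auto
   qed
   then have "\<exists>x\<ge>a + d. x <= l1 \<and> g x = y" using g0 g1 le by (intro IVT') auto
   then obtain x where x: "a + d <= x" "g x = y" by blast
   then have "x \<in> top_slot m K" using d by (simp add: top_slot_def a_def)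
   then show ?thesis using x(2) by blast
  qed
 qed simp
 let ?a = "if K = 0 then - \<infinity> else ereal (m (K - 1))"
 have "(\<integral>\<^sup>+y. f y * indicator (g ` einterval ?a \<infinity>) y \<partial>lborel) =
  (\<integral>\<^sup>+l. f (g l) * ennreal (D l) * indicator (einterval ?a \<infinity>) l \<partial>lborel)"
 proof (rule nn_integral_substitution_open[OF f])
  show "?a < \<infinity>" by auto
  fix l assume "l \<in> einterval ?a \<infinity>"
  then have l: "l \<in> top_slot m K" by (simp only: top_slot_einterval)
  have nz: "l - m j ~= 0" if "j < K" for j using gt[OF l that] by simp
  have ne: "l ~= m j" if "j < K" for j using gt[OF l that] by simp
  have "(g has_real_derivative 1 - (\<Sum>j<K. - r j / (l - m j)\<^sup>2)) (at l)"
   unfolding g_def by (auto intro!: derivative_eq_intros simp: nz power2_eq_square dest: ne)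
  then show "(g has_real_derivative D l) (at l)" by (simp add: D_def sum_negf)
  have "0 <= (\<Sum>j<K. r j / (l - m j)\<^sup>2)"
   using r by (intro sum_nonneg divide_nonneg_nonneg) (auto intro: less_imp_le)
  then show "0 < D l" by (simp add: D_def)
 next
  show "continuous_on (einterval ?a \<infinity>) D"
   unfolding top_slot_einterval[symmetric] D_def
   by (intro continuous_intros) (auto dest: gt)
 qed
 then show ?thesis unfolding top_slot_einterval[symmetric] img g_def D_def .
qed

lemma measurable_resid:
 assumes "K <= n" "j < K"
 shows "(\<lambda>l. resid K m l j) \<in> meas_leb n"
 unfolding resid_def using assms
 by (intro borel_measurable_times borel_measurable_prod borel_measurable_divide borel_measurable_diff
   borel_measurable_const measurable_leb_component) auto

lemma measurable_vand: "K <= n ==> (vand K :: (nat => real) => real) \<in> meas_leb n"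
 unfolding vand_def by (intro borel_measurable_prod borel_measurable_diff measurable_leb_component) auto

lemma sets_slot [simp]: "slot m j \<in> sets borel" "top_slot m j \<in> sets borel"
 by (simp_all add: slot_einterval top_slot_einterval)

lemma sets_slots:
 assumes "K <= n"
 shows "{l. \<forall>j<K. l j \<in> slot m j} \<inter> space (leb n) \<in> sets (leb n)"
proof -
 have "{l. \<forall>j<K. l j \<in> slot m j} \<inter> space (leb n) = {l \<in> space (leb n). \<forall>j\<in>{..<K}. l j \<in> slot m j}" by auto
 also have "... \<in> sets (leb n)"
 proof (rule sets.sets_Collect_finite_All[OF _ finite_lessThan])
  fix j assume "j \<in> {..<K}"
  then have "(\<lambda>l. l j) \<in> meas_leb n" using assms by (intro measurable_leb_component) auto
  then show "{l \<in> space (leb n). l j \<in> slot m j} \<in> sets (leb n)"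
   by (rule measurable_sets_Collect) simp
 qed
 finally show ?thesis .
qed

text \<open>The scalings \<open>t\<close> are the factors by which the residues change when the factor
 \<open>(x - l K) / (x - m K)\<close>, respectively \<open>x - l K\<close>, is split off.\<close>

lemma slot_chain:
 fixes g D t :: "_ => _ => real"
 assumes inc: "\<And>i j. i < j ==> j < K ==> m i < m j"
  and IH: "\<And>G. G \<in> meas_leb K ==> (\<integral>\<^sup>+r. G r * indicator {r. \<forall>j<K. 0 < r j} r \<partial>leb K) =
   (\<integral>\<^sup>+l. G (\<lambda>j\<in>{..<K}. resid K m l j) * ennreal (vand K l / vand K m) * indicator {l. \<forall>j<K. l j \<in> slot m j} l \<partial>leb K)"
  and sub: "\<And>r f. (\<And>j. j < K ==> 0 < r j) ==> f \<in> borel_measurable borel ==>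
   (\<integral>\<^sup>+y. f y * indicator T y \<partial>lborel) = (\<integral>\<^sup>+l. f (g r l) * ennreal (D r l) * indicator S l \<partial>lborel)"
  and gt: "\<And>l j. l \<in> S ==> j < K ==> m j < l" and tpos: "\<And>l j. l \<in> S ==> j < K ==> 0 < t l j"
  and cong: "\<And>r r' l. (\<And>j. j < K ==> r j = r' j) ==> g r l = g r' l \<and> D r l = D r' l"
  and ST: "S \<in> sets borel" "T \<in> sets borel"
  and mgD: "(\<lambda>x. g x (x K)) \<in> meas_leb (Suc K)" "(\<lambda>x. D x (x K)) \<in> meas_leb (Suc K)"
  and mt: "\<And>j. j < K ==> (\<lambda>l. t l j) \<in> borel_measurable borel"
  and mG: "G \<in> meas_leb (Suc K)"
  and D: "\<And>x. x K \<in> S ==> D (\<lambda>j. t (x K) j * resid K m x j) (x K) = 1 + (\<Sum>j<K. resid K m x j / (x K - m j))"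
  and V: "\<And>x. x K \<in> S ==> (\<lambda>j\<in>{..<K}. t (x K) j * resid K m x j)(K := g (\<lambda>j. t (x K) j * resid K m x j) (x K)) = V x"
  and J: "\<And>x. x K \<in> S ==> (\<Prod>j<K. t (x K) j) * (\<Prod>i<K. (x K - x i) / (x K - m i)) * (vand K x / vand K m) = J x"
 shows "(\<integral>\<^sup>+x. G x * indicator {x. (\<forall>j<K. 0 < x j) \<and> x K \<in> T} x \<partial>leb (Suc K)) =
  (\<integral>\<^sup>+x. G (V x) * ennreal (J x) * indicator {x. (\<forall>j<K. x j \<in> slot m j) \<and> x K \<in> S} x \<partial>leb (Suc K))"
proof -
 define A where "A = {l. \<forall>j<K. l j \<in> slot m j}"
 let ?r = "\<lambda>x j. t (x K) j * resid K m x j"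
 have inj: "inj_on m {..<K}"
  by (rule inj_onI) (metis inc less_irrefl lessThan_iff linorder_neqE_nat)
 have "(\<integral>\<^sup>+x. G x * indicator {x. (\<forall>j<K. 0 < x j) \<and> x K \<in> T} x \<partial>leb (Suc K)) =
  (\<integral>\<^sup>+x. G ((\<lambda>j\<in>{..<K}. ?r x j)(K := g (?r x) (x K))) *
    (ennreal (\<Prod>j<K. t (x K) j) * ennreal (D (?r x) (x K)) * ennreal (vand K x / vand K m)) *
    indicator {x. x \<in> A \<and> x K \<in> S} x \<partial>leb (Suc K))"
 proof (rule chain_step[OF sub IH[folded A_def] tpos _ ST mgD])
  show "A \<inter> space (leb K) \<in> sets (leb K)" unfolding A_def by (rule sets_slots) simp
  fix r r' :: "nat => real" and l assume "\<And>j. j < K ==> r j = r' j"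
  then show "g r l = g r' l \<and> D r l = D r' l \<and> vand K r / vand K m = vand K r' / vand K m \<and>
   (r \<in> A \<longleftrightarrow> r' \<in> A) \<and> (\<forall>j<K. resid K m r j = resid K m r' j)"
   using cong[of r r' l] by (auto simp: A_def vand_cong[of K r r'] resid_cong[of K r r'])
 qed (auto intro!: measurable_resid borel_measurable_divide measurable_vand mG mt)
 also have "... = (\<integral>\<^sup>+x. G (V x) * ennreal (J x) * indicator {x. (\<forall>j<K. x j \<in> slot m j) \<and> x K \<in> S} x \<partial>leb (Suc K))"
 proof (rule nn_integral_cong)
  fix x
  have Ac: "{x. (\<forall>j<K. x j \<in> slot m j) \<and> x K \<in> S} = {x. x \<in> A \<and> x K \<in> S}" by (simp add: A_def)
  show "G ((\<lambda>j\<in>{..<K}. ?r x j)(K := g (?r x) (x K))) *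
    (ennreal (\<Prod>j<K. t (x K) j) * ennreal (D (?r x) (x K)) * ennreal (vand K x / vand K m)) *
    indicator {x. x \<in> A \<and> x K \<in> S} x =
   G (V x) * ennreal (J x) * indicator {x. (\<forall>j<K. x j \<in> slot m j) \<and> x K \<in> S} x"
  proof (cases "x \<in> {x. x \<in> A \<and> x K \<in> S}")
   case False
   show ?thesis unfolding Ac indicator_simps(2)[OF False] by simp
  next
   case True
   then have xA: "x \<in> A" and xS: "x K \<in> S" by auto
   have lgt: "m j < x K" if "j < K" for j using gt[OF xS that] .
   have xlt: "x i < x K" if "i < K" for i
   proof -
    have "x i < m i" using xA that by (auto simp: A_def slot_def)
    then show ?thesis using lgt[OF that] by simp
   qed
   have pos1: "0 <= (\<Prod>j<K. t (x K) j)" "0 <= (\<Prod>i<K. (x K - x i) / (x K - m i))"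
    using tpos[OF xS] lgt xlt by (auto intro!: prod_nonneg divide_nonneg_nonneg simp: less_imp_le)
   \<comment> \<open>After the rescaling, the derivative is the sum of simple fractions at
     \<open>x K\<close>. Its product form lets the Jacobian of the whole step combine with the
     Vandermonde quotient.\<close>
   have D1: "D (?r x) (x K) = (\<Prod>i<K. (x K - x i) / (x K - m i))"
    unfolding D[of x, OF xS] by (rule partial_fractions[OF inj]) (use lgt in force)
   have "ennreal (\<Prod>j<K. t (x K) j) * ennreal (D (?r x) (x K)) * ennreal (vand K x / vand K m) = ennreal (J x)"
    unfolding D1 J[of x, OF xS, symmetric]
    by (simp only: ennreal_mult'[OF mult_nonneg_nonneg[OF pos1]] ennreal_mult'[OF pos1(1)])
   then show ?thesis unfolding Ac V[of x, OF xS] by simp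
  qed
 qed
 finally show ?thesis .
qed

text \<open>The Jacobian of the passage from interlacing vectors to residues is built up as a
  product of one-variable derivatives and scalings, so no matrix of partial derivatives
  occurs.\<close>

theorem interlacing_substitution:
 assumes "\<And>i j. i < j ==> j < K ==> m i < m j" "G \<in> meas_leb K"
 shows "(\<integral>\<^sup>+r. G r * indicator {r. \<forall>j<K. 0 < r j} r \<partial>leb K) =
  (\<integral>\<^sup>+l. G (\<lambda>j\<in>{..<K}. resid K m l j) * ennreal (vand K l / vand K m) *
   indicator {l. \<forall>j<K. l j \<in> slot m j} l \<partial>leb K)"
 using assms
proof (induction K arbitrary: G)
 case 0
 then show ?case by (simp add: leb.nn_integral_empty restrict_def space_PiM vand_def)
next
 case (Suc K)
 define g where "g r l = (m K - l) * (1 + (\<Sum>j<K. r j / (l - m j)))" for r l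
 define D where "D r l = 1 + (\<Sum>j<K. r j * (m K - m j) / (l - m j)\<^sup>2)" for r l
 define t where "t l j = (l - m j) / (m K - m j)" for l j
 note mc = measurable_leb_component
 have inc: "m i < m j" if "i < j" "j < K" for i j using Suc.prems(1) that by simp
 have gt: "m j < l" if "l \<in> slot m K" "j < K" for l j
  by (rule slot_gt[of K]) (use inc that in \<open>auto simp: slot_def top_slot_def\<close>)
 have mK: "m j < m K" if "j < K" for j using Suc.prems(1)[of j K] that by simp
 have inj: "inj_on m {..<K}"
  by (rule inj_onI) (metis inc less_irrefl lessThan_iff linorder_neqE_nat)
 have *: "(\<integral>\<^sup>+x. G x * indicator {x. (\<forall>j<K. 0 < x j) \<and> x K \<in> {0<..}} x \<partial>leb (Suc K)) =
  (\<integral>\<^sup>+x. G (\<lambda>j\<in>{..<Suc K}. resid (Suc K) m x j) * ennreal (vand (Suc K) x / vand (Suc K) m) *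
   indicator {x. (\<forall>j<K. x j \<in> slot m j) \<and> x K \<in> slot m K} x \<partial>leb (Suc K))"
 proof (rule slot_chain[where g = g and D = D and t = t, OF inc])
  show "(\<lambda>x. g x (x K)) \<in> meas_leb (Suc K)" "(\<lambda>x. D x (x K)) \<in> meas_leb (Suc K)"
   unfolding g_def D_def
   by (intro borel_measurable_times borel_measurable_add borel_measurable_sum borel_measurable_divide
     borel_measurable_diff borel_measurable_const borel_measurable_power mc; simp)+
  fix r :: "nat => real" and f :: "real => ennreal" assume "\<And>j. j < K ==> 0 < r j" "f \<in> borel_measurable borel"
  then show "(\<integral>\<^sup>+y. f y * indicator {0<..} y \<partial>lborel) = (\<integral>\<^sup>+l. f (g r l) * ennreal (D r l) * indicator (slot m K) l \<partial>lborel)"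
   unfolding g_def D_def by (intro slot_substitution Suc.prems(1))
 next
  fix x assume l: "x K \<in> slot m K"
  let ?l = "x K"
  have lgt: "m j < ?l" if "j < K" for j using gt[OF l that] .
  have "t ?l j * resid K m x j * (m K - m j) / (?l - m j)\<^sup>2 = resid K m x j / (?l - m j)" if "j < K" for j
   using lgt[OF that] mK[OF that] by (simp add: t_def power2_eq_square)
  then show "D (\<lambda>j. t ?l j * resid K m x j) ?l = 1 + (\<Sum>j<K. resid K m x j / (?l - m j))" by (simp add: D_def)
  \<comment> \<open>The scaling cancels the pole at \<open>m j\<close> and leaves the partial
    fraction sum evaluated at \<open>m K\<close>; its product form is the residue at the new
    pole.\<close>
  have "t ?l j * resid K m x j / (?l - m j) = resid K m x j / (m K - m j)" if "j < K" for j
   using lgt[OF that] by (simp add: t_def)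
  then have "g (\<lambda>j. t ?l j * resid K m x j) ?l = (m K - ?l) * (1 + (\<Sum>j<K. resid K m x j / (m K - m j)))"
   by (simp add: g_def)
  also have "1 + (\<Sum>j<K. resid K m x j / (m K - m j)) = (\<Prod>i<K. (m K - x i) / (m K - m i))"
   by (rule partial_fractions[OF inj]) (use mK in force)
  finally have g1: "g (\<lambda>j. t ?l j * resid K m x j) ?l = resid (Suc K) m x K" by (simp add: resid_last)
  have tr: "t ?l j * resid K m x j = resid (Suc K) m x j" if "j < K" for j
   unfolding resid_Suc[OF that] t_def
   by (metis (no_types, opaque_lifting) minus_diff_eq minus_divide_divide mult.commute)
  show "(\<lambda>j\<in>{..<K}. t ?l j * resid K m x j)(K := g (\<lambda>j. t ?l j * resid K m x j) ?l) = (\<lambda>j\<in>{..<Suc K}. resid (Suc K) m x j)"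
   unfolding g1 using tr by (auto simp: fun_eq_iff restrict_def less_Suc_eq)
  have "(\<Prod>j<K. t ?l j) * (\<Prod>i<K. (?l - x i) / (?l - m i)) = (\<Prod>i<K. (?l - x i) / (m K - m i))"
   unfolding prod.distrib[symmetric] using lgt by (intro prod.cong refl) (force simp: t_def)
  then show "(\<Prod>j<K. t ?l j) * (\<Prod>i<K. (?l - x i) / (?l - m i)) * (vand K x / vand K m) = vand (Suc K) x / vand (Suc K) m"
   by (simp add: vand_Suc prod_dividef mult.commute)
 qed (use gt mK Suc.prems(2) in \<open>auto simp: t_def g_def D_def intro!: Suc.IH inc\<close>)
 have "{x. (\<forall>j<K. 0 < x j) \<and> x K \<in> {0<..}} = {r. \<forall>j<Suc K. 0 < r j}"
  "{x. (\<forall>j<K. x j \<in> slot m j) \<and> x K \<in> slot m K} = {l. \<forall>j<Suc K. l j \<in> slot m j}"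
  by (auto simp: less_Suc_eq)
 from *[unfolded this] show ?case .
qed

text \<open>In this final step the numerator gains the factor x - l K but no pole is added. The
  residues are multiplied by l K - m j and become the squared moduli of the new column, and the last
  coordinate becomes the corner entry, as in \<open>interlacing_poly_identity\<close>.\<close>

theorem border_substitution:
 assumes inc: "\<And>i j. i < j ==> j < K ==> m i < m j" and mG: "G \<in> meas_leb (Suc K)"
 shows "(\<integral>\<^sup>+x. G x * indicator {x. \<forall>j<K. 0 < x j} x \<partial>leb (Suc K)) =
  (\<integral>\<^sup>+l. G ((\<lambda>j\<in>{..<K}. resid K m l j * (l K - m j))(K := l K - (\<Sum>j<K. resid K m l j))) *
   ennreal (vand (Suc K) l / vand K m) *
   indicator {l. (\<forall>j<K. l j \<in> slot m j) \<and> l K \<in> top_slot m K} l \<partial>leb (Suc K))"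
proof -
 define g where "g r l = l - (\<Sum>j<K. r j / (l - m j))" for r l
 define D where "D r l = 1 + (\<Sum>j<K. r j / (l - m j)\<^sup>2)" for r l
 define t where "t l j = l - m j" for l j
 note mc = measurable_leb_component
 have gt: "m j < l" if "l \<in> top_slot m K" "j < K" for l j
  by (rule slot_gt[of K]) (use inc that in auto)
 have "(\<integral>\<^sup>+x. G x * indicator {x. (\<forall>j<K. 0 < x j) \<and> x K \<in> UNIV} x \<partial>leb (Suc K)) =
  (\<integral>\<^sup>+l. G ((\<lambda>j\<in>{..<K}. resid K m l j * (l K - m j))(K := l K - (\<Sum>j<K. resid K m l j))) *
   ennreal (vand (Suc K) l / vand K m) *
   indicator {l. (\<forall>j<K. l j \<in> slot m j) \<and> l K \<in> top_slot m K} l \<partial>leb (Suc K))"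
 proof (rule slot_chain[where g = g and D = D and t = t, OF inc interlacing_substitution[OF inc]])
  show "(\<lambda>x. g x (x K)) \<in> meas_leb (Suc K)" "(\<lambda>x. D x (x K)) \<in> meas_leb (Suc K)"
   unfolding g_def D_def
   by (intro borel_measurable_times borel_measurable_add borel_measurable_sum borel_measurable_divide
     borel_measurable_diff borel_measurable_const borel_measurable_power mc; simp)+
  fix r :: "nat => real" and f :: "real => ennreal" assume "\<And>j. j < K ==> 0 < r j" "f \<in> borel_measurable borel"
  then show "(\<integral>\<^sup>+y. f y * indicator UNIV y \<partial>lborel) = (\<integral>\<^sup>+l. f (g r l) * ennreal (D r l) * indicator (top_slot m K) l \<partial>lborel)"
   unfolding g_def D_def by (intro top_slot_substitution inc)
 next
  fix x assume l: "x K \<in> top_slot m K"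
  let ?l = "x K"
  have lgt: "m j < ?l" if "j < K" for j using gt[OF l that] .
  have "t ?l j * resid K m x j / (?l - m j)\<^sup>2 = resid K m x j / (?l - m j)" "t ?l j * resid K m x j / (?l - m j) = resid K m x j"
   if "j < K" for j using lgt[OF that] by (simp_all add: t_def power2_eq_square)
  then show "D (\<lambda>j. t ?l j * resid K m x j) ?l = 1 + (\<Sum>j<K. resid K m x j / (?l - m j))"
   "(\<lambda>j\<in>{..<K}. t ?l j * resid K m x j)(K := g (\<lambda>j. t ?l j * resid K m x j) ?l) =
    (\<lambda>j\<in>{..<K}. resid K m x j * (?l - m j))(K := ?l - (\<Sum>j<K. resid K m x j))"
   by (simp add: D_def, auto simp: g_def fun_eq_iff restrict_def t_def)
  have "(\<Prod>j<K. t ?l j) * (\<Prod>i<K. (?l - x i) / (?l - m i)) = (\<Prod>i<K. ?l - x i)"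
   unfolding prod.distrib[symmetric] using lgt by (intro prod.cong refl) (force simp: t_def)
  then show "(\<Prod>j<K. t ?l j) * (\<Prod>i<K. (?l - x i) / (?l - m i)) * (vand K x / vand K m) = vand (Suc K) x / vand K m"
   by (simp add: vand_Suc)
 qed (use gt mG inc in \<open>auto simp: t_def g_def D_def\<close>)
 then show ?thesis by simp
qed

section \<open>Unitary invariance of Lebesgue measure\<close>

text \<open>The permutation that sorts the diagonal entries is applied to the columns of
  \<open>U\<close>.\<close>

lemma spectral_sorted:
 assumes X: "X \<in> hermitian_mats n"
 shows "\<exists>U. unitary_mat n U \<and> X = U * real_diag n (eigs n X) * mat_adjoint U"
proof -
 obtain U d where U0: "unitary_mat n U"
  and Xeq: "X = U * real_diag n d * mat_adjoint U"
  using hermitian_spectral[OF X] by blast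
 note U = unitary_matD[OF U0]
 have eqp: "(\<Prod>i<n. [:- complex_of_real (d i), 1:]) = (\<Prod>i<n. [:- complex_of_real (eigs n X i), 1:])"
  using eigs_char_poly[OF X] char_poly_unitary_conj[OF U0] Xeq by simp
 have ord: "Polynomial.order a (\<Prod>i<n. [:- complex_of_real (x i), 1:]) =
   (\<Sum>i<n. if of_real (x i) = a then 1 else 0)" for x :: "nat => real" and a
 proof (induction n)
  case (Suc m)
  have "(\<Prod>i<m. [:- complex_of_real (x i), 1:]) * [:- complex_of_real (x m), 1:] ~= 0"
   by (simp del: mult_pCons_right mult_pCons_left)
  then show ?case using Suc.IH by (simp add: order_mult order_linear_factor del: mult_pCons_right mult_pCons_left)
 qed simp
 have "image_mset (eigs n X) (mset_set {..<n}) = image_mset d (mset_set {..<n})"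
 proof (rule multiset_eqI)
  fix t
  have cnt: "count (image_mset x (mset_set {..<n})) t =
    (\<Sum>i<n. if complex_of_real (x i) = of_real t then 1 else 0)" for x :: "nat => real"
   by (simp add: count_image_mset sum.If_cases Int_def vimage_def conj_commute)
  show "count (image_mset (eigs n X) (mset_set {..<n})) t = count (image_mset d (mset_set {..<n})) t"
   unfolding cnt ord[symmetric] eqp ..
 qed
 then obtain p where p: "p permutes {..<n}" "\<forall>x\<in>{..<n}. eigs n X x = d (p x)"
  using image_mset_eq_implies_permutes[of "{..<n}" "eigs n X" d] by auto
 define V where "V = mat n n (\<lambda>(i, j). U $$ (i, p j))"
 have V: "V \<in> carrier_mat n n" by (simp add: V_def)
 have re: "(\<Sum>l<n. h (p l)) = (\<Sum>l<n. h l)" for h :: "nat => complex"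
  using sum.permute[OF p(1), of h] by (simp add: o_def)
 have Vu: "unitary_mat n V"
  unfolding unitary_mat_def
 proof (intro conjI V eq_matI)
  fix i j assume "i < dim_row (1\<^sub>m n :: complex mat)" "j < dim_col (1\<^sub>m n :: complex mat)"
  then have ij: "i < n" "j < n" by auto
  have "(V * mat_adjoint V) $$ (i, j) = (\<Sum>l<n. V $$ (i, l) * cnj (V $$ (j, l)))"
   unfolding index_mult_mat_sum[OF V mat_adjoint_carrier[OF V] ij]
   by (intro sum.cong refl) (simp add: mat_adjoint_index[OF V _ ij(2)])
  also have "... = (\<Sum>l<n. U $$ (i, p l) * cnj (U $$ (j, p l)))"
   using ij by (intro sum.cong refl) (simp add: V_def)
  also have "... = (\<Sum>l<n. U $$ (i, l) * cnj (U $$ (j, l)))"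
   by (rule re[of "\<lambda>l. U $$ (i, l) * cnj (U $$ (j, l))"])
  finally show "(V * mat_adjoint V) $$ (i, j) = 1\<^sub>m n $$ (i, j)"
   using unitary_index_sum(1)[OF U0 ij] ij by simp
 qed (use V in auto)
 moreover have "X = V * real_diag n (eigs n X) * mat_adjoint V"
 proof (rule eq_matI)
  fix i j assume "i < dim_row (V * real_diag n (eigs n X) * mat_adjoint V)"
   "j < dim_col (V * real_diag n (eigs n X) * mat_adjoint V)"
  then have ij: "i < n" "j < n" using V by auto
  have "(V * real_diag n (eigs n X) * mat_adjoint V) $$ (i, j) =
   (\<Sum>l<n. U $$ (i, p l) * of_real (d (p l)) * cnj (U $$ (j, p l)))"
   unfolding unitary_diag_index[OF V ij] using ij p(2) by (intro sum.cong refl) (simp add: V_def)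
  also have "... = (\<Sum>l<n. U $$ (i, l) * of_real (d l) * cnj (U $$ (j, l)))"
   by (rule re[of "\<lambda>l. U $$ (i, l) * of_real (d l) * cnj (U $$ (j, l))"])
  also have "... = X $$ (i, j)" unfolding unitary_diag_index[OF U(1) ij, symmetric] Xeq[symmetric] ..
  finally show "X $$ (i, j) = (V * real_diag n (eigs n X) * mat_adjoint V) $$ (i, j)" ..
 qed (use V hermitian_matsD(1)[OF X] in auto)
 ultimately show ?thesis by blast
qed

section \<open>Symmetries of product Lebesgue measure\<close>

interpretation lebs: product_sigma_finite "\<lambda>_::'i. lborel :: 'b::euclidean_space measure" ..

abbreviation cleb :: "nat => (nat => complex) measure" where
 "cleb n \<equiv> PiM {..<n} (\<lambda>_. lborel)"

lemma PiM_lborel_reindex: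
 assumes fin: "finite I" and bij: "bij_betw h J I"
 shows "distr (PiM I (\<lambda>_. lborel :: 'b::euclidean_space measure)) (PiM J (\<lambda>_. lborel)) (\<lambda>x. \<lambda>j\<in>J. x (h j)) =
  PiM J (\<lambda>_. lborel)"
proof (rule lebs.PiM_eqI)
 have hI: "h j \<in> I" if "j \<in> J" for j using bij that by (auto simp: bij_betw_def)
 show "finite J" using bij fin bij_betw_finite by blast
 have m: "(\<lambda>x. \<lambda>j\<in>J. x (h j)) \<in> measurable (PiM I (\<lambda>_. lborel :: 'b measure)) (PiM J (\<lambda>_. lborel))"
  by (intro measurable_restrict measurable_component_singleton hI)
 fix A :: "'c => 'b set" assume A: "\<And>j. j \<in> J ==> A j \<in> sets lborel"
 define B where "B i = A (inv_into J h i)" for i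
 have ij: "inv_into J h (h j) = j" if "j \<in> J" for j using bij that by (simp add: bij_betw_def)
 have hi: "h (inv_into J h i) = i" "inv_into J h i \<in> J" if "i \<in> I" for i
  using bij that by (auto simp: bij_betw_def f_inv_into_f inv_into_into)
 have pre: "(\<lambda>x. \<lambda>j\<in>J. x (h j)) -` (Pi\<^sub>E J A) \<inter> space (PiM I (\<lambda>_. lborel :: 'b measure)) = Pi\<^sub>E I B"
 proof (intro equalityI subsetI)
  fix x assume x: "x \<in> (\<lambda>x. \<lambda>j\<in>J. x (h j)) -` (Pi\<^sub>E J A) \<inter> space (PiM I (\<lambda>_. lborel :: 'b measure))"
  show "x \<in> Pi\<^sub>E I B"
  proof (rule PiE_I)
   fix i assume i: "i \<in> I"
   have "(\<lambda>j\<in>J. x (h j)) (inv_into J h i) \<in> A (inv_into J h i)" using x hi(2)[OF i] by blast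
   then show "x i \<in> B i" using hi[OF i] by (simp add: B_def)
  qed (use x in \<open>auto simp: space_PiM\<close>)
 next
  fix x assume x: "x \<in> Pi\<^sub>E I B"
  have "x (h j) \<in> A j" if "j \<in> J" for j using PiE_mem[OF x hI[OF that]] ij[OF that] by (simp add: B_def)
  then show "x \<in> (\<lambda>x. \<lambda>j\<in>J. x (h j)) -` (Pi\<^sub>E J A) \<inter> space (PiM I (\<lambda>_. lborel :: 'b measure))"
   using x by (auto simp: space_PiM)
 qed
 have "emeasure (distr (PiM I (\<lambda>_. lborel)) (PiM J (\<lambda>_. lborel)) (\<lambda>x. \<lambda>j\<in>J. x (h j))) (Pi\<^sub>E J A) =
  emeasure (PiM I (\<lambda>_. lborel)) (Pi\<^sub>E I B)"
  unfolding pre[symmetric]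
  by (rule emeasure_distr[OF m]) (use A \<open>finite J\<close> in \<open>auto intro!: sets_PiM_I_finite\<close>)
 also have "... = (\<Prod>i\<in>I. emeasure lborel (B i))"
  by (rule lebs.emeasure_PiM[OF fin]) (use A hi in \<open>auto simp: B_def\<close>)
 also have "... = (\<Prod>j\<in>J. emeasure lborel (A j))"
  by (rule prod.reindex_bij_betw[OF bij, symmetric, THEN trans]) (intro prod.cong refl, simp add: B_def ij)
 finally show "emeasure (distr (PiM I (\<lambda>_. lborel)) (PiM J (\<lambda>_. lborel)) (\<lambda>x. \<lambda>j\<in>J. x (h j))) (Pi\<^sub>E J A) =
  (\<Prod>j\<in>J. emeasure lborel (A j))" .
qed simp

lemma nn_integral_PiM_lborel_reindex:
 assumes "finite I" "bij_betw h J I" "f \<in> borel_measurable (PiM J (\<lambda>_. lborel :: 'b::euclidean_space measure))"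
 shows "(\<integral>\<^sup>+x. f (\<lambda>j\<in>J. x (h j)) \<partial>PiM I (\<lambda>_. lborel)) = (\<integral>\<^sup>+x. f x \<partial>PiM J (\<lambda>_. lborel))"
proof -
 have "(\<lambda>x. \<lambda>j\<in>J. x (h j)) \<in> measurable (PiM I (\<lambda>_. lborel :: 'b measure)) (PiM J (\<lambda>_. lborel))"
  using assms(2) by (intro measurable_restrict measurable_component_singleton) (auto simp: bij_betw_def)
 then have "(\<integral>\<^sup>+x. f x \<partial>distr (PiM I (\<lambda>_. lborel)) (PiM J (\<lambda>_. lborel)) (\<lambda>x. \<lambda>j\<in>J. x (h j))) =
   (\<integral>\<^sup>+x. f (\<lambda>j\<in>J. x (h j)) \<partial>PiM I (\<lambda>_. lborel))"
  by (rule nn_integral_distr) (use assms(3) in simp)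
 then show ?thesis unfolding PiM_lborel_reindex[OF assms(1,2)] by simp
qed

lemma PiM_lborel_translate:
 assumes fin: "finite I"
 shows "distr (PiM I (\<lambda>_. lborel :: 'b::euclidean_space measure)) (PiM I (\<lambda>_. lborel)) (\<lambda>x. \<lambda>i\<in>I. x i + y i) =
  PiM I (\<lambda>_. lborel)"
proof (rule lebs.PiM_eqI[OF fin])
 have m: "(\<lambda>x. \<lambda>i\<in>I. x i + y i) \<in> measurable (PiM I (\<lambda>_. lborel :: 'b measure)) (PiM I (\<lambda>_. lborel))"
  by measurable
 fix A :: "'a => 'b set" assume A: "\<And>i. i \<in> I ==> A i \<in> sets lborel"
 have pre: "(\<lambda>x. \<lambda>i\<in>I. x i + y i) -` (Pi\<^sub>E I A) \<inter> space (PiM I (\<lambda>_. lborel :: 'b measure)) =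
  Pi\<^sub>E I (\<lambda>i. (\<lambda>t. y i + t) -` A i)"
  by (auto simp: space_PiM PiE_iff add.commute)
 have mt: "(\<lambda>t. y i + t) -` A i \<in> sets borel" if "i \<in> I" for i
  using measurable_sets[of "\<lambda>t. y i + t" borel borel "A i"] A[OF that] by simp
 have "emeasure (distr (PiM I (\<lambda>_. lborel)) (PiM I (\<lambda>_. lborel)) (\<lambda>x. \<lambda>i\<in>I. x i + y i)) (Pi\<^sub>E I A) =
  emeasure (PiM I (\<lambda>_. lborel)) (Pi\<^sub>E I (\<lambda>i. (\<lambda>t. y i + t) -` A i))"
  unfolding pre[symmetric]
  by (rule emeasure_distr[OF m]) (use A fin in \<open>auto intro!: sets_PiM_I_finite\<close>)
 also have "... = (\<Prod>i\<in>I. emeasure lborel ((\<lambda>t. y i + t) -` A i))"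
  by (rule lebs.emeasure_PiM[OF fin]) (use mt in auto)
 also have "... = (\<Prod>i\<in>I. emeasure lborel (A i))"
 proof (intro prod.cong refl)
  fix i assume i: "i \<in> I"
  have "emeasure lborel (A i) = emeasure (distr lborel borel ((+) (y i))) (A i)"
   by (simp add: lborel_distr_plus)
  also have "... = emeasure lborel ((\<lambda>t. y i + t) -` A i)"
   using A[OF i] by (subst emeasure_distr) auto
  finally show "emeasure lborel ((\<lambda>t. y i + t) -` A i) = emeasure lborel (A i)" ..
 qed
 finally show "emeasure (distr (PiM I (\<lambda>_. lborel)) (PiM I (\<lambda>_. lborel)) (\<lambda>x. \<lambda>i\<in>I. x i + y i)) (Pi\<^sub>E I A) =
  (\<Prod>i\<in>I. emeasure lborel (A i))" .
qed simp

lemma lborel_distr_minus: "distr lborel borel uminus = (lborel :: 'b::euclidean_space measure)"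
 using lborel_affine[of "- 1 :: real" "0 :: 'b"] by (simp add: density_1)

lemma PiM_lborel_reflect:
 assumes fin: "finite I"
 shows "distr (PiM I (\<lambda>_. lborel :: 'b::euclidean_space measure)) (PiM I (\<lambda>_. lborel)) (\<lambda>x. \<lambda>i\<in>I. - x i) =
  PiM I (\<lambda>_. lborel)"
proof (rule lebs.PiM_eqI[OF fin])
 have m: "(\<lambda>x. \<lambda>i\<in>I. - x i) \<in> measurable (PiM I (\<lambda>_. lborel :: 'b measure)) (PiM I (\<lambda>_. lborel))"
  by measurable
 fix A :: "'a => 'b set" assume A: "\<And>i. i \<in> I ==> A i \<in> sets lborel"
 have pre: "(\<lambda>x. \<lambda>i\<in>I. - x i) -` (Pi\<^sub>E I A) \<inter> space (PiM I (\<lambda>_. lborel :: 'b measure)) =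
  Pi\<^sub>E I (\<lambda>i. uminus -` A i)"
  by (auto simp: space_PiM PiE_iff)
 have mt: "uminus -` A i \<in> sets borel" if "i \<in> I" for i
  using measurable_sets[of "uminus :: 'b => 'b" borel borel "A i"] A[OF that] by simp
 have "emeasure (distr (PiM I (\<lambda>_. lborel)) (PiM I (\<lambda>_. lborel)) (\<lambda>x. \<lambda>i\<in>I. - x i)) (Pi\<^sub>E I A) =
  emeasure (PiM I (\<lambda>_. lborel)) (Pi\<^sub>E I (\<lambda>i. uminus -` A i))"
  unfolding pre[symmetric]
  by (rule emeasure_distr[OF m]) (use A fin in \<open>auto intro!: sets_PiM_I_finite\<close>)
 also have "... = (\<Prod>i\<in>I. emeasure lborel (uminus -` A i))"
  by (rule lebs.emeasure_PiM[OF fin]) (use mt in auto)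
 also have "... = (\<Prod>i\<in>I. emeasure lborel (A i))"
 proof (intro prod.cong refl)
  fix i assume i: "i \<in> I"
  have "emeasure lborel (A i) = emeasure (distr lborel borel uminus) (A i)"
   by (simp add: lborel_distr_minus)
  also have "... = emeasure lborel (uminus -` A i)"
   using A[OF i] by (subst emeasure_distr) auto
  finally show "emeasure lborel (uminus -` A i) = emeasure lborel (A i)" ..
 qed
 finally show "emeasure (distr (PiM I (\<lambda>_. lborel)) (PiM I (\<lambda>_. lborel)) (\<lambda>x. \<lambda>i\<in>I. - x i)) (Pi\<^sub>E I A) =
  (\<Prod>i\<in>I. emeasure lborel (A i))" .
qed simp

definition cact :: "nat => complex mat => (nat => complex) => nat => complex" where
 "cact n U v = (\<lambda>i\<in>{..<n}. \<Sum>l<n. U $$ (i, l) * v l)"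

lemma cact_measurable [measurable]: "cact n U \<in> measurable (cleb n) (cleb n)"
 unfolding cact_def by measurable

lemma cact_adjoint:
 assumes "unitary_mat n U" "v \<in> extensional {..<n}"
 shows "cact n U (cact n (mat_adjoint U) v) = v"
proof
 note U = unitary_matD[OF assms(1)]
 fix i show "cact n U (cact n (mat_adjoint U) v) i = v i"
 proof (cases "i < n")
  case True
  have "cact n U (cact n (mat_adjoint U) v) i = (\<Sum>l<n. \<Sum>k<n. U $$ (i, l) * cnj (U $$ (k, l)) * v k)"
   using True by (simp add: cact_def sum_distrib_left mult.assoc mat_adjoint_index[OF U(1)])
  also have "... = (\<Sum>k<n. (\<Sum>l<n. U $$ (i, l) * cnj (U $$ (k, l))) * v k)"
   unfolding sum_distrib_right by (rule sum.swap)
  also have "... = (\<Sum>k<n. if i = k then v k else 0)"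
   using True by (intro sum.cong refl) (simp add: unitary_index_sum(1)[OF assms(1)])
  finally show ?thesis using True by simp
 next
  case False
  then show ?thesis using assms(2) by (simp add: cact_def extensional_def)
 qed
qed

lemma cact_norm:
 assumes "unitary_mat n U"
 shows "(\<Sum>i<n. (cmod (cact n U v i))\<^sup>2) = (\<Sum>i<n. (cmod (v i))\<^sup>2)"
proof -
 have "complex_of_real (\<Sum>i<n. (cmod (cact n U v i))\<^sup>2) =
  (\<Sum>i<n. \<Sum>k<n. \<Sum>l<n. cnj (U $$ (i, l)) * U $$ (i, k) * (v k * cnj (v l)))"
  unfolding of_real_sum
 proof (intro sum.cong refl)
  fix i assume "i \<in> {..<n}"
  then have "complex_of_real ((cmod (cact n U v i))\<^sup>2) =
   (\<Sum>k<n. U $$ (i, k) * v k) * (\<Sum>l<n. cnj (U $$ (i, l)) * cnj (v l))"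
   unfolding complex_norm_square by (simp add: cact_def)
  also have "... = (\<Sum>k<n. \<Sum>l<n. (U $$ (i, k) * v k) * (cnj (U $$ (i, l)) * cnj (v l)))"
   by (rule sum_product)
  finally show "complex_of_real ((cmod (cact n U v i))\<^sup>2) =
   (\<Sum>k<n. \<Sum>l<n. cnj (U $$ (i, l)) * U $$ (i, k) * (v k * cnj (v l)))"
   by (simp add: mult_ac)
 qed
 also have "... = (\<Sum>k<n. \<Sum>i<n. \<Sum>l<n. cnj (U $$ (i, l)) * U $$ (i, k) * (v k * cnj (v l)))"
  by (rule sum.swap)
 also have "... = (\<Sum>k<n. \<Sum>l<n. (\<Sum>i<n. cnj (U $$ (i, l)) * U $$ (i, k)) * (v k * cnj (v l)))"
  unfolding sum_distrib_right by (intro sum.cong refl sum.swap)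
 also have "... = (\<Sum>k<n. \<Sum>l<n. if l = k then v k * cnj (v l) else 0)"
  by (intro sum.cong refl) (simp add: unitary_index_sum(2)[OF assms])
 also have "... = (\<Sum>k<n. v k * cnj (v k))" by (intro sum.cong refl) simp
 also have "... = complex_of_real (\<Sum>i<n. (cmod (v i))\<^sup>2)"
  unfolding of_real_sum complex_norm_square ..
 finally show ?thesis unfolding of_real_eq_iff .
qed

text \<open>Both \<open>\<mu>\<close> (the image of Lebesgue measure under the unitary map) and Lebesgue measure
 are invariant under translations, hence \<open>\<mu>(f) \<lambda>(g) = \<mu>(g) \<lambda>(f)\<close> by Tonelli's theorem;
 the indicator function of the unit ball as \<open>f\<close> shows that they coincide.\<close>

lemma nn_integral_cleb_unitary:
 assumes Un: "unitary_mat n U" and g: "g \<in> borel_measurable (cleb n)"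
 shows "(\<integral>\<^sup>+v. g (cact n U v) \<partial>cleb n) = (\<integral>\<^sup>+v. g v \<partial>cleb n)"
proof -
 note [measurable] = g
 note U = unitary_matD[OF Un]
 interpret C: sigma_finite_measure "cleb n" by (rule lebs.sigma_finite) simp
 interpret P: pair_sigma_finite "cleb n" "cleb n" ..
 \<comment> \<open>The closed Euclidean unit ball, which the unitary map preserves.\<close>
 define S where "S = {v \<in> space (cleb n). (\<Sum>i<n. (cmod (v i))\<^sup>2) <= 1}"
 define f where "f v = (indicator S v :: ennreal)" for v
 have S_meas [measurable]: "S \<in> sets (cleb n)" unfolding S_def by measurable
 have f_meas [measurable]: "f \<in> borel_measurable (cleb n)" unfolding f_def by measurable
 define add where "add x y = (\<lambda>i\<in>{..<n}. x i + y i :: complex)" for x y :: "nat => complex"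
 define neg where "neg x = (\<lambda>i\<in>{..<n}. - x i :: complex)" for x :: "nat => complex"
 have add_meas [measurable]: "(\<lambda>(x, y). add x y) \<in> measurable (cleb n \<Otimes>\<^sub>M cleb n) (cleb n)"
  unfolding add_def by measurable
 have neg_meas [measurable]: "neg \<in> measurable (cleb n) (cleb n)" unfolding neg_def by measurable
 have sp: "x \<in> space (cleb n) \<longleftrightarrow> x \<in> extensional {..<n}" for x by (auto simp: space_PiM PiE_def)
 have add_sp: "add x y \<in> space (cleb n)" "neg x \<in> space (cleb n)" for x y by (auto simp: sp add_def neg_def)
 have T_sp: "cact n A x \<in> space (cleb n)" for A x by (auto simp: sp cact_def)
 have add1 [measurable]: "(\<lambda>x. add x y) \<in> measurable (cleb n) (cleb n)" for y
  unfolding add_def by measurable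
 have add2: "(\<lambda>y. add x y) \<in> measurable (cleb n) (cleb n)" for x
  unfolding add_def by measurable
 have tr: "(\<integral>\<^sup>+x. h (add x y) \<partial>cleb n) = (\<integral>\<^sup>+x. h x \<partial>cleb n)"
  if [measurable]: "h \<in> borel_measurable (cleb n)" for h y
  using PiM_lborel_translate[of "{..<n}" y] nn_integral_distr[of "\<lambda>x. add x y" "cleb n" "cleb n" h]
  by (simp add: add_def[symmetric])
 have refl: "(\<integral>\<^sup>+x. h (neg x) \<partial>cleb n) = (\<integral>\<^sup>+x. h x \<partial>cleb n)"
  if [measurable]: "h \<in> borel_measurable (cleb n)" for h
 proof -
  have "neg = (\<lambda>x. \<lambda>i\<in>{..<n}. - x i)" by (simp add: fun_eq_iff neg_def)
  then have "distr (cleb n) (cleb n) neg = cleb n" using PiM_lborel_reflect[of "{..<n}"] by simp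
  moreover have "(\<integral>\<^sup>+x. h x \<partial>distr (cleb n) (cleb n) neg) = (\<integral>\<^sup>+x. h (neg x) \<partial>cleb n)"
   by (rule nn_integral_distr[OF neg_meas]) (use that in simp)
  ultimately show ?thesis by simp
 qed
 let ?T = "cact n U"
 have Tadd: "?T (add x y) = add (?T x) (?T y)" for x y
  by (auto simp: cact_def add_def fun_eq_iff sum.distrib algebra_simps)
 \<comment> \<open>Translating the image by \<open>y\<close> amounts to translating the argument by
   the preimage of \<open>y\<close>, since the map is linear and onto. This is the translation
   invariance of the image measure.\<close>
 have trT: "(\<integral>\<^sup>+x. h (add (?T x) y) \<partial>cleb n) = (\<integral>\<^sup>+x. h (?T x) \<partial>cleb n)"
  if [measurable]: "h \<in> borel_measurable (cleb n)" and y: "y \<in> space (cleb n)" for h y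
 proof -
  have "?T (cact n (mat_adjoint U) y) = y" by (rule cact_adjoint[OF Un]) (use y in \<open>simp add: sp\<close>)
  then have "(\<integral>\<^sup>+x. h (add (?T x) y) \<partial>cleb n) = (\<integral>\<^sup>+x. (\<lambda>x. h (?T x)) (add x (cact n (mat_adjoint U) y)) \<partial>cleb n)"
   by (simp add: Tadd)
  also have "... = (\<integral>\<^sup>+x. h (?T x) \<partial>cleb n)" by (rule tr) measurable
  finally show ?thesis .
 qed
 have add_cancel: "add (add x y) (neg y) = x" "add x (neg (add y x)) = neg y" if "x \<in> space (cleb n)" for x y
  using that by (auto simp: sp add_def neg_def fun_eq_iff extensional_def)
 have fT: "f (?T x) = f x" if "x \<in> space (cleb n)" for x
  using that T_sp[of U x] by (auto simp: f_def S_def indicator_def cact_norm[OF Un])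
 let ?l = "\<lambda>h. \<integral>\<^sup>+x. h x \<partial>cleb n" and ?m = "\<lambda>h. \<integral>\<^sup>+x. h (?T x) \<partial>cleb n"
 have "?m f * ?l g = (\<integral>\<^sup>+x. \<integral>\<^sup>+y. f (?T x) * g y \<partial>cleb n \<partial>cleb n)"
  by (simp add: nn_integral_cmult nn_integral_multc)
 also have "... = (\<integral>\<^sup>+x. \<integral>\<^sup>+y. f (?T x) * g (add y (?T x)) \<partial>cleb n \<partial>cleb n)"
 proof (rule nn_integral_cong)
  fix x
  have "(\<lambda>y. g (add y (?T x))) \<in> borel_measurable (cleb n)" by measurable
  then show "(\<integral>\<^sup>+y. f (?T x) * g y \<partial>cleb n) = (\<integral>\<^sup>+y. f (?T x) * g (add y (?T x)) \<partial>cleb n)"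
   by (simp add: nn_integral_cmult tr)
 qed
 also have "... = (\<integral>\<^sup>+y. \<integral>\<^sup>+x. f (?T x) * g (add y (?T x)) \<partial>cleb n \<partial>cleb n)"
  by (rule P.Fubini') measurable
 also have "... = (\<integral>\<^sup>+y. \<integral>\<^sup>+x. f (add (?T x) (neg y)) * g (?T x) \<partial>cleb n \<partial>cleb n)"
 proof (rule nn_integral_cong)
  fix y assume y: "y \<in> space (cleb n)"
  have comm: "add y z = add z y" for z by (simp add: add_def add.commute)
  have "(\<integral>\<^sup>+x. f (?T x) * g (add y (?T x)) \<partial>cleb n) =
   (\<integral>\<^sup>+x. (\<lambda>z. f (add z (neg y)) * g z) (add (?T x) y) \<partial>cleb n)"
   by (intro nn_integral_cong) (simp add: add_cancel T_sp comm)
  also have "... = (\<integral>\<^sup>+x. f (add (?T x) (neg y)) * g (?T x) \<partial>cleb n)"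
   by (rule trT[OF _ y]) measurable
  finally show "(\<integral>\<^sup>+x. f (?T x) * g (add y (?T x)) \<partial>cleb n) =
   (\<integral>\<^sup>+x. f (add (?T x) (neg y)) * g (?T x) \<partial>cleb n)" .
 qed
 also have "... = (\<integral>\<^sup>+x. \<integral>\<^sup>+y. f (add (?T x) (neg y)) * g (?T x) \<partial>cleb n \<partial>cleb n)"
  by (rule P.Fubini'[symmetric]) measurable
 also have "... = (\<integral>\<^sup>+x. ?l f * g (?T x) \<partial>cleb n)"
 proof (rule nn_integral_cong)
  fix x assume "x \<in> space (cleb n)"
  have m: "(\<lambda>y. f (add (?T x) (neg y))) \<in> borel_measurable (cleb n)"
   by (rule measurable_compose[OF measurable_compose[OF neg_meas add2] f_meas])
  have "(\<integral>\<^sup>+y. f (add (?T x) (neg y)) \<partial>cleb n) = (\<integral>\<^sup>+y. (\<lambda>y. f (add (?T x) (neg y))) (add y (?T x)) \<partial>cleb n)"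
   by (rule tr[symmetric, OF m])
  also have "... = (\<integral>\<^sup>+y. f (neg y) \<partial>cleb n)"
   by (intro nn_integral_cong) (simp add: add_cancel(2)[OF T_sp])
  also have "... = ?l f" by (rule refl) measurable
  finally show "(\<integral>\<^sup>+y. f (add (?T x) (neg y)) * g (?T x) \<partial>cleb n) = ?l f * g (?T x)"
   using m by (simp add: nn_integral_multc)
 qed
 also have "... = ?l f * ?m g" by (rule nn_integral_cmult) measurable
 finally have eq: "?m f * ?l g = ?l f * ?m g" .
 have mf: "?m f = ?l f" by (intro nn_integral_cong fT)
 have lS: "?l f = emeasure (cleb n) S" unfolding f_def by simp
 \<comment> \<open>Cancelling the measure of the ball requires that it be finite and positive. The
   ball lies in a product of unit discs and contains the product of discs of radius 1 / (1 +
   n).\<close>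
 have "emeasure (cleb n) S <= emeasure (cleb n) (Pi\<^sub>E {..<n} (\<lambda>_. cball 0 1))"
 proof (rule emeasure_mono)
  show "S \<subseteq> Pi\<^sub>E {..<n} (\<lambda>_. cball 0 1)"
  proof
   fix v assume v: "v \<in> S"
   show "v \<in> Pi\<^sub>E {..<n} (\<lambda>_. cball 0 1)"
   proof (rule PiE_I)
    fix i assume i: "i \<in> {..<n}"
    have "(cmod (v i))\<^sup>2 <= (\<Sum>i<n. (cmod (v i))\<^sup>2)"
     by (rule member_le_sum[OF i]) auto
    also have "... <= 1" using v by (simp add: S_def)
    finally show "v i \<in> cball 0 1" by (simp add: power_le_one_iff abs_square_le_1)
   qed (use v in \<open>auto simp: S_def sp extensional_def\<close>)
  qed
 qed (auto intro!: sets_PiM_I_finite)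
 also have "... = (\<Prod>i<n. emeasure lborel (cball 0 1 :: complex set))"
  by (rule lebs.emeasure_PiM) auto
 also have "... < \<infinity>"
  using emeasure_lborel_cball_finite[of "0 :: complex" 1] by (auto simp: power_eq_top_ennreal less_top[symmetric])
 finally have fin: "?l f < \<infinity>" unfolding lS .
 have "0 < (\<Prod>i<n. emeasure lborel (ball 0 (1 / (1 + real n)) :: complex set))"
 proof -
  have "emeasure lborel (ball 0 (1 / (1 + real n)) :: complex set) ~= 0"
   using open_not_negligible[of "ball 0 (1 / (1 + real n)) :: complex set"]
   by (auto simp: negligible_iff_emeasure0 emeasure_lborel_ball_finite)
  then have e: "0 < emeasure lborel (ball 0 (1 / (1 + real n)) :: complex set)"
   by (simp only: zero_less_iff_neq_zero not_False_eq_True)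
  have "0 < emeasure lborel (ball 0 (1 / (1 + real n)) :: complex set) ^ k" for k
  proof (induction k)
   case (Suc k)
   then show ?case unfolding power_Suc ennreal_zero_less_mult_iff using e by blast
  qed simp
  then show ?thesis unfolding prod_constant .
 qed
 also have "... = emeasure (cleb n) (Pi\<^sub>E {..<n} (\<lambda>_. ball 0 (1 / (1 + real n))))"
  by (rule lebs.emeasure_PiM[symmetric]) auto
 also have "... <= emeasure (cleb n) S"
 proof (rule emeasure_mono)
  show "Pi\<^sub>E {..<n} (\<lambda>_. ball 0 (1 / (1 + real n))) \<subseteq> S"
  proof
   fix v :: "nat => complex" assume v: "v \<in> Pi\<^sub>E {..<n} (\<lambda>_. ball 0 (1 / (1 + real n)))"
   have "(\<Sum>i<n. (cmod (v i))\<^sup>2) <= (\<Sum>i<n. 1 / (1 + real n))"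
   proof (intro sum_mono)
    fix i assume "i \<in> {..<n}"
    then have "cmod (v i) <= 1 / (1 + real n)" using PiE_mem[OF v] by (force intro: less_imp_le)
    then have "(cmod (v i))\<^sup>2 <= (1 / (1 + real n))\<^sup>2" by (intro power_mono) auto
    also have "... <= 1 / (1 + real n)" using power_decreasing[of 1 2 "1 / (1 + real n)"] by simp
    finally show "(cmod (v i))\<^sup>2 <= 1 / (1 + real n)" .
   qed
   also have "... <= 1" by (simp add: field_simps)
   finally show "v \<in> S" using v by (auto simp: S_def sp PiE_def)
  qed
 qed simp
 finally have pos: "0 < ?l f" unfolding lS .
 show ?thesis using eq pos fin unfolding mf
  by (metis ennreal_mult_cancel_left less_irrefl infinity_ennreal_def top.not_eq_extremum)
qed

text \<open>The disc where |w|^2 is at most a has area pi a, so |w|^2 has the constant density pi on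
  the positive half-line. The two measures are compared on the half-lines, which generate the Borel
  sets.\<close>

lemma nn_integral_cmod_square:
 assumes f: "f \<in> borel_measurable borel"
 shows "(\<integral>\<^sup>+w. f ((cmod w)\<^sup>2) \<partial>lborel) = (\<integral>\<^sup>+r. ennreal pi * (f r * indicator {0<..} r) \<partial>lborel)"
proof -
 let ?D = "density lborel (\<lambda>r :: real. ennreal pi * indicator {0<..} r)"
 have emD: "emeasure ?D {..a} = ennreal (pi * max 0 a)" for a
 proof -
  have "emeasure ?D {..a} = (\<integral>\<^sup>+r. ennreal pi * indicator {0<..a} r \<partial>lborel)"
   by (subst emeasure_density) (auto intro!: nn_integral_cong split: split_indicator)
  also have "... = ennreal pi * emeasure lborel {0<..a}" by (rule nn_integral_cmult_indicator) simp
  also have "emeasure lborel {0<..a} = ennreal (max 0 a)" by (cases "0 <= a") auto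
  finally show ?thesis by (simp add: ennreal_mult)
 qed
 have emL: "emeasure (distr lborel borel (\<lambda>w :: complex. (cmod w)\<^sup>2)) {..a} = ennreal (pi * max 0 a)" for a
 proof -
  have "emeasure (distr lborel borel (\<lambda>w :: complex. (cmod w)\<^sup>2)) {..a} = emeasure lborel {w :: complex. (cmod w)\<^sup>2 <= a}"
   by (subst emeasure_distr) (auto simp: vimage_def)
  also have "... = ennreal (pi * max 0 a)"
  proof (cases "0 <= a")
   case True
   have "{w :: complex. (cmod w)\<^sup>2 <= a} = cball 0 (sqrt a)"
   proof -
    have "(cmod w)\<^sup>2 <= a \<longleftrightarrow> cmod w <= sqrt a" for w
     using real_sqrt_le_iff[of "(cmod w)\<^sup>2" a] by simp
    then show ?thesis unfolding cball_def dist_0_norm by (simp only:)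
   qed
   then show ?thesis using True
    by (simp add: emeasure_cball unit_ball_vol_2)
  next
   case False
   have "\<not> (cmod w)\<^sup>2 <= a" for w using False zero_le_power2[of "cmod w"] by linarith
   then have "{w :: complex. (cmod w)\<^sup>2 <= a} = {}" by auto
   then show ?thesis using False by simp
  qed
  finally show ?thesis .
 qed
 have "distr lborel borel (\<lambda>w :: complex. (cmod w)\<^sup>2) = ?D"
 proof (rule measure_eqI_generator_eq[where E="range (\<lambda>a :: real. {..a})" and \<Omega>=UNIV and A="\<lambda>i. {..real i}"])
  show "Int_stable (range (\<lambda>a :: real. {..a}))" by (auto simp: Int_stable_def)
  show "sets (distr lborel borel (\<lambda>w :: complex. (cmod w)\<^sup>2)) = sigma_sets UNIV (range (\<lambda>a :: real. {..a}))"
   "sets ?D = sigma_sets UNIV (range (\<lambda>a :: real. {..a}))" by (simp_all add: borel_eq_atMost)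
  show "(\<Union>i. {..real i}) = UNIV" by (auto simp: real_arch_simple)
 qed (auto simp: emL emD)
 then have "(\<integral>\<^sup>+w. f ((cmod w)\<^sup>2) \<partial>lborel) = (\<integral>\<^sup>+r. f r \<partial>?D)"
  using f by (subst nn_integral_distr[symmetric, of _ lborel borel]) auto
 also have "... = (\<integral>\<^sup>+r. ennreal pi * indicator {0<..} r * f r \<partial>lborel)"
  by (rule nn_integral_density) (use f in auto)
 finally show ?thesis by (simp add: mult_ac)
qed

section \<open>Weyl's integration formula\<close>

lemma cleb_Suc: "cleb (Suc n) = PiM (insert n {..<n}) (\<lambda>_. lborel)" by (simp add: lessThan_Suc)

lemma nn_integral_cleb_norm:
 assumes "f \<in> meas_leb n"
 shows "(\<integral>\<^sup>+v. f (\<lambda>j\<in>{..<n}. (cmod (v j))\<^sup>2) \<partial>cleb n) =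
  ennreal (pi ^ n) * (\<integral>\<^sup>+r. f r * indicator {r. \<forall>j<n. 0 < r j} r \<partial>leb n)"
 using assms
proof (induction n arbitrary: f)
 case 0
 then show ?case by (simp add: lebs.nn_integral_empty restrict_def space_PiM)
next
 case (Suc n)
 let ?P = "{r :: nat => real. \<forall>j<Suc n. 0 < r j}"
 note mf = Suc.prems
 define F where "F x = (\<integral>\<^sup>+r. ennreal pi * (f (x(n := r)) * indicator {0<..} r) \<partial>lborel)" for x
 have upd: "(\<lambda>(x, y). x(n := y)) \<in> measurable (leb n \<Otimes>\<^sub>M lborel) (leb (Suc n))"
  by (rule measurable_leb_update)
 have mF: "F \<in> meas_leb n"
 proof -
  have m0: "(\<lambda>z. f ((fst z)(n := snd z))) \<in> borel_measurable (leb n \<Otimes>\<^sub>M lborel)"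
   using measurable_compose[OF upd mf] unfolding case_prod_unfold .
  have "(\<lambda>(x, r). ennreal pi * (f (x(n := r)) * indicator {0<..} r)) \<in> borel_measurable (leb n \<Otimes>\<^sub>M lborel)"
   unfolding case_prod_unfold
   by (intro borel_measurable_times_ennreal borel_measurable_const m0
     measurable_compose[OF measurable_snd borel_measurable_indicator]) auto
  then show ?thesis unfolding F_def
   using sigma_finite_measure.borel_measurable_nn_integral[OF sigma_finite_lborel] by (simp add: case_prod_unfold)
 qed
 have mnorm: "(\<lambda>v. \<lambda>j\<in>{..<Suc n}. (cmod (v j))\<^sup>2) \<in> measurable (cleb (Suc n)) (leb (Suc n))"
 proof (rule measurable_leb_I)
  fix j assume "j < Suc n"
  then have "(\<lambda>v. v j) \<in> measurable (cleb (Suc n)) lborel" by (intro measurable_component_singleton) simp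
  then have [measurable]: "(\<lambda>v. v j) \<in> borel_measurable (cleb (Suc n))" by simp
  then show "(\<lambda>v. (\<lambda>j\<in>{..<Suc n}. (cmod (v j))\<^sup>2) j) \<in> borel_measurable (cleb (Suc n))"
   using \<open>j < Suc n\<close> by simp
 qed simp
 have "(\<integral>\<^sup>+v. f (\<lambda>j\<in>{..<Suc n}. (cmod (v j))\<^sup>2) \<partial>cleb (Suc n)) =
  (\<integral>\<^sup>+v. \<integral>\<^sup>+w. f (\<lambda>j\<in>{..<Suc n}. (cmod ((v(n := w)) j))\<^sup>2) \<partial>lborel \<partial>cleb n)"
  unfolding cleb_Suc
  by (rule lebs.product_nn_integral_insert[OF _ _ measurable_compose[OF mnorm mf, unfolded cleb_Suc]]) auto
 also have "... = (\<integral>\<^sup>+v. F (\<lambda>j\<in>{..<n}. (cmod (v j))\<^sup>2) \<partial>cleb n)"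
 proof (rule nn_integral_cong)
  fix v :: "nat => complex"
  let ?x = "\<lambda>j\<in>{..<n}. (cmod (v j))\<^sup>2"
  have e: "(\<lambda>j\<in>{..<Suc n}. (cmod ((v(n := w)) j))\<^sup>2) = ?x(n := (cmod w)\<^sup>2)" for w
   by (auto simp: fun_eq_iff less_Suc_eq)
  have "?x \<in> space (leb n)" by (simp add: space_PiM)
  then have "(\<lambda>r. ?x(n := r)) \<in> measurable lborel (leb (Suc n))"
   unfolding leb_Suc by (rule measurable_component_update) simp
  from measurable_compose[OF this mf] have "(\<lambda>r. f (?x(n := r))) \<in> borel_measurable borel"
   by (simp only: measurable_lborel1 measurable_lborel2)
  from nn_integral_cmod_square[OF this]
  show "(\<integral>\<^sup>+w. f (\<lambda>j\<in>{..<Suc n}. (cmod ((v(n := w)) j))\<^sup>2) \<partial>lborel) = F ?x"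
   unfolding e F_def .
 qed
 also have "... = ennreal (pi ^ n) * (\<integral>\<^sup>+r. F r * indicator {r. \<forall>j<n. 0 < r j} r \<partial>leb n)"
  by (rule Suc.IH[OF mF])
 also have "(\<integral>\<^sup>+r. F r * indicator {r. \<forall>j<n. 0 < r j} r \<partial>leb n) =
  (\<integral>\<^sup>+x. \<integral>\<^sup>+r. ennreal pi * (f (x(n := r)) * indicator ?P (x(n := r))) \<partial>lborel \<partial>leb n)"
 proof (rule nn_integral_cong)
  fix x :: "nat => real"
  have p: "x(n := r) \<in> ?P \<longleftrightarrow> x \<in> {r. \<forall>j<n. 0 < r j} \<and> r \<in> {0<..}" for r
   by (auto simp: less_Suc_eq)
  show "F x * indicator {r. \<forall>j<n. 0 < r j} x =
   (\<integral>\<^sup>+r. ennreal pi * (f (x(n := r)) * indicator ?P (x(n := r))) \<partial>lborel)"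
  proof (cases "x \<in> {r. \<forall>j<n. 0 < r j}")
   case True
   then have "indicator ?P (x(n := r)) = (indicator {0<..} r :: ennreal)" for r
    unfolding indicator_def p by simp
   then show ?thesis using True by (simp add: F_def)
  next
   case False
   then have "indicator ?P (x(n := r)) = (0 :: ennreal)" for r
    unfolding indicator_def p by simp
   then show ?thesis using False by simp
  qed
 qed
 also have "... = (\<integral>\<^sup>+x. ennreal pi * (f x * indicator ?P x) \<partial>leb (Suc n))"
 proof (rule nn_integral_leb_Suc[symmetric])
  have "?P \<inter> space (leb (Suc n)) = {r \<in> space (leb (Suc n)). \<forall>j\<in>{..<Suc n}. 0 < r j}" by auto
  also have "... \<in> sets (leb (Suc n))"
   by (intro sets.sets_Collect_finite_All) (auto intro!: borel_measurable_less measurable_leb_component)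
  finally have "(indicator ?P :: _ => ennreal) \<in> meas_leb (Suc n)"
   by (simp add: borel_measurable_indicator_iff)
  then show "(\<lambda>x. ennreal pi * (f x * indicator ?P x)) \<in> meas_leb (Suc n)"
   by (intro borel_measurable_times_ennreal mf) auto
 qed
 also have "... = ennreal pi * (\<integral>\<^sup>+x. f x * indicator ?P x \<partial>leb (Suc n))"
 proof (rule nn_integral_cmult)
  have "?P \<inter> space (leb (Suc n)) = {r \<in> space (leb (Suc n)). \<forall>j\<in>{..<Suc n}. 0 < r j}" by auto
  also have "... \<in> sets (leb (Suc n))"
   by (intro sets.sets_Collect_finite_All) (auto intro!: borel_measurable_less measurable_leb_component)
  finally have "(indicator ?P :: _ => ennreal) \<in> meas_leb (Suc n)"
   by (simp add: borel_measurable_indicator_iff)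
  then show "(\<lambda>x. f x * indicator ?P x) \<in> meas_leb (Suc n)"
   by (intro borel_measurable_times_ennreal mf) auto
 qed
 finally show ?case by (simp add: mult.assoc[symmetric] ennreal_mult[symmetric] mult.commute)
qed

lemma herm_of_coords_hermitian: "herm_of_coords N c \<in> hermitian_mats N"
 by (rule hermitian_matsI) (auto simp: herm_of_coords_def split: prod.splits)

lemma measurable_herm_index:
 assumes "i < N" "j < N"
 shows "(\<lambda>c. herm_of_coords N c $$ (i, j)) \<in> borel_measurable (herm_coords N)"
proof -
 have d: "(\<lambda>c. fst c k) \<in> borel_measurable (herm_coords N)" if "k < N" for k
 proof -
  have "(\<lambda>x. x k) \<in> measurable (leb N) lborel" by (rule measurable_component_singleton) (use that in simp)
  from measurable_compose[OF measurable_fst this] show ?thesis unfolding herm_coords_def by simp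
 qed
 have z: "(\<lambda>c. snd c p) \<in> borel_measurable (herm_coords N)" if "p \<in> upper_pairs N" for p
 proof -
  have "(\<lambda>x. x p) \<in> measurable (PiM (upper_pairs N) (\<lambda>_. lborel :: complex measure)) lborel"
   by (rule measurable_component_singleton[OF that])
  from measurable_compose[OF measurable_snd this] show ?thesis unfolding herm_coords_def by simp
 qed
 consider "i = j" | "i < j" | "j < i" by linarith
 then show ?thesis
 proof cases
  case 1
  then have "(\<lambda>c. herm_of_coords N c $$ (i, j)) = (\<lambda>c. complex_of_real (fst c i))"
   using assms by (auto simp: herm_of_coords_def fun_eq_iff)
  then show ?thesis using d[OF assms(1)] by simp
 next
  case 2
  then have "(\<lambda>c. herm_of_coords N c $$ (i, j)) = (\<lambda>c. snd c (i, j))"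
   using assms by (auto simp: herm_of_coords_def fun_eq_iff)
  then show ?thesis using z[of "(i, j)"] 2 assms by (simp add: upper_pairs_def)
 next
  case 3
  then have "(\<lambda>c. herm_of_coords N c $$ (i, j)) = (\<lambda>c. cnj (snd c (j, i)))"
   using assms by (auto simp: herm_of_coords_def fun_eq_iff)
  then show ?thesis using measurable_compose[OF z[of "(j, i)"] borel_measurable_continuous_onI[of cnj]] 3 assms
   by (simp add: upper_pairs_def continuous_on_cnj)
 qed
qed

lemma measurable_leb_iff_borel: "measurable M (PiM {..<n} (\<lambda>_. borel :: real measure)) = measurable M (leb n)"
 by (intro measurable_cong_sets sets_PiM_cong) auto

lemma eigs_measurable_leb:
 assumes "\<And>x. X x \<in> hermitian_mats n"
  and "\<And>i j. i < n ==> j < n ==> (\<lambda>x. X x $$ (i, j)) \<in> borel_measurable M"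
 shows "(\<lambda>x. eigs n (X x)) \<in> measurable M (leb n)"
 using eigs_measurable[of X n M] assms by (simp add: measurable_leb_iff_borel)

text \<open>The coordinates of a matrix of size N + 1 split into those of its old block, the pairs
  with second index N, which form the new column, and the last diagonal entry. Tonelli's theorem
  puts the old block outermost.\<close>

lemma nn_integral_herm_Suc:
 assumes f: "(\<lambda>c. f (herm_of_coords (Suc N) c)) \<in> borel_measurable (herm_coords (Suc N))"
 shows "(\<integral>\<^sup>+c. f (herm_of_coords (Suc N) c) \<partial>herm_coords (Suc N)) =
  (\<integral>\<^sup>+c. \<integral>\<^sup>+a. \<integral>\<^sup>+v. f (border N (herm_of_coords N c) v a) \<partial>cleb N \<partial>lborel \<partial>herm_coords N)"
proof -
 define E where "E = (\<lambda>j. (j, N)) ` {..<N}"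
 let ?U = "upper_pairs N"
 let ?Z = "PiM ?U (\<lambda>_. lborel :: complex measure)"
 have finU: "finite (upper_pairs n)" for n
  by (rule finite_subset[of _ "{..<n} \<times> {..<n}"]) (auto simp: upper_pairs_def)
 have UE: "upper_pairs (Suc N) = ?U \<union> E" "?U \<inter> E = {}" "finite E"
  by (auto simp: upper_pairs_def E_def image_iff less_Suc_eq)
 have bijE: "bij_betw fst E {..<N}" by (auto simp: bij_betw_def inj_on_def E_def image_image)
 define g where "g c = f (herm_of_coords (Suc N) c)" for c
 have g [measurable]: "g \<in> borel_measurable (leb (Suc N) \<Otimes>\<^sub>M PiM (?U \<union> E) (\<lambda>_. lborel))"
  using f unfolding g_def herm_coords_def UE .
 define mg where "mg z v = merge ?U E (z, \<lambda>p\<in>E. v (fst p))" for z :: "nat \<times> nat => complex" and v :: "nat => complex"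
 have mE: "(\<lambda>v. \<lambda>p\<in>E. v (fst p)) \<in> measurable (cleb N) (PiM E (\<lambda>_. lborel))"
  by (intro measurable_restrict measurable_component_singleton) (auto simp: E_def)
 have mmg [measurable]: "(\<lambda>x. mg (h x) (k x)) \<in> measurable M (PiM (?U \<union> E) (\<lambda>_. lborel))"
  if "h \<in> measurable M ?Z" "k \<in> measurable M (cleb N)" for h k and M :: "'x measure"
  unfolding mg_def
  by (rule measurable_compose[OF _ measurable_merge]) (intro measurable_Pair that measurable_compose[OF that(2) mE])
 interpret Z: sigma_finite_measure ?Z by (rule lebs.sigma_finite[OF finU])
 interpret Z': sigma_finite_measure "PiM (?U \<union> E) (\<lambda>_. lborel :: complex measure)"
  by (rule lebs.sigma_finite) (use UE finU in simp)
 interpret V: sigma_finite_measure "cleb N" by (rule lebs.sigma_finite) simp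
 interpret LZ: pair_sigma_finite "lborel :: real measure" ?Z ..
 define Q where "Q d z = (\<integral>\<^sup>+v. g (d, mg z v) \<partial>cleb N)" for d z
 have mQ [measurable]: "(\<lambda>x. Q (h x) (k x)) \<in> borel_measurable M"
  if [measurable]: "h \<in> measurable M (leb (Suc N))" "k \<in> measurable M ?Z" for h k and M :: "'x measure"
  unfolding Q_def by measurable
 have "(\<integral>\<^sup>+c. g c \<partial>herm_coords (Suc N)) = (\<integral>\<^sup>+d. \<integral>\<^sup>+z. g (d, z) \<partial>PiM (?U \<union> E) (\<lambda>_. lborel) \<partial>leb (Suc N))"
  unfolding herm_coords_def UE by (rule Z'.nn_integral_fst[symmetric]) measurable
 also have "... = (\<integral>\<^sup>+d. \<integral>\<^sup>+z. Q d z \<partial>?Z \<partial>leb (Suc N))"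
 proof (rule nn_integral_cong)
  fix d assume d: "d \<in> space (leb (Suc N))"
  have [measurable]: "(\<lambda>z. g (d, z)) \<in> borel_measurable (PiM (?U \<union> E) (\<lambda>_. lborel))"
   by (rule measurable_compose[OF _ g]) (use d in measurable)
  have "(\<integral>\<^sup>+z. g (d, z) \<partial>PiM (?U \<union> E) (\<lambda>_. lborel)) =
   (\<integral>\<^sup>+z. \<integral>\<^sup>+y. g (d, merge ?U E (z, y)) \<partial>PiM E (\<lambda>_. lborel) \<partial>?Z)"
   by (rule lebs.product_nn_integral_fold[OF UE(2) finU UE(3)]) measurable
  also have "... = (\<integral>\<^sup>+z. Q d z \<partial>?Z)"
  proof (rule nn_integral_cong)
   fix z assume z: "z \<in> space ?Z"
   have "(\<lambda>y. g (d, merge ?U E (z, y))) \<in> borel_measurable (PiM E (\<lambda>_. lborel))"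
    by (rule measurable_compose[OF measurable_compose[OF _ measurable_merge] \<open>(\<lambda>z. g (d, z)) \<in> _\<close>])
     (use z in measurable)
   from nn_integral_PiM_lborel_reindex[OF finite_lessThan bijE this]
   show "(\<integral>\<^sup>+y. g (d, merge ?U E (z, y)) \<partial>PiM E (\<lambda>_. lborel)) = Q d z"
    by (simp add: Q_def mg_def)
  qed
  finally show "(\<integral>\<^sup>+z. g (d, z) \<partial>PiM (?U \<union> E) (\<lambda>_. lborel)) = (\<integral>\<^sup>+z. Q d z \<partial>?Z)" .
 qed
 also have "... = (\<integral>\<^sup>+d. \<integral>\<^sup>+a. \<integral>\<^sup>+z. Q (d(N := a)) z \<partial>?Z \<partial>lborel \<partial>leb N)"
  by (rule nn_integral_leb_Suc) measurable
 also have "... = (\<integral>\<^sup>+d. \<integral>\<^sup>+z. \<integral>\<^sup>+a. Q (d(N := a)) z \<partial>lborel \<partial>?Z \<partial>leb N)"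
 proof (rule nn_integral_cong)
  fix d assume d: "d \<in> space (leb N)"
  have [measurable]: "(\<lambda>a. d(N := a)) \<in> measurable lborel (leb (Suc N))"
   unfolding leb_Suc by (rule measurable_component_update[OF d]) simp
  show "(\<integral>\<^sup>+a. \<integral>\<^sup>+z. Q (d(N := a)) z \<partial>?Z \<partial>lborel) = (\<integral>\<^sup>+z. \<integral>\<^sup>+a. Q (d(N := a)) z \<partial>lborel \<partial>?Z)"
   by (rule LZ.Fubini'[symmetric]) measurable
 qed
 also have "... = (\<integral>\<^sup>+c. \<integral>\<^sup>+a. Q ((fst c)(N := a)) (snd c) \<partial>lborel \<partial>herm_coords N)"
 proof -
  have "(\<lambda>(x, y). x(N := y)) \<in> measurable (leb N \<Otimes>\<^sub>M lborel) (leb (Suc N))"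
   by (rule measurable_leb_update)
  then have [measurable]: "(\<lambda>x. (h x)(N := k x)) \<in> measurable M (leb (Suc N))"
   if [measurable]: "h \<in> measurable M (leb N)" "k \<in> measurable M lborel" for h k and M :: "'x measure"
   using measurable_compose[of "\<lambda>x. (h x, k x)" M "leb N \<Otimes>\<^sub>M lborel" "\<lambda>(x, y). x(N := y)" "leb (Suc N)"] by simp
  have "(\<lambda>c. \<integral>\<^sup>+a. Q ((fst c)(N := a)) (snd c) \<partial>lborel) \<in> borel_measurable (leb N \<Otimes>\<^sub>M ?Z)"
   by measurable
  from Z.nn_integral_fst[OF this] show ?thesis unfolding herm_coords_def by simp
 qed
 also have "... = (\<integral>\<^sup>+c. \<integral>\<^sup>+a. \<integral>\<^sup>+v. f (border N (herm_of_coords N c) v a) \<partial>cleb N \<partial>lborel \<partial>herm_coords N)"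
 proof -
  have "herm_of_coords (Suc N) ((fst c)(N := a), mg (snd c) v) = border N (herm_of_coords N c) v a" for c a v
  proof (rule eq_matI)
   fix i j assume "i < dim_row (border N (herm_of_coords N c) v a)" "j < dim_col (border N (herm_of_coords N c) v a)"
   then have ij: "i < Suc N" "j < Suc N" by (auto simp: border_def)
   have m1: "mg (snd c) v (k, l) = snd c (k, l)" if "k < l" "l < N" for k l
    using that by (simp add: mg_def merge_def upper_pairs_def)
   have m2: "mg (snd c) v (k, N) = v k" if "k < N" for k
    using that by (auto simp: mg_def merge_def upper_pairs_def E_def)
   show "herm_of_coords (Suc N) ((fst c)(N := a), mg (snd c) v) $$ (i, j) = border N (herm_of_coords N c) v a $$ (i, j)"
    using ij by (auto simp: herm_of_coords_def case_prod_unfold border_def m1 m2 less_Suc_eq)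
  qed (auto simp: herm_of_coords_def border_def)
  then show ?thesis unfolding Q_def g_def by simp
 qed
 finally show ?thesis unfolding g_def .
qed

section \<open>Integrating a Vandermonde determinant over interlacing vectors\<close>

lemma det_on_col:
 "det_on (h :: nat => nat => real) {..<n} = (\<Sum>p | p permutes {..<n}. of_int (sign p) * (\<Prod>j<n. h (p j) j))"
 unfolding det_mat_eq_det_on[symmetric]
 by (subst det_col[of _ n]) (auto simp: lessThan_atLeast0 intro!: sum.cong arg_cong2[of _ _ _ _ times] prod.cong dest: permutes_in_image)

text \<open>Column differences reduce the determinant of the functions 1, x, x^2/2, ..., x^N/N at N
  + 1 points to the one on the left. Their leading coefficients multiply to 1/N!.\<close>

lemma det_on_power_differences:
 fixes l :: "nat => real"
 shows "det_on (\<lambda>i j. (l (Suc j) ^ Suc i - l j ^ Suc i) / real (Suc i)) {..<N} = vand (Suc N) l / fact N"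
proof -
 define p where "p i = monom (if i = 0 then 1 else 1 / real i) i" for i
 define m where "m = Suc N"
 define V where "V = mat m m (\<lambda>(i, j). poly (p i) (l j))"
 have V: "V \<in> carrier_mat m m" by (simp add: V_def)
 have dp: "Polynomial.degree (p i) = i" for i by (simp add: p_def degree_monom_eq)
 have detV: "det V = vand m l / fact N"
 proof -
  have "det V = (\<Prod>i<m. lead_coeff (p i)) * vand m l"
   unfolding V_def by (rule det_poly_vand) (simp add: dp)
  also have "(\<Prod>i<m. lead_coeff (p i)) = (\<Prod>i<N. 1 / real (Suc i))"
   unfolding m_def prod.lessThan_Suc_shift by (simp add: dp) (simp add: p_def)
  also have "... = 1 / fact N"
   by (simp add: prod_dividef fact_prod_Suc lessThan_atLeast0)
  finally show ?thesis by simp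
 qed
 \<comment> \<open>Multiplication by \<open>E\<close> subtracts from each column its left neighbour
   and preserves the determinant. The constant first row becomes (1, 0, ..., 0).\<close>
 define E where "E = mat m m (\<lambda>(i, j). if i = j then 1 else if Suc i = j then - 1 else (0 :: real))"
 have E: "E \<in> carrier_mat m m" by (simp add: E_def)
 have detE: "det E = 1"
 proof -
  have "det E = (\<Prod>i<m. E $$ (i, i))"
   by (rule det_triangular[OF E]) (auto simp: E_def upper_triangular_def)
  then show ?thesis by (simp add: E_def)
 qed
 define D where "D = mat N N (\<lambda>(i, j). (l (Suc j) ^ Suc i - l j ^ Suc i) / real (Suc i))"
 define C where "C = mat N 1 (\<lambda>(i, j). poly (p (Suc i)) (l 0))"
 have "V * E = four_block_mat (1\<^sub>m 1) (0\<^sub>m 1 N) C D"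
 proof (rule eq_matI)
  fix i j assume "i < dim_row (four_block_mat (1\<^sub>m 1) (0\<^sub>m 1 N) C D)" "j < dim_col (four_block_mat (1\<^sub>m 1) (0\<^sub>m 1 N) C D)"
  then have ij: "i < m" "j < m" by (auto simp: m_def C_def D_def)
  have "(V * E) $$ (i, j) = (\<Sum>k<m. V $$ (i, k) * E $$ (k, j))" by (rule index_mult_mat_sum[OF V E ij])
  also have "... = (\<Sum>k<m. (if k = j then V $$ (i, j) else 0) - (if Suc k = j then V $$ (i, k) else 0))"
   using ij by (intro sum.cong refl) (auto simp: E_def)
  also have "... = V $$ (i, j) - (\<Sum>k<m. if Suc k = j then V $$ (i, k) else 0)"
   using ij by (simp add: sum_subtractf)
  also have "(\<Sum>k<m. if Suc k = j then V $$ (i, k) else 0) = (if j = 0 then 0 else V $$ (i, j - 1))"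
  proof (cases j)
   case (Suc j')
   then have "(\<Sum>k<m. if Suc k = j then V $$ (i, k) else 0) = (\<Sum>k<m. if k = j' then V $$ (i, k) else 0)"
    by (intro sum.cong refl) auto
   then show ?thesis using Suc ij by simp
  qed simp
  finally have VE: "(V * E) $$ (i, j) = V $$ (i, j) - (if j = 0 then 0 else V $$ (i, j - 1))" .
  show "(V * E) $$ (i, j) = four_block_mat (1\<^sub>m 1) (0\<^sub>m 1 N) C D $$ (i, j)"
   unfolding VE using ij
   by (cases i; cases j) (auto simp: V_def m_def C_def D_def p_def poly_monom diff_divide_distrib)
 qed (auto simp: V_def E_def m_def C_def D_def)
 then have "det (V * E) = det (1\<^sub>m 1) * det D"
  using det_four_block_mat_upper_right_zero[of "1\<^sub>m 1" 1 "0\<^sub>m 1 N" N C D] by (simp add: C_def D_def)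
 then have "det D = vand m l / fact N" using det_mult[OF V E] detE detV by simp
 then show ?thesis unfolding D_def det_mat_eq_det_on m_def .
qed

text \<open>Each variable occurs in a single column of the Vandermonde matrix, and the domain is a
  product of intervals. Integration therefore replaces every column by differences of
  antiderivatives, and \<open>det_on_power_differences\<close> applies.\<close>

lemma vand_interlacing_integral:
 assumes l: "\<And>i j. i < j ==> j < Suc N ==> l i < l j"
 shows "(\<integral>\<^sup>+m. ennreal (vand N m) * indicator {m. \<forall>j<N. l j < m j \<and> m j < l (Suc j)} m \<partial>leb N) =
  ennreal (vand (Suc N) l / fact N)"
proof -
 let ?P = "{p. p permutes {..<N}}"
 let ?f = "\<lambda>p j (x :: real). x ^ p j * indicator {l j<..<l (Suc j)} x :: real"
 let ?S = "{m. \<forall>j<N. l j < m j \<and> m j < l (Suc j)}"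
 have int: "has_bochner_integral lborel (?f p j) ((l (Suc j) ^ Suc (p j) - l j ^ Suc (p j)) / real (Suc (p j)))" if "j < N" for p j
 proof -
  have le: "l j <= l (Suc j)" using l[of j "Suc j"] that by simp
  have i: "integrable lborel (\<lambda>x. x ^ p j * indicator {l j..l (Suc j)} x)"
  proof -
   have "continuous_on {l j..l (Suc j)} (\<lambda>x. x ^ p j)" by (intro continuous_intros)
   from borel_integrable_compact[OF compact_Icc this] show ?thesis by (simp add: mult.commute)
  qed
  have hb: "has_bochner_integral lborel (\<lambda>x. x ^ p j * indicator {l j..l (Suc j)} x)
    ((l (Suc j) ^ Suc (p j) - l j ^ Suc (p j)) / real (Suc (p j)))"
   unfolding has_bochner_integral_iff using i integral_power[OF le, of "p j"] by simp
  have ae: "AE x in lborel. x ^ p j * indicator {l j..l (Suc j)} x = ?f p j x"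
   using AE_lborel_singleton[of "l j"] AE_lborel_singleton[of "l (Suc j)"]
   by eventually_elim (auto simp: indicator_def)
  show ?thesis by (rule iffD1[OF has_bochner_integral_cong_AE[OF _ _ ae] hb]) measurable
 qed
 have vd: "vand N m = det_on (\<lambda>i j. m j ^ i) {..<N}" for m :: "nat => real"
  using det_poly_vand[of N "\<lambda>i. monom 1 i" m] by (simp add: degree_monom_eq poly_monom det_mat_eq_det_on)
 have eq: "vand N m * indicator ?S m = (\<Sum>p\<in>?P. of_int (sign p) * (\<Prod>j<N. ?f p j (m j)))" for m
 proof -
  have "indicator ?S m = (\<Prod>j<N. indicator {l j<..<l (Suc j)} (m j) :: real)"
  proof (cases "m \<in> ?S")
   case True
   then show ?thesis by (simp add: indicator_def)
  next
   case False
   then obtain j where j: "j < N" "m j \<notin> {l j<..<l (Suc j)}" by auto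
   have "(\<Prod>j<N. indicator {l j<..<l (Suc j)} (m j) :: real) = 0"
    using j by (intro prod_zero finite_lessThan bexI[of _ j] indicator_simps(2)) simp_all
   with False show ?thesis by (simp add: indicator_def)
  qed
  then show ?thesis unfolding vd det_on_col by (simp add: sum_distrib_right prod.distrib mult.assoc)
 qed
 have hb: "has_bochner_integral (leb N) (\<lambda>m. vand N m * indicator ?S m) (vand (Suc N) l / fact N)"
 proof -
  have "has_bochner_integral (leb N) (\<lambda>m. \<Sum>p\<in>?P. of_int (sign p) * (\<Prod>j<N. ?f p j (m j)))
   (\<Sum>p\<in>?P. of_int (sign p) * (\<Prod>j<N. (l (Suc j) ^ Suc (p j) - l j ^ Suc (p j)) / real (Suc (p j))))"
  proof (intro has_bochner_integral_sum has_bochner_integral_mult_right)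
   fix p
   have i: "integrable lborel (?f p j)" if "j \<in> {..<N}" for j using int[of j p] that by (simp add: has_bochner_integral_iff)
   have "(\<Prod>j<N. integral\<^sup>L lborel (?f p j)) = (\<Prod>j<N. (l (Suc j) ^ Suc (p j) - l j ^ Suc (p j)) / real (Suc (p j)))"
    using int[of _ p] by (intro prod.cong refl) (simp add: has_bochner_integral_iff)
   then show "has_bochner_integral (leb N) (\<lambda>m. \<Prod>j<N. ?f p j (m j)) (\<Prod>j<N. (l (Suc j) ^ Suc (p j) - l j ^ Suc (p j)) / real (Suc (p j)))"
    using leb.product_integrable_prod[OF finite_lessThan i] leb.product_integral_prod[OF finite_lessThan i]
    by (simp add: has_bochner_integral_iff)
  qed
  then show ?thesis
   unfolding eq det_on_power_differences[symmetric] det_on_col .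
 qed
 have nn: "0 <= vand N m * indicator ?S m" for m
 proof (cases "m \<in> ?S")
  case True
  have "m i < m j" if "i < j" "j < N" for i j
  proof -
   have "m i < l (Suc i)" "l j < m j" using True that by auto
   moreover have "l (Suc i) <= l j" using l[of "Suc i" j] that by (cases "Suc i = j") auto
   ultimately show ?thesis by simp
  qed
  then show ?thesis using vand_pos[of N m] by (simp add: less_imp_le)
 qed simp
 have "(\<integral>\<^sup>+m. ennreal (vand N m) * indicator ?S m \<partial>leb N) = (\<integral>\<^sup>+m. ennreal (vand N m * indicator ?S m) \<partial>leb N)"
  by (intro nn_integral_cong) (auto split: split_indicator)
 also have "... = ennreal (vand (Suc N) l / fact N)"
  using hb nn by (simp add: has_bochner_integral_iff nn_integral_eq_integral)
 finally show ?thesis .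
qed

text \<open>The vector \<open>x\<close> holds the squared moduli of the new column, followed by the
  corner entry at index \<open>N\<close>. The phases may be dropped because they do not enter
  \<open>char_poly_arrow\<close>.\<close>

definition arrow_eigs :: "nat => (nat => real) => (nat => real) => nat => real" where
 "arrow_eigs N m x = eigs (Suc N) (border N (real_diag N m)
  (\<lambda>j. complex_of_real (sqrt (x j))) (x N))"

lemma mat_diag_hermitian: "real_diag N m \<in> hermitian_mats N"
 by (rule hermitian_matsI) auto

lemma measurable_arrow_eigs:
 assumes h: "h \<in> measurable M (leb N)" and k: "k \<in> measurable M (leb (Suc N))"
 shows "(\<lambda>w. arrow_eigs N (h w) (k w)) \<in> measurable M (leb (Suc N))"
 unfolding arrow_eigs_def
proof (rule eigs_measurable_leb)
 fix w show "border N (mat_diag N (\<lambda>i. complex_of_real (h w i))) (\<lambda>j. complex_of_real (sqrt (k w j))) (k w N) \<in> hermitian_mats (Suc N)"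
  by (rule border_hermitian[OF mat_diag_hermitian])
next
 fix i j assume ij: "i < Suc N" "j < Suc N"
 have kc: "(\<lambda>w. k w l) \<in> borel_measurable M" if "l < Suc N" for l
  by (rule measurable_compose[OF k measurable_leb_component[OF that]])
 have hc: "(\<lambda>w. h w l) \<in> borel_measurable M" if "l < N" for l
  by (rule measurable_compose[OF h measurable_leb_component[OF that]])
 have kc': "(\<lambda>w. complex_of_real (sqrt (k w l))) \<in> borel_measurable M" if "l < Suc N" for l
 proof -
  note [measurable] = kc[OF that]
  show ?thesis by measurable
 qed
 consider "i < N" "j < N" | "i < N" "j = N" | "i = N" "j < N" | "i = N" "j = N" using ij by linarith
 then show "(\<lambda>w. border N (mat_diag N (\<lambda>i. complex_of_real (h w i))) (\<lambda>j. complex_of_real (sqrt (k w j))) (k w N) $$ (i, j))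
   \<in> borel_measurable M"
 proof cases
  case 1
  then show ?thesis using hc[of i] by (cases "i = j") (simp_all add: border_def)
 next
  case 2
  then show ?thesis using kc'[of i] by (simp add: border_def)
 next
  case 3
  then show ?thesis using kc'[of j] by (simp add: border_def)
 next
  case 4
  then show ?thesis using kc[of N] by (simp add: border_def)
 qed
qed

lemma indicator_pos_measurable:
 assumes "K <= n"
 shows "(indicator {r. \<forall>j<K. 0 < r j} :: _ => ennreal) \<in> meas_leb n"
proof -
 have "{r. \<forall>j<K. 0 < r j} \<inter> space (leb n) = {r \<in> space (leb n). \<forall>j\<in>{..<K}. 0 < r j}" by auto
 also have "... \<in> sets (leb n)"
  using assms by (intro sets.sets_Collect_finite_All) (auto intro!: borel_measurable_less measurable_leb_component)
 finally show ?thesis by (rule borel_measurable_indicator_iff[THEN iffD2])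
qed

text \<open>By \<open>char_poly_border\<close> the eigenvalues depend on the rotated column only
  through the moduli of its entries.\<close>

lemma eigs_border:
 assumes X: "X \<in> hermitian_mats N" and U: "unitary_mat N U"
  and Xeq: "X = U * real_diag N (eigs N X) * mat_adjoint U"
 shows "eigs (Suc N) (border N X v a) =
  arrow_eigs N (eigs N X) ((\<lambda>j\<in>{..<N}. (cmod (cact N (mat_adjoint U) v j))\<^sup>2)(N := a))"
 unfolding arrow_eigs_def
proof (rule eigs_cong_char_poly[OF border_hermitian[OF X] border_hermitian[OF mat_diag_hermitian]])
 let ?w = "cact N (mat_adjoint U) v"
 let ?x = "(\<lambda>j\<in>{..<N}. (cmod (?w j))\<^sup>2)(N := a)"
 have w: "?w j = (\<Sum>i<N. cnj (U $$ (i, j)) * v i)" if "j < N" for j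
  using that by (simp add: cact_def mat_adjoint_index[OF unitary_matD(1)[OF U]])
 have n: "(cmod (complex_of_real (sqrt (?x j))))\<^sup>2 = (cmod (?w j))\<^sup>2" if "j < N" for j
  using that by simp
 show "char_poly (border N X v a) = char_poly (border N (real_diag N (eigs N X))
  (\<lambda>j. complex_of_real (sqrt (?x j))) (?x N))"
 proof -
  let ?d = "\<lambda>i. complex_of_real (eigs N X i)"
  have e: "(\<Sum>j<N. smult (complex_of_real ((cmod (complex_of_real (sqrt (?x j))))\<^sup>2)) (P j)) =
   (\<Sum>j<N. smult (complex_of_real ((cmod (?w j))\<^sup>2)) (P j))" for P
   by (intro sum.cong refl) (simp only: n lessThan_iff)
  have "char_poly (border N X v a) = [:- of_real a, 1:] * (\<Prod>j<N. [:- ?d j, 1:]) -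
   (\<Sum>j<N. smult (of_real ((cmod (?w j))\<^sup>2)) (\<Prod>k\<in>{..<N} - {j}. [:- ?d k, 1:]))"
   by (rule char_poly_border[OF U Xeq w])
  also have "... = char_poly (border N (mat_diag N ?d) (\<lambda>j. complex_of_real (sqrt (?x j))) (?x N))"
   unfolding char_poly_arrow e fun_upd_same ..
  finally show ?thesis .
 qed
qed

text \<open>Unitary invariance removes the rotation of the new column. Passing to squared moduli
  then contributes a factor pi for each of its entries.\<close>

lemma nn_integral_border:
 assumes X: "X \<in> hermitian_mats N" and F: "F \<in> meas_leb (Suc N)"
 shows "(\<integral>\<^sup>+a. \<integral>\<^sup>+v. F (eigs (Suc N) (border N X v a)) \<partial>cleb N \<partial>lborel) =
  ennreal (pi ^ N) * (\<integral>\<^sup>+x. F (arrow_eigs N (eigs N X) x) * indicator {x. \<forall>j<N. 0 < x j} x \<partial>leb (Suc N))"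
proof -
 let ?J = "\<lambda>a. \<integral>\<^sup>+v. F (eigs (Suc N) (border N X v a)) \<partial>cleb N"
 obtain U where U: "unitary_mat N U"
  and Xeq: "X = U * real_diag N (eigs N X) * mat_adjoint U"
  using spectral_sorted[OF X] by blast
 have U': "unitary_mat N (mat_adjoint U)"
  using unitary_matD[OF U] mat_adjoint_adjoint[of U N] by (simp add: unitary_mat_def)
 define m where "m = eigs N X"
 have msp: "m \<in> space (leb N)" using eigs_extensional[OF X] by (simp add: m_def space_leb)
 define H where "H a r = F (arrow_eigs N m (r(N := a)))" for a r
 have ar: "(\<lambda>x. F (arrow_eigs N m x)) \<in> meas_leb (Suc N)"
  by (rule measurable_compose[OF measurable_arrow_eigs F]) (use msp in auto)
 have upd: "(\<lambda>r. r(N := a)) \<in> measurable (leb N) (leb (Suc N))" for a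
 proof (rule measurable_leb_I)
  fix j assume "j < Suc N"
  then show "(\<lambda>r. (r(N := a)) j) \<in> meas_leb N"
   using measurable_leb_component[of j N] by (cases "j = N") auto
 qed (auto simp: space_leb extensional_def)
 have mH: "H a \<in> meas_leb N" for a
  using measurable_compose[OF upd ar] unfolding H_def .
 have mn: "(\<lambda>v. \<lambda>j\<in>{..<N}. (cmod (v j))\<^sup>2) \<in> measurable (cleb N) (leb N)"
 proof (rule measurable_leb_I)
  fix j assume j: "j < N"
  then have "(\<lambda>v. v j) \<in> measurable (cleb N) lborel" by (intro measurable_component_singleton) simp
  then have [measurable]: "(\<lambda>v. v j) \<in> borel_measurable (cleb N)" by simp
  then show "(\<lambda>v. (\<lambda>j\<in>{..<N}. (cmod (v j))\<^sup>2) j) \<in> borel_measurable (cleb N)" using j by simp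
 qed simp
 have "(?J a) =
  ennreal (pi ^ N) * (\<integral>\<^sup>+r. H a r * indicator {r. \<forall>j<N. 0 < r j} r \<partial>leb N)" for a
 proof -
  have "(?J a) =
   (\<integral>\<^sup>+v. (\<lambda>v. H a (\<lambda>j\<in>{..<N}. (cmod (v j))\<^sup>2)) (cact N (mat_adjoint U) v) \<partial>cleb N)"
   unfolding H_def m_def eigs_border[OF X U Xeq] ..
  also have "... = (\<integral>\<^sup>+v. H a (\<lambda>j\<in>{..<N}. (cmod (v j))\<^sup>2) \<partial>cleb N)"
   by (rule nn_integral_cleb_unitary[OF U' measurable_compose[OF mn mH]])
  also have "... = ennreal (pi ^ N) * (\<integral>\<^sup>+r. H a r * indicator {r. \<forall>j<N. 0 < r j} r \<partial>leb N)"
   by (rule nn_integral_cleb_norm[OF mH])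
  finally show ?thesis .
 qed
 then have "(\<integral>\<^sup>+a. \<integral>\<^sup>+v. F (eigs (Suc N) (border N X v a)) \<partial>cleb N \<partial>lborel) =
  (\<integral>\<^sup>+a. \<integral>\<^sup>+r. ennreal (pi ^ N) * (F (arrow_eigs N m (r(N := a))) * indicator {x. \<forall>j<N. 0 < x j} (r(N := a))) \<partial>leb N \<partial>lborel)"
 proof (intro nn_integral_cong)
  fix a :: real
  assume eq: "\<And>a. (?J a) =
  ennreal (pi ^ N) * (\<integral>\<^sup>+r. H a r * indicator {r. \<forall>j<N. 0 < r j} r \<partial>leb N)"
  have "indicator {x. \<forall>j<N. 0 < x j} (r(N := a)) = (indicator {x. \<forall>j<N. 0 < x j} r :: ennreal)" for r
   by (auto simp: indicator_def)
  then show "(?J a) =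
   (\<integral>\<^sup>+r. ennreal (pi ^ N) * (F (arrow_eigs N m (r(N := a))) * indicator {x. \<forall>j<N. 0 < x j} (r(N := a))) \<partial>leb N)"
   unfolding eq H_def[symmetric]
   by (subst nn_integral_cmult) (auto intro!: borel_measurable_times_ennreal mH indicator_pos_measurable)
 qed
 also have "... = (\<integral>\<^sup>+x. ennreal (pi ^ N) * (F (arrow_eigs N m x) * indicator {x. \<forall>j<N. 0 < x j} x) \<partial>leb (Suc N))"
  by (rule nn_integral_leb_Suc_rev[symmetric]) (auto intro!: borel_measurable_times_ennreal ar indicator_pos_measurable)
 also have "... = ennreal (pi ^ N) * (\<integral>\<^sup>+x. F (arrow_eigs N m x) * indicator {x. \<forall>j<N. 0 < x j} x \<partial>leb (Suc N))"
  by (rule nn_integral_cmult) (auto intro!: borel_measurable_times_ennreal ar indicator_pos_measurable)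
 finally show ?thesis unfolding m_def .
qed

lemma resid_of_real: "resid n (\<lambda>i. complex_of_real (m i)) (\<lambda>i. complex_of_real (l i)) j = complex_of_real (resid n m l j)"
 by (simp add: resid_def)

lemma slots_interlace:
 assumes "\<And>i j. i < j ==> j < N ==> m i < (m j :: real)"
 shows "(\<forall>j<N. l j \<in> slot m j) \<and> l N \<in> top_slot m N \<longleftrightarrow> (\<forall>j<N. l j < m j \<and> m j < l (Suc j))"
proof safe
 fix j assume a: "\<forall>j<N. l j \<in> slot m j" "l N \<in> top_slot m N" "j < N"
 then show "l j < m j" by (auto simp: slot_def)
 show "m j < l (Suc j)"
 proof (cases "Suc j < N")
  case True
  then have "l (Suc j) \<in> slot m (Suc j)" using a by blast
  then show ?thesis by (auto simp: slot_def)
 next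
  case False
  then have "N = Suc j" using a(3) by simp
  then show ?thesis using a(2) by (auto simp: top_slot_def)
 qed
next
 fix j assume a: "\<forall>j<N. l j < m j \<and> m j < l (Suc j)" "j < N"
 have "m (j - 1) < l j" if "0 < j" using a(1)[rule_format, of "j - 1"] a(2) that by simp
 then show "l j \<in> slot m j" using a by (auto simp: slot_def)
next
 assume a: "\<forall>j<N. l j < m j \<and> m j < l (Suc j)"
 have "m (N - 1) < l N" if "0 < N" using a[rule_format, of "N - 1"] that by simp
 then show "l N \<in> top_slot m N" by (auto simp: top_slot_def)
qed

lemma interlace_strict:
 assumes "\<forall>j<N. l j < m j \<and> m j < (l (Suc j) :: real)" "i < j" "j < Suc N"
 shows "l i < l j"
 using assms(2,3)
proof (induction j)
 case (Suc j)
 have "l j < l (Suc j)" using assms(1) Suc.prems(2) by (metis less_trans Suc_less_eq)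
 then show ?case using Suc by (cases "i = j") auto
qed simp

text \<open>The substitution of \<open>border_substitution\<close> inverts the spectral map of arrow
  matrices. Interlacing makes the residues nonnegative, so the square roots inside
  \<open>arrow_eigs\<close> really return them as squared moduli.\<close>

lemma arrow_eigs_resid:
 assumes inc: "\<And>i j. i < j ==> j < N ==> m i < m j"
  and il: "\<forall>j<N. l j < m j \<and> m j < l (Suc j)" and ext: "l \<in> extensional {..<Suc N}"
 shows "arrow_eigs N m ((\<lambda>j\<in>{..<N}. resid N m l j * (l N - m j))(N := l N - (\<Sum>j<N. resid N m l j))) = l"
proof -
 have inj: "inj_on m {..<N}"
  by (rule inj_onI) (metis inc less_irrefl lessThan_iff linorder_neqE_nat)
 have sl: "i < j ==> j < Suc N ==> l i < l j" for i j by (rule interlace_strict[OF il])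
 have lm: "m j < l i" if "j < i" "i < Suc N" for i j
 proof -
  have "m j < l (Suc j)" using il that by auto
  also have "l (Suc j) <= l i" using sl[of "Suc j" i] that by (cases "Suc j = i") auto
  finally show ?thesis .
 qed
 have ml: "l i < m j" if "i <= j" "j < N" for i j
 proof -
  have "l i <= l j" using sl[of i j] that by (cases "i = j") auto
  also have "l j < m j" using il that by auto
  finally show ?thesis .
 qed
 have rpos: "0 <= resid N m l j" if j: "j < N" for j
  unfolding resid_def
 proof (intro mult_nonneg_nonneg prod_nonneg ballI)
  show "0 <= m j - l j" using ml[of j j] j by simp
  fix i assume i: "i \<in> {..<N} - {j}"
  show "0 <= (m j - l i) / (m j - m i)"
  proof (cases "i < j")
   case True
   then show ?thesis using ml[of i j] inc[of i j] j by simp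
  next
   case False
   then have "j < i" "i < N" using i by auto
   then show ?thesis using lm[of j i] inc[of j i] by (simp add: divide_nonpos_neg less_imp_le)
  qed
 qed
 let ?x = "(\<lambda>j\<in>{..<N}. resid N m l j * (l N - m j))(N := l N - (\<Sum>j<N. resid N m l j))"
 let ?M = "\<lambda>i. complex_of_real (m i)" and ?L = "\<lambda>i. complex_of_real (l i)"
 have sq: "complex_of_real ((cmod (complex_of_real (sqrt (?x j))))\<^sup>2) = resid N ?M ?L j * (?L N - ?M j)" if "j < N" for j
 proof -
  have "0 <= resid N m l j * (l N - m j)" using rpos[OF that] lm[of j N] that by (simp add: less_imp_le)
  then have "(cmod (complex_of_real (sqrt (?x j))))\<^sup>2 = resid N m l j * (l N - m j)" using that by simp
  then show ?thesis by (simp add: resid_of_real)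
 qed
 show ?thesis unfolding arrow_eigs_def
 proof (rule eigs_eqI[OF border_hermitian[OF mat_diag_hermitian] ext])
  show "mono_on {..<Suc N} l"
   by (rule mono_onI) (metis lessThan_iff less_imp_le order.order_iff_strict sl)
  have injc: "inj_on ?M {..<N}" using inj by (auto simp: inj_on_def)
  have "char_poly (border N (mat_diag N ?M) (\<lambda>j. complex_of_real (sqrt (?x j))) (?x N)) =
   [:- (?L N - (\<Sum>j<N. resid N ?M ?L j)), 1:] * (\<Prod>j<N. [:- ?M j, 1:]) -
   (\<Sum>j<N. smult (resid N ?M ?L j * (?L N - ?M j)) (\<Prod>k\<in>{..<N} - {j}. [:- ?M k, 1:]))"
   unfolding char_poly_arrow using sq
   by (intro arg_cong2[of _ _ _ _ minus] arg_cong2[of _ _ _ _ times] sum.cong arg_cong2[of _ _ _ _ smult])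
    (auto simp: resid_of_real)
  also have "... = (\<Prod>i<Suc N. [:- ?L i, 1:])" by (rule interlacing_poly_identity[OF injc])
  finally show "char_poly (border N (mat_diag N ?M) (\<lambda>j. complex_of_real (sqrt (?x j))) (?x N)) = (\<Prod>i<Suc N. [:- ?L i, 1:])" .
 qed
qed

definition strict_vecs :: "nat => (nat => real) set" where
 "strict_vecs n = {l. \<forall>i j. i < j --> j < n --> l i < l j}"

lemma strict_vecs_measurable: "strict_vecs n \<inter> space (leb n) \<in> sets (leb n)"
proof -
 have "strict_vecs n \<inter> space (leb n) = {l \<in> space (leb n). \<forall>i\<in>{..<n}. \<forall>j\<in>{..<n}. i < j --> l i < l j}"
  by (auto simp: strict_vecs_def)
 also have "... \<in> sets (leb n)"
 proof (intro sets.sets_Collect_finite_All finite_lessThan)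
  fix i j assume "i \<in> {..<n}" "j \<in> {..<n}"
  then have "{l \<in> space (leb n). l i < l j} \<in> sets (leb n)"
   by (intro borel_measurable_less measurable_leb_component) auto
  then show "{l \<in> space (leb n). i < j --> l i < l j} \<in> sets (leb n)"
   by (cases "i < j") auto
 qed
 finally show ?thesis .
qed

theorem weyl_integration:
 "\<exists>c>0. \<forall>F\<in>meas_leb N.
  (\<integral>\<^sup>+c. F (eigs N (herm_of_coords N c)) \<partial>herm_coords N) =
  ennreal c * (\<integral>\<^sup>+l. F l * (ennreal ((vand N l)\<^sup>2) * indicator (strict_vecs N) l) \<partial>leb N)"
proof (induction N)
 case 0
 \<comment> \<open>For \<open>N = 0\<close> both integrals are over one-point spaces of mass 1, so
   the constant is 1.\<close>
 have "(\<integral>\<^sup>+c. F (eigs 0 (herm_of_coords 0 c)) \<partial>herm_coords 0) = F (\<lambda>_. undefined)" for F :: "_ => ennreal"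
 proof -
  have up: "upper_pairs 0 = {}" by (auto simp: upper_pairs_def)
  have e: "eigs 0 (herm_of_coords 0 c) = (\<lambda>_. undefined)" for c
   using eigs_extensional[OF herm_of_coords_hermitian, of 0 c] by auto
  interpret Z: sigma_finite_measure "PiM {} (\<lambda>_::nat \<times> nat. lborel :: complex measure)"
   by (rule lebs.sigma_finite) simp
  have "emeasure (PiM {} (\<lambda>_::nat. lborel :: real measure) \<Otimes>\<^sub>M PiM {} (\<lambda>_::nat \<times> nat. lborel :: complex measure))
   (space (PiM {} (\<lambda>_::nat. lborel :: real measure)) \<times> space (PiM {} (\<lambda>_::nat \<times> nat. lborel :: complex measure))) = 1"
   by (subst Z.emeasure_pair_measure_Times[OF sets.top sets.top]) (simp add: space_PiM)
  then show ?thesis unfolding e herm_coords_def up by (simp add: space_pair_measure)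
 qed
 moreover have "(\<integral>\<^sup>+l. F l * (ennreal ((vand 0 l)\<^sup>2) * indicator (strict_vecs 0) l) \<partial>leb 0) = F (\<lambda>_. undefined)" for F :: "_ => ennreal"
  by (simp add: leb.nn_integral_empty vand_def strict_vecs_def)
 ultimately show ?case by (intro exI[of _ 1]) auto
next
 case (Suc N)
 then obtain c where c: "c > 0" and IH: "\<And>F. F \<in> meas_leb N ==>
  (\<integral>\<^sup>+c. F (eigs N (herm_of_coords N c)) \<partial>herm_coords N) =
  ennreal c * (\<integral>\<^sup>+l. F l * (ennreal ((vand N l)\<^sup>2) * indicator (strict_vecs N) l) \<partial>leb N)" by blast
 let ?pos = "{x :: nat => real. \<forall>j<N. 0 < x j}"
 interpret L: sigma_finite_measure "leb N" by (rule leb.sigma_finite) simp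
 interpret L': sigma_finite_measure "leb (Suc N)" by (rule leb.sigma_finite) simp
 interpret LL: pair_sigma_finite "leb N" "leb (Suc N)" ..
 show ?case
 \<comment> \<open>The factor pi^N comes from the phases of the new column, and 1/N! from
   integrating out the old eigenvalues.\<close>
 proof (intro exI[of _ "c * pi ^ N / fact N"] conjI ballI)
  show "0 < c * pi ^ N / fact N" using c by simp
  fix F :: "(nat => real) => ennreal" assume F: "F \<in> meas_leb (Suc N)"
  define I where "I m = (\<integral>\<^sup>+x. F (arrow_eigs N m x) * indicator ?pos x \<partial>leb (Suc N))" for m
  have mI: "I \<in> meas_leb N"
  proof -
   have "(\<lambda>z. F (arrow_eigs N (fst z) (snd z)) * indicator ?pos (snd z)) \<in> borel_measurable (leb N \<Otimes>\<^sub>M leb (Suc N))"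
    by (intro borel_measurable_times_ennreal measurable_compose[OF measurable_arrow_eigs F]
      measurable_compose[OF measurable_snd indicator_pos_measurable] measurable_fst measurable_snd) simp
   then show ?thesis unfolding I_def
    using L'.borel_measurable_nn_integral[of "\<lambda>m x. F (arrow_eigs N m x) * indicator ?pos x" "leb N"]
    by (simp add: case_prod_unfold)
  qed
  let ?il = "\<lambda>m l. \<forall>j<N. l j < m j \<and> m j < (l (Suc j) :: real)"
  let ?W = "\<lambda>l. ennreal ((vand (Suc N) l)\<^sup>2) * indicator (strict_vecs (Suc N)) l"
  let ?T = "\<lambda>m l. ennreal (pi ^ N) * (F l * (ennreal (vand (Suc N) l) * indicator (strict_vecs (Suc N)) l) *
    (ennreal (vand N m) * indicator {m. ?il m l} m))"
  let ?V = "\<lambda>m l. F l * ennreal (vand (Suc N) l / vand N m)"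
  have "(\<integral>\<^sup>+c. F (eigs (Suc N) (herm_of_coords (Suc N) c)) \<partial>herm_coords (Suc N)) =
   (\<integral>\<^sup>+c. \<integral>\<^sup>+a. \<integral>\<^sup>+v. F (eigs (Suc N) (border N (herm_of_coords N c) v a)) \<partial>cleb N \<partial>lborel \<partial>herm_coords N)"
  proof (rule nn_integral_herm_Suc)
   show "(\<lambda>c. F (eigs (Suc N) (herm_of_coords (Suc N) c))) \<in> borel_measurable (herm_coords (Suc N))"
    by (intro measurable_compose[OF _ F] eigs_measurable_leb herm_of_coords_hermitian measurable_herm_index)
  qed
  also have "... = (\<integral>\<^sup>+c. ennreal (pi ^ N) * I (eigs N (herm_of_coords N c)) \<partial>herm_coords N)"
   unfolding nn_integral_border[OF herm_of_coords_hermitian F] I_def ..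
  also have "... = ennreal c * (\<integral>\<^sup>+m. ennreal (pi ^ N) * I m * (ennreal ((vand N m)\<^sup>2) * indicator (strict_vecs N) m) \<partial>leb N)"
   by (rule IH) (intro borel_measurable_times_ennreal mI borel_measurable_const)
  also have "(\<integral>\<^sup>+m. ennreal (pi ^ N) * I m * (ennreal ((vand N m)\<^sup>2) * indicator (strict_vecs N) m) \<partial>leb N) =
   (\<integral>\<^sup>+m. \<integral>\<^sup>+l. ?T m l \<partial>leb (Suc N) \<partial>leb N)"
  proof (rule nn_integral_cong)
   fix m
   show "ennreal (pi ^ N) * I m * (ennreal ((vand N m)\<^sup>2) * indicator (strict_vecs N) m) =
    (\<integral>\<^sup>+l. ?T m l \<partial>leb (Suc N))"
   proof (cases "m \<in> strict_vecs N")
    case True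
    then have inc: "i < j ==> j < N ==> m i < m j" for i j by (auto simp: strict_vecs_def)
    have vp: "0 < vand N m" by (rule vand_pos) (rule inc)
    let ?A = "{l. (\<forall>j<N. l j \<in> slot m j) \<and> l N \<in> top_slot m N}"
    let ?y = "\<lambda>l. (\<lambda>j\<in>{..<N}. resid N m l j * (l N - m j))(N := l N - (\<Sum>j<N. resid N m l j))"
    \<comment> \<open>Measurability is derived for points of the product space, so \<open>m\<close>
      is first replaced by its restriction, which \<open>arrow_eigs\<close> cannot distinguish from
      \<open>m\<close>.\<close>
    have mG: "(\<lambda>x. F (arrow_eigs N (restrict m {..<N}) x)) \<in> meas_leb (Suc N)"
     by (rule measurable_compose[OF measurable_arrow_eigs F]) (auto simp: space_leb)
    have "mat_diag N (\<lambda>i. complex_of_real (restrict m {..<N} i)) = real_diag N m"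
     by (intro eq_matI) (auto simp: mat_diag_def)
    then have am: "arrow_eigs N (restrict m {..<N}) x = arrow_eigs N m x" for x
     unfolding arrow_eigs_def by simp
    have "I m = (\<integral>\<^sup>+l. F (arrow_eigs N m (?y l)) * ennreal (vand (Suc N) l / vand N m) * indicator ?A l \<partial>leb (Suc N))"
     unfolding I_def by (rule border_substitution[OF inc mG[unfolded am]])
    also have "... = (\<integral>\<^sup>+l. ?V m l * indicator ?A l \<partial>leb (Suc N))"
    proof (rule nn_integral_cong)
     fix l assume l: "l \<in> space (leb (Suc N))"
     show "F (arrow_eigs N m (?y l)) * ennreal (vand (Suc N) l / vand N m) * indicator ?A l =
      ?V m l * indicator ?A l"
     proof (cases "l \<in> ?A")
      case True
      then have il: "?il m l" using slots_interlace[OF inc, where l = l] by simp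
      have "l \<in> extensional {..<Suc N}" using l by (simp add: space_leb)
      from arrow_eigs_resid[OF inc il this] have "arrow_eigs N m (?y l) = l" .
      then show ?thesis by simp
     qed simp
    qed
    finally have Im: "I m = (\<integral>\<^sup>+l. ?V m l * indicator ?A l \<partial>leb (Suc N))" .
    have mA: "?A \<inter> space (leb (Suc N)) \<in> sets (leb (Suc N))"
    proof -
     have s1: "{l \<in> space (leb (Suc N)). l N \<in> top_slot m N} \<in> sets (leb (Suc N))"
      by (rule measurable_sets_Collect[OF measurable_leb_component]) auto
     have s2: "?A \<inter> space (leb (Suc N)) = ({l. \<forall>j<N. l j \<in> slot m j} \<inter> space (leb (Suc N))) \<inter> {l \<in> space (leb (Suc N)). l N \<in> top_slot m N}"
      by auto
     have "{l. \<forall>j<N. l j \<in> slot m j} \<inter> space (leb (Suc N)) \<in> sets (leb (Suc N))" by (rule sets_slots) simp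
     then show ?thesis unfolding s2 using s1 by (rule sets.Int)
    qed
    have "ennreal (pi ^ N) * I m * ennreal ((vand N m)\<^sup>2) =
     (\<integral>\<^sup>+l. ennreal (pi ^ N) * ennreal ((vand N m)\<^sup>2) * (?V m l * indicator ?A l) \<partial>leb (Suc N))"
     unfolding Im
     by (subst nn_integral_cmult)
      (auto intro!: borel_measurable_times_ennreal F measurable_compose[OF _ measurable_ennreal] borel_measurable_divide
       measurable_vand simp: borel_measurable_indicator_iff mA mult_ac)
    also have "... = (\<integral>\<^sup>+l. ?T m l \<partial>leb (Suc N))"
    proof (rule nn_integral_cong)
     fix l :: "nat => real"
     show "ennreal (pi ^ N) * ennreal ((vand N m)\<^sup>2) * (?V m l * indicator ?A l) =
      ?T m l"
     proof (cases "?il m l")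
      case il: True
      have ls: "l \<in> strict_vecs (Suc N)" unfolding strict_vecs_def using interlace_strict[OF il] by blast
      have lA: "l \<in> ?A" using il slots_interlace[OF inc, where l = l] by simp
      have "0 < vand (Suc N) l" by (rule vand_pos) (rule interlace_strict[OF il])
      \<comment> \<open>The Jacobian cancels one of the two old Vandermonde factors; the other is
        left for \<open>vand_interlacing_integral\<close>.\<close>
      then have "ennreal ((vand N m)\<^sup>2) * ennreal (vand (Suc N) l / vand N m) = ennreal (vand (Suc N) l) * ennreal (vand N m)"
       using vp by (simp add: ennreal_mult[symmetric] power2_eq_square)
      then have "ennreal (pi ^ N) * F l * (ennreal ((vand N m)\<^sup>2) * ennreal (vand (Suc N) l / vand N m)) =
       ennreal (pi ^ N) * F l * (ennreal (vand (Suc N) l) * ennreal (vand N m))" by simp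
      then show ?thesis using ls lA il by (simp add: mult_ac)
     next
      case False
      then have "l \<notin> ?A" using slots_interlace[OF inc, where l = l] by simp
      with False show ?thesis by simp
     qed
    qed
    finally show ?thesis using True by simp
   next
    case False
    \<comment> \<open>Interlacing with \<open>l\<close> forces \<open>m\<close> to be strictly
      increasing, so outside \<open>strict_vecs N\<close> both sides are 0.\<close>
    have "\<not> ?il m l" for l
    proof
     assume il: "?il m l"
     have "m i < m j" if "i < j" "j < N" for i j
     proof -
      have "m i < l (Suc i)" "l j < m j" using il that by auto
      moreover have "l (Suc i) <= l j" using interlace_strict[OF il, of "Suc i" j] that by (cases "Suc i = j") auto
      ultimately show ?thesis by simp
     qed
     then show False using False by (auto simp: strict_vecs_def)
    qed
    then show ?thesis using False by simp
   qed
  qed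
  also have "... = (\<integral>\<^sup>+l. \<integral>\<^sup>+m. ?T m l \<partial>leb N \<partial>leb (Suc N))"
  proof (rule LL.Fubini'[symmetric])
   let ?LL = "leb N \<Otimes>\<^sub>M leb (Suc N)"
   have c1: "(\<lambda>z. fst z j) \<in> borel_measurable ?LL" if "j < N" for j
    by (rule measurable_compose[OF measurable_fst measurable_leb_component[OF that]])
   have c2: "(\<lambda>z. snd z j) \<in> borel_measurable ?LL" if "j < Suc N" for j
    by (rule measurable_compose[OF measurable_snd measurable_leb_component[OF that]])
   have "{z. ?il (fst z) (snd z)} \<inter> space ?LL =
    {z \<in> space ?LL. \<forall>j\<in>{..<N}. snd z j < fst z j \<and> fst z j < snd z (Suc j)}" by auto
   also have "... \<in> sets ?LL"
    by (intro sets.sets_Collect_finite_All finite_lessThan sets.sets_Collect_conj borel_measurable_less c1 c2) auto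
   finally have "(indicator {z. ?il (fst z) (snd z)} :: _ => ennreal) \<in> borel_measurable ?LL"
    by (rule borel_measurable_indicator_iff[THEN iffD2])
   moreover have "(indicator {z. ?il (fst z) (snd z)} z :: ennreal) = indicator {m. ?il m (snd z)} (fst z)" for z
    by (auto simp: indicator_def)
   ultimately have i1: "(\<lambda>z. indicator {m. ?il m (snd z)} (fst z) :: ennreal) \<in> borel_measurable ?LL"
    by (metis (no_types, lifting) ext)
   have i2: "(indicator (strict_vecs (Suc N)) :: _ => ennreal) \<in> meas_leb (Suc N)"
    using strict_vecs_measurable by (simp add: borel_measurable_indicator_iff)
   show "(\<lambda>(m, l). ?T m l) \<in> borel_measurable ?LL"
    unfolding case_prod_unfold
    by (intro borel_measurable_times_ennreal borel_measurable_const measurable_compose[OF measurable_snd F]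
      measurable_compose[OF measurable_compose[OF measurable_snd measurable_vand] measurable_ennreal]
      measurable_compose[OF measurable_compose[OF measurable_fst measurable_vand] measurable_ennreal]
      measurable_compose[OF measurable_snd i2] i1) auto
  qed
  also have "... = (\<integral>\<^sup>+l. ennreal (pi ^ N / fact N) * (F l * (?W l)) \<partial>leb (Suc N))"
  proof (rule nn_integral_cong)
   fix l :: "nat => real"
   show "(\<integral>\<^sup>+m. ?T m l \<partial>leb N) =
    ennreal (pi ^ N / fact N) * (F l * (?W l))"
   proof (cases "l \<in> strict_vecs (Suc N)")
    case True
    then have ls: "i < j ==> j < Suc N ==> l i < l j" for i j by (auto simp: strict_vecs_def)
    have "{m. ?il m l} \<inter> space (leb N) = {m \<in> space (leb N). \<forall>j\<in>{..<N}. l j < m j \<and> m j < l (Suc j)}" by auto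
    also have "... \<in> sets (leb N)"
     by (intro sets.sets_Collect_finite_All finite_lessThan sets.sets_Collect_conj borel_measurable_less
       borel_measurable_const measurable_leb_component) auto
    finally have i3: "(indicator {m. ?il m l} :: _ => ennreal) \<in> meas_leb N"
     by (rule borel_measurable_indicator_iff[THEN iffD2])
    have vp: "0 < vand (Suc N) l" by (rule vand_pos) (rule ls)
    have "(\<integral>\<^sup>+m. ennreal (pi ^ N) * (F l * (ennreal (vand (Suc N) l) * indicator (strict_vecs (Suc N)) l) *
     (ennreal (vand N m) * indicator {m. ?il m l} m)) \<partial>leb N) =
     (\<integral>\<^sup>+m. (ennreal (pi ^ N) * F l * ennreal (vand (Suc N) l)) * (ennreal (vand N m) * indicator {m. ?il m l} m) \<partial>leb N)"
     using True by (simp add: mult_ac)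
    also have "... = (ennreal (pi ^ N) * F l * ennreal (vand (Suc N) l)) * (\<integral>\<^sup>+m. ennreal (vand N m) * indicator {m. ?il m l} m \<partial>leb N)"
     by (rule nn_integral_cmult) (intro borel_measurable_times_ennreal measurable_compose[OF measurable_vand measurable_ennreal] i3, simp)
    also have "(\<integral>\<^sup>+m. ennreal (vand N m) * indicator {m. ?il m l} m \<partial>leb N) = ennreal (vand (Suc N) l / fact N)"
     by (rule vand_interlacing_integral) (rule ls)
    also have "ennreal (pi ^ N) * F l * ennreal (vand (Suc N) l) * ennreal (vand (Suc N) l / fact N) =
     F l * (ennreal (pi ^ N) * ennreal (vand (Suc N) l) * ennreal (vand (Suc N) l / fact N))" by (simp add: mult_ac)
    also have "ennreal (pi ^ N) * ennreal (vand (Suc N) l) * ennreal (vand (Suc N) l / fact N) =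
     ennreal (pi ^ N / fact N) * ennreal ((vand (Suc N) l)\<^sup>2)"
     using vp by (simp add: ennreal_mult[symmetric] power2_eq_square)
    finally show ?thesis using True by (simp add: mult_ac)
   qed simp
  qed
  also have "... = ennreal (pi ^ N / fact N) * (\<integral>\<^sup>+l. F l * (?W l) \<partial>leb (Suc N))"
   by (rule nn_integral_cmult)
    (auto intro!: borel_measurable_times_ennreal F measurable_compose[OF borel_measurable_power[OF measurable_vand] measurable_ennreal]
     simp: borel_measurable_indicator_iff strict_vecs_measurable)
  finally show "(\<integral>\<^sup>+c. F (eigs (Suc N) (herm_of_coords (Suc N) c)) \<partial>herm_coords (Suc N)) =
   ennreal (c * pi ^ N / fact N) * (\<integral>\<^sup>+l. F l * (?W l) \<partial>leb (Suc N))"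
   using c by (simp add: mult.assoc[symmetric] ennreal_mult[symmetric])
 qed
qed

section \<open>Cauchy's beta integral\<close>

text \<open>Comparison with a power of 1 + |x|, whose antiderivative is elementary, through (1 +
  |x|)^2 <= 2 (1 + x^2).\<close>

lemma integrable_powr_one_plus_square:
 fixes c :: real
 assumes c: "c > 1 / 2"
 shows "integrable lborel (\<lambda>x. (1 + x\<^sup>2) powr (- c))"
proof -
 define g where "g x = (1 + x) powr (- 2 * c) * indicator {0..} x" for x :: real
 have "(\<integral>\<^sup>+x. ennreal ((1 + x) powr (- 2 * c)) * indicator {0..} x \<partial>lborel) =
   ennreal (0 - (1 + 0) powr (1 - 2 * c) / (1 - 2 * c))"
 proof (rule nn_integral_FTC_atLeast)
  fix x :: real assume x: "0 <= x"
  show "((\<lambda>x. (1 + x) powr (1 - 2 * c) / (1 - 2 * c)) has_real_derivative (1 + x) powr (- 2 * c)) (at x)"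
  proof -
   have "((+) 1 has_real_derivative 1) (at x)" by (auto intro!: derivative_eq_intros)
   from DERIV_fun_powr[OF this, of "1 - 2 * c"] x
   have "((\<lambda>x. (1 + x) powr (1 - 2 * c)) has_real_derivative (1 - 2 * c) * (1 + x) powr (- 2 * c)) (at x)" by simp
   from DERIV_cdivide[OF this, of "1 - 2 * c"] show ?thesis using c by simp
  qed
  show "0 <= (1 + x) powr (- 2 * c)" by simp
 next
  have "((\<lambda>x::real. (1 + x) powr (1 - 2 * c)) \<longlongrightarrow> 0) at_top"
   using c by (intro tendsto_neg_powr filterlim_tendsto_add_at_top[OF tendsto_const filterlim_ident]) auto
  then show "((\<lambda>x. (1 + x) powr (1 - 2 * c) / (1 - 2 * c)) \<longlongrightarrow> 0) at_top"
   by (rule tendsto_divide_zero)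
 qed auto
 then have gi: "integrable lborel g"
  unfolding g_def by (intro integrableI_nonneg) (auto simp: ennreal_mult' ennreal_indicator)
 then have gi': "integrable lborel (\<lambda>x. g (- x))"
  using lborel_integrable_real_affine[of g "-1" 0] by simp
 show ?thesis
 proof (rule Bochner_Integration.integrable_bound)
  show "integrable lborel (\<lambda>x. 2 powr c * (g x + g (- x)))" using gi gi' by simp
  show "AE x in lborel. norm ((1 + x\<^sup>2) powr (- c)) <= norm (2 powr c * (g x + g (- x)))"
  proof (rule AE_I2)
   fix x :: real
   have k: "(1 + x\<^sup>2) powr (- c) <= 2 powr c * (1 + \<bar>x\<bar>) powr (- 2 * c)"
   proof -
    have "0 <= (1 - \<bar>x\<bar>)\<^sup>2" by simp
    then have le: "(1 + \<bar>x\<bar>)\<^sup>2 / 2 <= 1 + x\<^sup>2" by (simp add: power2_eq_square algebra_simps)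
    have "(1 + x\<^sup>2) powr (- c) <= ((1 + \<bar>x\<bar>)\<^sup>2 / 2) powr (- c)"
     using c le by (intro powr_mono2') auto
    also have "... = ((1 + \<bar>x\<bar>) powr 2 / 2) powr (- c)" by (simp add: powr_numeral)
    also have "... = 2 powr c * (1 + \<bar>x\<bar>) powr (- 2 * c)"
     by (simp add: powr_divide powr_powr powr_minus field_simps del: powr_numeral)
    finally show ?thesis .
   qed
   have "(1 + \<bar>x\<bar>) powr (- 2 * c) <= g x + g (- x)" by (cases "0 <= x") (auto simp: g_def)
   then have "2 powr c * (1 + \<bar>x\<bar>) powr (- 2 * c) <= 2 powr c * (g x + g (- x))"
    by (intro mult_left_mono) auto
   with k have "(1 + x\<^sup>2) powr (- c) <= 2 powr c * (g x + g (- x))" by linarith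
   then show "norm ((1 + x\<^sup>2) powr (- c)) <= norm (2 powr c * (g x + g (- x)))" by simp
  qed
 qed measurable
qed

text \<open>The weight \<open>w_H\<close> with independent complex exponents. The argument is
  complex so that complex differentiation applies.\<close>

definition cauchy_beta :: "complex => complex => complex => complex" where
 "cauchy_beta p q z = (1 + \<i> * z) powr (- p) * (1 - \<i> * z) powr (- q)"

lemma one_plus_i_real_notin: "1 + \<i> * complex_of_real x \<notin> \<real>\<^sub>\<le>\<^sub>0" "1 - \<i> * complex_of_real x \<notin> \<real>\<^sub>\<le>\<^sub>0"
 by (auto elim: nonpos_Reals_cases simp: complex_eq_iff)

lemma one_plus_i_real_nz: "1 + \<i> * complex_of_real x ~= 0" "1 - \<i> * complex_of_real x ~= 0"
 by (auto simp: complex_eq_iff)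

text \<open>The imaginary parts of the exponents only multiply arguments, which are at most pi in
  modulus, and hence contribute a bounded factor.\<close>

lemma cauchy_beta_norm_le:
 "cmod (cauchy_beta p q (of_real x)) <= exp (pi * (\<bar>Im p\<bar> + \<bar>Im q\<bar>)) * (1 + x\<^sup>2) powr (- (Re p + Re q) / 2)"
proof -
 define u where "u = 1 + \<i> * complex_of_real x"
 define v where "v = 1 - \<i> * complex_of_real x"
 have nz: "u ~= 0" "v ~= 0" using one_plus_i_real_nz by (auto simp: u_def v_def)
 have pos: "0 < 1 + x\<^sup>2" by (simp add: add_pos_nonneg)
 have cu: "cmod u = sqrt (1 + x\<^sup>2)" "cmod v = sqrt (1 + x\<^sup>2)" by (simp_all add: u_def v_def cmod_def)
 have l: "ln (sqrt (1 + x\<^sup>2)) = ln (1 + x\<^sup>2) / 2" using pos by (simp add: ln_sqrt)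
 have "cmod (cauchy_beta p q (of_real x)) = exp (Re (- p * Ln u)) * exp (Re (- q * Ln v))"
  unfolding cauchy_beta_def u_def[symmetric] v_def[symmetric] using nz by (simp add: powr_def norm_mult)
 also have "... = exp (- (Re p + Re q) / 2 * ln (1 + x\<^sup>2) + (Im p * Im (Ln u) + Im q * Im (Ln v)))"
  using nz by (simp add: exp_add[symmetric] cu l field_simps)
 also have "... <= exp (- (Re p + Re q) / 2 * ln (1 + x\<^sup>2) + pi * (\<bar>Im p\<bar> + \<bar>Im q\<bar>))"
 proof -
  have b: "\<bar>Im (Ln u)\<bar> <= pi" "\<bar>Im (Ln v)\<bar> <= pi"
   using mpi_less_Im_Ln[of u] Im_Ln_le_pi[of u] mpi_less_Im_Ln[of v] Im_Ln_le_pi[of v] nz by auto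
  have "Im p * Im (Ln u) <= \<bar>Im p\<bar> * pi"
   using abs_ge_self[of "Im p * Im (Ln u)"] mult_left_mono[OF b(1), of "\<bar>Im p\<bar>"] by (simp add: abs_mult)
  moreover have "Im q * Im (Ln v) <= \<bar>Im q\<bar> * pi"
   using abs_ge_self[of "Im q * Im (Ln v)"] mult_left_mono[OF b(2), of "\<bar>Im q\<bar>"] by (simp add: abs_mult)
  ultimately show ?thesis by (simp add: algebra_simps)
 qed
 also have "... = exp (pi * (\<bar>Im p\<bar> + \<bar>Im q\<bar>)) * (1 + x\<^sup>2) powr (- (Re p + Re q) / 2)"
  using pos by (simp add: powr_def exp_add)
 finally show ?thesis .
qed

lemma continuous_cauchy_beta: "continuous_on UNIV (\<lambda>x::real. cauchy_beta p q (of_real x))"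
 unfolding cauchy_beta_def using one_plus_i_real_notin one_plus_i_real_nz
 by (intro continuous_intros) auto

lemma integrable_cauchy_beta:
 assumes "Re p + Re q > 1"
 shows "integrable lborel (\<lambda>x. cauchy_beta p q (of_real x))"
proof (rule Bochner_Integration.integrable_bound)
 show "integrable lborel (\<lambda>x. exp (pi * (\<bar>Im p\<bar> + \<bar>Im q\<bar>)) * (1 + x\<^sup>2) powr - ((Re p + Re q) / 2))"
  using assms by (intro integrable_mult_right integrable_powr_one_plus_square) simp
 show "AE x in lborel. norm (cauchy_beta p q (of_real x)) \<le>
   norm (exp (pi * (\<bar>Im p\<bar> + \<bar>Im q\<bar>)) * (1 + x\<^sup>2) powr - ((Re p + Re q) / 2))"
  using cauchy_beta_norm_le[of p q] by (intro AE_I2) (simp only: real_norm_def abs_mult abs_exp_cancel abs_of_nonneg[OF powr_ge_zero] minus_divide_left)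
 show "(\<lambda>x. cauchy_beta p q (of_real x)) \<in> borel_measurable lborel"
  using borel_measurable_continuous_onI[OF continuous_cauchy_beta] by simp
qed

lemma cauchy_beta_shift:
 fixes x :: real
 shows "cauchy_beta (p + 1) q (of_real x) = cauchy_beta p q (of_real x) / (1 + \<i> * of_real x)"
  "cauchy_beta p (q + 1) (of_real x) = cauchy_beta p q (of_real x) / (1 - \<i> * of_real x)"
proof -
 have d: "z powr (- (p + 1)) = z powr (- p) / z" if "z ~= 0" for z p :: complex
  using that powr_diff[of z "- p" 1] by simp
 show "cauchy_beta (p + 1) q (of_real x) = cauchy_beta p q (of_real x) / (1 + \<i> * of_real x)"
  "cauchy_beta p (q + 1) (of_real x) = cauchy_beta p q (of_real x) / (1 - \<i> * of_real x)"
  using one_plus_i_real_nz[of x] by (simp_all only: cauchy_beta_def d times_divide_eq_left times_divide_eq_right not_False_eq_True)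
qed

lemma cauchy_beta_power:
 fixes x :: real
 shows "cauchy_beta (p - of_nat k) q (of_real x) = (1 + \<i> * of_real x) ^ k * cauchy_beta p q (of_real x)"
  "cauchy_beta p (q - of_nat k) (of_real x) = (1 - \<i> * of_real x) ^ k * cauchy_beta p q (of_real x)"
 using one_plus_i_real_nz[of x]
 by (simp_all add: cauchy_beta_def powr_diff powr_nat' powr_minus field_simps)

section \<open>Recurrences in the exponents of the beta integral\<close>

definition cauchy_beta_int :: "complex => complex => complex" where
 "cauchy_beta_int p q = (LINT x|lborel. cauchy_beta p q (of_real x))"

text \<open>The identity (1 + ix) + (1 - ix) = 2, divided by both factors and integrated.\<close>

lemma cauchy_beta_int_add:
 assumes "Re p + Re q > 0"
 shows "cauchy_beta_int p (q + 1) + cauchy_beta_int (p + 1) q = 2 * cauchy_beta_int (p + 1) (q + 1)"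
proof -
 have "cauchy_beta p (q + 1) (of_real x) + cauchy_beta (p + 1) q (of_real x) = 2 * cauchy_beta (p + 1) (q + 1) (of_real x)" for x :: real
  using one_plus_i_real_nz[of x] by (simp add: cauchy_beta_shift divide_simps) (simp add: algebra_simps)
 then have eq: "(\<lambda>x::real. cauchy_beta p (q + 1) (of_real x) + cauchy_beta (p + 1) q (of_real x)) =
   (\<lambda>x. 2 * cauchy_beta (p + 1) (q + 1) (of_real x))" by simp
 have i: "integrable lborel (\<lambda>x. cauchy_beta p (q + 1) (of_real x))" "integrable lborel (\<lambda>x. cauchy_beta (p + 1) q (of_real x))"
  using assms by (auto intro!: integrable_cauchy_beta)
 show ?thesis unfolding cauchy_beta_int_def Bochner_Integration.integral_add[OF i, symmetric] eq by simp
qed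

lemma cauchy_beta_deriv:
 fixes x :: real
 shows "((\<lambda>x. cauchy_beta p q (of_real x)) has_vector_derivative
  \<i> * (q * cauchy_beta p (q + 1) (of_real x) - p * cauchy_beta (p + 1) q (of_real x))) (at x)"
proof (rule has_vector_derivative_real_field)
 have n: "1 + \<i> * complex_of_real x \<notin> \<real>\<^sub>\<le>\<^sub>0" "1 - \<i> * complex_of_real x \<notin> \<real>\<^sub>\<le>\<^sub>0"
  and z: "1 + \<i> * complex_of_real x ~= 0" "1 - \<i> * complex_of_real x ~= 0"
  using one_plus_i_real_notin one_plus_i_real_nz by auto
 have d: "z powr (- p - 1) = z powr (- p) / z" if "z ~= 0" for z p :: complex
  using that by (simp add: powr_diff)
 show "(cauchy_beta p q has_field_derivative
  \<i> * (q * cauchy_beta p (q + 1) (of_real x) - p * cauchy_beta (p + 1) q (of_real x))) (at (of_real x))"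
  unfolding cauchy_beta_shift unfolding cauchy_beta_def
  by (rule derivative_eq_intros n refl | simp add: d z)+ (simp add: field_simps z d)
qed

text \<open>The derivative of \<open>cauchy_beta p q\<close> integrates to 0, as the function tends
  to 0 at both ends when Re p + Re q > 0.\<close>

lemma cauchy_beta_int_ratio:
 assumes "Re p + Re q > 0"
 shows "p * cauchy_beta_int (p + 1) q = q * cauchy_beta_int p (q + 1)"
proof -
 let ?f = "\<lambda>x::real. \<i> * (q * cauchy_beta p (q + 1) (of_real x) - p * cauchy_beta (p + 1) q (of_real x))"
 let ?F = "\<lambda>x::real. cauchy_beta p q (of_real x)"
 have i: "integrable lborel (\<lambda>x. cauchy_beta p (q + 1) (of_real x))" "integrable lborel (\<lambda>x. cauchy_beta (p + 1) q (of_real x))"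
  using assms by (auto intro!: integrable_cauchy_beta)
 have lim: "(?F \<longlongrightarrow> 0) F" if F: "filterlim (\<lambda>x::real. 1 + x\<^sup>2) at_top F" for F
 proof (rule Lim_null_comparison)
  show "\<forall>\<^sub>F x in F. norm (?F x) <= exp (pi * (\<bar>Im p\<bar> + \<bar>Im q\<bar>)) * (1 + x\<^sup>2) powr (- (Re p + Re q) / 2)"
   using cauchy_beta_norm_le[of p q] by simp
  show "((\<lambda>x. exp (pi * (\<bar>Im p\<bar> + \<bar>Im q\<bar>)) * (1 + x\<^sup>2) powr (- (Re p + Re q) / 2)) \<longlongrightarrow> 0) F"
   using assms by (intro tendsto_mult_right_zero tendsto_neg_powr F) auto
 qed
 have f1: "filterlim (\<lambda>x::real. 1 + x\<^sup>2) at_top at_top" "filterlim (\<lambda>x::real. 1 + x\<^sup>2) at_top at_bot"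
  by (intro filterlim_tendsto_add_at_top[OF tendsto_const] filterlim_pow_at_top filterlim_ident filterlim_pow_at_bot_even; simp)+
 have "(LBINT x=-\<infinity>..\<infinity>. ?f x) = 0 - 0"
 proof (rule interval_integral_FTC_integrable)
  show "(?F has_vector_derivative ?f x) (at x)" for x by (rule cauchy_beta_deriv)
  show "isCont ?f x" for x
   using continuous_cauchy_beta[of p "q + 1"] continuous_cauchy_beta[of "p + 1" q]
   by (intro continuous_intros) (auto simp: continuous_on_eq_continuous_at)
  show "set_integrable lborel (einterval (- \<infinity>) \<infinity>) ?f" using i by (simp add: set_integrable_def)
  show "((?F \<circ> real_of_ereal) \<longlongrightarrow> 0) (at_right (- \<infinity>))"
   unfolding ereal_tendsto_simps by (rule lim[OF f1(2)])
  show "((?F \<circ> real_of_ereal) \<longlongrightarrow> 0) (at_left \<infinity>)"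
   unfolding ereal_tendsto_simps by (rule lim[OF f1(1)])
 qed simp
 then have "(LINT x|lborel. ?f x) = 0" by (simp add: interval_lebesgue_integral_def set_lebesgue_integral_def)
 then show ?thesis unfolding cauchy_beta_int_def using i by simp
qed

text \<open>The sum and ratio relations together raise one exponent at a time. Using them twice
  returns to an integral with both exponents raised by 1.\<close>

lemma cauchy_beta_int_step:
 assumes "Re p + Re q > 1"
 shows "(p + q) * (p + q - 1) * cauchy_beta_int p q = 4 * p * q * cauchy_beta_int (p + 1) (q + 1)"
proof -
 have 1: "(p + q) * cauchy_beta_int p (q + 1) = 2 * p * cauchy_beta_int (p + 1) (q + 1)" if "Re p + Re q > 0" for p q
 proof -
  have "(p + q) * cauchy_beta_int p (q + 1) = p * (cauchy_beta_int p (q + 1) + cauchy_beta_int (p + 1) q)"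
   using cauchy_beta_int_ratio[OF that] by (simp add: ring_distribs)
  then show ?thesis using cauchy_beta_int_add[OF that] by simp
 qed
 have 2: "(p + q - 1) * cauchy_beta_int p q = 2 * q * cauchy_beta_int p (q + 1)"
 proof -
  have "(p - 1 + q) * cauchy_beta_int p q = q * (cauchy_beta_int (p - 1) (q + 1) + cauchy_beta_int p q)"
   using cauchy_beta_int_ratio[of "p - 1" q] assms by (simp add: ring_distribs)
  moreover have "cauchy_beta_int (p - 1) (q + 1) + cauchy_beta_int p q = 2 * cauchy_beta_int p (q + 1)"
   using cauchy_beta_int_add[of "p - 1" q] assms by simp
  ultimately show ?thesis by (simp only: diff_add_eq mult_ac)
 qed
 have "(p + q) * (p + q - 1) * cauchy_beta_int p q = 2 * q * ((p + q) * cauchy_beta_int p (q + 1))"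
  unfolding mult.assoc 2 by (simp only: mult_ac)
 then show ?thesis using 1[of p q] assms by simp
qed

lemma cauchy_beta_int_iterate:
 assumes "Re p + Re q > 1"
 shows "pochhammer (p + q - 1) (2 * n) * cauchy_beta_int p q =
  4 ^ n * pochhammer p n * pochhammer q n * cauchy_beta_int (p + of_nat n) (q + of_nat n)"
proof (induction n)
 case (Suc n)
 have "(p + of_nat n + (q + of_nat n)) * (p + of_nat n + (q + of_nat n) - 1) * cauchy_beta_int (p + of_nat n) (q + of_nat n) =
  4 * (p + of_nat n) * (q + of_nat n) * cauchy_beta_int (p + of_nat n + 1) (q + of_nat n + 1)"
  by (rule cauchy_beta_int_step) (use assms in auto)
 note st = this
 have s: "(p + q - 1 + of_nat (2 * n)) * (p + q - 1 + of_nat (Suc (2 * n))) * cauchy_beta_int (p + of_nat n) (q + of_nat n) =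
  4 * (p + of_nat n) * (q + of_nat n) * cauchy_beta_int (p + of_nat (Suc n)) (q + of_nat (Suc n))"
 proof -
  have "p + of_nat n + (q + of_nat n) = p + q - 1 + of_nat (Suc (2 * n))"
   "p + q - 1 + of_nat (Suc (2 * n)) - 1 = p + q - 1 + of_nat (2 * n)"
   "p + of_nat n + 1 = p + of_nat (Suc n)" "q + of_nat n + 1 = q + of_nat (Suc n)" by simp_all
  from st[unfolded this] show ?thesis by (simp only: mult_ac)
 qed
 have "pochhammer (p + q - 1) (2 * Suc n) * cauchy_beta_int p q =
  (pochhammer (p + q - 1) (2 * n) * cauchy_beta_int p q) * ((p + q - 1 + of_nat (2 * n)) * (p + q - 1 + of_nat (Suc (2 * n))))"
  by (simp add: pochhammer_Suc mult_ac)
 also have "... = 4 ^ n * pochhammer p n * pochhammer q n *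
  ((p + q - 1 + of_nat (2 * n)) * (p + q - 1 + of_nat (Suc (2 * n))) * cauchy_beta_int (p + of_nat n) (q + of_nat n))"
  unfolding Suc.IH by (simp only: mult_ac)
 also have "... = 4 ^ Suc n * pochhammer p (Suc n) * pochhammer q (Suc n) * cauchy_beta_int (p + of_nat (Suc n)) (q + of_nat (Suc n))"
  unfolding s by (simp only: pochhammer_Suc power_Suc mult_ac)
 finally show ?case .
qed simp

lemma cauchy_beta_add_nat:
 fixes x :: real
 shows "cauchy_beta (p + of_nat n) (q + of_nat n) (of_real x) = cauchy_beta p q (of_real x) * of_real (inverse ((1 + x\<^sup>2) ^ n))"
proof -
 have "(1 + \<i> * complex_of_real x) * (1 - \<i> * of_real x) = of_real (1 + x\<^sup>2)"
  by (simp add: complex_eq_iff power2_eq_square)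
 then have "cauchy_beta p q (of_real x) = of_real (1 + x\<^sup>2) ^ n * cauchy_beta (p + of_nat n) (q + of_nat n) (of_real x)"
  using cauchy_beta_power(1)[of "p + of_nat n" n q x] cauchy_beta_power(2)[of "p + of_nat n" "q + of_nat n" n x]
  by (simp flip: power_mult_distrib add: mult_ac)
 moreover have "complex_of_real (1 + x\<^sup>2) ~= 0" using add_pos_nonneg[of 1 "x\<^sup>2"] unfolding of_real_eq_0_iff by simp
 ultimately show ?thesis unfolding of_real_inverse of_real_power by (simp del: of_real_add)
qed

lemma cauchy_beta_1_1: "cauchy_beta 1 1 (of_real x) = of_real (inverse (1 + x\<^sup>2))"
proof -
 have "cauchy_beta (0 + of_nat 1) (0 + of_nat 1) (of_real x) = 1 * of_real (inverse ((1 + x\<^sup>2) ^ 1))"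
  unfolding cauchy_beta_add_nat using one_plus_i_real_nz[of x] by (simp add: cauchy_beta_def)
 then show ?thesis by simp
qed

lemma cauchy_beta_int_1_1: "cauchy_beta_int 1 1 = of_real pi"
proof -
 have pos: "1 + x\<^sup>2 ~= 0" for x :: real using add_pos_nonneg[of 1 "x\<^sup>2"] by simp
 have "integrable lborel (\<lambda>x. cauchy_beta 1 1 (of_real x))" by (rule integrable_cauchy_beta) simp
 then have i: "integrable lborel (\<lambda>x::real. inverse (1 + x\<^sup>2))" unfolding cauchy_beta_1_1 complex_of_real_integrable_eq .
 have "(LBINT x=-\<infinity>..\<infinity>. inverse (1 + x\<^sup>2)) = pi / 2 - (- (pi / 2))"
 proof (rule interval_integral_FTC_integrable)
  show "(arctan has_vector_derivative inverse (1 + x\<^sup>2)) (at x)" for x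
   using DERIV_arctan[of x] by (simp add: has_real_derivative_iff_has_vector_derivative)
  show "isCont (\<lambda>x::real. inverse (1 + x\<^sup>2)) x" for x using pos by (intro continuous_intros) auto
  show "set_integrable lborel (einterval (- \<infinity>) \<infinity>) (\<lambda>x::real. inverse (1 + x\<^sup>2))" using i by (simp add: set_integrable_def)
  show "((arctan \<circ> real_of_ereal) \<longlongrightarrow> - (pi / 2)) (at_right (- \<infinity>))"
   unfolding ereal_tendsto_simps by (rule tendsto_arctan_at_bot)
  show "((arctan \<circ> real_of_ereal) \<longlongrightarrow> pi / 2) (at_left \<infinity>)"
   unfolding ereal_tendsto_simps by (rule tendsto_arctan_at_top)
 qed simp
 then have "(LINT x|lborel. inverse (1 + x\<^sup>2)) = pi" by (simp add: interval_lebesgue_integral_def set_lebesgue_integral_def)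
 then show ?thesis unfolding cauchy_beta_int_def cauchy_beta_1_1 integral_complex_of_real by simp
qed

lemma cauchy_beta_int_diag: "cauchy_beta_int (1 + of_nat n) (1 + of_nat n) = of_real (pi * fact (2 * n) / (4 ^ n * (fact n)\<^sup>2))"
proof -
 have "fact (2 * n) * of_real pi = 4 ^ n * fact n * fact n * cauchy_beta_int (1 + of_nat n) (1 + of_nat n)"
  using cauchy_beta_int_iterate[of 1 1 n] by (simp add: cauchy_beta_int_1_1 pochhammer_fact)
 then show ?thesis by (simp add: power2_eq_square field_simps)
qed

text \<open>A crude bound suffices: its reciprocal grows linearly, while the tails of the
  concentrating measures decay geometrically.\<close>

lemma central_ratio_lower: "1 / (2 * real n + 1) <= fact (2 * n) / (4 ^ n * (fact n)\<^sup>2)"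
proof (induction n)
 case (Suc n)
 have "fact (2 * Suc n) / (4 ^ Suc n * (fact (Suc n))\<^sup>2) = (fact (2 * n) / (4 ^ n * (fact n)\<^sup>2)) * ((2 * real n + 1) / (2 * real n + 2))"
  by (simp add: power2_eq_square divide_simps) (simp add: algebra_simps)
 also have "... >= 1 / (2 * real n + 1) * ((2 * real n + 1) / (2 * real n + 2))"
  by (rule mult_right_mono[OF Suc.IH]) simp
 also have "1 / (2 * real n + 1) * ((2 * real n + 1) / (2 * real n + 2)) = 1 / (2 * real n + 2)" by (simp add: divide_simps)
 also have "1 / (2 * real n + 2) >= 1 / (2 * real (Suc n) + 1)" by (simp add: frac_le)
 finally show ?case by simp
qed simp

text \<open>The measures with density proportional to \<open>(1 + x\<^sup>2)\<^sup>-\<^sup>n\<close> concentrate at the origin.\<close>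

lemma cauchy_beta_int_ratio_tendsto:
 assumes "Re p + Re q > 1"
 shows "(\<lambda>n. cauchy_beta_int (p + of_nat n) (q + of_nat n) / cauchy_beta_int (1 + of_nat n) (1 + of_nat n)) \<longlonglongrightarrow> 1"
proof (rule LIMSEQ_I)
 let ?I = "\<lambda>n. cauchy_beta_int (p + of_nat n) (q + of_nat n)"
 let ?J = "\<lambda>n. cauchy_beta_int (1 + of_nat n) (1 + of_nat n)"
 let ?b = "\<lambda>n x. cauchy_beta (p + of_nat n) (q + of_nat n) (of_real x)"
 let ?c = "\<lambda>n x. cauchy_beta (1 + of_nat n) (1 + of_nat n) (of_real x)"
 fix r :: real assume r: "0 < r"
 define J where "J n = pi * fact (2 * n) / (4 ^ n * (fact n)\<^sup>2)" for n
 have Jpos: "J n > 0" for n by (simp add: J_def)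
 have Jlow: "1 / J n <= (2 * real n + 1) / pi" for n
 proof -
  have "pi * (1 / (2 * real n + 1)) <= J n" using mult_left_mono[OF central_ratio_lower, of pi n] by (simp add: J_def)
  then show ?thesis using Jpos[of n] by (simp add: field_simps)
 qed
 \<comment> \<open>Both integrands contain the factor (1 + x^2)^(-n); \<open>ph\<close> is the
   difference of what remains, and it vanishes at 0.\<close>
 define ph where "ph x = cauchy_beta p q (of_real x) - cauchy_beta 1 1 (of_real x)" for x :: real
 have phi: "integrable lborel ph"
  unfolding ph_def using assms by (intro Bochner_Integration.integrable_diff integrable_cauchy_beta) auto
 have phc: "isCont ph 0" unfolding ph_def
  using continuous_cauchy_beta[of p q] continuous_cauchy_beta[of 1 1] by (intro continuous_intros) (auto simp: continuous_on_eq_continuous_at)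
 have "ph 0 = 0" by (simp add: ph_def cauchy_beta_def)
 \<comment> \<open>The value r/4 becomes r/2 below, because 1/(1 + x^2) is at least 1/2 for |x| <
   1.\<close>
 then obtain d where d: "d > 0" "\<And>x. \<bar>x\<bar> < d ==> cmod (ph x) < r / 4"
  using phc[unfolded continuous_at_eps_delta, rule_format, of "r / 4"] r by (auto simp: dist_norm \<open>ph 0 = 0\<close>)
 define e where "e = min d 1"
 have e: "0 < e" "e <= 1" "\<And>x. \<bar>x\<bar> < e ==> cmod (ph x) < r / 4" using d by (auto simp: e_def)
 define B where "B = (LINT x|lborel. cmod (ph x))"
 \<comment> \<open>The largest value of 1/(1 + x^2) at distance at least \<open>e\<close> from the
   origin, hence the rate at which the tails decay.\<close>
 define q0 where "q0 = inverse (1 + e\<^sup>2)"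
 have q0: "0 < q0" "q0 < 1" using e(1) by (auto simp: q0_def add_pos_pos inverse_less_1_iff)
 let ?w = "\<lambda>n x::real. inverse ((1 + x\<^sup>2) ^ n)"
 have pos: "0 < 1 + x\<^sup>2" for x :: real by (simp add: add_pos_nonneg)
 have bound: "cmod (?I n / ?J n - 1) <= r / 2 + B / pi * ((2 * real n + 1) * q0 ^ n)" for n
 proof -
  have i1: "integrable lborel (\<lambda>x. ?b n x)"
   "integrable lborel (\<lambda>x. ?c n x)"
   using assms by (auto intro!: integrable_cauchy_beta)
  have Jc: "?J n = of_real (J n)" by (simp add: cauchy_beta_int_diag J_def)
  have eqr: "?c n x = of_real (inverse (1 + x\<^sup>2) * ?w n x)" for x :: real
   unfolding cauchy_beta_add_nat cauchy_beta_1_1 by simp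
  have iJ: "integrable lborel (\<lambda>x. inverse (1 + x\<^sup>2) * ?w n x)" and vJ: "(LINT x|lborel. inverse (1 + x\<^sup>2) * ?w n x) = J n"
   using i1(2) Jc unfolding cauchy_beta_int_def eqr complex_of_real_integrable_eq integral_complex_of_real of_real_eq_iff by blast+
  have eqd: "?b n x - ?c n x = ph x * of_real (?w n x)" for x :: real
   unfolding cauchy_beta_add_nat ph_def by (simp add: left_diff_distrib)
  have id: "integrable lborel (\<lambda>x. ph x * of_real (?w n x))"
   unfolding eqd[symmetric] using i1 by (rule Bochner_Integration.integrable_diff)
  have "?I n - ?J n = (LINT x|lborel. ph x * of_real (?w n x))"
   unfolding cauchy_beta_int_def eqd[symmetric] using i1 by simp
  also have "cmod ... <= (LINT x|lborel. cmod (ph x * of_real (?w n x)))" by (rule integral_norm_bound)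
  also have "... <= (LINT x|lborel. r / 2 * (inverse (1 + x\<^sup>2) * ?w n x) + q0 ^ n * cmod (ph x))"
  proof (rule integral_mono)
   show "integrable lborel (\<lambda>x. cmod (ph x * of_real (?w n x)))" using id by (rule integrable_norm)
   show "integrable lborel (\<lambda>x. r / 2 * (inverse (1 + x\<^sup>2) * ?w n x) + q0 ^ n * cmod (ph x))"
    using iJ phi by (intro Bochner_Integration.integrable_add integrable_mult_right integrable_norm)
   fix x :: real
   have wn: "0 <= ?w n x" using pos[of x] by simp
   have nm: "cmod (ph x * of_real (?w n x)) = cmod (ph x) * ?w n x" by (simp only: norm_mult norm_of_real abs_of_nonneg[OF wn])
   show "cmod (ph x * of_real (?w n x)) <= r / 2 * (inverse (1 + x\<^sup>2) * ?w n x) + q0 ^ n * cmod (ph x)"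
   proof (cases "\<bar>x\<bar> < e")
    case True
    then have "x\<^sup>2 <= 1" using e(2) abs_square_le_1[of x] by auto
    then have "1 / 2 <= inverse (1 + x\<^sup>2)" using pos[of x] by (simp add: field_simps)
    then have "r / 2 * (1 / 2) <= r / 2 * inverse (1 + x\<^sup>2)" using r by (intro mult_left_mono) auto
    then have "cmod (ph x) <= r / 2 * inverse (1 + x\<^sup>2)" using e(3)[OF True] by simp
    from mult_right_mono[OF this wn] show ?thesis unfolding nm using q0 by (simp add: mult.assoc add_increasing2)
   next
    case False
    then have "e\<^sup>2 <= x\<^sup>2" using e(1) power_mono[of e "\<bar>x\<bar>" 2] by simp
    then have "inverse ((1 + x\<^sup>2) ^ n) <= q0 ^ n"
     using pos[of x] e(1) unfolding q0_def power_inverse[symmetric]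
     by (intro le_imp_inverse_le power_mono zero_less_power) (auto simp: add_pos_pos)
    from mult_left_mono[OF this, of "cmod (ph x)"] have "cmod (ph x) * ?w n x <= q0 ^ n * cmod (ph x)" by (simp add: mult.commute)
    moreover have "0 <= r / 2 * (inverse (1 + x\<^sup>2) * ?w n x)" using r wn pos[of x] by simp
    ultimately show ?thesis unfolding nm by linarith
   qed
  qed
  also have "... = r / 2 * J n + q0 ^ n * B"
   using iJ phi unfolding B_def by (subst Bochner_Integration.integral_add) (auto simp: vJ intro!: integrable_norm)
  finally have b1: "cmod (?I n - of_real (J n)) <= r / 2 * J n + q0 ^ n * B" unfolding Jc .
  have "cmod (?I n / of_real (J n) - 1) = cmod (?I n - of_real (J n)) / J n"
  proof -
   have "?I n / of_real (J n) - 1 = (?I n - of_real (J n)) / of_real (J n)"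
    using Jpos[of n] by (simp add: diff_divide_distrib)
   then show ?thesis using Jpos[of n] by (simp add: norm_divide)
  qed
  also have "... <= (r / 2 * J n + q0 ^ n * B) / J n" using b1 Jpos[of n] by (simp add: divide_right_mono)
  also have "... = r / 2 + q0 ^ n * B * (1 / J n)" using Jpos[of n] by (simp add: field_simps)
  also have "q0 ^ n * B * (1 / J n) <= q0 ^ n * B * ((2 * real n + 1) / pi)"
   using Jlow[of n] q0 by (intro mult_left_mono) (auto simp: B_def)
  finally show ?thesis unfolding Jc by (simp add: mult_ac)
 qed
 have "(\<lambda>n. B / pi * ((2 * real n + 1) * q0 ^ n)) \<longlonglongrightarrow> 0"
 proof -
  have "(\<lambda>n. 2 * (real n * q0 ^ n) + q0 ^ n) \<longlonglongrightarrow> 2 * 0 + 0"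
   using q0 by (intro tendsto_intros powser_times_n_limit_0 LIMSEQ_realpow_zero) auto
  then have "(\<lambda>n. (2 * real n + 1) * q0 ^ n) \<longlonglongrightarrow> 0" by (simp add: algebra_simps)
  then show ?thesis by (rule tendsto_mult_right_zero)
 qed
 from LIMSEQ_D[OF this, of "r / 2"] r obtain no where no: "\<And>n. n >= no ==> \<bar>B / pi * ((2 * real n + 1) * q0 ^ n)\<bar> < r / 2" by auto
 show "\<exists>no. \<forall>n\<ge>no. norm (?I n / ?J n - 1) < r"
 proof (intro exI allI impI)
  fix n assume "no <= n"
  from no[OF this] bound[of n] show "norm (?I n / ?J n - 1) < r"
   by linarith
 qed
qed

text \<open>Euler's limit for the reciprocal Gamma function. The series \<open>rGamma_series\<close>
  has one more Pochhammer factor, which is balanced by n / (z + n), a sequence with limit 1.\<close>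

lemma pochhammer_asymp:
 "(\<lambda>n. pochhammer z n / (fact n * exp ((z - 1) * of_real (ln (real n))))) \<longlonglongrightarrow> rGamma (z :: complex)"
proof (rule Lim_transform_eventually)
 have t: "(\<lambda>n. of_nat n / (z + of_nat n)) \<longlonglongrightarrow> 1"
 proof -
  have "(\<lambda>n. inverse (z * of_real (inverse (real n)) + 1)) \<longlonglongrightarrow> inverse (z * of_real 0 + 1)"
   by (intro tendsto_intros lim_inverse_n) auto
  moreover have "\<forall>\<^sub>F n in sequentially. inverse (z * of_real (inverse (real n)) + 1) = of_nat n / (z + of_nat n)"
   using eventually_gt_at_top[of 0] by eventually_elim (simp add: field_simps)
  ultimately show ?thesis by (simp add: Lim_transform_eventually)
 qed
 show "(\<lambda>n. rGamma_series z n * (of_nat n / (z + of_nat n))) \<longlonglongrightarrow> rGamma z"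
  using tendsto_mult[OF rGamma_series_LIMSEQ[of z] t] by simp
 have "\<forall>\<^sub>F n in sequentially. real n > cmod z" by (rule eventually_gt_at_top[THEN filterlim_real_sequentially[unfolded filterlim_iff, rule_format]])
 then show "\<forall>\<^sub>F n in sequentially. rGamma_series z n * (of_nat n / (z + of_nat n)) =
   pochhammer z n / (fact n * exp ((z - 1) * of_real (ln (real n))))"
  using eventually_gt_at_top[of 0]
 proof eventually_elim
  case (elim n)
  have "z + of_nat n ~= 0" using elim(1) by (metis add_eq_0_iff norm_minus_cancel norm_of_nat order.irrefl)
  moreover have "exp (z * of_real (ln (real n))) = of_nat n * exp ((z - 1) * of_real (ln (real n)))"
  proof -
   have "exp (complex_of_real (ln (real n))) = of_nat n" using elim(2) unfolding exp_of_real by simp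
   then show ?thesis by (metis diff_add_cancel distrib_right exp_add mult.commute mult_1)
  qed
  ultimately show ?case using elim(2)
   unfolding rGamma_series_def Suc_eq_plus1[symmetric] pochhammer_Suc by (simp del: of_real_of_nat_eq)
 qed
qed

text \<open>Iterating the recurrence pushes both exponents to infinity, where the quotient by the
  explicitly known integral with p = q = 1 tends to 1. The Pochhammer factors left over converge to
  reciprocal Gamma functions, and the statement in terms of \<open>rGamma\<close> also covers
  arguments where Gamma has poles.\<close>

theorem cauchy_beta_integral:
 assumes pq: "Re p + Re q > 1"
 shows "cauchy_beta_int p q * rGamma (p + q - 1) * 2 powr (p + q - 2) = of_real pi * rGamma p * rGamma q"
proof (rule LIMSEQ_unique)
 define A where "A z n = pochhammer z n / (fact n * exp ((z - 1) * of_real (ln (real n))))" for z :: complex and n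
 have A: "A z \<longlonglongrightarrow> rGamma z" for z unfolding A_def by (rule pochhammer_asymp)
 define R where "R n = cauchy_beta_int (p + of_nat n) (q + of_nat n) / cauchy_beta_int (1 + of_nat n) (1 + of_nat n)" for n
 have R: "R \<longlonglongrightarrow> 1" unfolding R_def using pq by (rule cauchy_beta_int_ratio_tendsto)
 have A2: "(\<lambda>n. A (p + q - 1) (2 * n)) \<longlonglongrightarrow> rGamma (p + q - 1)"
  using LIMSEQ_subseq_LIMSEQ[OF A, of "\<lambda>n. 2 * n"] by (simp add: strict_mono_def comp_def)
 show "(\<lambda>n. cauchy_beta_int p q * A (p + q - 1) (2 * n) * 2 powr (p + q - 2)) \<longlonglongrightarrow> cauchy_beta_int p q * rGamma (p + q - 1) * 2 powr (p + q - 2)"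
  by (intro tendsto_intros A2)
 have "(\<lambda>n. of_real pi * A p n * A q n * R n) \<longlonglongrightarrow> of_real pi * rGamma p * rGamma q * 1"
  by (intro tendsto_intros A R)
 moreover have "\<forall>\<^sub>F n in sequentially. of_real pi * A p n * A q n * R n = cauchy_beta_int p q * A (p + q - 1) (2 * n) * 2 powr (p + q - 2)"
  using eventually_gt_at_top[of 0]
 proof eventually_elim
  case (elim n)
  define L where "L = complex_of_real (ln (real n))"
  \<comment> \<open>The doubled index belongs to the Pochhammer symbol of p + q - 1. Splitting ln
    (2n) is what produces the power of 2 in the formula.\<close>
  have l2: "complex_of_real (ln (real (2 * n))) = Ln 2 + L"
  proof -
   have "ln (real (2 * n)) = ln 2 + ln (real n)" using elim by (simp add: ln_mult)
   moreover have "Ln 2 = complex_of_real (ln 2)" using Ln_of_real[of 2] by simp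
   ultimately show ?thesis by (simp only: L_def of_real_add)
  qed
  have J0: "cauchy_beta_int (1 + of_nat n) (1 + of_nat n) = of_real pi * fact (2 * n) / (4 ^ n * (fact n)\<^sup>2)"
   unfolding cauchy_beta_int_diag by simp
  have I: "pochhammer (p + q - 1) (2 * n) * cauchy_beta_int p q =
   4 ^ n * pochhammer p n * pochhammer q n * (R n * cauchy_beta_int (1 + of_nat n) (1 + of_nat n))"
   unfolding cauchy_beta_int_iterate[OF pq] by (simp add: R_def J0)
  have e: "exp ((p + q - 1 - 1) * (Ln 2 + L)) = 2 powr (p + q - 2) * exp ((p - 1) * L) * exp ((q - 1) * L)"
  proof -
   have "2 powr (p + q - 2) = exp ((p + q - 2) * Ln 2)" by (simp add: powr_def)
   then show ?thesis unfolding exp_add[symmetric] by (simp add: algebra_simps flip: exp_add)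
  qed
  have "cauchy_beta_int p q * A (p + q - 1) (2 * n) * 2 powr (p + q - 2) =
   (pochhammer (p + q - 1) (2 * n) * cauchy_beta_int p q) / (fact (2 * n) * exp ((p - 1) * L) * exp ((q - 1) * L))"
   unfolding A_def l2 e by (simp add: mult_ac)
  also have "... = of_real pi * A p n * A q n * R n"
   unfolding I J0 A_def L_def[symmetric] by (simp add: power2_eq_square mult_ac)
  finally show ?case ..
 qed
 ultimately show "(\<lambda>n. cauchy_beta_int p q * A (p + q - 1) (2 * n) * 2 powr (p + q - 2)) \<longlonglongrightarrow> of_real pi * rGamma p * rGamma q"
  by (simp add: Lim_transform_eventually)
qed

section \<open>The distribution of the largest eigenvalue\<close>

lemma det_on_of_real: "det_on (\<lambda>i j. of_real (G i j) :: 'a::{real_algebra_1,comm_ring_1}) S = of_real (det_on G S)"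
 by (simp add: det_on_def)

text \<open>The k-fold integral is a sum over tuples of minors of the Gram matrix on the half-line,
  so the Fredholm series becomes the finite one of \<open>discrete_fredholm\<close>.\<close>

lemma fredholm_det_finite_rank:
 fixes f :: "nat => real => real"
 assumes int: "\<And>i j. i < n ==> j < n ==> integrable lborel (\<lambda>x. f i x * f j x)"
 shows "fredholm_det (\<lambda>x y. of_real (\<Sum>l<n. f l x * f l y)) t =
  of_real (det_on (\<lambda>i j. (if i = j then 1 else 0) - (\<integral>x. indicator {t<..} x * (f i x * f j x) \<partial>lborel)) {..<n})"
proof -
 define G where "G i j = (\<integral>x. indicator {t<..} x * (f i x * f j x) \<partial>lborel)" for i j
 define a where "a k = (\<Sum>l\<in>{..<k} \<rightarrow>\<^sub>E {..<n}. det_on (\<lambda>i j. G (l i) (l j)) {..<k})" for k :: nat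
 define D where "D = det_on (\<lambda>i j. (if i = j then 1 else 0) - G i j) {..<n}"
 have intc: "integrable lborel (\<lambda>x. indicator {t<..} x * (f i x * f j x))" if "i < n" "j < n" for i j
  using integrable_mult_indicator[OF _ int[OF that], of "{t<..}"] by simp
 have ak: "(LINT x:(\<Pi>\<^sub>E i\<in>{..<k}. {t<..})|leb k. det (mat k k
   (\<lambda>(i, j). complex_of_real (\<Sum>l<n. f l (x i) * f l (x j))))) = of_real (a k)" for k :: nat
 proof -
  have "(LINT x:(\<Pi>\<^sub>E i\<in>{..<k}. {t<..})|leb k. det (mat k k
   (\<lambda>(i, j). complex_of_real (\<Sum>l<n. f l (x i) * f l (x j))))) =
   (LINT x|leb k. complex_of_real ((\<Prod>i<k. indicator {t<..} (x i)) * det_on (\<lambda>i j. \<Sum>l<n. f l (x i) * f l (x j)) {..<k}))"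
   unfolding set_lebesgue_integral_def det_mat_eq_det_on
  proof (rule Bochner_Integration.integral_cong[OF refl])
   fix x assume x: "x \<in> space (leb k)"
   have "indicator (\<Pi>\<^sub>E i\<in>{..<k}. {t<..}) x = (\<Prod>i<k. indicator {t<..} (x i) :: real)"
   proof (cases "\<forall>i<k. t < x i")
    case True
    then show ?thesis using x by (auto simp: PiE_def space_leb indicator_def)
   next
    case False
    then obtain j where j: "j < k" "x j \<notin> {t<..}" by auto
    then have "(\<Prod>i<k. indicator {t<..} (x i) :: real) = 0"
     by (intro prod_zero finite_lessThan bexI[of _ j] indicator_simps(2)) simp_all
    moreover have "x \<notin> (\<Pi>\<^sub>E i\<in>{..<k}. {t<..})" using j by auto
    ultimately show ?thesis by simp
   qed
   then show "indicator (\<Pi>\<^sub>E i\<in>{..<k}. {t<..}) x *\<^sub>R det_on (\<lambda>i j. complex_of_real (\<Sum>l<n. f l (x i) * f l (x j))) {..<k} =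
    complex_of_real ((\<Prod>i<k. indicator {t<..} (x i)) * det_on (\<lambda>i j. \<Sum>l<n. f l (x i) * f l (x j)) {..<k})"
    unfolding det_on_of_real by (simp only: scaleR_conv_of_real of_real_mult)
  qed
  also have "... = of_real (a k)"
   using integral_det_kernel[of n "indicator {t<..}" f k, OF intc] unfolding a_def G_def
   by (simp only: has_bochner_integral_iff integral_complex_of_real)
  finally show ?thesis .
 qed
 have s: "(\<lambda>k. (- 1) ^ k / fact k * a k) sums D"
  unfolding a_def D_def by (rule discrete_fredholm)
 \<comment> \<open>The series in \<open>fredholm_det\<close> starts at k = 1; its separate summand 1
   is the term k = 0.\<close>
 have a0: "a 0 = 1" by (simp add: a_def det_on_def)
 have "(\<lambda>m. (- 1) ^ Suc m / fact (Suc m) * a (Suc m)) sums (D - 1)"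
  using s sums_Suc_iff[of "\<lambda>k. (- 1) ^ k / fact k * a k" "D - 1"] by (simp add: a0)
 from sums_of_real[OF this, where 'a = complex]
 have "(\<Sum>m. of_real ((- 1) ^ Suc m / fact (Suc m) * a (Suc m))) = complex_of_real (D - 1)" by (rule sums_unique[symmetric])
 then show ?thesis unfolding fredholm_det_def Let_def ak D_def[symmetric] G_def[symmetric] by simp
qed

section \<open>From ordered to arbitrary eigenvalue vectors\<close>

lemma vand_permute_square:
 fixes l :: "nat => real"
 assumes p: "p permutes {..<n}"
 shows "(vand n (\<lambda>j\<in>{..<n}. l (p j)))\<^sup>2 = (vand n l)\<^sup>2"
proof -
 have vd: "vand n m = det (mat n n (\<lambda>(i, j). m i ^ j))" for m :: "nat => real"
 proof -
  have "vand n m = det (mat n n (\<lambda>(i, j). m j ^ i))"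
   using det_poly_vand[of n "\<lambda>i. monom 1 i" m] by (simp add: degree_monom_eq poly_monom)
  also have "... = det (transpose_mat (mat n n (\<lambda>(i, j). m j ^ i)))"
   by (rule det_transpose[symmetric]) auto
  also have "transpose_mat (mat n n (\<lambda>(i, j). m j ^ i)) = mat n n (\<lambda>(i, j). m i ^ j)"
   by (intro eq_matI) auto
  finally show ?thesis .
 qed
 let ?A = "mat n n (\<lambda>(i, j). l i ^ j)"
 have p': "p permutes {0..<n}" using p by (simp add: lessThan_atLeast0)
 have pn: "p i < n" if "i < n" for i using permutes_in_image[OF p, of i] that by simp
 have "mat n n (\<lambda>(i, j). (\<lambda>j\<in>{..<n}. l (p j)) i ^ j) = mat n n (\<lambda>(i, j). ?A $$ (p i, j))"
  by (intro eq_matI) (auto simp: pn)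
 then have "vand n (\<lambda>j\<in>{..<n}. l (p j)) = signof p * det ?A"
  unfolding vd using det_permute_rows[of ?A n p, OF _ p'] by simp
 moreover have "(signof p :: real)\<^sup>2 = 1" by (simp add: sign_def)
 ultimately show ?thesis unfolding vd[of l] by (simp add: power_mult_distrib)
qed

text \<open>Existence reads the positions off the sorted list of values. For uniqueness, two sorted
  rearrangements have the same root polynomial and agree by \<open>roots_unique\<close>.\<close>

lemma sorting_permutation:
 fixes l :: "nat => real"
 assumes inj: "inj_on l {..<n}"
 shows "\<exists>!p. p permutes {..<n} \<and> (\<lambda>j\<in>{..<n}. l (p j)) \<in> strict_vecs n"
proof (rule ex_ex1I)
 let ?xs = "sorted_list_of_set (l ` {..<n})"
 have len: "length ?xs = n" using inj by (simp add: card_image)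
 have set: "set ?xs = l ` {..<n}" by simp
 have ss: "?xs ! i < ?xs ! j" if "i < j" "j < n" for i j
  using strict_sorted_list_of_set[of "l ` {..<n}"] that len by (metis sorted_wrt_nth_less)
 define p where "p j = (if j < n then inv_into {..<n} l (?xs ! j) else j)" for j
 have mem: "?xs ! j \<in> l ` {..<n}" if "j < n" for j using that len set nth_mem by metis
 have lp: "l (p j) = ?xs ! j" if "j < n" for j using that mem[OF that] by (simp add: p_def f_inv_into_f)
 have pn: "p j < n" if "j < n" for j using that inv_into_into[OF mem[OF that]] by (simp add: p_def)
 have ip: "inj_on p {..<n}"
 proof (rule inj_onI)
  fix i j assume a: "i \<in> {..<n}" "j \<in> {..<n}" "p i = p j"
  then have "?xs ! i = ?xs ! j" using lp[of i] lp[of j] by simp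
  then show "i = j" using ss[of i j] ss[of j i] a by (cases i j rule: linorder_cases) auto
 qed
 then have "p ` {..<n} = {..<n}" using pn by (intro endo_inj_surj) auto
 then have "bij_betw p {..<n} {..<n}" using ip by (simp add: bij_betw_def)
 then have "p permutes {..<n}" by (rule bij_imp_permutes) (simp add: p_def)
 moreover have "(\<lambda>j\<in>{..<n}. l (p j)) \<in> strict_vecs n" using ss lp by (auto simp: strict_vecs_def)
 ultimately show "\<exists>p. p permutes {..<n} \<and> (\<lambda>j\<in>{..<n}. l (p j)) \<in> strict_vecs n" by blast
next
 fix p q assume p: "p permutes {..<n} \<and> (\<lambda>j\<in>{..<n}. l (p j)) \<in> strict_vecs n"
  and q: "q permutes {..<n} \<and> (\<lambda>j\<in>{..<n}. l (q j)) \<in> strict_vecs n"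
 have mono: "mono_on {..<n} (\<lambda>j. l (r j))" if "(\<lambda>j\<in>{..<n}. l (r j)) \<in> strict_vecs n" for r
 proof (rule mono_onI)
  fix i j assume ij: "i \<in> {..<n}" "j \<in> {..<n}" "i <= j"
  show "l (r i) <= l (r j)"
  proof (cases "i = j")
   case False
   then have "(\<lambda>j\<in>{..<n}. l (r j)) i < (\<lambda>j\<in>{..<n}. l (r j)) j" using that ij by (simp only: strict_vecs_def) simp
   then show ?thesis using ij by simp
  qed simp
 qed
 have pr: "(\<Prod>i<n. [:- complex_of_real (l (r i)), 1:]) = (\<Prod>i<n. [:- complex_of_real (l i), 1:])" if "r permutes {..<n}" for r
  using prod.permute[OF that, of "\<lambda>i. [:- complex_of_real (l i), 1:]"] by (simp add: comp_def)
 have "\<forall>i<n. l (p i) = l (q i)"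
  using p q by (intro roots_unique mono) (simp_all only: pr)
 then have "p i = q i" if "i < n" for i
  using that inj_onD[OF inj, of "p i" "q i"] permutes_in_image[of p "{..<n}" i] permutes_in_image[of q "{..<n}" i] p q by simp
 moreover have "p i = q i" if "\<not> i < n" for i
  using that p q permutes_not_in[of p "{..<n}" i] permutes_not_in[of q "{..<n}" i] by simp
 ultimately show "p = q" by (metis ext)
qed

text \<open>Exactly one of the n! rearrangements of a vector with distinct entries is increasing,
  and where two entries coincide the Vandermonde factor vanishes.\<close>

lemma nn_integral_symmetric_strict:
 fixes g :: "(nat => real) => ennreal"
 assumes g: "g \<in> meas_leb n"
  and sym: "\<And>p l. p permutes {..<n} ==> g (\<lambda>j\<in>{..<n}. l (p j)) = g l"
 shows "(\<integral>\<^sup>+l. g l * ennreal ((vand n l)\<^sup>2) \<partial>leb n) =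
  fact n * (\<integral>\<^sup>+l. g l * (ennreal ((vand n l)\<^sup>2) * indicator (strict_vecs n) l) \<partial>leb n)"
proof -
 let ?P = "{p. p permutes {..<n}}"
 let ?h = "\<lambda>l. g l * (ennreal ((vand n l)\<^sup>2) * indicator (strict_vecs n) l)"
 let ?q = "\<lambda>p l. \<lambda>j\<in>{..<n}. l (p j)"
 have fin: "finite ?P" by (simp add: finite_permutations)
 have i2: "(indicator (strict_vecs n) :: _ => ennreal) \<in> meas_leb n"
  by (rule borel_measurable_indicator_iff[THEN iffD2, OF strict_vecs_measurable])
 have mh: "?h \<in> meas_leb n"
  by (intro borel_measurable_times_ennreal g i2 measurable_compose[OF borel_measurable_power[OF measurable_vand] measurable_ennreal]) simp
 have eq: "g l * ennreal ((vand n l)\<^sup>2) = (\<Sum>p\<in>?P. ?h (?q p l))" for l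
 proof -
  have "(\<Sum>p\<in>?P. ?h (?q p l)) =
   (\<Sum>p\<in>?P. g l * ennreal ((vand n l)\<^sup>2) * indicator (strict_vecs n) (?q p l))"
   by (intro sum.cong refl) (simp only: mem_Collect_eq sym vand_permute_square mult.assoc)
  also have "... = g l * ennreal ((vand n l)\<^sup>2) * (\<Sum>p\<in>?P. indicator (strict_vecs n) (?q p l))"
   by (simp only: sum_distrib_left)
  also have "... = g l * ennreal ((vand n l)\<^sup>2)"
  proof (cases "inj_on l {..<n}")
   case True
   from sorting_permutation[OF this] obtain p where p: "p permutes {..<n}" "(?q p l) \<in> strict_vecs n"
    and u: "\<And>q. q permutes {..<n} \<and> (\<lambda>j\<in>{..<n}. l (q j)) \<in> strict_vecs n ==> q = p" by (elim ex1E) blast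
   have "(\<Sum>q\<in>?P. indicator (strict_vecs n) (\<lambda>j\<in>{..<n}. l (q j)) :: ennreal) = (\<Sum>q\<in>?P. if q = p then 1 else 0)"
   proof (intro sum.cong refl)
    fix q assume q: "q \<in> ?P"
    show "(indicator (strict_vecs n) (\<lambda>j\<in>{..<n}. l (q j)) :: ennreal) = (if q = p then 1 else 0)"
    proof (cases "q = p")
     case True
     show ?thesis unfolding True indicator_simps(1)[OF p(2)] by simp
    next
     case False
     then have ns: "(\<lambda>j\<in>{..<n}. l (q j)) \<notin> strict_vecs n" using u[of q] q by blast
     show ?thesis unfolding indicator_simps(2)[OF ns] using False by simp
    qed
   qed
   also have "... = 1" using p fin by simp
   finally show ?thesis by simp
  next
   case False
   then obtain i j where "i < n" "j < n" "i < j" "l i = l j"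
    unfolding inj_on_def by (metis lessThan_iff linorder_neqE_nat)
   then have "vand n l = 0" unfolding vand_def
    by (intro prod_zero finite_lessThan bexI[of _ j] bexI[of _ i]) auto
   then show ?thesis by simp
  qed
  finally show ?thesis ..
 qed
 have ri: "(\<integral>\<^sup>+l. ?h (?q p l) \<partial>leb n) = (\<integral>\<^sup>+l. ?h l \<partial>leb n)" if "p \<in> ?P" for p
  by (rule nn_integral_PiM_lborel_reindex) (use that mh in \<open>auto intro: permutes_imp_bij\<close>)
 have mp: "(\<lambda>l. ?h (?q p l)) \<in> meas_leb n" if "p \<in> ?P" for p
 proof (rule measurable_compose[OF _ mh])
  show "(\<lambda>l. \<lambda>j\<in>{..<n}. l (p j)) \<in> measurable (leb n) (leb n)"
   using that permutes_in_image[of p "{..<n}"] by (intro measurable_restrict measurable_component_singleton) auto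
 qed
 have "(\<integral>\<^sup>+l. g l * ennreal ((vand n l)\<^sup>2) \<partial>leb n) = (\<Sum>p\<in>?P. \<integral>\<^sup>+l. ?h (?q p l) \<partial>leb n)"
  unfolding eq by (rule nn_integral_sum[OF mp])
 also have "... = (\<Sum>p\<in>?P. \<integral>\<^sup>+l. ?h l \<partial>leb n)" by (intro sum.cong refl ri)
 also have "... = of_nat (card ?P) * (\<integral>\<^sup>+l. ?h l \<partial>leb n)" by (simp only: sum_constant)
 also have "card ?P = fact n" by (simp add: card_permutations)
 finally show ?thesis by (simp only: of_nat_fact)
qed

lemma w_H_pos: "w_H s N x > 0"
 unfolding w_H_def using add_pos_nonneg[of 1 "x\<^sup>2"] by (intro mult_pos_pos exp_gt_zero) simp

lemma w_H_eq_cauchy_beta: "complex_of_real (w_H s N x) = cauchy_beta (s + of_nat N) (cnj s + of_nat N) (of_real x)"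
 unfolding w_H_eq_powr cauchy_beta_def by simp

lemma continuous_w_H: "continuous_on UNIV (w_H s N)"
proof -
 have "w_H s N = (\<lambda>x. Re (cauchy_beta (s + of_nat N) (cnj s + of_nat N) (of_real x)))"
  by (simp add: fun_eq_iff flip: w_H_eq_cauchy_beta)
 then show ?thesis using continuous_on_Re[OF continuous_cauchy_beta] by metis
qed

lemma measurable_w_H: "w_H s N \<in> borel_measurable borel"
 by (rule borel_measurable_continuous_onI[OF continuous_w_H])

lemma det_on_scale_columns:
 fixes h :: "nat => nat => real"
 shows "det_on (\<lambda>i j. h i j * r j) {..<n} = det_on h {..<n} * (\<Prod>j<n. r j)"
 unfolding det_on_col by (simp add: prod.distrib sum_distrib_right mult.assoc)

lemma det_on_kronecker: "det_on (\<lambda>i j. if i = j then 1 else 0 :: real) {..<n :: nat} = 1"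
proof -
 have "mat n n (\<lambda>(i, j). if i = j then 1 else 0 :: real) = 1\<^sub>m n" by (intro eq_matI) auto
 then show ?thesis unfolding det_mat_eq_det_on[symmetric] by simp
qed

text \<open>The conditions concern degrees below \<open>N\<close> only: products of higher degree
  may fail to be integrable against the weight.\<close>

locale orthonormal_polys =
 fixes s :: complex and N :: nat and e :: "nat => real poly"
 assumes degree_e: "j < N ==> Polynomial.degree (e j) = j"
  and e_nonzero: "j < N ==> e j ~= 0"
  and orthonormal: "[|i < N; j < N|] ==>
   has_bochner_integral lborel (\<lambda>x. poly (e i) x * poly (e j) x * w_H s N x) (if i = j then 1 else 0)"
begin

abbreviation wfun :: "nat => real => real" where
 "wfun j x \<equiv> poly (e j) x * sqrt (w_H s N x)"

lemma wfun_mult: "wfun i x * wfun j x = poly (e i) x * poly (e j) x * w_H s N x"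
 using w_H_pos[of s N x] by (simp add: mult_ac flip: power2_eq_square)

lemma integrable_wfun: "i < N ==> j < N ==> integrable lborel (\<lambda>x. wfun i x * wfun j x)"
 unfolding wfun_mult using orthonormal by (auto simp: has_bochner_integral_iff)

text \<open>Up to the squared product of leading coefficients, the weights times the squared
  Vandermonde factor are a product of two determinants of the \<open>wfun\<close>. Here
  \<open>andreief\<close> applies with the indicator attached to one of them, and its N! cancels
  against the restriction to ordered vectors.\<close>

lemma strict_integral:
 assumes T: "T \<in> sets borel"
 defines "D \<equiv> det_on (\<lambda>i j. \<integral>x. indicator T x * (wfun i x * wfun j x) \<partial>lborel) {..<N}"
 shows "(\<integral>\<^sup>+l. (\<Prod>i<N. ennreal (w_H s N (l i)) * indicator T (l i)) * (ennreal ((vand N l)\<^sup>2) * indicator (strict_vecs N) l) \<partial>leb N)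
  = ennreal (D / (\<Prod>i<N. lead_coeff (e i))\<^sup>2)" "0 <= D"
proof -
 define la where "la = (\<Prod>i<N. lead_coeff (e i))"
 have la: "la ~= 0" unfolding la_def using e_nonzero by auto
 let ?r = "\<lambda>x. \<Prod>i<N. w_H s N (x i) * indicator T (x i)"
 let ?f = "\<lambda>i x. wfun i x * indicator T x"
 have r0: "0 <= ?r x" for x by (intro prod_nonneg) (simp add: w_H_pos less_imp_le)
 have "has_bochner_integral (leb N) (\<lambda>x. det_on (\<lambda>i j. ?f i (x j)) {..<N} * det_on (\<lambda>i j. wfun i (x j)) {..<N})
  (fact N * det_on (\<lambda>i j. \<integral>x. ?f i x * wfun j x \<partial>lborel) {..<N})"
 proof (rule andreief)
  fix i j assume "i < N" "j < N"
  from integrable_mult_indicator[OF _ integrable_wfun[OF this], of T] T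
  show "integrable lborel (\<lambda>x. ?f i x * wfun j x)" by (simp add: mult_ac)
 qed
 moreover have "(\<integral>x. ?f i x * wfun j x \<partial>lborel) = (\<integral>x. indicator T x * (wfun i x * wfun j x) \<partial>lborel)" for i j
  by (simp only: mult_ac)
 moreover have "det_on (\<lambda>i j. ?f i (x j)) {..<N} * det_on (\<lambda>i j. wfun i (x j)) {..<N} = la\<^sup>2 * (?r x * (vand N x)\<^sup>2)" for x
 proof -
  have e: "det_on (\<lambda>i j. poly (e i) (x j)) {..<N} = la * vand N x"
   unfolding det_mat_eq_det_on[symmetric] la_def by (rule det_poly_vand[OF degree_e])
  have "det_on (\<lambda>i j. ?f i (x j)) {..<N} * det_on (\<lambda>i j. wfun i (x j)) {..<N} =
   (la * vand N x)\<^sup>2 * ((\<Prod>j<N. sqrt (w_H s N (x j)) * indicator T (x j)) * (\<Prod>j<N. sqrt (w_H s N (x j))))"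
   unfolding mult.assoc det_on_scale_columns e by (simp only: power2_eq_square mult_ac)
  also have "(\<Prod>j<N. sqrt (w_H s N (x j)) * indicator T (x j)) * (\<Prod>j<N. sqrt (w_H s N (x j))) = ?r x"
   unfolding prod.distrib[symmetric]
  proof (rule prod.cong[OF refl])
   fix j
   have "sqrt (w_H s N (x j)) * sqrt (w_H s N (x j)) = w_H s N (x j)" using w_H_pos[of s N "x j"] by simp
   then show "sqrt (w_H s N (x j)) * indicator T (x j) * sqrt (w_H s N (x j)) = w_H s N (x j) * indicator T (x j)"
    by (metis mult.assoc mult.commute)
  qed
  finally show ?thesis by (simp only: power_mult_distrib mult_ac)
 qed
 ultimately have hb: "has_bochner_integral (leb N) (\<lambda>x. la\<^sup>2 * (?r x * (vand N x)\<^sup>2)) (fact N * D)"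
  unfolding D_def by simp
 have "0 <= fact N * D"
  unfolding has_bochner_integral_integral_eq[OF hb, symmetric]
  by (rule Bochner_Integration.integral_nonneg) (intro mult_nonneg_nonneg r0 zero_le_power2)
 then show D0: "0 <= D" using fact_gt_zero[of N, where 'a = real] by (simp add: zero_le_mult_iff not_le)
 have hb2: "has_bochner_integral (leb N) (\<lambda>x. ?r x * (vand N x)\<^sup>2) (fact N * D / la\<^sup>2)"
 proof -
  have "has_bochner_integral (leb N) (\<lambda>x. 1 / la\<^sup>2 * (la\<^sup>2 * (?r x * (vand N x)\<^sup>2))) (1 / la\<^sup>2 * (fact N * D))"
   by (rule has_bochner_integral_mult_right) (rule hb)
  then show ?thesis using la by simp
 qed
 define g where "g l = (\<Prod>i<N. ennreal (w_H s N (l i)) * indicator T (l i))" for l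
 have geq: "g l = ennreal (?r l)" for l
  unfolding g_def using w_H_pos[of s N] by (subst prod_ennreal[symmetric]) (auto simp: ennreal_mult' ennreal_indicator less_imp_le intro!: prod.cong)
 have gm: "g \<in> meas_leb N" unfolding g_def
  by (intro borel_measurable_prod_ennreal borel_measurable_times_ennreal measurable_compose[OF measurable_compose[OF measurable_leb_component measurable_w_H] measurable_ennreal]
   measurable_compose[OF measurable_leb_component borel_measurable_indicator] T) auto
 have gs: "g (\<lambda>j\<in>{..<N}. l (p j)) = g l" if "p permutes {..<N}" for p l
  unfolding g_def using prod.permute[OF that, of "\<lambda>i. ennreal (w_H s N (l i)) * indicator T (l i)"] by (simp add: comp_def)
 let ?S = "\<integral>\<^sup>+l. g l * (ennreal ((vand N l)\<^sup>2) * indicator (strict_vecs N) l) \<partial>leb N"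
 have "fact N * ?S = (\<integral>\<^sup>+l. g l * ennreal ((vand N l)\<^sup>2) \<partial>leb N)"
  by (rule nn_integral_symmetric_strict[symmetric, OF gm gs])
 also have "... = (\<integral>\<^sup>+l. ennreal (?r l * (vand N l)\<^sup>2) \<partial>leb N)" unfolding geq using r0 by (simp add: ennreal_mult')
 also have "... = ennreal (fact N * D / la\<^sup>2)"
  using hb2 r0 by (subst nn_integral_eq_integral) (auto simp: has_bochner_integral_iff)
 also have "... = fact N * ennreal (D / la\<^sup>2)"
  using D0 by (simp add: ennreal_mult' mult.assoc flip: ennreal_fact times_divide_eq_right)
 finally have "fact N * ?S = fact N * ennreal (D / la\<^sup>2)" .
 then have "?S = ennreal (D / la\<^sup>2)" by (simp add: ennreal_mult_cancel_left flip: ennreal_fact)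
 then show "(\<integral>\<^sup>+l. (\<Prod>i<N. ennreal (w_H s N (l i)) * indicator T (l i)) * (ennreal ((vand N l)\<^sup>2) * indicator (strict_vecs N) l) \<partial>leb N)
  = ennreal (D / (\<Prod>i<N. lead_coeff (e i))\<^sup>2)"
  unfolding g_def la_def .
qed

text \<open>The weight of the event and the total weight are given by one formula, for a half-line
  and for the whole line, so Weyl's constant and the leading coefficients cancel in their
  quotient.\<close>

theorem largest_eigenvalue_distribution:
 assumes N: "N >= 1"
 shows "complex_of_real (measure (cauchy_measure s N) {X \<in> space (cauchy_measure s N). largest_eigenvalue X / real N <= x0}) =
  fredholm_det (\<lambda>x y. of_real (\<Sum>j<N. wfun j x * wfun j y)) (real N * x0)"
proof -
 let ?V = "\<lambda>l. ennreal ((vand N l)\<^sup>2) * indicator (strict_vecs N) l"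
 let ?g = "\<lambda>T l. \<Prod>i<N. ennreal (w_H s N (l i)) * indicator T (l i)"
 let ?t = "real N * x0" and ?L = "lebesgue_herm N" and ?W = "cauchy_weight s N"
 obtain c where c: "c > 0" and weyl: "\<And>F. F \<in> meas_leb N ==>
   (\<integral>\<^sup>+c. F (eigs N (herm_of_coords N c)) \<partial>herm_coords N) =
   ennreal c * (\<integral>\<^sup>+l. F l * (?V l) \<partial>leb N)"
  using weyl_integration[of N] by blast
 have me: "eigs N \<in> measurable ?L (leb N)" unfolding lebesgue_herm_def
  by (intro measurable_embed_measure1 eigs_measurable_leb herm_of_coords_hermitian measurable_herm_index)
 define la where "la = (\<Prod>i<N. lead_coeff (e i))"
 have la: "la ~= 0" unfolding la_def using e_nonzero by auto
 define Dt where "Dt T = det_on (\<lambda>i j. \<integral>x. indicator T x * (wfun i x * wfun j x) \<partial>lborel) {..<N}" for T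
 \<comment> \<open>Agreement on increasing vectors is enough, and there a bound on the last
   coordinate is the same as a bound on all of them.\<close>
 have key: "(\<integral>\<^sup>+X. F (eigs N X) \<partial>?L) = ennreal c * ennreal (Dt T / la\<^sup>2)"
  if F: "F \<in> meas_leb N" and T: "T \<in> sets borel"
   and eq: "\<And>l. l \<in> strict_vecs N ==> F l = (?g T l)" for F T
 proof -
  have "(\<integral>\<^sup>+X. F (eigs N X) \<partial>?L) = (\<integral>\<^sup>+c. F (eigs N (herm_of_coords N c)) \<partial>herm_coords N)"
   unfolding lebesgue_herm_def by (rule nn_integral_embed_measure'[OF inj_on_herm_of_coords])
    (use measurable_compose[OF me F] in \<open>simp add: lebesgue_herm_def\<close>)
  also have "... = ennreal c * (\<integral>\<^sup>+l. F l * (?V l) \<partial>leb N)" by (rule weyl[OF F])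
  also have "(\<integral>\<^sup>+l. F l * (?V l) \<partial>leb N) =
   (\<integral>\<^sup>+l. (?g T l) * (?V l) \<partial>leb N)"
  proof (rule nn_integral_cong)
   fix l :: "nat => real"
   show "F l * (?V l) =
    (?g T l) * (?V l)"
    by (cases "l \<in> strict_vecs N") (simp_all add: eq)
  qed
  also have "... = ennreal (Dt T / la\<^sup>2)" unfolding Dt_def la_def by (rule strict_integral(1)[OF T])
  finally show ?thesis .
 qed
 define F0 where "F0 l = (\<Prod>i<N. ennreal (w_H s N (l i)))" for l :: "nat => real"
 define F1 where "F1 l = F0 l * indicator {..?t} (l (N - 1))" for l :: "nat => real"
 have F0m: "F0 \<in> meas_leb N" unfolding F0_def
  by (intro borel_measurable_prod_ennreal measurable_compose[OF measurable_compose[OF measurable_leb_component measurable_w_H] measurable_ennreal]) auto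
 have F1m: "F1 \<in> meas_leb N" unfolding F1_def using N
  by (intro borel_measurable_times_ennreal F0m measurable_compose[OF measurable_leb_component borel_measurable_indicator]) auto
 have WF: "ennreal (?W X) = F0 (eigs N X)" if "X \<in> space ?L" for X
  using that w_H_pos unfolding space_lebesgue_herm F0_def by (simp add: cauchy_weight_eigs prod_ennreal less_imp_le)
 have Wm: "(\<lambda>X. ennreal (?W X)) \<in> borel_measurable ?L"
  using measurable_compose[OF me F0m] by (subst measurable_cong[OF WF]) auto
 have D1: "Dt UNIV = 1"
 proof -
  have "Dt UNIV = det_on (\<lambda>i j. if i = j then 1 else 0) {..<N}" unfolding Dt_def det_mat_eq_det_on[symmetric]
   using orthonormal by (intro arg_cong[of _ _ det] eq_matI) (auto simp: wfun_mult has_bochner_integral_iff)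
  then show ?thesis by (simp add: det_on_kronecker)
 qed
 have Z: "(\<integral>\<^sup>+X. ennreal (?W X) \<partial>?L) = ennreal (c / la\<^sup>2)"
 proof -
  have "(\<integral>\<^sup>+X. ennreal (?W X) \<partial>?L) = (\<integral>\<^sup>+X. F0 (eigs N X) \<partial>?L)" by (intro nn_integral_cong WF)
  also have "... = ennreal c * ennreal (Dt UNIV / la\<^sup>2)" by (rule key[OF F0m]) (simp_all add: F0_def)
  finally show ?thesis using c by (simp add: D1 flip: ennreal_mult')
 qed
 let ?S = "{X \<in> space (cauchy_measure s N). largest_eigenvalue X / real N <= x0}"
 have Seq: "?S = {X \<in> space ?L. eigs N X (N - 1) <= ?t}"
  using N by (auto simp: cauchy_measure_def space_lebesgue_herm largest_eigenvalue_eq_eigs field_simps)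
 have Sm: "?S \<in> sets ?L" unfolding Seq using N
  by (intro borel_measurable_le measurable_compose[OF me measurable_leb_component] borel_measurable_const) auto
 have num: "(\<integral>\<^sup>+X. ennreal (?W X) * indicator ?S X \<partial>?L) = ennreal c * ennreal (Dt {..?t} / la\<^sup>2)"
 proof -
  have "(\<integral>\<^sup>+X. ennreal (?W X) * indicator ?S X \<partial>?L) = (\<integral>\<^sup>+X. F1 (eigs N X) \<partial>?L)"
   by (intro nn_integral_cong) (auto simp: WF F1_def Seq indicator_def)
  also have "... = ennreal c * ennreal (Dt {..?t} / la\<^sup>2)"
  proof (rule key[OF F1m])
   fix l assume l: "l \<in> strict_vecs N"
   have lt: "l i <= l (N - 1)" if "i < N" for i
   proof (cases "i = N - 1")
    case False
    then have "l i < l (N - 1)" using l that unfolding strict_vecs_def using False N by simp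
    then show ?thesis by simp
   qed simp
   show "F1 l = (\<Prod>i<N. ennreal (w_H s N (l i)) * indicator {..?t} (l i))"
   proof (cases "l (N - 1) <= ?t")
    case True
    then have "\<And>i. i < N ==> l i <= ?t" using lt order_trans by blast
    then show ?thesis using True unfolding F1_def F0_def by simp
   next
    case False
    have "(\<Prod>i<N. ennreal (w_H s N (l i)) * indicator {..?t} (l i)) = 0"
     using False N by (intro prod_zero finite_lessThan bexI[of _ "N - 1"]) auto
    then show ?thesis using False unfolding F1_def by simp
   qed
  qed simp
  finally show ?thesis .
 qed
 have D0: "0 <= Dt {..?t}" unfolding Dt_def by (rule strict_integral(2)) simp
 have "emeasure (cauchy_measure s N) ?S = (\<integral>\<^sup>+X. ennreal (?W X) / ennreal (c / la\<^sup>2) * indicator ?S X \<partial>?L)"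
  unfolding cauchy_measure_def Z by (rule emeasure_density) (use Wm Sm in \<open>auto simp: cauchy_measure_def Z\<close>)
 also have "... = (\<integral>\<^sup>+X. ennreal (?W X) * indicator ?S X / ennreal (c / la\<^sup>2) \<partial>?L)"
  by (simp add: divide_ennreal_def mult_ac)
 also have "... = (\<integral>\<^sup>+X. ennreal (?W X) * indicator ?S X \<partial>?L) / ennreal (c / la\<^sup>2)"
  by (rule nn_integral_divide) (intro borel_measurable_times_ennreal Wm borel_measurable_indicator Sm)
 also have "... = ennreal (Dt {..?t})"
  unfolding num using c la D0 by (simp add: divide_ennreal flip: ennreal_mult')
 finally have m: "measure (cauchy_measure s N) ?S = Dt {..?t}" using D0 by (simp add: measure_def)
 \<comment> \<open>By orthonormality, the Gram matrices of the two complementary half-lines add up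
   to the identity.\<close>
 have "Dt {..?t} = det_on (\<lambda>i j. (if i = j then 1 else 0) - (\<integral>x. indicator {?t<..} x * (wfun i x * wfun j x) \<partial>lborel)) {..<N}"
  unfolding Dt_def det_mat_eq_det_on[symmetric]
 proof (intro arg_cong[of _ _ det] eq_matI; clarsimp)
  fix i j assume ij: "i < N" "j < N"
  have ii: "integrable lborel (\<lambda>x. indicator T x * (wfun i x * wfun j x))" if "T \<in> sets borel" for T
   using integrable_mult_indicator[OF _ integrable_wfun[OF ij], of T] that by simp
  have "(\<integral>x. indicator {..?t} x * (wfun i x * wfun j x) \<partial>lborel) + (\<integral>x. indicator {?t<..} x * (wfun i x * wfun j x) \<partial>lborel) =
   (\<integral>x. indicator {..?t} x * (wfun i x * wfun j x) + indicator {?t<..} x * (wfun i x * wfun j x) \<partial>lborel)"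
   by (rule Bochner_Integration.integral_add[symmetric]) (simp_all add: ii)
  also have "... = (\<integral>x. wfun i x * wfun j x \<partial>lborel)"
   by (intro Bochner_Integration.integral_cong refl) (auto simp: indicator_def)
  also have "... = (if i = j then 1 else 0)" unfolding wfun_mult using orthonormal[OF ij] by (simp only: has_bochner_integral_iff)
  finally show "(i = j --> (\<integral>x. indicator {..?t} x * (wfun j x * wfun j x) \<partial>lborel) = 1 - (\<integral>x. indicator {?t<..} x * (wfun j x * wfun j x) \<partial>lborel)) \<and>
   (i ~= j --> (\<integral>x. indicator {..?t} x * (wfun i x * wfun j x) \<partial>lborel) = - (\<integral>x. indicator {?t<..} x * (wfun i x * wfun j x) \<partial>lborel))"
   by (auto simp: eq_neg_iff_add_eq_0)
 qed
 then show ?thesis unfolding m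
  using fredholm_det_finite_rank[of N "\<lambda>j x. wfun j x" ?t, OF integrable_wfun] by (simp only:)
qed

end

section \<open>Orthogonal polynomials and the finite kernel\<close>

lemma poly_map_poly_of_real: "poly (map_poly of_real q) (complex_of_real x) = of_real (poly q x)"
 by (induction q) (auto simp: map_poly_pCons)

text \<open>The pairing of polynomials is \<open>wint s N (q * g)\<close>: bilinear, without
  conjugation.\<close>

definition wint :: "complex => nat => complex poly => complex" where
 "wint s N q = (LINT x|lborel. poly q (of_real x) * of_real (w_H s N x))"

lemma re_pos_not_nonpos_Ints: "Re z > 0 ==> z \<notin> \<int>\<^sub>\<le>\<^sub>0"
 by (auto elim!: nonpos_Ints_cases)

text \<open>Degree bounds are expressed by vanishing coefficients here and below. This form also
  covers the bound below degree 0, which singles out the zero polynomial and occurs for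
  \<open>N = 1\<close>.\<close>

lemma coeff_mult_0:
 fixes f g :: "'a::comm_ring_1 poly"
 assumes "\<And>k. k > m ==> coeff f k = 0" "\<And>k. k > n ==> coeff g k = 0" "k > m + n"
 shows "coeff (f * g) k = 0"
proof (rule coeff_eq_0)
 have "Polynomial.degree f <= m" "Polynomial.degree g <= n" using assms by (auto intro: degree_le)
 then show "Polynomial.degree (f * g) < k" using degree_mult_le[of f g] assms(3) by linarith
qed

lemma poly_linear_powers:
 fixes c :: complex and q :: "complex poly"
 assumes "c ~= 0" "\<And>k. k >= n ==> coeff q k = 0"
 shows "\<exists>b. q = (\<Sum>i<n. smult (b i) ([:1, c:] ^ i))"
proof (rule poly_span)
 show "Polynomial.degree ([:1, c:] ^ i) = i" "[:1, c:] ^ i ~= 0" for i using assms(1) by (simp_all add: degree_power_eq)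
qed (use assms in auto)

context
 fixes s :: complex and N :: nat
 assumes s: "Re s > - 1 / 2" and N: "N >= 1"
begin

text \<open>Powers of 1 + ix lower the first exponent of the weight. Degree at most 2N - 2 leaves
  exponents whose real parts add up to at least 2 Re s + 2, which exceeds 1.\<close>

lemma integrable_poly_w:
 fixes q :: "complex poly"
 assumes q: "\<And>k. k >= 2 * N - 1 ==> coeff q k = 0"
 shows "integrable lborel (\<lambda>x. poly q (of_real x) * of_real (w_H s N x))"
proof -
 from poly_linear_powers[of \<i> "2 * N - 1" q] q
 obtain b where b: "q = (\<Sum>i<2 * N - 1. smult (b i) ([:1, \<i>:] ^ i))" by auto
 have "poly q (of_real x) * of_real (w_H s N x) =
  (\<Sum>i<2 * N - 1. b i * cauchy_beta (s + of_nat N - of_nat i) (cnj s + of_nat N) (of_real x))" for x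
  unfolding b w_H_eq_cauchy_beta cauchy_beta_power(1)
  by (simp add: poly_sum sum_distrib_left mult_ac)
 moreover have "integrable lborel (\<lambda>x. \<Sum>i<2 * N - 1. b i * cauchy_beta (s + of_nat N - of_nat i) (cnj s + of_nat N) (of_real x))"
 proof (intro Bochner_Integration.integrable_sum integrable_mult_right integrable_cauchy_beta)
  fix i assume "i \<in> {..<2 * N - 1}"
  then have "real i <= 2 * real N - 2" by (simp add: less_diff_conv)
  then show "Re (s + of_nat N - of_nat i) + Re (cnj s + of_nat N) > 1" using s by simp
 qed
 ultimately show ?thesis by simp
qed

lemma wint_sum:
 assumes "finite A" "\<And>i k. i \<in> A ==> k >= 2 * N - 1 ==> coeff (f i) k = 0"
 shows "wint s N (\<Sum>i\<in>A. smult (c i) (f i)) = (\<Sum>i\<in>A. c i * wint s N (f i))"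
proof -
 have "wint s N (\<Sum>i\<in>A. smult (c i) (f i)) =
  (LINT x|lborel. (\<Sum>i\<in>A. c i * (poly (f i) (of_real x) * of_real (w_H s N x))))"
  unfolding wint_def by (simp add: poly_sum sum_distrib_right mult.assoc)
 also have "... = (\<Sum>i\<in>A. (LINT x|lborel. c i * (poly (f i) (of_real x) * of_real (w_H s N x))))"
  by (rule Bochner_Integration.integral_sum) (intro integrable_mult_right integrable_poly_w assms(2))
 finally show ?thesis by (simp add: wint_def)
qed

lemma wint_lin:
 assumes "\<And>k. k >= 2 * N - 1 ==> coeff f k = 0" "\<And>k. k >= 2 * N - 1 ==> coeff g k = 0"
 shows "wint s N (f + smult c g) = wint s N f + c * wint s N g"
proof -
 have "poly (f + smult c g) (of_real x) * of_real (w_H s N x) =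
  poly f (of_real x) * of_real (w_H s N x) + c * (poly g (of_real x) * of_real (w_H s N x))" for x
  by (simp add: algebra_simps)
 then show ?thesis unfolding wint_def
  using integrable_poly_w[of f] integrable_poly_w[of g] assms by simp
qed

text \<open>The terminating hypergeometric series times (x - i)^n, expanded in powers of 1 + ix by
  means of x - i = -i (1 + ix). Writing it this way displays it as a polynomial.\<close>

definition jac :: "nat => complex => complex => complex poly" where
 "jac n b c = (\<Sum>k\<le>n. smult ((- \<i>) ^ n * (pochhammer (- of_nat n) k * pochhammer b k / (pochhammer c k * fact k) * 2 ^ k)) ([:1, \<i>:] ^ (n - k)))"

lemma poly_jac: "poly (jac n b c) (of_real x) = (of_real x - \<i>) ^ n * hyp2F1 (- of_nat n) b c (2 / (1 + \<i> * of_real x))"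
proof -
 define u where "u = 1 + \<i> * complex_of_real x"
 have u: "u ~= 0" using one_plus_i_real_nz by (simp add: u_def)
 have xi: "of_real x - \<i> = - \<i> * u" by (simp add: u_def algebra_simps)
 have h1: "hyp2F1 (- of_nat n) b c (2 / u) = (\<Sum>k\<le>n. pochhammer (- of_nat n) k * pochhammer b k / (pochhammer c k * fact k) * (2 / u) ^ k)"
  unfolding hyp2F1_def by (rule suminf_finite) (auto simp: pochhammer_of_nat_eq_0_lemma)
 have h2: "(- \<i> * u) ^ n * (\<Sum>k\<le>n. pochhammer (- of_nat n) k * pochhammer b k / (pochhammer c k * fact k) * (2 / u) ^ k) = (\<Sum>k\<le>n. (- \<i>) ^ n * (pochhammer (- of_nat n) k * pochhammer b k / (pochhammer c k * fact k) * 2 ^ k) * u ^ (n - k))"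
  unfolding sum_distrib_left
 proof (rule sum.cong[OF refl])
  fix k assume "k \<in> {..n}"
  then have "u ^ n = u ^ (n - k) * u ^ k" by (simp flip: power_add)
  then have "u ^ n * (2 / u) ^ k = 2 ^ k * u ^ (n - k)" using u by (simp add: power_divide)
  note r = this
  have c: "(- \<i> * u) ^ n * (a * (2 / u) ^ k) = (- \<i>) ^ n * a * (u ^ n * (2 / u) ^ k)" for a
   unfolding power_mult_distrib[of "- \<i>" u] by (simp only: mult_ac)
  show "(- \<i> * u) ^ n * (pochhammer (- of_nat n) k * pochhammer b k / (pochhammer c k * fact k) * (2 / u) ^ k) =
   (- \<i>) ^ n * (pochhammer (- of_nat n) k * pochhammer b k / (pochhammer c k * fact k) * 2 ^ k) * u ^ (n - k)"
   unfolding c r by (simp only: mult_ac)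
 qed
 show ?thesis unfolding u_def[symmetric] xi h1 h2 jac_def poly_sum
  by (rule sum.cong[OF refl]) (simp add: u_def mult.commute)
qed

lemma jac_coeff: "k > n ==> coeff (jac n b c) k = 0" "coeff (jac n b c) n = 1"
proof -
 have d: "Polynomial.degree ([:1, \<i>:] ^ j) = j" for j by (simp add: degree_power_eq)
 show "coeff (jac n b c) k = 0" if "k > n"
  unfolding jac_def coeff_sum by (intro sum.neutral ballI) (use that in \<open>auto intro!: coeff_eq_0 simp: d\<close>)
 have l: "coeff ([:1, \<i>:] ^ n) n = \<i> ^ n" using lead_coeff_power[of "[:1, \<i>:]" n] by (simp add: d)
 have "coeff (jac n b c) n = (\<Sum>k\<le>n. if k = 0 then 1 else 0)"
  unfolding jac_def coeff_sum
  by (intro sum.cong refl) (auto simp: l coeff_eq_0 d power_mult_distrib[symmetric])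
 then show "coeff (jac n b c) n = 1" by simp
qed

text \<open>The factor (1 - ix)^m lowers one exponent of the weight and each term of
  \<open>jac\<close> the other, so beta integrals result. Their Gamma factors and powers of 2 cancel
  (b)_k and 2^k, and what remains is the sum 2F1[-n, d, c; 1] of Chu and Vandermonde. Both families
  satisfy the first hypothesis: n + b = N + s.\<close>

lemma wint_jac:
 assumes b: "s + of_nat N = b + of_nat n" and m: "Re b + Re s + real N - real m > 1"
  and c: "\<And>i. i < n ==> c ~= - of_nat i" and q: "q = cnj s + of_nat N - of_nat m" and d: "d = b + q - 1"
 shows "wint s N (jac n b c * [:1, -\<i>:] ^ m) =
  (- \<i>) ^ n * (of_real pi * 2 powr (2 - b - q) * Gamma d * rGamma b * rGamma q) * (pochhammer (c - d) n / pochhammer c n)"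
proof -
 let ?k = "(- \<i>) ^ n * (of_real pi * 2 powr (2 - b - q) * Gamma d * rGamma b * rGamma q)"
 let ?I = "\<lambda>k. cauchy_beta_int (b + of_nat k) q"
 have red: "Re d > 0" using m by (simp add: d q)
 then have dn: "d \<notin> \<int>\<^sub>\<le>\<^sub>0" by (rule re_pos_not_nonpos_Ints)
 let ?c = "\<lambda>k. (- \<i>) ^ n * (pochhammer (- of_nat n) k * pochhammer b k / (pochhammer c k * fact k) * 2 ^ k)"
 have pw: "poly (jac n b c * [:1, -\<i>:] ^ m) (of_real x) * of_real (w_H s N x) =
  (\<Sum>k\<le>n. ?c k * cauchy_beta (b + of_nat k) q (of_real x))" for x
 proof -
  have "cauchy_beta (b + of_nat k) q (of_real x) = (1 + \<i> * of_real x) ^ (n - k) * ((1 - \<i> * of_real x) ^ m * of_real (w_H s N x))" if "k <= n" for k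
  proof -
   have "b + of_nat k = s + of_nat N - of_nat (n - k)" using b that by (simp add: of_nat_diff algebra_simps)
   then show ?thesis unfolding q w_H_eq_cauchy_beta cauchy_beta_power by (simp only: cauchy_beta_power) (simp only: mult_ac)
  qed
  then show ?thesis by (simp add: jac_def poly_sum sum_distrib_left mult_ac)
 qed
 have "wint s N (jac n b c * [:1, -\<i>:] ^ m) = (\<Sum>k\<le>n. ?c k * ?I k)"
  unfolding wint_def pw cauchy_beta_int_def
  by (subst Bochner_Integration.integral_sum) (use m in \<open>auto simp: q intro!: integrable_mult_right integrable_cauchy_beta\<close>)
 also have "... = (\<Sum>k\<le>n. ?k *
  (pochhammer d k * pochhammer (- of_nat n) k / (of_nat (fact k) * pochhammer c k)))"
 proof (rule sum.cong[OF refl])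
  fix k assume "k \<in> {..n}"
  have dk: "Re (d + of_nat k) > 0" using red by simp
  then have dkn: "d + of_nat k \<notin> \<int>\<^sub>\<le>\<^sub>0" by (rule re_pos_not_nonpos_Ints)
  then have rg: "rGamma (d + of_nat k) * Gamma (d + of_nat k) = 1" by (simp add: Gamma_def rGamma_eq_zero_iff)
  have p2: "2 powr (b + of_nat k + q - 2) * (2 powr (2 - b - q) / 2 ^ k) = 1"
   by (simp add: powr_def exp_add exp_diff algebra_simps exp_of_nat_mult)
  have "?I k * rGamma (d + of_nat k) * 2 powr (b + of_nat k + q - 2) = of_real pi * rGamma (b + of_nat k) * rGamma q"
   using cauchy_beta_integral[of "b + of_nat k" q] m by (simp add: q d algebra_simps)
  note h = this
  have "?I k = ?I k * (rGamma (d + of_nat k) * Gamma (d + of_nat k)) *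
   (2 powr (b + of_nat k + q - 2) * (2 powr (2 - b - q) / 2 ^ k))" unfolding rg p2 by simp
  also have "... = (?I k * rGamma (d + of_nat k) * 2 powr (b + of_nat k + q - 2)) *
   (Gamma (d + of_nat k) * (2 powr (2 - b - q) / 2 ^ k))" by (simp only: mult_ac)
  finally have I: "?I k = of_real pi * rGamma (b + of_nat k) * rGamma q * Gamma (d + of_nat k) * (2 powr (2 - b - q) / 2 ^ k)"
   unfolding h by (simp only: mult.assoc)
  have G: "Gamma (d + of_nat k) = Gamma d * pochhammer d k"
   using pochhammer_Gamma[OF dn, of k] dn by (simp add: Gamma_eq_zero_iff)
  show "?c k * ?I k = ?k *
  (pochhammer d k * pochhammer (- of_nat n) k / (of_nat (fact k) * pochhammer c k))"
   unfolding I G pochhammer_rGamma[of b k] by (simp add: mult_ac)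
 qed
 also have "... = ?k * (pochhammer (c - d) n / pochhammer c n)"
  unfolding sum_distrib_left[symmetric] using Vandermonde_pochhammer[of n c d] c by (simp add: atMost_atLeast0)
 finally show ?thesis .
qed

abbreviation "pP \<equiv> jac (N - 1) (s + 1) (2 * of_real (Re s) + 2)"
abbreviation "ptP \<equiv> jac N s (2 * of_real (Re s) + 1)"

lemma p_N1_poly: "p_N1 s N x = poly pP (of_real x)"
 unfolding p_N1_def poly_jac ..

lemma p_tilde_poly: "p_tilde s N x = poly ptP (of_real x)"
 unfolding p_tilde_def poly_jac ..

lemma re_pos_not_neg_nat: "Re c > 0 ==> c ~= - of_nat i"
 by auto

text \<open>Here c - d = -(N - 2 - m) is a nonpositive integer of modulus below N - 1, so its
  Pochhammer symbol contains the factor 0.\<close>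

lemma wint_pP_low:
 assumes "Suc m < N"
 shows "wint s N (pP * [:1, -\<i>:] ^ m) = 0"
proof -
 define d where "d = s + 1 + (cnj s + of_nat N - of_nat m) - 1"
 have "wint s N (pP * [:1, -\<i>:] ^ m) = (- \<i>) ^ (N - 1) * (of_real pi * 2 powr (2 - (s + 1) - (cnj s + of_nat N - of_nat m)) *
  Gamma d * rGamma (s + 1) * rGamma (cnj s + of_nat N - of_nat m)) * (pochhammer (2 * of_real (Re s) + 2 - d) (N - 1) / pochhammer (2 * of_real (Re s) + 2) (N - 1))"
  by (rule wint_jac[OF _ _ _ refl d_def]) (use s N assms in \<open>auto simp: of_nat_diff intro!: re_pos_not_neg_nat\<close>)
 moreover have "2 * of_real (Re s) + 2 - d = - of_nat (N - 2 - m)"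
  using assms by (simp add: d_def of_nat_diff complex_eq_iff)
 moreover have "pochhammer (- of_nat (N - 2 - m)) (N - 1) = (0 :: complex)"
  using assms by (intro pochhammer_of_nat_eq_0_lemma) auto
 ultimately show ?thesis by simp
qed

lemma wint_ptP_low:
 assumes "Suc m < N"
 shows "wint s N (ptP * [:1, -\<i>:] ^ m) = 0"
proof -
 define d where "d = s + (cnj s + of_nat N - of_nat m) - 1"
 have "wint s N (ptP * [:1, -\<i>:] ^ m) = (- \<i>) ^ N * (of_real pi * 2 powr (2 - s - (cnj s + of_nat N - of_nat m)) *
  Gamma d * rGamma s * rGamma (cnj s + of_nat N - of_nat m)) * (pochhammer (2 * of_real (Re s) + 1 - d) N / pochhammer (2 * of_real (Re s) + 1) N)"
  by (rule wint_jac[OF _ _ _ refl d_def]) (use s N assms in \<open>auto simp: of_nat_diff intro!: re_pos_not_neg_nat\<close>)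
 moreover have "2 * of_real (Re s) + 1 - d = - of_nat (N - 2 - m)"
  using assms by (simp add: d_def of_nat_diff complex_eq_iff)
 moreover have "pochhammer (- of_nat (N - 2 - m)) N = (0 :: complex)"
  using assms by (intro pochhammer_of_nat_eq_0_lemma) auto
 ultimately show ?thesis by simp
qed

text \<open>For m = N - 1 the difference c - d equals 1, whose Pochhammer symbol is (N - 1)!. The
  Gamma factors of \<open>C_N\<close> are exactly those that cancel the rest.\<close>

lemma wint_pP_top: "C_N s N * wint s N (pP * [:1, -\<i>:] ^ (N - 1)) = (- \<i>) ^ (N - 1)"
proof -
 let ?a = "complex_of_real (Re s)"
 have "wint s N (pP * [:1, -\<i>:] ^ (N - 1)) = (- \<i>) ^ (N - 1) * (of_real pi * 2 powr (2 - (s + 1) - (cnj s + 1)) *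
  Gamma (2 * ?a + 1) * rGamma (s + 1) * rGamma (cnj s + 1)) * (pochhammer (2 * ?a + 2 - (2 * ?a + 1)) (N - 1) / pochhammer (2 * ?a + 2) (N - 1))"
  by (rule wint_jac) (use s N in \<open>auto simp: of_nat_diff complex_eq_iff intro!: re_pos_not_neg_nat\<close>)
 moreover have "2 - (s + 1) - (cnj s + 1) = - of_real (2 * Re s)" by (simp add: complex_eq_iff)
 moreover have "2 * ?a + 2 - (2 * ?a + 1) = 1" by simp
 ultimately have w: "wint s N (pP * [:1, -\<i>:] ^ (N - 1)) = (- \<i>) ^ (N - 1) * (of_real pi * 2 powr (- of_real (2 * Re s)) *
  Gamma (2 * ?a + 1) * rGamma (s + 1) * rGamma (cnj s + 1)) * (fact (N - 1) / pochhammer (2 * ?a + 2) (N - 1))"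
  by (simp only: pochhammer_fact[symmetric])
 note nn = re_pos_not_nonpos_Ints
 have g0: "Gamma (2 * ?a + 1) ~= 0" "Gamma (2 * ?a + 2) ~= 0" "Gamma (s + 1) ~= 0" "Gamma (cnj s + 1) ~= 0"
  unfolding Gamma_eq_zero_iff using s by (intro nn; simp)+
 have "pochhammer (2 * ?a + 2) (N - 1) = Gamma (2 * ?a + 2 + of_nat (N - 1)) / Gamma (2 * ?a + 2)"
  by (rule pochhammer_Gamma) (use s in \<open>intro nn; simp\<close>)
 moreover have "2 * ?a + 2 + of_nat (N - 1) = 2 * ?a + of_nat N + 1" using N by (simp add: of_nat_diff)
 ultimately have po: "pochhammer (2 * ?a + 2) (N - 1) = Gamma (2 * ?a + of_nat N + 1) / Gamma (2 * ?a + 2)" by (simp only:)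
 have g1: "Gamma (2 * ?a + of_nat N + 1) ~= 0" unfolding Gamma_eq_zero_iff using s N by (intro nn) simp
 have gn: "Gamma (of_nat N) = (fact (N - 1) :: complex)" using N Gamma_fact[of "N - 1", where 'a = complex] by (simp add: of_nat_diff)
 have rg: "rGamma z = 1 / Gamma z" for z :: complex by (simp add: Gamma_def divide_inverse)
 have p2: "complex_of_real (2 powr (2 * Re s)) * 2 powr (- of_real (2 * Re s)) = 1"
  using powr_of_real[of 2 "2 * Re s"] by (simp add: powr_minus)
 have "C_N s N * wint s N (pP * [:1, -\<i>:] ^ (N - 1)) =
  (- \<i>) ^ (N - 1) * (complex_of_real (2 powr (2 * Re s)) * 2 powr (- of_real (2 * Re s)))"
  unfolding w po C_N_def gn rg using g0 g1 by (simp add: divide_simps)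
 then show ?thesis unfolding p2 by simp
qed

text \<open>Serves both pairings: degree N against degree at most N - 2, and, for
  \<open>n = N\<close>, degree N - 1 against degree N - 1. In either case the product has degree at
  most 2N - 2.\<close>

lemma mult_v_span:
 assumes q: "\<And>k. k > N ==> coeff q k = 0" "n <= N" "\<And>k. k >= n ==> coeff g k = 0" "n = N ==> coeff q N = 0"
 shows "\<exists>b. g = (\<Sum>i<n. smult (b i) ([:1, -\<i>:] ^ i)) \<and>
  wint s N (q * g) = (\<Sum>i<n. b i * wint s N (q * [:1, -\<i>:] ^ i))"
proof -
 from poly_linear_powers[of "- \<i>" n g] assms(3)
 obtain b where b: "g = (\<Sum>i<n. smult (b i) ([:1, -\<i>:] ^ i))" by auto
 have "wint s N (q * g) = wint s N (\<Sum>i<n. smult (b i) (q * [:1, -\<i>:] ^ i))"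
  unfolding b by (simp add: sum_distrib_left)
 also have "... = (\<Sum>i<n. b i * wint s N (q * [:1, -\<i>:] ^ i))"
 proof (rule wint_sum)
  fix i k assume i: "i \<in> {..<n}" and k: "2 * N - 1 <= k"
  have v: "coeff ([:1, -\<i>:] ^ i) k = 0" if "k > i" for k using that by (intro coeff_eq_0) (simp add: degree_power_eq)
  show "coeff (q * [:1, -\<i>:] ^ i) k = 0"
  proof (cases "n = N")
   case True
   have "coeff q k = 0" if "k > N - 1" for k using assms(1)[of k] assms(4)[OF True] that by (cases "k = N") auto
   then show ?thesis by (rule coeff_mult_0[OF _ v]) (use i k N True in auto)
  next
   case False
   then show ?thesis by (intro coeff_mult_0[OF q(1) v]) (use i k N q(2) in auto)
  qed
 qed simp
 finally show ?thesis using b by blast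
qed

lemma wint_ptP_zero:
 assumes "\<And>k. k >= N - 1 ==> coeff g k = 0"
 shows "wint s N (ptP * g) = 0"
proof -
 from mult_v_span[of ptP "N - 1" g] assms N jac_coeff(1)
 obtain b where "wint s N (ptP * g) = (\<Sum>i<N - 1. b i * wint s N (ptP * [:1, -\<i>:] ^ i))" by auto
 then show ?thesis by (simp add: wint_ptP_low less_diff_conv)
qed

text \<open>Only the highest power of 1 - ix survives, and its leading coefficient (-i)^(N-1) is the
  value found in \<open>wint_pP_top\<close>. Thus \<open>C_N\<close> times the pairing with
  \<open>pP\<close> reads off the top coefficient.\<close>

lemma wint_pP:
 assumes "\<And>k. k >= N ==> coeff g k = 0"
 shows "C_N s N * wint s N (pP * g) = coeff g (N - 1)"
proof -
 have d: "Polynomial.degree ([:1, -\<i>:] ^ j) = j" for j by (simp add: degree_power_eq)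
 from mult_v_span[of pP N g] assms N jac_coeff(1)[of "N - 1"]
 obtain b where g: "g = (\<Sum>i<N. smult (b i) ([:1, -\<i>:] ^ i))"
  and w: "wint s N (pP * g) = (\<Sum>i<N. b i * wint s N (pP * [:1, -\<i>:] ^ i))" by auto
 have "(\<Sum>i<N. b i * wint s N (pP * [:1, -\<i>:] ^ i)) = (\<Sum>i<Suc (N - 1). b i * wint s N (pP * [:1, -\<i>:] ^ i))" using N by simp
 also have "... = b (N - 1) * wint s N (pP * [:1, -\<i>:] ^ (N - 1))"
 proof -
  have "(\<Sum>i<N - 1. b i * wint s N (pP * [:1, -\<i>:] ^ i)) = 0"
   by (intro sum.neutral ballI) (simp only: lessThan_iff less_diff_conv add_Suc_right add_0_right One_nat_def[symmetric] wint_pP_low Suc_eq_plus1 mult_zero_right)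
  then show ?thesis by (simp only: sum.lessThan_Suc add_0)
 qed
 finally have 1: "C_N s N * wint s N (pP * g) = b (N - 1) * (- \<i>) ^ (N - 1)"
  unfolding w using wint_pP_top by (simp add: mult.left_commute)
 have "coeff g (N - 1) = (\<Sum>i<Suc (N - 1). b i * coeff ([:1, -\<i>:] ^ i) (N - 1))" using N by (subst g) (simp add: coeff_sum)
 also have "... = b (N - 1) * coeff ([:1, -\<i>:] ^ (N - 1)) (N - 1)" by (simp add: coeff_eq_0 d)
 also have "coeff ([:1, -\<i>:] ^ (N - 1)) (N - 1) = (- \<i>) ^ (N - 1)" using lead_coeff_power[of "[:1, -\<i>:]" "N - 1"] by (simp add: d)
 finally show ?thesis using 1 by simp
qed

end

section \<open>Existence of the orthonormal polynomials\<close>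

lemma integrable_real_poly_w:
 fixes q :: "real poly"
 assumes "Re s > - 1 / 2" "N >= 1" and q: "\<And>k. k >= 2 * N - 1 ==> coeff q k = 0"
 shows "integrable lborel (\<lambda>x. poly q x * w_H s N x)"
proof -
 have "integrable lborel (\<lambda>x. poly (map_poly of_real q) (complex_of_real x) * of_real (w_H s N x))"
  by (rule integrable_poly_w[OF assms(1,2)]) (simp add: coeff_map_poly q)
 then show ?thesis unfolding poly_map_poly_of_real of_real_mult[symmetric] complex_of_real_integrable_eq .
qed

lemma wint_of_real: "wint s N (map_poly of_real q) = of_real (\<integral>x. poly q x * w_H s N x \<partial>lborel)"
 unfolding wint_def poly_map_poly_of_real of_real_mult[symmetric] integral_complex_of_real ..

lemma weighted_square_pos:
 fixes q :: "real poly"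
 assumes i: "integrable lborel (\<lambda>x. poly (q * q) x * w_H s N x)" and q: "q ~= 0"
 shows "(\<integral>x. poly (q * q) x * w_H s N x \<partial>lborel) > 0"
proof -
 let ?I = "\<integral>x. poly (q * q) x * w_H s N x \<partial>lborel"
 have nn: "0 <= poly (q * q) x * w_H s N x" for x using w_H_pos[of s N x] by simp
 have "?I ~= 0"
 proof
  assume "?I = 0"
  then have "AE x in lborel. poly (q * q) x * w_H s N x = 0"
   using integral_nonneg_eq_0_iff_AE[OF i] nn by simp
  moreover have "AE x in lborel. x \<notin> {x. poly q x = 0}"
   by (rule AE_not_in) (use poly_roots_finite[OF q] in \<open>simp add: finite_imp_null_set_lborel\<close>)
  ultimately have "AE x in lborel. poly (q * q) x * w_H s N x = 0 \<and> x \<notin> {x. poly q x = 0}" by (rule AE_conjI)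
  then have "AE x in (lborel :: real measure). False"
   by (rule eventually_mono) (use w_H_pos[of s N] in \<open>auto simp: less_le\<close>)
  then have "ae_filter (lborel :: real measure) = bot" by (simp add: trivial_limit_def)
  then show False by (simp add: ae_filter_eq_bot_iff)
 qed
 moreover have "?I >= 0" by (rule Bochner_Integration.integral_nonneg) (rule nn)
 ultimately show ?thesis by simp
qed

text \<open>Gram-Schmidt on the monomials, stopped at degree N - 1, so that every product involved
  is integrable. The norms are positive since a polynomial has finitely many roots and the weight is
  positive.\<close>

lemma orthonormal_polys_exist:
 assumes s: "Re s > - 1 / 2" and N: "N >= 1"
 shows "\<exists>e. orthonormal_polys s N e"
proof -
 define ip where "ip q = (\<integral>x. poly q x * w_H s N x \<partial>lborel)" for q :: "real poly"
 have int: "integrable lborel (\<lambda>x. poly (f * g) x * w_H s N x)"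
  if "Polynomial.degree f < N" "Polynomial.degree g < N" for f g
  by (rule integrable_real_poly_w[OF s N])
   (use that degree_mult_le[of f g] in \<open>intro coeff_eq_0, linarith\<close>)
 have "\<exists>e. (\<forall>j<n. Polynomial.degree (e j) = j \<and> e j ~= 0) \<and> (\<forall>i<n. \<forall>j<n. ip (e i * e j) = (if i = j then 1 else 0))" if "n <= N" for n
  using that
 proof (induction n)
  case (Suc n)
  then obtain e where e: "\<And>j. j < n ==> Polynomial.degree (e j) = j \<and> e j ~= 0"
   and o: "\<And>i j. i < n ==> j < n ==> ip (e i * e j) = (if i = j then 1 else 0)" by auto
  define q where "q = monom 1 n - (\<Sum>j<n. smult (ip (monom 1 n * e j)) (e j))"
  let ?t = "\<lambda>i j x. ip (monom 1 n * e j) * (poly (e j * e i) x * w_H s N x)"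
  have cq: "coeff q k = (if k = n then 1 else 0)" if "k >= n" for k
   unfolding q_def using that e by (auto simp: coeff_sum coeff_eq_0 intro!: sum.neutral)
  have q0: "q ~= 0" using cq[of n] by auto
  have dq: "Polynomial.degree q = n"
   by (rule antisym[OF degree_le le_degree]) (use cq[of n] cq in auto)
  have qe: "ip (q * e i) = 0" if i: "i < n" for i
  proof -
   have ii: "integrable lborel (\<lambda>x. poly (monom 1 n * e i) x * w_H s N x)" "\<And>j. j < n ==> integrable lborel (\<lambda>x. poly (e j * e i) x * w_H s N x)"
    using e i Suc.prems by (auto intro!: int simp: degree_monom_eq simp del: poly_mult)
   have "poly (q * e i) x * w_H s N x = poly (monom 1 n * e i) x * w_H s N x - (\<Sum>j<n. ?t i j x)" for x
    by (simp add: q_def poly_sum left_diff_distrib sum_distrib_right mult.assoc)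
   then have "ip (q * e i) = (\<integral>x. poly (monom 1 n * e i) x * w_H s N x - (\<Sum>j<n. ?t i j x) \<partial>lborel)"
    unfolding ip_def by simp
   also have "... = ip (monom 1 n * e i) - (\<integral>x. (\<Sum>j<n. ?t i j x) \<partial>lborel)"
    unfolding ip_def by (rule Bochner_Integration.integral_diff) (intro ii Bochner_Integration.integrable_sum integrable_mult_right; simp)+
   also have "(\<integral>x. (\<Sum>j<n. ?t i j x) \<partial>lborel) = (\<Sum>j<n. (\<integral>x. ?t i j x \<partial>lborel))"
    by (rule Bochner_Integration.integral_sum) (intro ii integrable_mult_right; simp)
   also have "... = (\<Sum>j<n. ip (monom 1 n * e j) * ip (e j * e i))" unfolding ip_def by simp
   also have "... = (\<Sum>j<n. if j = i then ip (monom 1 n * e j) else 0)" by (intro sum.cong refl) (simp add: o i)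
   finally show ?thesis using i by simp
  qed
  have qq: "ip (q * q) > 0" unfolding ip_def
   by (rule weighted_square_pos[OF int q0]) (use dq Suc.prems in auto)
  define r where "r = 1 / sqrt (ip (q * q))"
  define e' where "e' = e(n := smult r q)"
  have r: "r ~= 0" "r * (r * ip (q * q)) = 1"
   using qq by (simp_all add: r_def mult.assoc[symmetric] power2_eq_square[symmetric] power_divide)
  have sm: "ip (smult r q * f) = r * ip (q * f)" "ip (f * smult r q) = r * ip (q * f)" for f
  proof -
   have sm0: "poly (smult r q * f) x * w_H s N x = r * (poly (q * f) x * w_H s N x)"
    "poly (f * smult r q) x * w_H s N x = r * (poly (q * f) x * w_H s N x)" for x by simp_all
   show "ip (smult r q * f) = r * ip (q * f)" "ip (f * smult r q) = r * ip (q * f)"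
    unfolding ip_def sm0 by (rule integral_mult_right_zero)+
  qed
  have "\<forall>j<Suc n. Polynomial.degree (e' j) = j \<and> e' j ~= 0" using e dq q0 r by (auto simp: e'_def less_Suc_eq)
  moreover have "\<forall>i<Suc n. \<forall>j<Suc n. ip (e' i * e' j) = (if i = j then 1 else 0)"
   using o qe r sm by (auto simp: e'_def less_Suc_eq)
  ultimately show ?case by blast
 qed simp
 from this[of N] obtain e where e: "\<And>j. j < N ==> Polynomial.degree (e j) = j \<and> e j ~= 0"
  and o: "\<And>i j. i < N ==> j < N ==> ip (e i * e j) = (if i = j then 1 else 0)" by auto
 have "orthonormal_polys s N e"
 proof
  fix i j assume ij: "i < N" "j < N"
  then have "integrable lborel (\<lambda>x. poly (e i * e j) x * w_H s N x)" using e by (intro int) auto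
  then show "has_bochner_integral lborel (\<lambda>x. poly (e i) x * poly (e j) x * w_H s N x) (if i = j then 1 else 0)"
   unfolding has_bochner_integral_iff using o[OF ij] by (simp add: ip_def)
 qed (use e in auto)
 then show ?thesis by blast
qed

section \<open>The Christoffel-Darboux formula for the kernel\<close>

context orthonormal_polys
begin

abbreviation E :: "nat => complex poly" where "E j \<equiv> map_poly of_real (e j)"

lemma map_poly_of_real_mult: "map_poly complex_of_real (p * q) = map_poly of_real p * map_poly of_real q"
 by (intro poly_eqI) (simp add: coeff_map_poly coeff_mult)

lemma wint_E: "i < N ==> j < N ==> wint s N (E i * E j) = (if i = j then 1 else 0)"
 unfolding map_poly_of_real_mult[symmetric] wint_of_real
 using orthonormal[of i j] by (simp add: has_bochner_integral_iff)

lemma coeff_E: "j < N ==> k > j ==> coeff (E j) k = 0"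
 using degree_e[of j] by (simp add: coeff_map_poly coeff_eq_0)

context
 assumes s: "Re s > - 1 / 2" and N: "N >= 1"
begin

lemma E_expansion:
 assumes g: "\<And>k. k >= N ==> coeff g k = 0"
 shows "g = (\<Sum>j<N. smult (wint s N (g * E j)) (E j))"
proof -
 have "\<exists>b. g = (\<Sum>j<N. smult (b j) (E j))"
  by (rule poly_span) (use degree_e e_nonzero g in \<open>auto simp: degree_map_poly map_poly_eq_0_iff\<close>)
 then obtain b where b: "g = (\<Sum>j<N. smult (b j) (E j))" by blast
 have "wint s N (g * E i) = b i" if i: "i < N" for i
 proof -
  have "wint s N (g * E i) = wint s N (\<Sum>j<N. smult (b j) (E j * E i))" unfolding b by (simp add: sum_distrib_right)
  also have "... = (\<Sum>j<N. b j * wint s N (E j * E i))"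
  proof (rule wint_sum[OF s N])
   fix j k assume j: "j \<in> {..<N}" and "2 * N - 1 <= k"
   then show "coeff (E j * E i) k = 0"
    by (intro coeff_mult_0[where m = j and n = i] coeff_E) (use i in auto)
  qed simp
  also have "... = (\<Sum>j<N. if j = i then b j else 0)" by (intro sum.cong refl) (simp add: wint_E i)
  finally show ?thesis using i by simp
 qed
 then show ?thesis by (subst b) simp
qed

abbreviation "p \<equiv> pP s N"
abbreviation "pt \<equiv> ptP s N"
abbreviation "S y \<equiv> (\<Sum>j<N. smult (of_real (poly (e j) y)) (E j))"

lemma N_less: "N - 1 < N" "Suc (N - 1) = N" using N by auto

lemma orthogonal_top:
 assumes "\<And>k. k >= N ==> coeff r k = 0" "\<And>g. (\<And>k. k >= N - 1 ==> coeff g k = 0) ==> wint s N (r * g) = 0"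
 shows "r = smult (wint s N (r * E (N - 1))) (E (N - 1))"
proof -
 have "r = (\<Sum>j<Suc (N - 1). smult (wint s N (r * E j)) (E j))"
  unfolding N_less by (rule E_expansion[OF assms(1)])
 moreover have "wint s N (r * E j) = 0" if "j < N - 1" for j
  by (rule assms(2), rule coeff_E) (use that in auto)
 ultimately show ?thesis by simp
qed

lemma lead_e: "coeff (e (N - 1)) (N - 1) ~= 0"
 using degree_e[OF N_less(1)] e_nonzero[OF N_less(1)] by (metis leading_coeff_0_iff)

lemma coeff_p: "k >= N ==> coeff p k = 0" "coeff p (N - 1) = 1"
 using jac_coeff(1)[OF s N, of "N - 1" k] jac_coeff(2)[OF s N] N by auto

text \<open>Orthogonality to all lower degrees makes \<open>p\<close> proportional to the last
  orthonormal polynomial. Comparing leading coefficients with the value of the pairing in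
  \<open>wint_pP\<close> identifies the constant as a squared leading coefficient.\<close>

lemma C_N_E:
 defines "l \<equiv> complex_of_real (coeff (e (N - 1)) (N - 1))"
 shows "C_N s N = l\<^sup>2" "E (N - 1) = smult l p"
proof -
 have l0: "l ~= 0" using lead_e by (simp add: l_def)
 have cl: "C_N s N * wint s N (p * E (N - 1)) = l"
  using wint_pP[OF s N, of "E (N - 1)"] coeff_E[OF N_less(1)] N by (simp add: l_def coeff_map_poly)
 have "wint s N (p * g) = 0" if "\<And>k. k >= N - 1 ==> coeff g k = 0" for g
 proof -
  have "C_N s N * wint s N (p * g) = 0" using wint_pP[OF s N, of g] that by simp
  moreover have "C_N s N ~= 0" using cl l0 by auto
  ultimately show ?thesis by simp
 qed
 from orthogonal_top[OF coeff_p(1) this]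
 have pe: "p = smult (wint s N (p * E (N - 1))) (E (N - 1))" by blast
 from arg_cong[OF pe, of "\<lambda>q. coeff q (N - 1)"]
 have 1: "1 = wint s N (p * E (N - 1)) * l" using coeff_p(2) by (simp add: l_def coeff_map_poly)
 show "C_N s N = l\<^sup>2" using cl 1 by (metis mult.assoc mult.right_neutral power2_eq_square)
 have "smult l p = smult (l * wint s N (p * E (N - 1))) (E (N - 1))"
  using arg_cong[OF pe, of "smult l"] by simp
 then show "E (N - 1) = smult l p" using 1 by (simp add: mult.commute)
qed

text \<open>Removing the multiple of \<open>pt\<close> from (x - y) S y leaves a remainder
  orthogonal to all degrees below N - 1, hence a multiple c(y) of \<open>p\<close>. The value of
  c(y) is then forced by the symmetry of the sum in its two points.\<close>

lemma christoffel_darboux: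
 "[:- of_real y, 1:] * S y =
  smult (C_N s N) (smult (poly p (of_real y)) pt - smult (poly pt (of_real y)) p)"
proof -
 let ?L = "\<lambda>y. [:- of_real y, 1:] * S y"
 let ?M = "\<lambda>y. smult (C_N s N * poly p (of_real y)) pt"
 define l where "l = complex_of_real (coeff (e (N - 1)) (N - 1))"
 have cS: "coeff (S y) k = 0" if "k >= N" for k y
  unfolding coeff_sum using that by (intro sum.neutral ballI) (simp add: coeff_map_poly coeff_eq_0 degree_e)
 have cS1: "coeff (S y) (N - 1) = of_real (poly (e (N - 1)) y) * l" for y
 proof -
  have "coeff (S y) (N - 1) = (\<Sum>j<Suc (N - 1). of_real (poly (e j) y) * coeff (E j) (N - 1))"
   unfolding N_less by (simp add: coeff_sum)
  also have "... = of_real (poly (e (N - 1)) y) * coeff (E (N - 1)) (N - 1)" by (simp add: coeff_map_poly coeff_eq_0 degree_e)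
  finally show ?thesis by (simp add: l_def coeff_map_poly)
 qed
 have cf: "coeff (?L y) k = (case k of 0 => 0 | Suc k' => coeff (S y) k') - of_real y * coeff (S y) k" for k y
  by (simp add: coeff_pCons split: nat.split)
 have "\<exists>c. ?L y = ?M y + smult c p" for y
 proof -
  define r where "r = ?L y + smult (- (C_N s N * poly p (of_real y))) pt"
  have Ey: "of_real (poly (e (N - 1)) y) = l * poly p (of_real y)"
   using arg_cong[OF C_N_E(2), of "\<lambda>q. poly q (of_real y)"] by (simp add: poly_map_poly_of_real l_def)
  have "coeff r k = 0" if kN: "k >= N" for k
  proof (cases "k = N")
   case True
   \<comment> \<open>The coefficient of x^N in (x - y) S y is l^2 p(y). As \<open>pt\<close> is
     monic and \<open>C_N\<close> equals l^2, the top terms cancel.\<close>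
   have "coeff (?L y) (Suc (N - 1)) = coeff (S y) (N - 1) - of_real y * coeff (S y) (Suc (N - 1))"
    unfolding cf by (simp only: nat.case)
   then have cN: "coeff (?L y) N = l * poly p (of_real y) * l"
    unfolding N_less(2) cS1 Ey cS[OF order_refl] by (simp only: mult_zero_right diff_0_right)
   show ?thesis unfolding True r_def coeff_add coeff_smult cN jac_coeff(2)[OF s N] C_N_E(1)[folded l_def]
    by (simp only: power2_eq_square) (simp add: mult_ac)
  next
   case False
   define k' where "k' = k - 1"
   have k: "k = Suc k'" "N <= k'" using kN False N unfolding k'_def by linarith+
   have pt0: "coeff pt k = 0" using k by (intro jac_coeff(1)[OF s N]) simp
   have c2: "coeff (S y) k = 0" using k by (intro cS) simp
   have "coeff (?L y) k = coeff (S y) k' - of_real y * coeff (S y) k"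
    unfolding cf unfolding k(1) by (simp only: nat.case)
   then have ck: "coeff (?L y) k = 0" unfolding c2 cS[OF k(2)] by (simp only: mult_zero_right diff_0_right)
   show ?thesis unfolding r_def coeff_add coeff_smult ck pt0 by simp
  qed
  moreover have "wint s N (r * g) = 0" if g: "\<And>k. k >= N - 1 ==> coeff g k = 0" for g
  proof -
   \<comment> \<open>The sum \<open>S y\<close> reproduces the value of \<open>h\<close> at
     \<open>y\<close>, and this value is 0. The pairing of \<open>pt\<close> with \<open>g\<close>
     vanishes by \<open>wint_ptP_zero\<close>.\<close>
   define h where "h = [:- of_real y, 1:] * g"
   have ch: "coeff h k = 0" if "k >= N" for k
    unfolding h_def using that g[of k] g[of "k - 1"] N by (auto simp: coeff_pCons split: nat.split)
   have "S y * h = (\<Sum>j<N. smult (of_real (poly (e j) y)) (E j * h))"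
    by (simp only: sum_distrib_right mult_smult_left)
   moreover have "r * g = S y * h + smult (- (C_N s N * poly p (of_real y))) (pt * g)"
    unfolding r_def h_def distrib_right mult_smult_left by (simp only: mult_ac)
   ultimately have eq: "r * g = (\<Sum>j<N. smult (of_real (poly (e j) y)) (E j * h)) + smult (- (C_N s N * poly p (of_real y))) (pt * g)"
    by (simp only:)
   have cEh: "coeff (E j * h) k = 0" if "j < N" "2 * N - 1 <= k" for j k
    by (rule coeff_mult_0[where m = "N - 1" and n = "N - 1"]) (use that coeff_E ch N in auto)
   have "wint s N (r * g) = wint s N (\<Sum>j<N. smult (of_real (poly (e j) y)) (E j * h)) + (- (C_N s N * poly p (of_real y))) * wint s N (pt * g)"
    unfolding eq
   proof (rule wint_lin[OF s N])
    fix k assume k: "2 * N - 1 <= k"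
    show "coeff (\<Sum>j<N. smult (of_real (poly (e j) y)) (E j * h)) k = 0"
     unfolding coeff_sum using k by (intro sum.neutral ballI) (simp add: cEh)
    show "coeff (pt * g) k = 0"
    proof (cases "N = 1")
     case True
     then have "g = 0" using g by (intro poly_eqI) simp
     then show ?thesis by simp
    next
     case False
     show ?thesis by (rule coeff_mult_0[where m = N and n = "N - 2"]) (use jac_coeff(1)[OF s N] g k N False in auto)
    qed
   qed
   also have "wint s N (\<Sum>j<N. smult (of_real (poly (e j) y)) (E j * h)) = (\<Sum>j<N. of_real (poly (e j) y) * wint s N (E j * h))"
    by (rule wint_sum[OF s N]) (use cEh in auto)
   also have "... = poly (\<Sum>j<N. smult (wint s N (h * E j)) (E j)) (of_real y)"
    by (simp add: poly_sum poly_map_poly_of_real mult.commute)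
   also have "... = poly h (of_real y)" using E_expansion[OF ch] by simp
   also have "... = 0" by (simp add: h_def)
   finally show ?thesis using wint_ptP_zero[OF s N g] by simp
  qed
  ultimately have "r = smult (wint s N (r * E (N - 1))) (E (N - 1))" by (rule orthogonal_top)
  then have "\<exists>w. r = smult w p" unfolding C_N_E(2) by (metis smult_smult)
  then obtain w where rw: "r = smult w p" ..
  have "?L y = r + ?M y"
   unfolding r_def by (simp only: smult_minus_left add.assoc add.left_inverse add_0_right)
  then have "?L y = ?M y + smult w p"
   unfolding rw by (simp only: add.commute)
  then show ?thesis by blast
 qed
 then have "\<forall>y. \<exists>c. ?L y = ?M y + smult c p" by (rule allI)
 from choice[OF this] obtain c where "\<forall>y. ?L y = ?M y + smult (c y) p" ..
 note c = spec[OF this]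
 define Sv where "Sv x y = (\<Sum>j<N. complex_of_real (poly (e j) x) * of_real (poly (e j) y))" for x y
 have ev: "(of_real x - of_real y) * Sv x y = C_N s N * poly p (of_real y) * poly pt (of_real x) + c y * poly p (of_real x)" for x y
  using arg_cong[OF c[of y], of "\<lambda>q. poly q (of_real x)"] by (simp add: Sv_def poly_sum poly_map_poly_of_real mult.commute left_diff_distrib)
 have sym: "Sv x y = Sv y x" for x y by (simp add: Sv_def mult.commute)
 have "p ~= 0" using coeff_p(2) by auto
 then have "finite {x. poly p x = 0}" by (rule poly_roots_finite)
 then have "finite (complex_of_real -` {x. poly p x = 0})" by (rule finite_vimageI) (simp add: inj_on_def)
 then obtain x0 where x0: "poly p (complex_of_real x0) ~= 0"
  using infinite_UNIV_char_0[where 'a = real] ex_new_if_finite[of "complex_of_real -` {x. poly p x = 0}"] by auto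
 \<comment> \<open>On the diagonal the left side of \<open>ev\<close> is 0, which determines c(x0)
   at a point where \<open>p\<close> does not vanish. Exchanging \<open>x0\<close> and
   \<open>y\<close> changes the sign of that side and yields c(y) for every
   \<open>y\<close>.\<close>
 have "poly p (of_real x0) * (C_N s N * poly pt (of_real x0) + c x0) = 0"
  using ev[of x0 x0] by (simp add: algebra_simps)
 then have cx: "c x0 = - C_N s N * poly pt (of_real x0)" using x0 by (simp add: eq_neg_iff_add_eq_0 add.commute)
 have "c y = - C_N s N * poly pt (of_real y)" for y
 proof -
  have "C_N s N * poly p (of_real y) * poly pt (of_real x0) + c y * poly p (of_real x0) =
   - (C_N s N * poly p (of_real x0) * poly pt (of_real y) + c x0 * poly p (of_real y))"
   unfolding ev[symmetric] sym[of x0 y] by (simp add: algebra_simps)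
  then have "(c y + C_N s N * poly pt (of_real y)) * poly p (of_real x0) = 0"
   unfolding cx by (simp add: algebra_simps)
  then show ?thesis using x0 by (simp add: eq_neg_iff_add_eq_0)
 qed
 then show ?thesis unfolding c by (simp add: smult_diff_right)
qed

text \<open>Off the diagonal \<open>christoffel_darboux\<close> is evaluated and divided by x - y.
  On the diagonal it is differentiated, and the factor x - y leaves the value of the sum
  itself.\<close>

theorem K_N_eq: "K_N s N x y = of_real (\<Sum>j<N. wfun j x * wfun j y)"
proof -
 have Sx: "poly (S y) (of_real x) = of_real (\<Sum>j<N. poly (e j) x * poly (e j) y)" for x y
  by (simp add: poly_sum poly_map_poly_of_real mult.commute)
 have R: "of_real (\<Sum>j<N. wfun j x * wfun j y) = complex_of_real (\<Sum>j<N. poly (e j) x * poly (e j) y) * of_real (sqrt (w_H s N x * w_H s N y))"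
  by (simp add: sum_distrib_left real_sqrt_mult mult_ac)
 show ?thesis
 proof (cases "x = y")
  case True
  have d: "vector_derivative (\<lambda>x. poly q (complex_of_real x)) (at z) = poly (pderiv q) (of_real z)" for q z
   by (intro vector_derivative_at has_vector_derivative_real_field poly_DERIV)
  have f: "p_tilde s N = (\<lambda>x. poly pt (of_real x))" "p_N1 s N = (\<lambda>x. poly p (of_real x))"
   using p_tilde_poly[OF s N] p_N1_poly[OF s N] by auto
  from arg_cong[OF christoffel_darboux[of x], of "\<lambda>q. poly (pderiv q) (of_real x)"]
  have "poly (S x) (of_real x) = C_N s N * (poly p (of_real x) * poly (pderiv pt) (of_real x) - poly pt (of_real x) * poly (pderiv p) (of_real x))"
   by (simp only: pderiv_mult pderiv_smult pderiv_diff poly_add poly_mult poly_smult poly_diff) (simp add: pderiv_pCons)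
  then show ?thesis unfolding R Sx[symmetric] K_N_def using True w_H_pos[of s N y]
   by (simp only: d f if_True refl) (simp add: mult_ac)
 next
  case False
  from arg_cong[OF christoffel_darboux[of y], of "\<lambda>q. poly q (of_real x)"]
  have "(of_real x - of_real y) * complex_of_real (\<Sum>j<N. poly (e j) x * poly (e j) y) =
    C_N s N * (poly p (of_real y) * poly pt (of_real x) - poly pt (of_real y) * poly p (of_real x))"
   unfolding Sx[symmetric] by (simp add: algebra_simps)
  then have "complex_of_real (\<Sum>j<N. poly (e j) x * poly (e j) y) =
    C_N s N * (poly p (of_real y) * poly pt (of_real x) - poly pt (of_real y) * poly p (of_real x)) / (of_real x - of_real y)"
   using False by (simp add: eq_divide_eq mult.commute)
  then show ?thesis unfolding R K_N_def using False
   by (simp add: p_tilde_poly[OF s N] p_N1_poly[OF s N] mult_ac)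
 qed
qed

end

end

section \<open>Convergence of Fredholm determinants\<close>

text \<open>The eigenvalues are nonnegative, as the quadratic form at the columns of
  \<open>U\<close> shows, and their sum is the trace n. Hence their geometric mean is at most
  1.\<close>

lemma psd_unit_diagonal_det:
 assumes B: "B \<in> hermitian_mats n" and diag: "\<And>i. i < n ==> B $$ (i, i) = 1"
  and psd: "\<And>c. 0 <= Re (\<Sum>j<n. \<Sum>i<n. cnj (c j) * B $$ (j, i) * c i)"
 shows "\<exists>d. det B = complex_of_real d \<and> 0 <= d \<and> d <= 1"
proof -
 obtain U e where U0: "unitary_mat n U" and Beq: "B = U * real_diag n e * mat_adjoint U"
  using hermitian_spectral[OF B] by blast
 note U = unitary_matD[OF U0] and Bc = hermitian_matsD(1)[OF B]
 let ?D = "real_diag n e"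
 have "B * U = U * ?D * (mat_adjoint U * U)"
  unfolding Beq by (rule assoc_mult_mat[OF mult_carrier_mat[OF U(1) mat_diag_carrier] U(4) U(1)])
 then have BU: "B * U = U * ?D" unfolding U(3) right_mult_one_mat[OF mult_carrier_mat[OF U(1) mat_diag_carrier]] .
 have e: "0 <= e p" if p: "p < n" for p
 proof -
  have BUp: "(\<Sum>i<n. B $$ (j, i) * U $$ (i, p)) = of_real (e p) * U $$ (j, p)" if "j < n" for j
  proof -
   have "(\<Sum>i<n. B $$ (j, i) * U $$ (i, p)) = (\<Sum>i<n. U $$ (j, i) * ?D $$ (i, p))"
    using index_mult_mat_sum[OF Bc U(1) that p] index_mult_mat_sum[OF U(1) mat_diag_carrier that p] by (simp only: BU)
   also have "... = (\<Sum>i<n. if i = p then of_real (e p) * U $$ (j, p) else 0)"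
    using p by (intro sum.cong refl) (auto simp: mat_diag_def)
   finally show ?thesis using p by simp
  qed
  have "(\<Sum>j<n. \<Sum>i<n. cnj (U $$ (j, p)) * B $$ (j, i) * U $$ (i, p)) = (\<Sum>j<n. of_real (e p) * (cnj (U $$ (j, p)) * U $$ (j, p)))"
  proof (intro sum.cong refl)
   fix j assume "j \<in> {..<n}"
   moreover have "(\<Sum>i<n. cnj (U $$ (j, p)) * B $$ (j, i) * U $$ (i, p)) = cnj (U $$ (j, p)) * (\<Sum>i<n. B $$ (j, i) * U $$ (i, p))"
    by (simp only: sum_distrib_left mult.assoc)
   ultimately show "(\<Sum>i<n. cnj (U $$ (j, p)) * B $$ (j, i) * U $$ (i, p)) = of_real (e p) * (cnj (U $$ (j, p)) * U $$ (j, p))"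
    using BUp by simp
  qed
  also have "... = of_real (e p)" using p unitary_index_sum(2)[OF U0 p p] by (simp flip: sum_distrib_left)
  finally show ?thesis using psd[of "\<lambda>i. U $$ (i, p)"] by simp
 qed
 have tr: "(\<Sum>p<n. e p) = real n"
 proof -
  have "complex_of_real (real n) = (\<Sum>i<n. B $$ (i, i))" using diag by simp
  also have "... = (\<Sum>i<n. \<Sum>p<n. of_real (e p) * (cnj (U $$ (i, p)) * U $$ (i, p)))"
   unfolding Beq by (intro sum.cong refl) (simp add: unitary_diag_index[OF U(1)] mult_ac)
  also have "... = (\<Sum>p<n. of_real (e p) * (\<Sum>i<n. cnj (U $$ (i, p)) * U $$ (i, p)))"
   unfolding sum_distrib_left by (rule sum.swap)
  also have "... = of_real (\<Sum>p<n. e p)"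
   unfolding of_real_sum by (intro sum.cong refl) (simp add: unitary_index_sum(2)[OF U0])
  finally show ?thesis unfolding of_real_eq_iff ..
 qed
 have p0: "0 <= (\<Prod>i<n. e i)" using e by (intro prod_nonneg) auto
 have "(\<Prod>i<n. e i) <= 1"
 proof (cases "n = 0")
  case False
  have "(\<Prod>i<n. e i) powr (1 / real n) <= (\<Sum>i<n. e i / real n)"
   using arith_geom_mean[of "{..<n}" e] e False by auto
  also have "... = 1" using tr False by (simp flip: sum_divide_distrib)
  finally have "((\<Prod>i<n. e i) powr (1 / real n)) powr real n <= 1 powr real n"
   by (intro powr_mono2) auto
  then show ?thesis using False p0 by (simp add: powr_powr)
 qed simp
 moreover have "det B = of_real (\<Prod>i<n. e i)" unfolding Beq det_unitary_conj[OF U0] by simp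
 ultimately show ?thesis using p0 by blast
qed

text \<open>Hadamard's inequality for Gram matrices; scaling the vectors to unit length reduces it to
 the inequality between the geometric and the arithmetic mean of the eigenvalues.\<close>

lemma det_gram_bound:
 fixes f :: "nat => real => real" and x :: "nat => real"
 shows "\<bar>det_on (\<lambda>i j. \<Sum>l<n. f l (x i) * f l (x j)) {..<k}\<bar> <= (\<Prod>i<k. \<Sum>l<n. f l (x i) * f l (x i))"
proof -
 define G where "G i j = (\<Sum>l<n. f l (x i) * f l (x j))" for i j
 have G0: "0 <= G i i" for i unfolding G_def by (intro sum_nonneg) simp
 have "\<bar>det_on G {..<k}\<bar> <= (\<Prod>i<k. G i i)"
 proof (cases "\<exists>i<k. G i i = 0")
  \<comment> \<open>A vanishing diagonal entry belongs to a zero vector, which cannot be normalised;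
    its whole row is 0, and so is the determinant.\<close>
  case True
  then obtain i where i: "i < k" "G i i = 0" by blast
  then have "f l (x i) = 0" if "l < n" for l
   using that sum_nonneg_eq_0_iff[of "{..<n}" "\<lambda>l. f l (x i) * f l (x i)"] unfolding G_def by simp
  then have "G i j = 0" for j by (simp add: G_def)
  then have "(\<Prod>i<k. G i (p i)) = 0" for p using i by (intro prod_zero finite_lessThan bexI[of _ i]) simp_all
  then have "det_on G {..<k} = 0" by (simp add: det_on_def)
  then show ?thesis using G0 by (simp add: prod_nonneg)
 next
  case False
  then have Gp: "0 < G i i" if "i < k" for i using G0[of i] that by (auto simp: less_le)
  define r where "r i = sqrt (G i i)" for i
  have r: "r i ~= 0" "r i * r i = G i i" if "i < k" for i using Gp[OF that] by (simp_all add: r_def)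
  define H where "H i j = G i j / (r i * r j)" for i j
  let ?B = "mat k k (\<lambda>(i, j). complex_of_real (H i j))"
  have "?B \<in> hermitian_mats k"
   by (rule hermitian_matsI) (auto simp: H_def G_def mult.commute)
  moreover have "?B $$ (i, i) = 1" if "i < k" for i
  proof -
   have "H i i = 1" unfolding H_def r(2)[OF that] using Gp[OF that] by simp
   then show ?thesis using that by simp
  qed
  moreover have "0 <= Re (\<Sum>j<k. \<Sum>i<k. cnj (c j) * ?B $$ (j, i) * c i)" for c
  proof -
   define z where "z l = (\<Sum>j<k. of_real (f l (x j) / r j) * c j)" for l
   have "(\<Sum>j<k. \<Sum>i<k. cnj (c j) * ?B $$ (j, i) * c i) =
    (\<Sum>j<k. \<Sum>i<k. \<Sum>l<n. cnj (of_real (f l (x j) / r j) * c j) * (of_real (f l (x i) / r i) * c i))"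
    by (intro sum.cong refl) (simp add: H_def G_def sum_distrib_left sum_distrib_right sum_divide_distrib mult_ac)
   also have "... = (\<Sum>j<k. \<Sum>l<n. \<Sum>i<k. cnj (of_real (f l (x j) / r j) * c j) * (of_real (f l (x i) / r i) * c i))"
    by (intro sum.cong refl sum.swap)
   also have "... = (\<Sum>l<n. cnj (z l) * z l)"
    unfolding z_def cnj_sum sum_product by (rule sum.swap)
   also have "... = of_real (\<Sum>l<n. (cmod (z l))\<^sup>2)"
    unfolding of_real_sum by (intro sum.cong refl) (metis complex_norm_square mult.commute of_real_power)
   finally show ?thesis by (simp add: sum_nonneg)
  qed
  ultimately obtain d where d: "det ?B = complex_of_real d" "0 <= d" "d <= 1"
   using psd_unit_diagonal_det by blast
  have "det_on G {..<k} = (\<Prod>i<k. G i i) * det_on H {..<k}"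
   unfolding det_on_def sum_distrib_left
  proof (intro sum.cong refl)
   fix p assume "p \<in> {p. p permutes {..<k}}"
   then have p: "p permutes {..<k}" by simp
   have "(\<Prod>i<k. G i (p i)) = (\<Prod>i<k. r i) * (\<Prod>i<k. r (p i)) * (\<Prod>i<k. H i (p i))"
    unfolding prod.distrib[symmetric] using r permutes_in_image[OF p] by (intro prod.cong refl) (simp add: H_def)
   also have "(\<Prod>i<k. r (p i)) = (\<Prod>i<k. r i)" using prod.permute[OF p, of r] by (simp add: comp_def)
   also have "(\<Prod>i<k. r i) * (\<Prod>i<k. r i) = (\<Prod>i<k. G i i)"
    unfolding prod.distrib[symmetric] using r by (intro prod.cong refl) simp
   finally show "of_int (sign p) * (\<Prod>i<k. G i (p i)) = (\<Prod>i<k. G i i) * (of_int (sign p) * (\<Prod>i<k. H i (p i)))" by simp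
  qed
  moreover have "det_on H {..<k} = d" using d(1) unfolding det_mat_eq_det_on det_on_of_real by simp
  ultimately show ?thesis using d G0 by (simp add: abs_mult prod_nonneg mult_left_le)
 qed
 then show ?thesis unfolding G_def .
qed

text \<open>A bound on the diagonal is enough, because the kernels are Gram kernels. The k-th
  integral is then at most I^k uniformly in \<open>N\<close>, and the summable bound I^k / k! allows
  the limit to pass through the series.\<close>

lemma fredholm_det_tendsto:
 fixes f :: "nat => nat => real => real" and n :: "nat => nat" and G :: "real => real"
 assumes meas: "\<And>N l. f N l \<in> borel_measurable borel"
  and lim: "\<And>x y. t < x ==> t < y ==> (\<lambda>N. complex_of_real (\<Sum>l<n N. f N l x * f N l y)) \<longlonglongrightarrow> K x y"
  and dom: "\<And>N x. t < x ==> (\<Sum>l<n N. f N l x * f N l x) <= G x"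
  and G: "integrable lborel (\<lambda>x. indicator {t<..} x * G x)"
 shows "(\<lambda>N. fredholm_det (\<lambda>x y. of_real (\<Sum>l<n N. f N l x * f N l y)) t) \<longlonglongrightarrow> fredholm_det K t"
proof -
 define kap where "kap N x y = (\<Sum>l<n N. f N l x * f N l y)" for N x y
 define S where "S k = (\<Pi>\<^sub>E i\<in>{..<k}. {t<..})" for k :: nat
 define g where "g N k x = indicator (S k) x *\<^sub>R complex_of_real (det_on (\<lambda>i j. kap N (x i) (x j)) {..<k})" for N k and x :: "nat => real"
 define h where "h k x = indicator (S k) x *\<^sub>R det_on (\<lambda>i j. K (x i) (x j)) {..<k}" for k and x :: "nat => real"
 define W where "W k x = (\<Prod>i<k. indicator {t<..} (x i) * G (x i))" for k :: nat and x :: "nat => real"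
 define I where "I = (\<integral>x. indicator {t<..} x * G x \<partial>lborel)"
 have kk: "0 <= kap N x x" for N x unfolding kap_def by (intro sum_nonneg) simp
 have Wi: "integrable (leb k) (W k)" for k unfolding W_def by (rule leb.product_integrable_prod) (simp_all add: G)
 have WI: "(\<integral>x. W k x \<partial>leb k) = I ^ k" for k
  unfolding W_def I_def by (subst leb.product_integral_prod) (simp_all add: G)
 have gW: "norm (g N k x) <= W k x" for N k x
 proof (cases "x \<in> S k")
  case True
  then have xi: "t < x i" if "i < k" for i using that by (auto simp: S_def PiE_def)
  have "\<bar>det_on (\<lambda>i j. kap N (x i) (x j)) {..<k}\<bar> <= (\<Prod>i<k. kap N (x i) (x i))"
   unfolding kap_def by (rule det_gram_bound)
  also have "... <= W k x" unfolding W_def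
   by (rule prod_mono) (use kk dom xi in \<open>auto simp: kap_def\<close>)
  finally show ?thesis using True by (simp add: g_def)
 next
  case False
  \<comment> \<open>The dominating function is nonnegative beyond \<open>t\<close>, since it bounds
    a sum of squares there.\<close>
  have "0 <= indicator {t<..} (x i) * G (x i)" for i
   using order_trans[OF kk dom[unfolded kap_def[symmetric]]] by (auto simp: indicator_def)
  then have "0 <= W k x" unfolding W_def by (intro prod_nonneg) blast
  then show ?thesis using False by (simp add: g_def)
 qed
 have gm: "g N k \<in> meas_leb k" for N k
 proof -
  have "S k \<in> sets (leb k)" unfolding S_def by (rule sets_PiM_I_finite) auto
  moreover have "(\<lambda>x. det_on (\<lambda>i j. kap N (x i) (x j)) {..<k}) \<in> meas_leb k"
   unfolding det_on_def kap_def
  proof (intro borel_measurable_sum borel_measurable_times borel_measurable_prod borel_measurable_const)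
   fix p i l assume p: "p \<in> {p. p permutes {..<k}}" and i: "i \<in> {..<k}"
   then have "p i < k" using permutes_in_image[of p "{..<k}" i] by simp
   then show "(\<lambda>x. f N l (x (p i))) \<in> meas_leb k" by (intro measurable_compose[OF measurable_leb_component meas])
   show "(\<lambda>x. f N l (x i)) \<in> meas_leb k" using i by (intro measurable_compose[OF measurable_leb_component meas]) simp
  qed
  ultimately show ?thesis unfolding g_def
   by (intro borel_measurable_scaleR borel_measurable_indicator measurable_compose[OF _ borel_measurable_of_real]) auto
 qed
 have gh: "(\<lambda>N. g N k x) \<longlonglongrightarrow> h k x" for k x
 proof (cases "x \<in> S k")
  case True
  then have xi: "t < x i" if "i < k" for i using that by (auto simp: S_def PiE_def)
  have "(\<lambda>N. det_on (\<lambda>i j. complex_of_real (kap N (x i) (x j))) {..<k}) \<longlonglongrightarrow> det_on (\<lambda>i j. K (x i) (x j)) {..<k}"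
   unfolding det_on_def
  proof (intro tendsto_sum tendsto_mult tendsto_prod tendsto_const)
   fix p i assume p: "p \<in> {p. p permutes {..<k}}" and i: "i \<in> {..<k}"
   then have "p i < k" using permutes_in_image[of p "{..<k}" i] by simp
   then show "(\<lambda>N. complex_of_real (kap N (x i) (x (p i)))) \<longlonglongrightarrow> K (x i) (x (p i))"
    unfolding kap_def using i by (intro lim xi) auto
  qed
  then show ?thesis using True unfolding g_def h_def det_on_of_real by simp
 qed (simp add: g_def h_def)
 have hm: "h k \<in> meas_leb k" for k by (rule borel_measurable_LIMSEQ_metric[OF gm gh])
 have int: "(\<lambda>N. LINT x|leb k. g N k x) \<longlonglongrightarrow> (LINT x|leb k. h k x)" for k
  by (rule integral_dominated_convergence[OF hm gm Wi]) (simp_all add: gh gW)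
 have nb: "norm (LINT x|leb k. g N k x) <= I ^ k" for N k
 proof -
  have "norm (LINT x|leb k. g N k x) <= (LINT x|leb k. norm (g N k x))" by (rule integral_norm_bound)
  also have "... <= (LINT x|leb k. W k x)"
   by (rule integral_mono[OF integrable_norm[OF Bochner_Integration.integrable_bound[OF Wi gm]] Wi gW])
    (use gW in \<open>auto intro!: AE_I2 order_trans[OF gW abs_ge_self]\<close>)
  finally show ?thesis unfolding WI .
 qed
 have "(\<lambda>N. \<Sum>m. (- 1) ^ Suc m / fact (Suc m) * (LINT x|leb (Suc m). g N (Suc m) x)) \<longlonglongrightarrow>
  (\<Sum>m. (- 1) ^ Suc m / fact (Suc m) * (LINT x|leb (Suc m). h (Suc m) x))"
 proof (rule tannerys_theorem[THEN conjunct2, THEN conjunct2])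
  show "(\<lambda>N. (- 1) ^ Suc m / fact (Suc m) * (LINT x|leb (Suc m). g N (Suc m) x)) \<longlonglongrightarrow>
   (- 1) ^ Suc m / fact (Suc m) * (LINT x|leb (Suc m). h (Suc m) x)" for m
   by (intro tendsto_mult tendsto_const int)
  show "\<forall>\<^sub>F (m, N) in at_top \<times>\<^sub>F sequentially. norm ((- 1) ^ Suc m / fact (Suc m) * (LINT x|leb (Suc m). g N (Suc m) x)) <= I ^ Suc m / fact (Suc m)"
  proof (rule always_eventually, clarify)
   fix m N
   show "norm ((- 1) ^ Suc m / fact (Suc m) * (LINT x|leb (Suc m). g N (Suc m) x)) <= I ^ Suc m / fact (Suc m)"
    using divide_right_mono[OF nb[where N = N and k = "Suc m"], of "fact (Suc m)"]
    by (simp only: norm_mult norm_divide norm_power norm_minus_cancel norm_one power_one norm_fact times_divide_eq_left mult_1 fact_ge_zero)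
  qed
  have "summable (\<lambda>m. I ^ m / fact m)" using summable_exp[of I] by (simp add: field_simps)
  then show "summable (\<lambda>m. I ^ Suc m / fact (Suc m))" by (rule summable_Suc_iff[THEN iffD2])
 qed simp
 then have "(\<lambda>N. 1 + (\<Sum>m. (- 1) ^ Suc m / fact (Suc m) * (LINT x|leb (Suc m). g N (Suc m) x))) \<longlonglongrightarrow>
  1 + (\<Sum>m. (- 1) ^ Suc m / fact (Suc m) * (LINT x|leb (Suc m). h (Suc m) x))" by (intro tendsto_intros)
 then show ?thesis
  unfolding fredholm_det_def Let_def set_lebesgue_integral_def det_mat_eq_det_on g_def h_def S_def kap_def det_on_of_real .
qed

text \<open>Both sides are determinants of Gram matrices over half-lines, and the factor sqrt c on
  each function carries the Jacobian of the scaling.\<close>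

lemma fredholm_det_scale:
 fixes f :: "nat => real => real"
 assumes c: "c > 0" and int: "\<And>i j. i < n ==> j < n ==> integrable lborel (\<lambda>x. f i x * f j x)"
 shows "fredholm_det (\<lambda>x y. of_real (\<Sum>l<n. f l x * f l y)) (c * t) =
  fredholm_det (\<lambda>x y. of_real (\<Sum>l<n. (sqrt c * f l (c * x)) * (sqrt c * f l (c * y)))) t"
proof -
 have eq: "(sqrt c * f i (c * x)) * (sqrt c * f j (c * x)) = c * (f i (c * x) * f j (c * x))" for i j x
  using c by (simp add: algebra_simps)
 have "integrable lborel (\<lambda>x. (sqrt c * f i (c * x)) * (sqrt c * f j (c * x)))" if "i < n" "j < n" for i j
  unfolding eq using lborel_integrable_real_affine[OF int[OF that], of c 0] c by (intro integrable_mult_right) simp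
 moreover have "(\<integral>x. indicator {c * t<..} x * (f i x * f j x) \<partial>lborel) =
  (\<integral>x. indicator {t<..} x * ((sqrt c * f i (c * x)) * (sqrt c * f j (c * x))) \<partial>lborel)" for i j
 proof -
  have "(\<integral>x. indicator {c * t<..} x * (f i x * f j x) \<partial>lborel) =
   \<bar>c\<bar> *\<^sub>R (\<integral>x. indicator {c * t<..} (0 + c * x) * (f i (0 + c * x) * f j (0 + c * x)) \<partial>lborel)"
   by (rule lborel_integral_real_affine) (use c in simp)
  also have "... = (\<integral>x. c * (indicator {c * t<..} (c * x) * (f i (c * x) * f j (c * x))) \<partial>lborel)" using c by simp
  also have "(\<lambda>x. c * (indicator {c * t<..} (c * x) * (f i (c * x) * f j (c * x)))) = (\<lambda>x. indicator {t<..} x * ((sqrt c * f i (c * x)) * (sqrt c * f j (c * x))))"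
   unfolding eq using c by (auto simp: fun_eq_iff indicator_def)
  finally show ?thesis .
 qed
 ultimately show ?thesis
  using fredholm_det_finite_rank[of n f "c * t", OF int] fredholm_det_finite_rank[of n "\<lambda>l x. sqrt c * f l (c * x)" t] by simp
qed

section \<open>Asymptotics of the finite kernel\<close>

definition ser :: "(nat => complex) => complex => complex" where
 "ser c t = (\<Sum>k. c k * t ^ k)"

text \<open>Domination by the Taylor coefficients of A exp (M x). One such bound gives convergence
  everywhere, termwise limits and bounds uniform in a parameter, and it passes to the derivative
  with A replaced by A M.\<close>

definition exp_bounded' :: "real => real => (nat => complex) => bool" where
 "exp_bounded' A M c \<longleftrightarrow> (\<forall>k. cmod (c k) <= A * (M ^ k / fact k))"

lemma summable_exp_real: "summable (\<lambda>k. x ^ k / fact k :: real)"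
 using summable_exp[of x] by (simp add: field_simps)

lemma exp_real_series: "(\<Sum>k. x ^ k / fact k :: real) = exp x"
 by (simp add: exp_def scaleR_conv_of_real field_simps)

lemma exp_bounded'_term:
 assumes "exp_bounded' A M c" "cmod t <= R" "0 <= M" "0 <= A"
 shows "cmod (c k * t ^ k) <= A * ((M * R) ^ k / fact k)"
proof -
 have "cmod (c k) <= A * (M ^ k / fact k)" using assms(1) by (simp add: exp_bounded'_def)
 moreover have "cmod (t ^ k) <= R ^ k" using assms(2) by (simp add: norm_power power_mono)
 ultimately have "cmod (c k * t ^ k) <= A * (M ^ k / fact k) * R ^ k"
  unfolding norm_mult using assms by (intro mult_mono) auto
 then show ?thesis by (simp add: power_mult_distrib)
qed

lemma summable_ser:
 assumes "exp_bounded' A M c" "0 <= M" "0 <= A"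
 shows "summable (\<lambda>k. c k * t ^ k)"
 by (rule summable_comparison_test'[where N = 0, OF summable_mult[OF summable_exp_real]])
  (rule exp_bounded'_term[OF assms(1) order_refl assms(2,3)])

lemma ser_bound:
 assumes "exp_bounded' A M c" "cmod t <= R" "0 <= M" "0 <= A"
 shows "cmod (ser c t) <= A * exp (M * R)"
proof -
 have "cmod (ser c t) <= (\<Sum>k. A * ((M * R) ^ k / fact k))"
  unfolding ser_def by (rule norm_suminf_le) (use exp_bounded'_term[OF assms] summable_mult[OF summable_exp_real] in auto)
 also have "... = A * exp (M * R)" unfolding suminf_mult[OF summable_exp_real] exp_real_series ..
 finally show ?thesis .
qed

lemma ser_tendsto:
 assumes "\<And>N. exp_bounded' A M (c N)" "0 <= M" "0 <= A" "\<And>N. cmod (t N) <= R"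
  and "\<And>k. (\<lambda>N. c N k) \<longlonglongrightarrow> c' k" "t \<longlonglongrightarrow> t'"
 shows "(\<lambda>N. ser (c N) (t N)) \<longlonglongrightarrow> ser c' t'"
 unfolding ser_def
proof (rule tannerys_theorem[THEN conjunct2, THEN conjunct2])
 show "(\<lambda>N. c N k * t N ^ k) \<longlonglongrightarrow> c' k * t' ^ k" for k by (intro tendsto_intros assms)
 show "\<forall>\<^sub>F (k, N) in at_top \<times>\<^sub>F sequentially. norm (c N k * t N ^ k) <= A * ((M * R) ^ k / fact k)"
  by (rule always_eventually, clarify) (rule exp_bounded'_term[OF assms(1,4,2,3)])
 show "summable (\<lambda>k. A * ((M * R) ^ k / fact k))" by (intro summable_mult summable_exp_real)
qed simp

lemma exp_bounded'_diffs:
 assumes "exp_bounded' A M c"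
 shows "exp_bounded' (A * M) M (diffs c)"
 unfolding exp_bounded'_def
proof
 fix k
 have "cmod (diffs c k) = (1 + real k) * cmod (c (Suc k))"
  unfolding diffs_def norm_mult norm_of_nat by simp
 also have "... <= (1 + real k) * (A * (M ^ Suc k / fact (Suc k)))"
 proof (rule mult_left_mono)
  show "cmod (c (Suc k)) <= A * (M ^ Suc k / fact (Suc k))" using assms unfolding exp_bounded'_def by blast
 qed simp
 also have "... = A * M * (M ^ k / fact k)" by (simp add: divide_simps)
 finally show "cmod (diffs c k) <= A * M * (M ^ k / fact k)" .
qed

lemma ser_has_derivative:
 assumes "exp_bounded' A M c" "0 <= M" "0 <= A"
 shows "(ser c has_field_derivative ser (diffs c) t) (at t)"
 unfolding ser_def[abs_def] by (rule termdiffs_strong_converges_everywhere) (rule summable_ser[OF assms])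

text \<open>The coefficients of \<open>hyp1F1 b q\<close>. Those of the terminating 2F1 have one
  more factor, which is treated separately in \<open>dampf\<close>.\<close>

definition hyp_coeff :: "complex => real => nat => complex" where
 "hyp_coeff b q k = pochhammer b k / (pochhammer (of_real q) k * fact k)"

text \<open>With this rate |b + k| <= rate * (q + k) for every k, which bounds quotients of
  Pochhammer symbols factor by factor.\<close>

definition hyp_rate :: "complex => real => real" where
 "hyp_rate b q = max (cmod b / q) 1"

lemma hyp_rate_nonneg: "0 <= hyp_rate b q" by (simp add: hyp_rate_def)

lemma hyp_coeff_bound:
 assumes q: "q > 0"
 shows "cmod (hyp_coeff b q k) <= hyp_rate b q ^ k / fact k"
proof -
 let ?M = "hyp_rate b q"
 have pq: "pochhammer q k > 0" using q by (rule pochhammer_pos)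
 have "cmod (pochhammer b k) <= ?M ^ k * pochhammer q k"
 proof (induction k)
  case (Suc k)
  have "cmod (b + of_nat k) <= cmod b + real k" by (rule order_trans[OF norm_triangle_ineq]) simp
  also have "... <= ?M * q + ?M * real k"
  proof (rule add_mono)
   have "cmod b / q * q <= ?M * q" using q by (intro mult_right_mono) (auto simp: hyp_rate_def)
   then show "cmod b <= ?M * q" using q by simp
   have "1 * real k <= ?M * real k" by (intro mult_right_mono) (auto simp: hyp_rate_def)
   then show "real k <= ?M * real k" by simp
  qed
  finally have "cmod (b + of_nat k) <= ?M * (q + real k)" by (simp add: algebra_simps)
  then have "cmod (pochhammer b k) * cmod (b + of_nat k) <= (?M ^ k * pochhammer q k) * (?M * (q + real k))"
   using Suc.IH q hyp_rate_nonneg[of b q] pochhammer_pos[of q k] by (intro mult_mono) (auto simp: less_imp_le)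
  then show ?case by (simp add: pochhammer_Suc norm_mult mult_ac)
 qed simp
 then have "cmod (pochhammer b k) / (pochhammer q k * fact k) <= (?M ^ k * pochhammer q k) / (pochhammer q k * fact k)"
  using pq by (intro divide_right_mono) auto
 moreover have "cmod (hyp_coeff b q k) = cmod (pochhammer b k) / (pochhammer q k * fact k)"
  using pq by (simp add: hyp_coeff_def norm_divide norm_mult pochhammer_of_real)
 ultimately show ?thesis using pq by simp
qed

text \<open>The upper parameter -(N - d) of the 2F1, divided by the power of \<open>N\<close> that
  its rescaled argument releases. The offset \<open>d\<close> is 0 for \<open>p_tilde\<close> and 1
  for \<open>p_N1\<close>.\<close>

definition dampf :: "nat => nat => nat => complex" where
 "dampf d N k = pochhammer (- of_nat (N - d)) k / of_nat N ^ k"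

lemma dampf_bound: "cmod (dampf d N k) <= 1"
proof -
 have "cmod (pochhammer (- of_nat n) k) <= real n ^ k" for n
 proof (induction k)
  case (Suc k)
  show ?case
  proof (cases "k <= n")
   case True
   have "cmod (- of_nat n + of_nat k) = cmod (of_real (real k - real n))" by simp
   also have "... <= real n" unfolding norm_of_real using True by simp
   finally have "cmod (pochhammer (- of_nat n) k) * cmod (- of_nat n + of_nat k) <= real n ^ k * real n"
    using Suc.IH by (intro mult_mono) auto
   then show ?thesis by (simp add: pochhammer_Suc norm_mult mult_ac)
  qed (simp add: pochhammer_of_nat_eq_0_lemma)
 qed simp
 then have "cmod (pochhammer (- of_nat (N - d)) k) <= real (N - d) ^ k" .
 also have "... <= real N ^ k" by (intro power_mono) auto
 finally show ?thesis unfolding dampf_def norm_divide norm_power norm_of_nat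
  by (intro divide_le_eq_1[THEN iffD2]) (cases "real N ^ k = 0"; simp)
qed

lemma dampf_tendsto: "(\<lambda>N. dampf d N k) \<longlonglongrightarrow> (- 1) ^ k"
proof -
 have "(\<lambda>N. \<Prod>j<k. of_real (- 1 + real (d + j) * inverse (real N)) :: complex) \<longlonglongrightarrow> (\<Prod>j<k. of_real (- 1 + real (d + j) * 0))"
  by (intro tendsto_intros lim_inverse_n)
 moreover have "\<forall>\<^sub>F N in sequentially. (\<Prod>j<k. of_real (- 1 + real (d + j) * inverse (real N))) = dampf d N k"
  using eventually_gt_at_top[of d]
 proof eventually_elim
  case (elim N)
  have "dampf d N k = (\<Prod>j<k. (- of_nat (N - d) + of_nat j) / of_nat N)"
   unfolding dampf_def pochhammer_prod by (simp add: prod_dividef atLeast0LessThan)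
  also have "... = (\<Prod>j<k. of_real (- 1 + real (d + j) * inverse (real N)))"
   using elim by (intro prod.cong refl) (simp add: of_nat_diff field_simps)
  finally show ?case ..
 qed
 ultimately show ?thesis by (simp add: Lim_transform_eventually)
qed

definition fin_coeff :: "nat => complex => real => nat => nat => complex" where
 "fin_coeff d b q N k = dampf d N k * hyp_coeff b q k"

definition lim_coeff :: "complex => real => nat => complex" where
 "lim_coeff b q k = (- 1) ^ k * hyp_coeff b q k"

lemma fin_coeff_bound: "q > 0 ==> exp_bounded' 1 (hyp_rate b q) (fin_coeff d b q N)"
 unfolding exp_bounded'_def fin_coeff_def norm_mult
 using mult_mono[OF dampf_bound hyp_coeff_bound] by simp

lemma lim_coeff_bound: "q > 0 ==> exp_bounded' 1 (hyp_rate b q) (lim_coeff b q)"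
 unfolding exp_bounded'_def lim_coeff_def norm_mult
 using hyp_coeff_bound by (simp add: norm_power)

lemma fin_coeff_tendsto: "(\<lambda>N. fin_coeff d b q N k) \<longlonglongrightarrow> lim_coeff b q k"
 unfolding fin_coeff_def lim_coeff_def by (intro tendsto_intros dampf_tendsto)

lemma diffs_fin_coeff_tendsto: "(\<lambda>N. diffs (fin_coeff d b q N) k) \<longlonglongrightarrow> diffs (lim_coeff b q) k"
 unfolding diffs_def by (intro tendsto_intros fin_coeff_tendsto)

text \<open>N times the hypergeometric argument 2 / (1 + i N z), which has a limit as
  \<open>N\<close> grows.\<close>

definition tvar :: "nat => complex => complex" where
 "tvar N z = 2 / (1 / of_nat N + \<i> * z)"

text \<open>The imaginary part of the denominator is \<open>x\<close>, so this bound and those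
  derived from it are uniform in \<open>N\<close>.\<close>

lemma tvar_denom: "x > 0 ==> cmod (1 / of_nat N + \<i> * of_real x) >= x"
 using abs_Im_le_cmod[of "1 / of_nat N + \<i> * of_real x"] by simp

lemma tvar_bound:
 assumes "x > 0" shows "cmod (tvar N (of_real x)) <= 2 / x"
 unfolding tvar_def norm_divide using tvar_denom[OF assms, of N] assms by (simp add: frac_le)

lemma tvar_tendsto:
 assumes "x > 0" shows "(\<lambda>N. tvar N (of_real x)) \<longlonglongrightarrow> 2 / (\<i> * of_real x)"
proof -
 have "(\<lambda>N. 2 / (of_real (inverse (real N)) + \<i> * complex_of_real x)) \<longlonglongrightarrow> 2 / (of_real 0 + \<i> * of_real x)"
  by (intro tendsto_intros lim_inverse_n) (use assms in auto)
 then show ?thesis by (simp add: tvar_def divide_inverse)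
qed

lemma tvar_deriv:
 assumes "x > 0"
 shows "(tvar N has_field_derivative - 2 * \<i> / (1 / of_nat N + \<i> * of_real x)\<^sup>2) (at (of_real x))"
proof -
 have nz: "1 / of_nat N + \<i> * complex_of_real x ~= 0" using tvar_denom[OF assms, of N] assms by auto
 show ?thesis unfolding tvar_def[abs_def]
  by (rule derivative_eq_intros nz refl | simp)+ (simp add: power2_eq_square)
qed

definition hfin :: "nat => complex => real => nat => complex => complex" where
 "hfin d b q N z = ser (fin_coeff d b q N) (tvar N z)"

definition hfin' :: "nat => complex => real => nat => real => complex" where
 "hfin' d b q N x = ser (diffs (fin_coeff d b q N)) (tvar N (of_real x)) * (- 2 * \<i> / (1 / of_nat N + \<i> * of_real x)\<^sup>2)"

definition hlim :: "complex => real => complex => complex" where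
 "hlim b q z = ser (lim_coeff b q) (2 / (\<i> * z))"

definition hlim' :: "complex => real => real => complex" where
 "hlim' b q x = ser (diffs (lim_coeff b q)) (2 / (\<i> * of_real x)) * (2 * \<i> / (of_real x)\<^sup>2)"

lemma hfin_deriv:
 assumes "q > 0" "x > 0"
 shows "(hfin d b q N has_field_derivative hfin' d b q N x) (at (of_real x))"
 unfolding hfin_def[abs_def] hfin'_def
 by (rule DERIV_chain2[OF ser_has_derivative[OF fin_coeff_bound[OF assms(1)] hyp_rate_nonneg zero_le_one] tvar_deriv[OF assms(2)]])

lemma hlim_deriv:
 assumes "q > 0" "x > 0"
 shows "(hlim b q has_field_derivative hlim' b q x) (at (of_real x))"
proof -
 have "((\<lambda>z. 2 / (\<i> * z)) has_field_derivative 2 * \<i> / (of_real x)\<^sup>2) (at (of_real x))"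
  using assms by (auto intro!: derivative_eq_intros simp: field_simps power2_eq_square)
 from DERIV_chain2[OF ser_has_derivative[OF lim_coeff_bound[OF assms(1)] hyp_rate_nonneg zero_le_one] this]
 show ?thesis unfolding hlim_def[abs_def] hlim'_def .
qed

lemma hfin_tendsto:
 assumes "q > 0" "x > 0"
 shows "(\<lambda>N. hfin d b q N (of_real x)) \<longlonglongrightarrow> hlim b q (of_real x)"
 unfolding hfin_def hlim_def
 by (rule ser_tendsto[OF fin_coeff_bound[OF assms(1)] hyp_rate_nonneg zero_le_one tvar_bound[OF assms(2)] fin_coeff_tendsto tvar_tendsto[OF assms(2)]])

lemma hfin'_tendsto:
 assumes "q > 0" "x > 0"
 shows "(\<lambda>N. hfin' d b q N x) \<longlonglongrightarrow> hlim' b q x"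
proof -
 have 1: "(\<lambda>N. ser (diffs (fin_coeff d b q N)) (tvar N (of_real x))) \<longlonglongrightarrow> ser (diffs (lim_coeff b q)) (2 / (\<i> * of_real x))"
  by (rule ser_tendsto[OF exp_bounded'_diffs[OF fin_coeff_bound[OF assms(1)]] hyp_rate_nonneg _ tvar_bound[OF assms(2)] diffs_fin_coeff_tendsto tvar_tendsto[OF assms(2)]])
   (simp add: hyp_rate_nonneg)
 have "(\<lambda>N. - 2 * \<i> / (of_real (inverse (real N)) + \<i> * complex_of_real x)\<^sup>2) \<longlonglongrightarrow> - 2 * \<i> / (of_real 0 + \<i> * of_real x)\<^sup>2"
  by (intro tendsto_intros lim_inverse_n) (use assms in auto)
 then have 2: "(\<lambda>N. - 2 * \<i> / (1 / of_nat N + \<i> * complex_of_real x)\<^sup>2) \<longlonglongrightarrow> 2 * \<i> / (of_real x)\<^sup>2"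
  by (simp add: divide_inverse power_mult_distrib)
 show ?thesis unfolding hfin'_def hlim'_def by (rule tendsto_mult[OF 1 2])
qed

lemma hfin_bound:
 assumes "q > 0" "x > 0"
 shows "cmod (hfin d b q N (of_real x)) <= exp (hyp_rate b q * (2 / x))"
 using ser_bound[OF fin_coeff_bound[OF assms(1)] tvar_bound[OF assms(2)] hyp_rate_nonneg zero_le_one] by (simp add: hfin_def)

lemma hfin'_bound:
 assumes "q > 0" "x > 0"
 shows "cmod (hfin' d b q N x) <= hyp_rate b q * exp (hyp_rate b q * (2 / x)) * (2 / x\<^sup>2)"
proof -
 have "cmod (ser (diffs (fin_coeff d b q N)) (tvar N (of_real x))) <= 1 * hyp_rate b q * exp (hyp_rate b q * (2 / x))"
  by (rule ser_bound[OF exp_bounded'_diffs[OF fin_coeff_bound[OF assms(1)]] tvar_bound[OF assms(2)] hyp_rate_nonneg]) (simp add: hyp_rate_nonneg)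
 moreover have "cmod (- 2 * \<i> / (1 / of_nat N + \<i> * of_real x)\<^sup>2) <= 2 / x\<^sup>2"
  unfolding norm_divide norm_power using power_mono[OF tvar_denom[OF assms(2), of N], of 2] assms(2) by (simp add: norm_mult frac_le)
 ultimately show ?thesis unfolding hfin'_def norm_mult[of "ser _ _"]
  by (intro mult_mono) (auto simp: hyp_rate_nonneg)
qed

lemma hyp2F1_eq_hfin:
 assumes N: "N >= 1" and n: "n = N - d"
 shows "hyp2F1 (- of_nat n) b (of_real q) (2 / (1 + \<i> * of_real (real N * x))) = hfin d b q N (of_real x)"
proof -
 have "1 + \<i> * of_real (real N * x) = of_nat N * (1 / of_nat N + \<i> * of_real x)" using N by (simp add: field_simps)
 then have t: "2 / (1 + \<i> * of_real (real N * x)) = tvar N (of_real x) / of_nat N" by (simp add: tvar_def)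
 show ?thesis unfolding hyp2F1_def hfin_def ser_def t fin_coeff_def dampf_def hyp_coeff_def n
  by (intro arg_cong[of _ _ suminf] ext) (simp add: power_divide)
qed

text \<open>Since 2 / (ix) = -(2i / x), the sign (-1)^k in \<open>lim_coeff\<close> is absorbed by
  the argument.\<close>

lemma hyp1F1_eq_hlim: "x > 0 ==> hyp1F1 b (of_real q) (2 * \<i> / of_real x) = hlim b q (of_real x)"
proof -
 assume x: "x > 0"
 have t: "2 * \<i> / of_real x = - (2 / (\<i> * complex_of_real x))" using x by (simp add: field_simps)
 show ?thesis unfolding hyp1F1_def hlim_def ser_def t lim_coeff_def hyp_coeff_def
  by (intro arg_cong[of _ _ suminf] ext) (subst power_minus, simp)
qed

lemma square_powr: "x > 0 ==> (x\<^sup>2) powr e = x powr (2 * e)" for x :: real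
 by (simp add: powr_powr flip: powr_numeral)

section \<open>The kernel at the points N x\<close>

context
 fixes s :: complex
 assumes s: "Re s > - 1 / 2"
begin

text \<open>The polynomial \<open>p_tilde\<close> at N z, without the factor N (N z - i)^(N-1). One
  of its N factors N z - i stays here, so that both polynomials share the same power.\<close>

definition ufun :: "nat => complex => complex" where
 "ufun N z = (z - \<i> / of_nat N) * hfin 0 s (2 * Re s + 1) N z"

definition ufun' :: "nat => real => complex" where
 "ufun' N x = hfin 0 s (2 * Re s + 1) N (of_real x) + (of_real x - \<i> / of_nat N) * hfin' 0 s (2 * Re s + 1) N x"

abbreviation vfun :: "nat => complex => complex" where
 "vfun N \<equiv> hfin 1 (s + 1) (2 * Re s + 2) N"

abbreviation vfun' :: "nat => real => complex" where
 "vfun' N \<equiv> hfin' 1 (s + 1) (2 * Re s + 2) N"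

text \<open>The factor common to both polynomials at N x, with half of the weight. Its power of
  \<open>N\<close> makes it converge; two such powers account for N \<open>C_N\<close> up to the
  convergent factor \<open>dN\<close>.\<close>

definition psi :: "nat => real => complex" where
 "psi N x = of_real (real N powr (Re s + 1)) * (of_real (real N * x) - \<i>) ^ (N - 1) * of_real (sqrt (w_H s N (real N * x)))"

definition dN :: "nat => complex" where
 "dN N = C_N s N / of_real (real N powr (2 * Re s + 1))"

definition dlim :: complex where
 "dlim = of_real (2 powr (2 * Re s + 1)) * c_lim s"

lemma q_pos: "2 * Re s + 1 > 0" "2 * Re s + 2 > 0" using s by auto

lemma ufun_deriv: "x > 0 ==> (ufun N has_field_derivative ufun' N x) (at (of_real x))"
 unfolding ufun_def[abs_def] ufun'_def
 by (rule derivative_eq_intros hfin_deriv[OF q_pos(1)] refl | assumption)+ simp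

lemma p_scaled:
 assumes "N >= 1"
 shows "p_tilde s N (real N * x) = (of_real (real N * x) - \<i>) ^ (N - 1) * of_nat N * ufun N (of_real x)"
  "p_N1 s N (real N * x) = (of_real (real N * x) - \<i>) ^ (N - 1) * vfun N (of_real x)"
proof -
 have q: "2 * complex_of_real (Re s) + 1 = of_real (2 * Re s + 1)" "2 * complex_of_real (Re s) + 2 = of_real (2 * Re s + 2)" by simp_all
 have X': "of_real (real N * x) - \<i> = of_nat N * (of_real x - \<i> / of_nat N)" using assms by (simp add: right_diff_distrib)
 have X: "(of_real (real N * x) - \<i>) ^ N = (of_real (real N * x) - \<i>) ^ (N - 1) * (of_nat N * (of_real x - \<i> / of_nat N))"
  unfolding X'[symmetric] using assms by (simp flip: power_Suc2)
 show "p_tilde s N (real N * x) = (of_real (real N * x) - \<i>) ^ (N - 1) * of_nat N * ufun N (of_real x)"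
  unfolding p_tilde_def q hyp2F1_eq_hfin[OF assms diff_zero[symmetric]] ufun_def X by (simp only: mult_ac)
 show "p_N1 s N (real N * x) = (of_real (real N * x) - \<i>) ^ (N - 1) * vfun N (of_real x)"
  unfolding p_N1_def q hyp2F1_eq_hfin[OF assms refl] ..
qed

lemma N_powr: "N >= 1 ==> complex_of_real (real N powr (Re s + 1)) * of_real (real N powr (Re s + 1)) = of_nat N * of_real (real N powr (2 * Re s + 1))"
proof -
 assume N: "N >= 1"
 have "real N powr (Re s + 1) * real N powr (Re s + 1) = real N powr 1 * real N powr (2 * Re s + 1)"
  unfolding powr_add[symmetric] by (simp add: algebra_simps)
 then have "real N powr (Re s + 1) * real N powr (Re s + 1) = real N * real N powr (2 * Re s + 1)" using N by simp
 then show ?thesis by (metis of_real_mult of_real_of_nat_eq)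
qed

lemma K_N_scaled_off_diagonal:
 assumes N: "N >= 1" and xy: "x ~= y"
 shows "of_nat N * K_N s N (real N * x) (real N * y) =
  dN N * psi N x * psi N y * (ufun N (of_real x) * vfun N (of_real y) - vfun N (of_real x) * ufun N (of_real y)) / (of_real x - of_real y)"
proof -
 let ?w = "ufun N (of_real x) * vfun N (of_real y) - vfun N (of_real x) * ufun N (of_real y)"
 define H where "H x = (of_real (real N * x) - \<i>) ^ (N - 1)" for x
 define W where "W x = complex_of_real (sqrt (w_H s N (real N * x)))" for x
 define R where "R = complex_of_real (real N powr (2 * Re s + 1))"
 have R: "R ~= 0" using N by (simp add: R_def)
 have ne: "real N * x ~= real N * y" using N xy by simp
 have "of_nat N * K_N s N (real N * x) (real N * y) =
  of_nat N * (C_N s N * ((H x * of_nat N * ufun N (of_real x) * (H y * vfun N (of_real y)) - H x * vfun N (of_real x) * (H y * of_nat N * ufun N (of_real y))) /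
   (of_nat N * (of_real x - of_real y))) * (W x * W y))"
  unfolding K_N_def if_not_P[OF ne] p_scaled[OF N] H_def W_def by (simp add: real_sqrt_mult right_diff_distrib)
 also have "H x * of_nat N * ufun N (of_real x) * (H y * vfun N (of_real y)) - H x * vfun N (of_real x) * (H y * of_nat N * ufun N (of_real y)) =
  of_nat N * (H x * H y * (?w))" by (simp add: algebra_simps)
 also have "... / (of_nat N * (of_real x - of_real y)) = H x * H y * (?w) / (of_real x - of_real y)"
  using N by simp
 also have "of_nat N * (C_N s N * ... * (W x * W y)) =
  C_N s N / R * (of_nat N * R) * (H x * W x) * (H y * W y) * (?w) / (of_real x - of_real y)"
  using R by simp
 also have "of_nat N * R = complex_of_real (real N powr (Re s + 1)) * of_real (real N powr (Re s + 1))" unfolding R_def N_powr[OF N] ..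
 finally show ?thesis unfolding dN_def psi_def R_def H_def W_def by (simp only: mult_ac)
qed

text \<open>In the Wronskian the terms with the derivative of the common factor (X - i)^(N-1)
  cancel, so only derivatives of \<open>ufun\<close> and \<open>vfun\<close> remain.\<close>

lemma K_N_scaled_diagonal:
 assumes N: "N >= 1" and x: "x > 0"
 shows "of_nat N * K_N s N (real N * x) (real N * x) =
  dN N * psi N x * psi N x * (ufun' N x * vfun N (of_real x) - ufun N (of_real x) * vfun' N x)"
proof -
 let ?X = "complex_of_real (real N * x)"
 define Hc where "Hc z = (z - \<i>) ^ (N - 1)" for z :: complex
 define H where "H = Hc ?X"
 define H' where "H' = of_nat (N - 1) * (of_real (real N * x) - \<i>) ^ (N - 1 - 1)"
 define W where "W = complex_of_real (sqrt (w_H s N (real N * x)))"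
 define R where "R = complex_of_real (real N powr (2 * Re s + 1))"
 let ?u = "ufun N (of_real x)" and ?v = "vfun N (of_real x)"
 have R: "R ~= 0" using N by (simp add: R_def)
 have X: "complex_of_real (real N * x) / of_nat N = of_real x" using N by simp
 have dH: "(Hc has_field_derivative H') (at ?X)"
  unfolding Hc_def[abs_def] H'_def by (auto intro!: derivative_eq_intros)
 have ds: "((\<lambda>z. z / of_nat N) has_field_derivative 1 / of_nat N) (at ?X)"
  by (rule DERIV_cdivide[OF DERIV_ident])
 have du: "((\<lambda>z. ufun N (z / of_nat N)) has_field_derivative ufun' N x * (1 / of_nat N)) (at ?X)"
  by (rule DERIV_chain2[OF _ ds]) (use ufun_deriv[OF x] X in simp)
 have dv: "((\<lambda>z. vfun N (z / of_nat N)) has_field_derivative vfun' N x * (1 / of_nat N)) (at ?X)"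
  by (rule DERIV_chain2[OF _ ds]) (use hfin_deriv[OF q_pos(2) x] X in simp)
 have fp: "p_tilde s N = (\<lambda>Y. Hc (of_real Y) * of_nat N * ufun N (of_real Y / of_nat N))"
  "p_N1 s N = (\<lambda>Y. Hc (of_real Y) * vfun N (of_real Y / of_nat N))"
 proof -
  have NY: "real N * (Y / real N) = Y" for Y using N by simp
  have "p_tilde s N Y = Hc (of_real Y) * of_nat N * ufun N (of_real Y / of_nat N)"
   "p_N1 s N Y = Hc (of_real Y) * vfun N (of_real Y / of_nat N)" for Y
   using p_scaled[OF N, of "Y / real N"] unfolding NY Hc_def by simp_all
  then show "p_tilde s N = (\<lambda>Y. Hc (of_real Y) * of_nat N * ufun N (of_real Y / of_nat N))"
   "p_N1 s N = (\<lambda>Y. Hc (of_real Y) * vfun N (of_real Y / of_nat N))" by auto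
 qed
 have d1: "vector_derivative (p_tilde s N) (at (real N * x)) = H' * of_nat N * ?u + H * ufun' N x"
  unfolding fp
 proof (rule vector_derivative_at, rule has_vector_derivative_real_field)
  have "((\<lambda>z. Hc z * of_nat N * ufun N (z / of_nat N)) has_field_derivative
   (H' * of_nat N) * ufun N (of_real (real N * x) / of_nat N) + ufun' N x * (1 / of_nat N) * (Hc ?X * of_nat N)) (at ?X)"
   by (rule DERIV_mult[OF DERIV_cmult_right[OF dH] du])
  then show "((\<lambda>z. Hc z * of_nat N * ufun N (z / of_nat N)) has_field_derivative H' * of_nat N * ?u + H * ufun' N x) (at ?X)"
   unfolding X H_def[symmetric] using N by (simp add: mult_ac)
 qed
 have d2: "vector_derivative (p_N1 s N) (at (real N * x)) = H' * ?v + H * vfun' N x / of_nat N"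
  unfolding fp
 proof (rule vector_derivative_at, rule has_vector_derivative_real_field)
  have "((\<lambda>z. Hc z * vfun N (z / of_nat N)) has_field_derivative
   H' * vfun N (of_real (real N * x) / of_nat N) + vfun' N x * (1 / of_nat N) * Hc ?X) (at ?X)"
   by (rule DERIV_mult[OF dH dv])
  then show "((\<lambda>z. Hc z * vfun N (z / of_nat N)) has_field_derivative H' * ?v + H * vfun' N x / of_nat N) (at ?X)"
   unfolding X H_def[symmetric] by (simp add: mult_ac)
 qed
 have W2: "complex_of_real (w_H s N (real N * x)) = W * W"
  unfolding W_def using w_H_pos[of s N "real N * x"] by (simp flip: of_real_mult)
 have "of_nat N * K_N s N (real N * x) (real N * x) =
  of_nat N * (C_N s N * ((H' * of_nat N * ?u + H * ufun' N x) * (H * ?v) - H * of_nat N * ?u * (H' * ?v + H * vfun' N x / of_nat N)) * (W * W))"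
  unfolding K_N_def if_P[OF refl] d1 d2 W2 p_scaled[OF N] H_def Hc_def ..
 also have "(H' * of_nat N * ?u + H * ufun' N x) * (H * ?v) - H * of_nat N * ?u * (H' * ?v + H * vfun' N x / of_nat N) =
  H * H * (ufun' N x * ?v - ?u * vfun' N x)" using N by (simp add: field_simps)
 also have "of_nat N * (C_N s N * ... * (W * W)) = C_N s N / R * (of_nat N * R) * (H * W) * (H * W) * (ufun' N x * ?v - ?u * vfun' N x)"
  using R by simp
 also have "of_nat N * R = complex_of_real (real N powr (Re s + 1)) * of_real (real N powr (Re s + 1))" unfolding R_def N_powr[OF N] ..
 finally show ?thesis unfolding dN_def psi_def R_def H_def Hc_def W_def by (simp only: mult_ac)
qed

lemma Arg_one_plus_i: "Arg (1 + \<i> * complex_of_real x) = arctan x"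
proof -
 have nz: "1 + \<i> * complex_of_real x ~= 0" by (simp add: complex_eq_iff)
 show ?thesis unfolding Arg_eq_Im_Ln[OF nz] using Im_Ln_eq[OF nz] by simp
qed

definition psi_mod :: "nat => real => real" where
 "psi_mod N x = ((inverse (real N))\<^sup>2 + x\<^sup>2) powr (- (Re s + 1) / 2) * exp (Im s * arctan (real N * x))"

text \<open>The number N x - i has argument -arctan (1 / (N x)). The exponents of 1 + (N x)^2, which
  are (N - 1)/2 from the power and -(Re s + N)/2 from the weight, add up to -(Re s + 1)/2.\<close>

lemma psi_polar:
 assumes N: "N >= 1" and x: "x > 0"
 shows "psi N x = of_real (psi_mod N x) * exp (- \<i> * of_real ((real N - 1) * arctan (1 / (real N * x))))"
proof -
 let ?e = "- (Re s + 1) / 2"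
 let ?B = "(inverse (real N))\<^sup>2 + x\<^sup>2"
 define X where "X = real N * x"
 have X: "X > 0" using N x by (simp add: X_def)
 define r where "r = 1 + X\<^sup>2"
 let ?h = "r powr ((- Re s - real N) / 2) * exp (Im s * arctan X)"
 have r: "r > 0" by (simp add: r_def add_pos_nonneg)
 have sq: "sqrt (1 + (1 / X)\<^sup>2) = sqrt r / X"
 proof -
  have "1 + (1 / X)\<^sup>2 = r / X\<^sup>2" using X by (simp add: r_def field_simps)
  then show ?thesis using X by (simp add: real_sqrt_divide)
 qed
 have "of_real X - \<i> = of_real (sqrt r) * cis (- arctan (1 / X))"
  using X r sq by (simp add: complex_eq_iff cos_arctan sin_arctan)
 also have "sqrt r = r powr (1 / 2)" using r by (simp add: powr_half_sqrt)
 also have "cis (- arctan (1 / X)) = exp (- \<i> * of_real (arctan (1 / X)))" by (simp add: cis_conv_exp)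
 finally have Xi: "of_real X - \<i> = of_real (r powr (1 / 2)) * exp (- \<i> * of_real (arctan (1 / X)))" .
 have n1: "real (N - 1) = real N - 1" using N by (simp add: of_nat_diff)
 have pw: "(of_real X - \<i>) ^ (N - 1) = of_real (r powr ((real N - 1) / 2)) * exp (- \<i> * of_real ((real N - 1) * arctan (1 / X)))"
 proof -
  have "(r powr (1 / 2)) ^ (N - 1) = r powr ((real N - 1) / 2)"
  proof -
   have "(r powr (1 / 2)) ^ (N - 1) = (r powr (1 / 2)) powr real (N - 1)" using r by (intro powr_realpow[symmetric]) simp
   also have "... = r powr (1 / 2 * real (N - 1))" by (rule powr_powr)
   finally show ?thesis unfolding n1 by simp
  qed
  moreover have "exp (- \<i> * of_real (arctan (1 / X))) ^ (N - 1) = exp (- \<i> * of_real ((real N - 1) * arctan (1 / X)))"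
   unfolding exp_of_nat_mult[symmetric] n1[symmetric] by (simp add: mult_ac)
  ultimately show ?thesis unfolding Xi power_mult_distrib by (simp flip: of_real_power)
 qed
 have "w_H s N X = (?h)\<^sup>2"
  unfolding w_H_def Arg_one_plus_i r_def[symmetric] power_mult_distrib
  using r by (simp add: power2_eq_square flip: powr_add exp_add)
 then have sw: "sqrt (w_H s N X) = r powr ((- Re s - real N) / 2) * exp (Im s * arctan X)" by simp
 have rN: "r = (real N)\<^sup>2 * ?B"
  using N by (simp add: r_def X_def field_simps)
 have "r powr ?e = ((real N)\<^sup>2) powr ?e * ?B powr ?e"
  unfolding rN by (rule powr_mult)
 also have "((real N)\<^sup>2) powr ?e = real N powr (- (Re s + 1))"
  using N by (simp add: square_powr diff_divide_distrib)
 finally have h: "r powr ?e = real N powr (- (Re s + 1)) * ?B powr ?e" .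
 have "real N powr (Re s + 1) * real N powr (- (Re s + 1)) = 1" unfolding powr_add[symmetric] using N by simp
 then have rp: "real N powr (Re s + 1) * r powr ?e = ?B powr ?e"
  unfolding h mult.assoc[symmetric] by simp
 have ee: "(real N - 1) / 2 + (- Re s - real N) / 2 = - (Re s + 1) / 2" by (simp add: field_simps)
 have h2: "r powr ((real N - 1) / 2) * r powr ((- Re s - real N) / 2) = r powr ?e"
  by (simp only: powr_add[symmetric] ee)
 have "real N powr (Re s + 1) * r powr ((real N - 1) / 2) * (?h) =
  real N powr (Re s + 1) * (r powr ((real N - 1) / 2) * r powr ((- Re s - real N) / 2)) * exp (Im s * arctan X)"
  by (simp only: mult.assoc)
 also have "... = psi_mod N x" unfolding h2 rp psi_mod_def X_def ..
 finally have pm: "psi_mod N x = real N powr (Re s + 1) * r powr ((real N - 1) / 2) * (?h)" ..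
 have "of_real (psi_mod N x) = complex_of_real (real N powr (Re s + 1)) * of_real (r powr ((real N - 1) / 2)) * of_real (?h)"
  unfolding pm of_real_mult ..
 then show ?thesis unfolding psi_def X_def[symmetric] pw sw by (simp only: mult_ac)
qed

text \<open>The limit of \<open>psi\<close> on the positive axis, extended by \<open>Ln\<close> to
  complex arguments so that it can be differentiated.\<close>

definition Ec :: "complex => complex" where
 "Ec z = exp (- \<i> / z + of_real (pi * Im s / 2) - of_real (Re s + 1) * Ln z)"

text \<open>The phase (N - 1) arctan (1 / (N x)) tends to 1/x and is the origin of exp (-i/x);
  arctan (N x) tends to pi/2, which explains the factor exp (pi Im s / 2).\<close>

lemma psi_tendsto:
 assumes x: "x > 0"
 shows "(\<lambda>N. psi N x) \<longlonglongrightarrow> Ec (of_real x)"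
proof -
 have "(\<lambda>N. psi_mod N x) \<longlonglongrightarrow> (0\<^sup>2 + x\<^sup>2) powr (- (Re s + 1) / 2) * exp (Im s * (pi / 2))"
  unfolding psi_mod_def
 proof (intro tendsto_mult tendsto_powr tendsto_add tendsto_power lim_inverse_n tendsto_const tendsto_exp)
  show "(\<lambda>N. arctan (real N * x)) \<longlonglongrightarrow> pi / 2"
   by (rule filterlim_compose[OF tendsto_arctan_at_top])
    (use x in \<open>intro filterlim_at_top_mult_tendsto_pos[OF tendsto_const _ filterlim_real_sequentially], simp\<close>)
 qed (use x in auto)
 also have "(0\<^sup>2 + x\<^sup>2) powr (- (Re s + 1) / 2) = x powr (- (Re s + 1))"
  using x by (simp add: square_powr diff_divide_distrib)
 finally have 1: "(\<lambda>N. complex_of_real (psi_mod N x)) \<longlonglongrightarrow> of_real (x powr (- (Re s + 1)) * exp (Im s * (pi / 2)))"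
  by (rule tendsto_of_real)
 have "(\<lambda>N. (real N - 1) * arctan (1 / (real N * x))) \<longlonglongrightarrow> inverse x" using x by real_asymp
 then have "(\<lambda>N. (real N - 1) * arctan (1 / (real N * x))) \<longlonglongrightarrow> 1 / x" unfolding inverse_eq_divide .
 then have 2: "(\<lambda>N. exp (- \<i> * of_real ((real N - 1) * arctan (1 / (real N * x))))) \<longlonglongrightarrow> exp (- \<i> * of_real (1 / x))"
  by (intro tendsto_intros)
 have e: "of_real (x powr (- (Re s + 1)) * exp (Im s * (pi / 2))) * exp (- \<i> * of_real (1 / x)) = Ec (of_real x)"
  using x by (simp add: Ec_def powr_def Ln_of_real exp_of_real[symmetric] algebra_simps flip: exp_add)
 have "(\<lambda>N. of_real (psi_mod N x) * exp (- \<i> * of_real ((real N - 1) * arctan (1 / (real N * x))))) \<longlonglongrightarrow> Ec (of_real x)"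
  using tendsto_mult[OF 1 2] unfolding e .
 moreover have "\<forall>\<^sub>F N in sequentially. of_real (psi_mod N x) * exp (- \<i> * of_real ((real N - 1) * arctan (1 / (real N * x)))) = psi N x"
  using eventually_ge_at_top[of 1] by eventually_elim (rule psi_polar[OF _ x, symmetric])
 ultimately show ?thesis by (rule Lim_transform_eventually)
qed

lemma psi_bound:
 assumes N: "N >= 1" and x: "x > 0"
 shows "cmod (psi N x) * cmod (psi N x) <= exp (pi * \<bar>Im s\<bar>) * x powr (- 2 * Re s - 2)"
proof -
 have p0: "0 <= psi_mod N x" by (simp add: psi_mod_def)
 have "cmod (psi N x) = psi_mod N x" unfolding psi_polar[OF N x] norm_mult norm_of_real using p0 by simp
 moreover have "psi_mod N x <= x powr (- (Re s + 1)) * exp (pi / 2 * \<bar>Im s\<bar>)"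
  unfolding psi_mod_def
 proof (rule mult_mono)
  have "((inverse (real N))\<^sup>2 + x\<^sup>2) powr (- (Re s + 1) / 2) <= (x\<^sup>2) powr (- (Re s + 1) / 2)"
   using x s by (intro powr_mono2') auto
  also have "... = x powr (- (Re s + 1))" using x by (simp add: square_powr diff_divide_distrib)
  finally show "((inverse (real N))\<^sup>2 + x\<^sup>2) powr (- (Re s + 1) / 2) <= x powr (- (Re s + 1))" .
  have "\<bar>arctan (real N * x)\<bar> <= pi / 2" using arctan_bounded[of "real N * x"] by auto
  then have "\<bar>Im s * arctan (real N * x)\<bar> <= \<bar>Im s\<bar> * (pi / 2)" unfolding abs_mult by (intro mult_left_mono) auto
  then show "exp (Im s * arctan (real N * x)) <= exp (pi / 2 * \<bar>Im s\<bar>)" by (simp add: mult.commute)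
 qed auto
 ultimately have "cmod (psi N x) * cmod (psi N x) <= (x powr (- (Re s + 1)) * exp (pi / 2 * \<bar>Im s\<bar>)) * (x powr (- (Re s + 1)) * exp (pi / 2 * \<bar>Im s\<bar>))"
  using p0 by (intro mult_mono) auto
 also have "... = (x powr (- (Re s + 1)) * x powr (- (Re s + 1))) * (exp (pi / 2 * \<bar>Im s\<bar>) * exp (pi / 2 * \<bar>Im s\<bar>))" by (simp only: mult_ac)
 also have "... = exp (pi * \<bar>Im s\<bar>) * x powr (- 2 * Re s - 2)" unfolding powr_add[symmetric] exp_add[symmetric] by (simp add: mult.commute)
 finally show ?thesis .
qed

text \<open>The quotient of Gamma (2 Re s + N + 1) by Gamma (N) grows like N^(2 Re s + 1), by
  \<open>pochhammer_asymp\<close> at 2 Re s + 1.\<close>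

lemma dN_tendsto: "dN \<longlonglongrightarrow> dlim"
proof -
 let ?a = "complex_of_real (Re s)"
 define z where "z = 2 * ?a + 1"
 have zr: "z \<notin> \<int>\<^sub>\<le>\<^sub>0" using s by (intro re_pos_not_nonpos_Ints) (simp add: z_def)
 define B where "B = of_real (2 powr (2 * Re s) / pi) * Gamma (s + 1) * Gamma (cnj s + 1) / (Gamma (2 * ?a + 1) * Gamma (2 * ?a + 2))"
 have "(\<lambda>N. B * (Gamma z * (pochhammer z N / (fact N * exp ((z - 1) * of_real (ln (real N))))))) \<longlonglongrightarrow> B * (Gamma z * rGamma z)"
  by (intro tendsto_mult tendsto_const pochhammer_asymp)
 moreover have "Gamma z * rGamma z = 1" using zr by (simp add: Gamma_def rGamma_eq_zero_iff)
 moreover have "B = dlim" by (simp add: B_def dlim_def c_lim_def powr_add)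
 moreover have "\<forall>\<^sub>F N in sequentially. B * (Gamma z * (pochhammer z N / (fact N * exp ((z - 1) * of_real (ln (real N)))))) = dN N"
  using eventually_ge_at_top[of 1]
 proof eventually_elim
  case (elim N)
  have G: "Gamma (2 * ?a + of_nat N + 1) = Gamma z * pochhammer z N"
   using pochhammer_Gamma[OF zr, of N] zr by (simp add: Gamma_eq_zero_iff z_def add_ac)
  have "Gamma (of_nat N) * of_nat N = (fact N :: complex)"
   using Gamma_fact[of "N - 1", where 'a = complex] elim by (cases N) (simp_all add: mult.commute)
  then have gn: "Gamma (of_nat N) = (fact N / of_nat N :: complex)" using elim by (simp add: field_simps)
  have e: "exp ((z - 1) * of_real (ln (real N))) = of_real (real N powr (2 * Re s))"
   using elim by (simp add: z_def powr_def exp_of_real[symmetric])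
  have p: "complex_of_real (real N powr (2 * Re s + 1)) = of_real (real N powr (2 * Re s)) * of_nat N"
   using elim by (simp add: powr_add)
  have n0: "complex_of_real (real N powr (2 * Re s)) ~= 0" "of_nat N ~= (0 :: complex)" using elim by simp_all
  show ?case unfolding dN_def C_N_def B_def G gn e p using n0 by (simp add: field_simps)
 qed
 ultimately show ?thesis by (simp add: Lim_transform_eventually)
qed

section \<open>Identification of the limit with the limiting kernel\<close>

abbreviation "Bl \<equiv> hlim s (2 * Re s + 1)"
abbreviation "Bl' \<equiv> hlim' s (2 * Re s + 1)"
abbreviation "Al \<equiv> hlim (s + 1) (2 * Re s + 2)"
abbreviation "Al' \<equiv> hlim' (s + 1) (2 * Re s + 2)"

lemma ufun_tendsto: "x > 0 ==> (\<lambda>N. ufun N (of_real x)) \<longlonglongrightarrow> of_real x * Bl (of_real x)"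
 and ufun'_tendsto: "x > 0 ==> (\<lambda>N. ufun' N x) \<longlonglongrightarrow> Bl (of_real x) + of_real x * Bl' x"
proof -
 assume x: "x > 0"
 have "(\<lambda>N. of_real x - \<i> * of_real (inverse (real N))) \<longlonglongrightarrow> of_real x - \<i> * of_real 0"
  by (intro tendsto_intros lim_inverse_n)
 then have t: "(\<lambda>N. of_real x - \<i> / of_nat N) \<longlonglongrightarrow> of_real x" by (simp add: divide_inverse)
 show "(\<lambda>N. ufun N (of_real x)) \<longlonglongrightarrow> of_real x * Bl (of_real x)"
  unfolding ufun_def by (intro tendsto_mult t hfin_tendsto q_pos x)
 show "(\<lambda>N. ufun' N x) \<longlonglongrightarrow> Bl (of_real x) + of_real x * Bl' x"
  unfolding ufun'_def by (intro tendsto_mult tendsto_add t hfin_tendsto hfin'_tendsto q_pos x)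
qed

text \<open>Redistributing the powers of x brings both limit functions into the shape of the finite
  ones: a common factor \<open>Ec\<close> times a hypergeometric function.\<close>

lemma lim_factors:
 assumes x: "x > 0"
 shows "P_lim s x = of_real (2 powr Re s) * (Ec (of_real x) * (of_real x * Bl (of_real x)))"
  "Q_lim s x = of_real (2 powr (Re s + 1)) * (Ec (of_real x) * Al (of_real x))"
proof -
 have q: "2 * complex_of_real (Re s) + 1 = of_real (2 * Re s + 1)" "2 * complex_of_real (Re s) + 2 = of_real (2 * Re s + 2)" by simp_all
 have E: "exp (- \<i> / of_real x + of_real (pi * Im s * sgn x / 2)) = Ec (of_real x) * of_real (x powr (Re s + 1))"
  using x by (simp add: Ec_def powr_def Ln_of_real exp_of_real[symmetric] flip: exp_add)
 have p: "\<bar>2 / x\<bar> powr Re s * x powr (Re s + 1) = 2 powr Re s * x"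
  "2 / x * \<bar>2 / x\<bar> powr Re s * x powr (Re s + 1) = 2 powr (Re s + 1)"
  using x by (simp_all add: powr_divide powr_add)
 show "P_lim s x = of_real (2 powr Re s) * (Ec (of_real x) * (of_real x * Bl (of_real x)))"
 proof -
  have "P_lim s x = of_real (\<bar>2 / x\<bar> powr Re s * x powr (Re s + 1)) * Ec (of_real x) * Bl (of_real x)"
   unfolding P_lim_def E q hyp1F1_eq_hlim[OF x] of_real_mult by (simp only: mult_ac)
  then show ?thesis unfolding p by (simp add: mult_ac)
 qed
 show "Q_lim s x = of_real (2 powr (Re s + 1)) * (Ec (of_real x) * Al (of_real x))"
 proof -
  have "Q_lim s x = of_real (2 / x * \<bar>2 / x\<bar> powr Re s * x powr (Re s + 1)) * Ec (of_real x) * Al (of_real x)"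
   unfolding Q_lim_def E q hyp1F1_eq_hlim[OF x] of_real_mult by (simp only: mult_ac)
  then show ?thesis unfolding p by (simp add: mult_ac)
 qed
qed

lemma powr_const: "c_lim s * complex_of_real (2 powr Re s) * of_real (2 powr (Re s + 1)) = dlim"
proof -
 have "2 powr Re s * 2 powr (Re s + 1) = 2 powr (2 * Re s + 1)" unfolding powr_add[symmetric] by simp
 then have "complex_of_real (2 powr Re s) * of_real (2 powr (Re s + 1)) = of_real (2 powr (2 * Re s + 1))" unfolding of_real_mult[symmetric] by (simp only:)
 then show ?thesis unfolding dlim_def mult.assoc by (simp only: mult.commute)
qed

lemma K_inf_off_diagonal:
 assumes "x > 0" "y > 0" "x ~= y"
 shows "K_inf s x y = dlim * Ec (of_real x) * Ec (of_real y) *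
  (of_real x * Bl (of_real x) * Al (of_real y) - Al (of_real x) * (of_real y * Bl (of_real y))) / (of_real x - of_real y)"
 unfolding K_inf_def lim_factors[OF assms(1)] lim_factors[OF assms(2)] powr_const[symmetric] using assms(3)
 by (simp add: algebra_simps)

lemma K_inf_diagonal:
 assumes x: "x > 0"
 shows "K_inf s x x = dlim * Ec (of_real x) * Ec (of_real x) *
  ((Bl (of_real x) + of_real x * Bl' x) * Al (of_real x) - of_real x * Bl (of_real x) * Al' x)"
proof -
 have nr: "complex_of_real x \<notin> \<real>\<^sub>\<le>\<^sub>0" using x by (auto simp: complex_nonpos_Reals_iff)
 \<comment> \<open>Only the existence of a derivative matters, as the terms that contain it cancel
   in the Wronskian.\<close>
 have "\<exists>E'. (Ec has_field_derivative E') (at (of_real x))"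
  unfolding Ec_def[abs_def] using x nr
  by (intro exI) (rule derivative_eq_intros refl | simp)+
 then obtain E' where dE: "(Ec has_field_derivative E') (at (of_real x))" by blast
 have dB: "((\<lambda>z. z * Bl z) has_field_derivative 1 * Bl (of_real x) + Bl' x * of_real x) (at (of_real x))"
  by (rule DERIV_mult[OF DERIV_ident hlim_deriv[OF q_pos(1) x]])
 note dA = hlim_deriv[OF q_pos(2) x, where b = "s + 1"]
 have vd: "vector_derivative f (at x) = D"
  if "\<And>y. y > 0 ==> f y = g (of_real y)" "(g has_field_derivative D) (at (of_real x))" for f g D
 proof (rule vector_derivative_at)
  show "(f has_vector_derivative D) (at x)"
   by (rule has_vector_derivative_transform_within_open[OF has_vector_derivative_real_field[OF that(2)], of "{0<..}"]) (use x that(1) in auto)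
 qed
 have P': "vector_derivative (P_lim s) (at x) = of_real (2 powr Re s) * (E' * (of_real x * Bl (of_real x)) + (1 * Bl (of_real x) + Bl' x * of_real x) * Ec (of_real x))"
  by (rule vd[of "P_lim s" "\<lambda>z. of_real (2 powr Re s) * (Ec z * (z * Bl z))"]) (erule lim_factors(1), rule DERIV_cmult[OF DERIV_mult[OF dE dB]])
 have Q': "vector_derivative (Q_lim s) (at x) = of_real (2 powr (Re s + 1)) * (E' * Al (of_real x) + Al' x * Ec (of_real x))"
  by (rule vd[of "Q_lim s" "\<lambda>z. of_real (2 powr (Re s + 1)) * (Ec z * Al z)"]) (erule lim_factors(2), rule DERIV_cmult[OF DERIV_mult[OF dE dA]])
 show ?thesis unfolding K_inf_def if_P[OF refl] P' Q' lim_factors[OF x] powr_const[symmetric] by (simp add: algebra_simps)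
qed

lemma kernel_tendsto:
 assumes x: "x > 0" and y: "y > 0"
 shows "(\<lambda>N. of_nat N * K_N s N (real N * x) (real N * y)) \<longlonglongrightarrow> K_inf s x y"
proof (cases "x = y")
 case True
 have "(\<lambda>N. dN N * psi N x * psi N x * (ufun' N x * vfun N (of_real x) - ufun N (of_real x) * vfun' N x)) \<longlonglongrightarrow> K_inf s x x"
  unfolding K_inf_diagonal[OF x]
  by (intro tendsto_mult tendsto_diff dN_tendsto psi_tendsto ufun_tendsto ufun'_tendsto hfin_tendsto hfin'_tendsto q_pos x)
 moreover have "\<forall>\<^sub>F N in sequentially. dN N * psi N x * psi N x * (ufun' N x * vfun N (of_real x) - ufun N (of_real x) * vfun' N x) =
  of_nat N * K_N s N (real N * x) (real N * y)"
  using eventually_ge_at_top[of 1] by eventually_elim (simp add: K_N_scaled_diagonal x flip: True)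
 ultimately show ?thesis using True by (simp add: Lim_transform_eventually)
next
 case False
 have "(\<lambda>N. dN N * psi N x * psi N y * (ufun N (of_real x) * vfun N (of_real y) - vfun N (of_real x) * ufun N (of_real y)) / (of_real x - of_real y)) \<longlonglongrightarrow> K_inf s x y"
  unfolding K_inf_off_diagonal[OF x y False]
  by (intro tendsto_mult tendsto_diff tendsto_divide tendsto_const dN_tendsto psi_tendsto ufun_tendsto hfin_tendsto q_pos x y) (use False in simp)
 moreover have "\<forall>\<^sub>F N in sequentially. dN N * psi N x * psi N y * (ufun N (of_real x) * vfun N (of_real y) - vfun N (of_real x) * ufun N (of_real y)) / (of_real x - of_real y) =
  of_nat N * K_N s N (real N * x) (real N * y)"
  using eventually_ge_at_top[of 1] by eventually_elim (rule K_N_scaled_off_diagonal[OF _ False, symmetric])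
 ultimately show ?thesis by (rule Lim_transform_eventually)
qed

text \<open>For x > t the Wronskian of \<open>ufun\<close> and \<open>vfun\<close> is bounded
  uniformly in \<open>N\<close> and x, so the decay comes from the two factors \<open>psi\<close>
  alone.\<close>

lemma kernel_diagonal_bound:
 assumes t: "t > 0"
 shows "\<exists>c\<ge>0. \<forall>N\<ge>1. \<forall>x>t. cmod (of_nat N * K_N s N (real N * x) (real N * x)) <= c * x powr (- 2 * Re s - 2)"
proof -
 obtain D where D: "D > 0" "\<And>N. cmod (dN N) <= D"
  using convergent_imp_Bseq[OF convergentI[OF dN_tendsto]] by (elim BseqE) blast
 define m where "m = hyp_rate s (2 * Re s + 1)"
 define m' where "m' = hyp_rate (s + 1) (2 * Re s + 2)"
 define U where "U = exp (m * (2 / t))"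
 define V where "V = exp (m' * (2 / t))"
 define r where "r = 2 * (1 / t + 1 / t\<^sup>2)"
 have m: "0 <= m" "0 <= m'" by (simp_all add: m_def m'_def hyp_rate_nonneg)
 have UV: "0 <= U" "0 <= V" "0 <= r" using t by (simp_all add: U_def V_def r_def)
 have bound: "cmod (ufun' N x * vfun N (of_real x) - ufun N (of_real x) * vfun' N x) <= (U + r * (m * U)) * V + U * (r * (m' * V))"
  if N: "N >= 1" and xt: "x > t" for N x
 proof -
  have x: "x > 0" using t xt by simp
  have em: "exp (k * (2 / x)) <= exp (k * (2 / t))" if "0 <= k" for k
   using that x t xt by (auto intro!: mult_left_mono simp: frac_le)
  have 1: "cmod (hfin 0 s (2 * Re s + 1) N (of_real x)) <= U"
   using order_trans[OF hfin_bound[OF q_pos(1) x] em] m by (simp add: U_def m_def)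
  have 2: "cmod (vfun N (of_real x)) <= V"
   using order_trans[OF hfin_bound[OF q_pos(2) x] em] m by (simp add: V_def m'_def)
  have 3: "cmod (hfin' 0 s (2 * Re s + 1) N x) <= m * U * (2 / x\<^sup>2)"
   by (rule order_trans[OF hfin'_bound[OF q_pos(1) x]]) (use em[OF m(1)] m in \<open>auto simp: U_def m_def intro!: mult_left_mono divide_right_mono\<close>)
  have 4: "cmod (vfun' N x) <= m' * V * (2 / x\<^sup>2)"
   by (rule order_trans[OF hfin'_bound[OF q_pos(2) x]]) (use em[OF m(2)] m in \<open>auto simp: V_def m'_def intro!: mult_left_mono divide_right_mono\<close>)
  have 5: "cmod (of_real x - \<i> / of_nat N) <= x + 1"
  proof -
   have "cmod (of_real x - \<i> / of_nat N) <= cmod (of_real x) + cmod (\<i> / of_nat N)" by (rule norm_triangle_ineq4)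
   also have "... <= x + 1" using x N by (simp add: norm_divide divide_le_eq)
   finally show ?thesis .
  qed
  \<comment> \<open>The linear growth of x - i/N only meets derivatives, which carry the factor 2 /
    x^2 from the derivative of \<open>tvar\<close>; the product stays bounded for x > t.\<close>
  have 6: "(x + 1) * (2 / x\<^sup>2) <= r"
  proof -
   have "(x + 1) * (2 / x\<^sup>2) = 2 * (1 / x + 1 / x\<^sup>2)" using x by (simp add: field_simps power2_eq_square)
   also have "... <= r" unfolding r_def using x t xt by (intro mult_left_mono add_mono frac_le power_mono) auto
   finally show ?thesis .
  qed
  have 7: "(x + 1) * (k * W * (2 / x\<^sup>2)) <= r * (k * W)" if "0 <= k" "0 <= W" for k W
   using mult_right_mono[OF 6, of "k * W"] that by (simp add: mult_ac)
  have u': "cmod (ufun' N x) <= U + r * (m * U)"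
  proof -
   have "cmod (ufun' N x) <= cmod (hfin 0 s (2 * Re s + 1) N (of_real x)) + cmod (of_real x - \<i> / of_nat N) * cmod (hfin' 0 s (2 * Re s + 1) N x)"
    unfolding ufun'_def norm_mult[symmetric] by (rule norm_triangle_ineq)
   also have "... <= U + (x + 1) * (m * U * (2 / x\<^sup>2))" using x by (intro add_mono 1 mult_mono 5 3) auto
   also have "... <= U + r * (m * U)" using 7[of m U] m UV by simp
   finally show ?thesis .
  qed
  have uv: "cmod (ufun N (of_real x) * vfun' N x) <= U * (r * (m' * V))"
  proof -
   have "cmod (ufun N (of_real x) * vfun' N x) <= ((x + 1) * U) * (m' * V * (2 / x\<^sup>2))"
    unfolding ufun_def norm_mult using x UV by (intro mult_mono 1 5 4) auto
   also have "... = U * ((x + 1) * (m' * V * (2 / x\<^sup>2)))" by (simp only: mult_ac)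
   also have "... <= U * (r * (m' * V))" using 7[of m' V] m UV by (intro mult_left_mono) auto
   finally show ?thesis .
  qed
  have "cmod (ufun' N x * vfun N (of_real x) - ufun N (of_real x) * vfun' N x) <= cmod (ufun' N x) * cmod (vfun N (of_real x)) + cmod (ufun N (of_real x) * vfun' N x)"
   unfolding norm_mult[symmetric, of "ufun' N x"] by (rule norm_triangle_ineq4)
  also have "... <= (U + r * (m * U)) * V + U * (r * (m' * V))"
   using UV m by (intro add_mono mult_mono u' 2 uv) auto
  finally show ?thesis .
 qed
 define c where "c = D * exp (pi * \<bar>Im s\<bar>) * ((U + r * (m * U)) * V + U * (r * (m' * V)))"
 have "c >= 0" using D(1) UV m by (simp add: c_def)
 moreover have "cmod (of_nat N * K_N s N (real N * x) (real N * x)) <= c * x powr (- 2 * Re s - 2)" if N: "N >= 1" and xt: "x > t" for N x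
 proof -
  have x: "x > 0" using t xt by simp
  have "cmod (of_nat N * K_N s N (real N * x) (real N * x)) =
   cmod (dN N) * (cmod (psi N x) * cmod (psi N x)) * cmod (ufun' N x * vfun N (of_real x) - ufun N (of_real x) * vfun' N x)"
   unfolding K_N_scaled_diagonal[OF N x] norm_mult by (simp only: mult_ac)
  also have "... <= D * (exp (pi * \<bar>Im s\<bar>) * x powr (- 2 * Re s - 2)) * ((U + r * (m * U)) * V + U * (r * (m' * V)))"
   using D(1) by (intro mult_mono D(2) psi_bound[OF N x] bound[OF N xt]) auto
  also have "... = c * x powr (- 2 * Re s - 2)" unfolding c_def by (simp only: mult_ac)
  finally show ?thesis .
 qed
 ultimately show ?thesis by blast
qed

text \<open>For x > t one has x^2 >= t^2 / (1 + t^2) * (1 + x^2), so the power is dominated by the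
  integrable one with exponent -(Re s + 1), where Re s + 1 > 1/2.\<close>

lemma integrable_tail:
 assumes t: "t > 0"
 shows "integrable lborel (\<lambda>x. indicator {t<..} x * (c * x powr (- 2 * Re s - 2)))"
proof (rule Bochner_Integration.integrable_bound)
 define k where "k = (t\<^sup>2 / (1 + t\<^sup>2)) powr (- (Re s + 1))"
 show "integrable lborel (\<lambda>x. \<bar>c\<bar> * (k * (1 + x\<^sup>2) powr (- (Re s + 1))))"
  using s by (intro integrable_mult_right integrable_powr_one_plus_square) simp
 show "AE x in lborel. norm (indicator {t<..} x * (c * x powr (- 2 * Re s - 2))) <= norm (\<bar>c\<bar> * (k * (1 + x\<^sup>2) powr (- (Re s + 1))))"
 proof (rule AE_I2)
  fix x :: real
  show "norm (indicator {t<..} x * (c * x powr (- 2 * Re s - 2))) <= norm (\<bar>c\<bar> * (k * (1 + x\<^sup>2) powr (- (Re s + 1))))"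
  proof (cases "x > t")
   case True
   then have x: "x > 0" using t by simp
   have p: "0 < 1 + t\<^sup>2" "0 < 1 + x\<^sup>2" by (simp_all add: add_pos_nonneg)
   have "t\<^sup>2 <= x\<^sup>2" using True t by (intro power_mono) auto
   then have "t\<^sup>2 / (1 + t\<^sup>2) * (1 + x\<^sup>2) <= x\<^sup>2" using p by (simp add: field_simps)
   then have "(x\<^sup>2) powr (- (Re s + 1)) <= (t\<^sup>2 / (1 + t\<^sup>2) * (1 + x\<^sup>2)) powr (- (Re s + 1))"
    using s t p by (intro powr_mono2') auto
   also have "... = k * (1 + x\<^sup>2) powr (- (Re s + 1))" unfolding k_def by (rule powr_mult)
   also have "(x\<^sup>2) powr (- (Re s + 1)) = x powr (- 2 * Re s - 2)" using x by (simp add: square_powr diff_divide_distrib)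
   finally have "\<bar>c\<bar> * x powr (- 2 * Re s - 2) <= \<bar>c\<bar> * (k * (1 + x\<^sup>2) powr (- (Re s + 1)))" by (intro mult_left_mono) auto
   then show ?thesis using True by (simp add: abs_mult k_def)
  qed (simp add: k_def)
 qed
qed measurable

end

theorem corollary1p5:
 fixes s :: complex and x0 :: real
 assumes "Re s > - 1 / 2" and "x0 > 0"
 shows "(\<forall>N\<ge>1.
      complex_of_real (measure (cauchy_measure s N)
       {X \<in> space (cauchy_measure s N). largest_eigenvalue X / real N \<le> x0})
      = fredholm_det (K_N s N) (real N * x0)) \<and>
    (\<lambda>N. fredholm_det (K_N s N) (real N * x0)) \<longlonglongrightarrow> fredholm_det (K_inf s) x0"
proof -
 have s: "Re s > - 1 / 2" using assms(1) .
 have "\<forall>N. \<exists>e. N >= 1 --> orthonormal_polys s N e" using orthonormal_polys_exist[OF s] by blast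
 from choice[OF this] obtain e where "\<forall>N. N >= 1 --> orthonormal_polys s N (e N)" ..
 then have e: "orthonormal_polys s N (e N)" if "N >= 1" for N using that by blast
 define ph where "ph N l x = poly (e N l) x * sqrt (w_H s N x)" for N l x
 \<comment> \<open>The factor sqrt N makes the kernel built from \<open>f N\<close> equal to N K_N(N
   x, N y), which is the convergent one, and preserves the Fredholm determinant under the
   scaling.\<close>
 define f where "f N l x = sqrt (real N) * ph N l (real N * x)" for N l x
 have K: "K_N s N x y = of_real (\<Sum>l<N. ph N l x * ph N l y)" if "N >= 1" for N x y
  unfolding ph_def by (rule orthonormal_polys.K_N_eq[OF e[OF that] s that])
 have scaled: "complex_of_real (\<Sum>l<N. f N l x * f N l y) = of_nat N * K_N s N (real N * x) (real N * y)" if "N >= 1" for N x y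
 proof -
  have "f N l x * f N l y = real N * (ph N l (real N * x) * ph N l (real N * y))" for l
   by (simp add: f_def)
  then have "(\<Sum>l<N. f N l x * f N l y) = real N * (\<Sum>l<N. ph N l (real N * x) * ph N l (real N * y))"
   by (simp only: sum_distrib_left)
  then show ?thesis unfolding K[OF that] by (simp only: of_real_mult of_real_of_nat_eq)
 qed
 have Keq: "K_N s N = (\<lambda>x y. of_real (\<Sum>l<N. ph N l x * ph N l y))" if "N >= 1" for N
  using K[OF that] by (intro ext)
 have law: "complex_of_real (measure (cauchy_measure s N) {X \<in> space (cauchy_measure s N). largest_eigenvalue X / real N <= x0}) =
  fredholm_det (K_N s N) (real N * x0)" if "N >= 1" for N
  unfolding Keq[OF that] ph_def by (rule orthonormal_polys.largest_eigenvalue_distribution[OF e[OF that] that])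
 have "(\<lambda>N. fredholm_det (\<lambda>x y. of_real (\<Sum>l<N. f N l x * f N l y)) x0) \<longlonglongrightarrow> fredholm_det (K_inf s) x0"
 proof -
  obtain c where c: "c >= 0"
   and cb: "\<And>N x. N >= 1 ==> x > x0 ==> cmod (of_nat N * K_N s N (real N * x) (real N * x)) <= c * x powr (- 2 * Re s - 2)"
   using kernel_diagonal_bound[OF s assms(2)] by blast
  show ?thesis
  proof (rule fredholm_det_tendsto)
   fix N l
   have "continuous_on UNIV (\<lambda>x. f N l x)" unfolding f_def ph_def
    by (intro continuous_intros continuous_on_compose2[OF continuous_w_H]) auto
   then show "f N l \<in> borel_measurable borel" by (intro borel_measurable_continuous_onI) simp
  next
   fix x y assume "x0 < x" "x0 < y"
   then have "(\<lambda>N. of_nat N * K_N s N (real N * x) (real N * y)) \<longlonglongrightarrow> K_inf s x y"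
    using assms(2) by (intro kernel_tendsto[OF s]) auto
   moreover have "\<forall>\<^sub>F N in sequentially. of_nat N * K_N s N (real N * x) (real N * y) = complex_of_real (\<Sum>l<N. f N l x * f N l y)"
    using eventually_ge_at_top[of 1] by eventually_elim (rule scaled[symmetric])
   ultimately show "(\<lambda>N. complex_of_real (\<Sum>l<N. f N l x * f N l y)) \<longlonglongrightarrow> K_inf s x y"
    by (rule Lim_transform_eventually)
  next
   fix N x assume x: "x0 < x"
   show "(\<Sum>l<N. f N l x * f N l x) <= c * x powr (- 2 * Re s - 2)"
   \<comment> \<open>The bound is required for every \<open>N\<close>; for \<open>N = 0\<close> the
     sum is empty and \<open>c\<close> is nonnegative.\<close>
   proof (cases "N >= 1")
    case True
    have "(\<Sum>l<N. f N l x * f N l x) <= cmod (complex_of_real (\<Sum>l<N. f N l x * f N l x))" unfolding norm_of_real by (rule abs_ge_self)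
    then show ?thesis unfolding scaled[OF True] using cb[OF True x] by linarith
   qed (use c in \<open>simp add: not_le\<close>)
  next
   show "integrable lborel (\<lambda>x. indicator {x0<..} x * (c * x powr (- 2 * Re s - 2)))"
    by (rule integrable_tail[OF s assms(2)])
  qed
 qed
 moreover have "\<forall>\<^sub>F N in sequentially. fredholm_det (\<lambda>x y. of_real (\<Sum>l<N. f N l x * f N l y)) x0 = fredholm_det (K_N s N) (real N * x0)"
  using eventually_ge_at_top[of 1]
 proof eventually_elim
  case (elim N)
  show ?case unfolding Keq[OF elim] f_def
   by (rule fredholm_det_scale[symmetric]) (use elim orthonormal_polys.integrable_wfun[OF e[OF elim]] in \<open>auto simp: ph_def\<close>)
 qed
 ultimately have "(\<lambda>N. fredholm_det (K_N s N) (real N * x0)) \<longlonglongrightarrow> fredholm_det (K_inf s) x0"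
  by (rule Lim_transform_eventually)
 then show ?thesis using law by blast
qed

end
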